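(* Let $\alpha\ge 0$ be a real number and let $T$ be a Sidon automorphism (Sidon rank one construction) belonging to the class $\mathbf C(\alpha)$. Let $n\geq 1$ be a natural number. 1. If $n\le 1+\alpha/2$, then $T^{\otimes n}$ has singular spectrum; if $n>1+\alpha/2$, then $T^{\otimes n}$ has absolutely continuous spectrum. 2. If $n\le 1+\alpha$, then $T^{\otimes n}$ is conservative; if $n>1+\alpha$, then $T^{\otimes n}$ is dissipative.
   Context: Rank one constructions. Fix a natural number $h_1$, a sequence of natural numbers $r_j$, $j\ge1$, and a sequence of vectors of non-negative integers $\bar s_j=(s_j(1),\dots,s_j(r_j))$ (spacer parameters). At stage $j$ one has disjoint half-intervals of equal length $E_j,TE_j,\dots,T^{h_j-1}E_j$, where $T$ acts as a translation on $E_j,\dots,T^{h_j-2}E_j$; this family, and also its union $X_j$, is called the tower of stage $j$. Represent $E_j$ as a disjoint union of $r_j$ half-intervals $E_j^1,\dots,E_j^{r_j}$ of the same length. For $1\le i\le r_j$ the column $X_{i,j}$ is the union of $E_j^i,TE_j^i,\dots,T^{h_j-1}E_j^i$. Above each column $X_{i,j}$ add $s_j(i)$ new disjoint half-intervals of the same measure as $E_j^i$, obtaining $E_j^i,TE_j^i,\dots,T^{h_j+s_j(i)-1}E_j^i$ (all these sets are disjoint). Put $E_{j+1}=E_j^1$ and, for $i<r_j$, $T^{h_j+s_j(i)}E_j^i=E_j^{i+1}$. The result is the tower of stage $j+1$: $E_{j+1},TE_{j+1},\dots,T^{h_{j+1}-1}E_{j+1}$, with $h_{j+1}=h_jr_j+\sum_{i=1}^{r_j}s_j(i)$.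 The partial definition of $T$ at stage $j$ is kept at all later stages. This yields an invertible transformation $T$ of $X=\bigcup_jX_j$ preserving the Lebesgue measure $\mu$ on $X$ (finite or sigma-finite). Sidon: a rank one construction $T$ is called Sidon if for every $j$ and every $m$ with $h_j<m\le h_{j+1}$ the intersection $T^mX_j\cap X_j$ is contained in a single column $X_{i,j}$ of $X_j$. Class $\mathbf C(\alpha)$: a Sidon construction $T$ belongs to $\mathbf C(\alpha)$ if there is a sequence $j(k)\to\infty$ such that $\sum_k r_{j(k)}^{-\delta}<\infty$ for every $\delta>0$; $r_j=r_{j(k)}$ whenever $j(k)\le j<j(k+1)$; and $j(k+1)-j(k)=[r_{j(k)}^\alpha]$, where $[\cdot]$ is the integer part. The tensor power $T^{\otimes n}$ is the product transformation $T\times\cdots\times T$ ($n$ factors) on $(X^n,\mu^n)$; the same symbol denotes the induced unitary operator on $L_2(X^n,\mu^n)$. The spectrum is singular (respectively absolutely continuous) if the maximal spectral type of this operator, a measure on the unit circle, is singular (respectively absolutely continuous) with respect to Lebesgue measure on the circle. A measurable set $W$ is wandering for $S$ if the sets $S^mW$, $m\in\mathbb Z$, are pairwise disjoint. $S$ is conservative if there is no wandering set of positive measure, and dissipative if, up to a null set, the whole space is $\bigcup_{m\in\mathbb Z}S^mW$ for some wandering set $W$. *)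

theory Defs
  imports "HOL-Analysis.Analysis"
begin

section \<open>Automorphisms of measure spaces\<close>

definition automorphism :: "'a measure \<Rightarrow> ('a \<Rightarrow> 'a) \<Rightarrow> bool" where
  "automorphism M S \<longleftrightarrow>
     bij_betw S (space M) (space M) \<and>
     S \<in> measurable M M \<and>
     inv_into (space M) S \<in> measurable M M \<and>
     distr M M S = M"

definition int_iterate :: "'a set \<Rightarrow> ('a \<Rightarrow> 'a) \<Rightarrow> int \<Rightarrow> 'a \<Rightarrow> 'a" where
  "int_iterate A S m = (if 0 \<le> m then S ^^ nat m else inv_into A S ^^ nat (- m))"

definition wandering :: "'a measure \<Rightarrow> ('a \<Rightarrow> 'a) \<Rightarrow> 'a set \<Rightarrow> bool" where
  "wandering M S W \<longleftrightarrow>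
     W \<in> sets M \<and> disjoint_family (\<lambda>m::int. int_iterate (space M) S m ` W)"

definition conservative :: "'a measure \<Rightarrow> ('a \<Rightarrow> 'a) \<Rightarrow> bool" where
  "conservative M S \<longleftrightarrow> \<not> (\<exists>W. wandering M S W \<and> emeasure M W > 0)"

definition dissipative :: "'a measure \<Rightarrow> ('a \<Rightarrow> 'a) \<Rightarrow> bool" where
  "dissipative M S \<longleftrightarrow>
     (\<exists>W. wandering M S W \<and>
        space M - (\<Union>m::int. int_iterate (space M) S m ` W) \<in> null_sets M)"

text \<open>Points of the \<open>n\<close>-fold product are extensional functions on \<open>{..<n}\<close>.\<close>

definition tensor_space :: "nat \<Rightarrow> 'a measure \<Rightarrow> (nat \<Rightarrow> 'a) measure" where
  "tensor_space n M = PiM {..<n} (\<lambda>_. M)"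

definition tensor_power :: "nat \<Rightarrow> ('a \<Rightarrow> 'a) \<Rightarrow> (nat \<Rightarrow> 'a) \<Rightarrow> (nat \<Rightarrow> 'a)" where
  "tensor_power n T x = (\<lambda>i\<in>{..<n}. T (x i))"


section \<open>Spectral type of the unitary operator induced on \<open>L\<^sub>2\<close>\<close>

text \<open>Elements of \<open>L\<^sub>2\<close> are represented by square-integrable functions; everything below
  is invariant under changes on null sets.\<close>

definition L2 :: "'a measure \<Rightarrow> ('a \<Rightarrow> complex) set" where
  "L2 M = {f \<in> borel_measurable M. integrable M (\<lambda>x. (cmod (f x))\<^sup>2)}"

definition L2_inner :: "'a measure \<Rightarrow> ('a \<Rightarrow> complex) \<Rightarrow> ('a \<Rightarrow> complex) \<Rightarrow> complex" where
  "L2_inner M f g = (LINT x|M. f x * cnj (g x))"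

text \<open>\<open>koopman_power M S m\<close> is the \<open>m\<close>-th power, \<open>m\<close> an integer, of the unitary operator
  \<open>f \<mapsto> f \<circ> S\<close>.\<close>

definition koopman_power ::
  "'a measure \<Rightarrow> ('a \<Rightarrow> 'a) \<Rightarrow> int \<Rightarrow> ('a \<Rightarrow> complex) \<Rightarrow> ('a \<Rightarrow> complex)" where
  "koopman_power M S m f = f \<circ> int_iterate (space M) S m"

definition circle_borel :: "complex measure" where
  "circle_borel = restrict_space borel (sphere 0 1)"

definition circle_lebesgue :: "complex measure" where
  "circle_lebesgue = distr (restrict_space lborel {0..<2 * pi}) circle_borel cis"

definition finite_circle_measure :: "complex measure \<Rightarrow> bool" where
  "finite_circle_measure \<sigma> \<longleftrightarrow> finite_measure \<sigma> \<and> sets \<sigma> = sets circle_borel"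

text \<open>The spectral measure of a vector \<open>f\<close>; by Herglotz' theorem there is exactly one for
  every \<open>f\<close> in \<open>L\<^sub>2\<close>.\<close>

definition is_spectral_measure ::
  "'a measure \<Rightarrow> ('a \<Rightarrow> 'a) \<Rightarrow> ('a \<Rightarrow> complex) \<Rightarrow> complex measure \<Rightarrow> bool" where
  "is_spectral_measure M S f \<sigma> \<longleftrightarrow>
     finite_circle_measure \<sigma> \<and>
     (\<forall>m::int. (LINT z|\<sigma>. z powi m) = L2_inner M (koopman_power M S m f) f)"

definition dominates_spectral_measures ::
  "'a measure \<Rightarrow> ('a \<Rightarrow> 'a) \<Rightarrow> complex measure \<Rightarrow> bool" where
  "dominates_spectral_measures M S \<sigma> \<longleftrightarrow>
     finite_circle_measure \<sigma> \<and>
     (\<forall>f\<in>L2 M. \<forall>\<nu>. is_spectral_measure M S f \<nu> \<longrightarrow> absolutely_continuous \<sigma> \<nu>)"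

text \<open>The maximal spectral type is the least upper bound, with respect to absolute continuity,
  of all spectral measures. It is unique up to equivalence of measures. Note that
  \<open>absolutely_continuous \<sigma> \<nu>\<close> says that \<open>\<nu>\<close> is absolutely continuous with respect to \<open>\<sigma>\<close>.\<close>

definition is_maximal_spectral_type ::
  "'a measure \<Rightarrow> ('a \<Rightarrow> 'a) \<Rightarrow> complex measure \<Rightarrow> bool" where
  "is_maximal_spectral_type M S \<sigma> \<longleftrightarrow>
     dominates_spectral_measures M S \<sigma> \<and>
     (\<forall>\<tau>. dominates_spectral_measures M S \<tau> \<longrightarrow> absolutely_continuous \<tau> \<sigma>)"

definition mutually_singular :: "'a measure \<Rightarrow> 'a measure \<Rightarrow> bool" where
  "mutually_singular \<mu> \<nu> \<longleftrightarrow> (\<exists>A. A \<in> null_sets \<mu> \<and> space \<nu> - A \<in> null_sets \<nu>)"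

definition singular_spectrum :: "'a measure \<Rightarrow> ('a \<Rightarrow> 'a) \<Rightarrow> bool" where
  "singular_spectrum M S \<longleftrightarrow>
     (\<exists>\<sigma>. is_maximal_spectral_type M S \<sigma> \<and> mutually_singular circle_lebesgue \<sigma>)"

definition absolutely_continuous_spectrum :: "'a measure \<Rightarrow> ('a \<Rightarrow> 'a) \<Rightarrow> bool" where
  "absolutely_continuous_spectrum M S \<longleftrightarrow>
     (\<exists>\<sigma>. is_maximal_spectral_type M S \<sigma> \<and> absolutely_continuous circle_lebesgue \<sigma>)"


section \<open>Rank one constructions\<close>

text \<open>The partial maps of a rank one construction may leave \<open>T\<close> or its inverse undefined at some
  points (for example at the point common to all \<open>E\<^sub>j\<close>), whose orbits form a null set. The phase
  space \<open>X\<close> is the union of the half-intervals used in the construction with such a null set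
  removed, so that \<open>T\<close> is a genuine bijection of \<open>X\<close>, and half-intervals are taken relative
  to \<open>X\<close>.\<close>

definition half_interval :: "real set \<Rightarrow> real \<Rightarrow> real set \<Rightarrow> bool" where
  "half_interval X l A \<longleftrightarrow>
     0 < l \<and> (\<exists>a. A = X \<inter> {a..<a + l} \<and> {a..<a + l} - X \<in> null_sets lborel)"

definition lebesgue_space :: "real set \<Rightarrow> real measure" where
  "lebesgue_space X = restrict_space lborel X"

definition tower :: "(nat \<Rightarrow> nat) \<Rightarrow> (real \<Rightarrow> real) \<Rightarrow> (nat \<Rightarrow> real set) \<Rightarrow> nat \<Rightarrow> real set" where
  "tower h T E j = (\<Union>k<h j. (T ^^ k) ` E j)"

definition column ::
  "(nat \<Rightarrow> nat) \<Rightarrow> (real \<Rightarrow> real) \<Rightarrow> (nat \<Rightarrow> nat \<Rightarrow> real set) \<Rightarrow> nat \<Rightarrow> nat \<Rightarrow> real set" where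
  "column h T B i j = (\<Union>k<h j. (T ^^ k) ` B j i)"

text \<open>Stages are numbered from \<open>1\<close>; values of the parameters at stage \<open>0\<close> are irrelevant.
  \<open>E j\<close> is the base of the tower of stage \<open>j\<close>, and \<open>B j i\<close> (for \<open>i = 1, \<dots>, r j\<close>) is the base
  \<open>E\<^sub>j\<^sup>i\<close> of its \<open>i\<close>-th column. In \<open>stacked_disjoint\<close> the indices \<open>k < h j\<close> give the levels
  of the columns (whose union is the tower) and the indices \<open>k \<ge> h j\<close> the spacers, so that the
  spacers are disjoint from each other and from the tower.\<close>

locale rank_one_construction =
  fixes h :: "nat \<Rightarrow> nat" and r :: "nat \<Rightarrow> nat" and s :: "nat \<Rightarrow> nat \<Rightarrow> nat"
    and X :: "real set" and T :: "real \<Rightarrow> real"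
    and E :: "nat \<Rightarrow> real set" and B :: "nat \<Rightarrow> nat \<Rightarrow> real set"
  assumes height_pos: "1 \<le> h 1"
    and cuts_pos: "\<And>j. 1 \<le> j \<Longrightarrow> 1 \<le> r j"
    and height_Suc: "\<And>j. 1 \<le> j \<Longrightarrow> h (Suc j) = h j * r j + (\<Sum>i=1..r j. s j i)"
    and space_borel: "X \<in> sets borel"
    and automorphism: "automorphism (lebesgue_space X) T"
    and levels: "\<And>j. 1 \<le> j \<Longrightarrow> \<exists>l. \<forall>k<h j. half_interval X l ((T ^^ k) ` E j)"
    and levels_disjoint: "\<And>j. 1 \<le> j \<Longrightarrow> disjoint_family_on (\<lambda>k. (T ^^ k) ` E j) {..<h j}"
    and translation:
      "\<And>j k. 1 \<le> j \<Longrightarrow> Suc k < h j \<Longrightarrow> \<exists>c. \<forall>x\<in>(T ^^ k) ` E j. T x = x + c"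
    and base_split: "\<And>j. 1 \<le> j \<Longrightarrow> E j = (\<Union>i\<in>{1..r j}. B j i)"
    and stacked:
      "\<And>j. 1 \<le> j \<Longrightarrow>
         \<exists>l. \<forall>i\<in>{1..r j}. \<forall>k<h j + s j i. half_interval X l ((T ^^ k) ` B j i)"
    and stacked_disjoint:
      "\<And>j. 1 \<le> j \<Longrightarrow>
         disjoint_family_on (\<lambda>(i, k). (T ^^ k) ` B j i) (SIGMA i:{1..r j}. {..<h j + s j i})"
    and base_Suc: "\<And>j. 1 \<le> j \<Longrightarrow> E (Suc j) = B j 1"
    and stacking:
      "\<And>j i. 1 \<le> j \<Longrightarrow> 1 \<le> i \<Longrightarrow> i < r j \<Longrightarrow> (T ^^ (h j + s j i)) ` B j i = B j (Suc i)"
    and exhausts: "X = (\<Union>j\<in>{1..}. tower h T E j)"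

locale sidon_construction = rank_one_construction +
  assumes sidon:
    "\<And>j m. 1 \<le> j \<Longrightarrow> h j < m \<Longrightarrow> m \<le> h (Suc j) \<Longrightarrow>
       \<exists>i\<in>{1..r j}. (T ^^ m) ` tower h T E j \<inter> tower h T E j \<subseteq> column h T B i j"

text \<open>In \<open>class_C\<close> the sequence \<open>J\<close> is the sequence \<open>j(k)\<close>, indexed from \<open>k = 0\<close>.\<close>

locale class_C = sidon_construction +
  fixes \<alpha> :: real
  assumes class_C:
    "\<exists>J :: nat \<Rightarrow> nat.
       (\<forall>k. 1 \<le> J k) \<and>
       filterlim J at_top sequentially \<and>
       (\<forall>\<delta>>0. summable (\<lambda>k. real (r (J k)) powr (- \<delta>))) \<and>
       (\<forall>k j. J k \<le> j \<and> j < J (Suc k) \<longrightarrow> r j = r (J k)) \<and>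
       (\<forall>k. int (J (Suc k)) - int (J k) = \<lfloor>real (r (J k)) powr \<alpha>\<rfloor>)"

end

(* Let c(m) be the normalized correlation of the base of the tower of stage j with its image under
   T^m. Boxes of levels generate the sigma-algebra of the n-th power of X, and the normalized
   indicator of a box has a spectral measure with Fourier coefficients c(m)^n; these measures
   determine the maximal spectral type. In the class C(alpha) the series sum_j r_j^(-p) converges
   iff p > alpha.

   Absolutely continuous spectrum: the Sidon property says that a window of length h_j carries
   correlation at most 2/r_j, so Jensen's inequality bounds sum_m c(m)^(2n) by
   exp(const * sum_j r_j^(2-2n)), and square-summable coefficients give a density.

   Singular spectrum, n >= 2: the characters z^m, with m a difference of two column positions of
   stage j, have c(m) = 1/r_j and are nearly uncorrelated. Averaging them with weights r_j^(-n)
   gives polynomials which tend to 1 in mean square for the spectral measure and to 0 for Lebesgue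
   measure, because sum_j r_j^(2-2n) diverges.

   Singular spectrum, n = 1: the spectral measure is a Riesz product with factors |P_j|^2. The
   Sidon property gives P_j the second and fourth moments of a Gaussian variable with respect to
   every trigonometric polynomial of degree less than h_j, so that |P_j| is not close to 1, infinite
   products of the |P_j| vanish in mean, and Bourgain's criterion applies.

   Dissipativity: a point of a fixed tower that returns to it after a time between h_j and h_{j+1}
   has all its coordinates in the same column of stage j. These sets have measures proportional to
   r_j^(1-n), and the Borel-Cantelli lemma applies.

   Conservativity: on a set of measure proportional to r_j^(1-n) all coordinates lie in the same
   column of stage j other than the first, and one common power of T moves them all to the
   previous column. For a wandering set W these images of pieces of W are disjoint for all columns
   and all stages. As the pieces are pairwise independent in j and the series of their measures
   diverges, W has measure zero. *)

theory Submission
  imports Defs "HOL-Probability.Probability"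
begin

section \<open>Trigonometric polynomials and measures on the circle\<close>

text \<open>Three points decide the shape of the proof. The correlation of a box of stage j does not
  depend on the levels chosen, so one measure per stage carries the whole spectrum, and n enters
  only as the exponent of c(m). The estimate behind the averaging of characters breaks down for n =
  1: a stage supplies about r_j^2 of them, and their mutual correlations, of size up to 1/r_j^n, are
  dominated by the diagonal only if n >= 2; hence the separate argument with Riesz products.
  Characters of different stages are nearly uncorrelated only after the column pairs are restricted:
  the source column must carry a spacer of height at least h_j, which catches the points that a
  shift by less than h_j pushes over its top. At most one column of the first half is lost in this
  way. Apart from singularity for n = 1, the series over j is tested at the exponent 2n - 2 for the
  spectrum and n - 1 for the dynamics, and comparing these with alpha gives the two
  thresholds.\<close>

abbreviation circle :: "complex set" where "circle \<equiv> sphere 0 1"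

text \<open>The degree bound is an integer, so that it compares directly with differences of
  positions. For negative \<open>d\<close> the sum is empty and \<open>f\<close> vanishes on the
  circle.\<close>

definition trig :: "int \<Rightarrow> (complex \<Rightarrow> complex) \<Rightarrow> bool" where
  "trig d f \<longleftrightarrow> (\<exists>c. \<forall>z\<in>circle. f z = (\<Sum>m\<in>{-d..d}. c m * z powi m))"

lemma norm_powi_circle [simp]: "norm z = 1 \<Longrightarrow> norm (z powi m) = 1" for z :: complex
  by (simp add: norm_power_int)

lemma cnj_powi_circle: "z \<in> circle \<Longrightarrow> cnj (z powi m) = z powi (- m)"
proof -
  assume z: "z \<in> circle"
  then have "cnj z = inverse z"
    using complex_norm_square[of z] by (metis inverse_unique mem_sphere_0 of_real_1 power_one)
  moreover have "cnj (z powi m) = cnj z powi m"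
    by (simp add: power_int_def)
  ultimately show ?thesis
    by (simp add: power_int_inverse power_int_minus)
qed

lemma powi_circle_mult: "z \<in> circle \<Longrightarrow> z powi m * z powi k = z powi (m + k)"
  by (subst power_int_add) auto

lemma trig_cong: "trig d f \<Longrightarrow> (\<And>z. z \<in> circle \<Longrightarrow> f z = g z) \<Longrightarrow> trig d g"
  unfolding trig_def by metis

lemma trig_monom: assumes "\<bar>m\<bar> \<le> d" shows "trig d (\<lambda>z. a * z powi m)"
proof -
  have "(\<Sum>k\<in>{-d..d}. (if k = m then a else 0) * z powi k) = a * z powi m" for z :: complex
  proof -
    have "(\<Sum>k\<in>{-d..d}. (if k = m then a else 0) * z powi k) =
        (\<Sum>k\<in>{-d..d}. if k = m then a * z powi k else 0)"
      by (intro sum.cong) auto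
    also have "\<dots> = a * z powi m"
      using assms by (subst sum.delta) auto
    finally show ?thesis .
  qed
  then show ?thesis
    unfolding trig_def by (intro exI[of _ "\<lambda>k. if k = m then a else 0"]) simp
qed

lemma trig_const: "0 \<le> d \<Longrightarrow> trig d (\<lambda>z. a)"
  using trig_monom[of 0 d a] by simp

lemma trig_add: assumes "trig d f" "trig d g" shows "trig d (\<lambda>z. f z + g z)"
proof -
  from assms obtain a b where
    "\<forall>z\<in>circle. f z = (\<Sum>m\<in>{-d..d}. a m * z powi m)"
    "\<forall>z\<in>circle. g z = (\<Sum>m\<in>{-d..d}. b m * z powi m)"
    unfolding trig_def by auto
  then show ?thesis
    unfolding trig_def
    by (intro exI[of _ "\<lambda>m. a m + b m"]) (simp add: sum.distrib algebra_simps)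
qed

lemma trig_sum:
  assumes "0 \<le> d" "\<And>i. i \<in> A \<Longrightarrow> trig d (f i)" shows "trig d (\<lambda>z. \<Sum>i\<in>A. f i z)"
  using assms
  by (induction A rule: infinite_finite_induct) (auto intro!: trig_add trig_const[of d 0, simplified])

lemma trig_mult:
  assumes "trig d f" "trig e g" "0 \<le> d" "0 \<le> e" shows "trig (d + e) (\<lambda>z. f z * g z)"
proof -
  from assms obtain a b where ab:
    "\<forall>z\<in>circle. f z = (\<Sum>m\<in>{-d..d}. a m * z powi m)"
    "\<forall>z\<in>circle. g z = (\<Sum>m\<in>{-e..e}. b m * z powi m)"
    unfolding trig_def by auto
  have "trig (d + e) (\<lambda>z. \<Sum>m\<in>{-d..d}. \<Sum>k\<in>{-e..e}. (a m * b k) * z powi (m + k))"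
    using assms by (intro trig_sum trig_monom) auto
  then show ?thesis
    by (rule trig_cong)
       (simp add: ab sum_product powi_circle_mult[symmetric] mult_ac)
qed

lemma trig_mono: assumes "trig d f" "d \<le> e" shows "trig e f"
proof (cases "0 \<le> d")
  case True
  with assms have "trig (d + (e - d)) (\<lambda>z. f z * 1)"
    by (intro trig_mult trig_const) auto
  then show ?thesis by simp
next
  case False
  with assms(1) have "\<And>z. z \<in> circle \<Longrightarrow> f z = 0"
    unfolding trig_def by auto
  then show ?thesis
    unfolding trig_def by (intro exI[of _ "\<lambda>_. 0"]) auto
qed

lemma trig_continuous: assumes "trig d f" shows "continuous_on circle f"
proof -
  from assms obtain c where "\<forall>z\<in>circle. f z = (\<Sum>m\<in>{-d..d}. c m * z powi m)"
    unfolding trig_def by auto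
  moreover have "continuous_on circle (\<lambda>z. \<Sum>m\<in>{-d..d}. c m * z powi m)"
    by (intro continuous_intros) auto
  ultimately show ?thesis by (subst continuous_on_cong) auto
qed

text \<open>Stone-Weierstrass gives a real polynomial in Re z and Im z. On the circle cnj z =
  z^(-1), so a linear functional is a combination of z and z^(-1), and sums and products stay
  trigonometric.\<close>

lemma trig_approx:
  assumes u: "continuous_on circle (u :: complex \<Rightarrow> real)" and e: "0 < e"
  shows "\<exists>d p. 0 \<le> d \<and> trig d (\<lambda>z. of_real (p z)) \<and> (\<forall>z\<in>circle. \<bar>u z - p z\<bar> < e)"
proof -
  obtain g where g: "real_polynomial_function g" "\<And>x. x \<in> circle \<Longrightarrow> \<bar>u x - g x\<bar> < e"
    using Stone_Weierstrass_real_polynomial_function[OF _ u e] by auto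
  from g(1) have "\<exists>d. 0 \<le> d \<and> trig d (\<lambda>z. of_real (g z))"
  proof induction
    case (linear f)
    then interpret bounded_linear f .
    have "f z = Re z * f 1 + Im z * f \<i>" for z
    proof -
      have "f z = f (Re z *\<^sub>R 1 + Im z *\<^sub>R \<i>)"
        by (rule arg_cong[of _ _ f]) (simp add: complex_eq_iff)
      then show ?thesis by (simp only: add scaleR) simp
    qed
    have *: "of_real (f z) = (of_real (f 1) / 2 - \<i> * of_real (f \<i>) / 2) * z powi 1 +
        (of_real (f 1) / 2 + \<i> * of_real (f \<i>) / 2) * z powi (-1)" if "z \<in> circle" for z
    proof -
      have "z powi (-1) = cnj z"
        using cnj_powi_circle[OF that, of 1] by simp
      then show ?thesis
        unfolding \<open>\<And>z. f z = Re z * f 1 + Im z * f \<i>\<close>[of z] by (simp add: complex_eq_iff algebra_simps)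
    qed
    have "trig 1 (\<lambda>z. (of_real (f 1) / 2 - \<i> * of_real (f \<i>) / 2) * z powi 1 +
        (of_real (f 1) / 2 + \<i> * of_real (f \<i>) / 2) * z powi (-1))"
      by (intro trig_add trig_monom) auto
    then have "trig 1 (\<lambda>z. of_real (f z))"
      by (rule trig_cong) (rule *[symmetric])
    then show ?case by (intro exI[of _ 1]) simp
  next
    case (const c)
    show ?case by (intro exI[of _ 0]) (simp add: trig_const)
  next
    case (add f g)
    then obtain d e where "0 \<le> d" "0 \<le> e" "trig d (\<lambda>z. of_real (f z))" "trig e (\<lambda>z. of_real (g z))"
      by auto
    then show ?case
      by (intro exI[of _ "max d e"]) (auto intro!: trig_add elim!: trig_mono)
  next
    case (mult f g)
    then obtain d e where "0 \<le> d" "0 \<le> e" "trig d (\<lambda>z. of_real (f z))" "trig e (\<lambda>z. of_real (g z))"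
      by auto
    then show ?case
      by (intro exI[of _ "d + e"]) (auto intro!: trig_mult)
  qed
  then obtain d where "0 \<le> d" "trig d (\<lambda>z. of_real (g z))" by auto
  with g(2) show ?thesis by (intro exI[of _ d] exI[of _ g]) blast
qed

section \<open>Finite Borel measures on the circle and their Fourier coefficients\<close>

lemma sets_circle_borel: "A \<in> sets circle_borel \<longleftrightarrow> A \<subseteq> circle \<and> A \<in> sets borel"
  unfolding circle_borel_def by (subst sets_restrict_space_iff) auto

lemma finite_circle_measureD:
  assumes "finite_circle_measure \<nu>"
  shows "finite_measure \<nu>" "sets \<nu> = sets circle_borel" "space \<nu> = circle"
proof -
  show *: "finite_measure \<nu>" "sets \<nu> = sets circle_borel"
    using assms unfolding finite_circle_measure_def by auto
  show "space \<nu> = circle"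
    using sets_eq_imp_space_eq[OF *(2)] unfolding circle_borel_def by (simp add: space_restrict_space)
qed

lemma circle_measurable:
  assumes "finite_circle_measure \<nu>" "continuous_on circle f"
  shows "f \<in> borel_measurable \<nu>"
  using borel_measurable_continuous_on_restrict[OF assms(2)] finite_circle_measureD(2)[OF assms(1)]
  unfolding circle_borel_def by (simp cong: measurable_cong_sets)

lemma circle_integrable:
  fixes f :: "complex \<Rightarrow> 'b::{banach, second_countable_topology}"
  assumes \<nu>: "finite_circle_measure \<nu>" and f: "continuous_on circle f"
  shows "integrable \<nu> f"
proof -
  interpret finite_measure \<nu> using \<nu> by (rule finite_circle_measureD)
  have "bounded (f ` circle)"
    by (intro compact_imp_bounded compact_continuous_image f compact_sphere)
  then obtain B where "\<And>z. z \<in> circle \<Longrightarrow> norm (f z) \<le> B"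
    unfolding bounded_iff by blast
  then show ?thesis
    using circle_measurable[OF \<nu> f]
    by (intro integrable_const_bound[of _ B]) (auto simp: finite_circle_measureD[OF \<nu>])
qed

lemma powi_continuous_circle [continuous_intros]: "continuous_on circle (\<lambda>z::complex. z powi m)"
  by (intro continuous_intros) auto

text \<open>The tent functions max 0 (1 - k dist(z, K)) decrease to the indicator of K and are
  replaced by polynomials within 1/(k + 1). The uniform bound 2 is what dominated convergence
  needs.\<close>

lemma trig_approx_compact:
  assumes K: "compact K"
  shows "\<exists>d p. (\<forall>k::nat. 0 \<le> d k \<and> trig (d k) (p k)) \<and> (\<forall>k. \<forall>z\<in>circle. norm (p k z) \<le> 2) \<and>
     (\<forall>z\<in>circle. (\<lambda>k. p k z) \<longlonglongrightarrow> indicator K z)"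
\<comment> \<open>For empty K the value of \<open>infdist\<close> is 0 by convention, so that the
  tent functions would be constantly 1.\<close>
proof (cases "K = {}")
  case True
  then show ?thesis
    by (intro exI[of _ "\<lambda>_. 0"] exI[of _ "\<lambda>_ _. 0"]) (auto intro: trig_const)
next
  case False
  define u where "u k z = max 0 (1 - real k * infdist z K)" for k :: nat and z :: complex
  have "continuous_on circle (u k)" for k
    unfolding u_def by (intro continuous_intros)
  then have "\<exists>d p. 0 \<le> d \<and> trig d (\<lambda>z. of_real (p z)) \<and> (\<forall>z\<in>circle. \<bar>u k z - p z\<bar> < 1 / real (Suc k))" for k
    by (rule trig_approx) simp
  then obtain d p where dp: "\<And>k. 0 \<le> d k" "\<And>k. trig (d k) (\<lambda>z. of_real (p k z))"
      "\<And>k z. z \<in> circle \<Longrightarrow> \<bar>u k z - p k z\<bar> < 1 / real (Suc k)"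
    by metis
  have u01: "0 \<le> u k z" "u k z \<le> 1" for k z
    unfolding u_def by (auto simp: infdist_nonneg)
  have bd: "\<bar>p k z\<bar> \<le> 2" if "z \<in> circle" for k z
  proof -
    have "1 / real (Suc k) \<le> 1" by simp
    then show ?thesis using dp(3)[OF that, of k] u01[of k z] by linarith
  qed
  have ulim: "(\<lambda>k. u k z) \<longlonglongrightarrow> indicator K z" for z
  proof (cases "z \<in> K")
    case True
    then show ?thesis by (simp add: u_def)
  next
    case zK: False
    then have pos: "infdist z K > 0"
      using K False by (metis compact_imp_closed in_closed_iff_infdist_zero infdist_nonneg order_less_le)
    obtain N :: nat where N: "1 / infdist z K < real N" using reals_Archimedean2 by auto
    have "u k z = 0" if "k \<ge> N" for k
    proof -
      have "1 / infdist z K < real k" using N that by linarith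
      then have "1 < real k * infdist z K" using pos by (simp add: field_simps)
      then show ?thesis by (simp add: u_def)
    qed
    then have "(\<lambda>k. u k z) \<longlonglongrightarrow> 0"
      by (intro tendsto_eventually) (auto simp: eventually_sequentially)
    then show ?thesis using zK by simp
  qed
  have plim: "(\<lambda>k. p k z) \<longlonglongrightarrow> indicator K z" if z: "z \<in> circle" for z
  proof -
    have "(\<lambda>k. u k z - p k z) \<longlonglongrightarrow> 0"
      by (rule Lim_null_comparison[OF _ LIMSEQ_Suc[OF lim_1_over_n]])
         (use dp(3)[OF z] in \<open>auto intro!: always_eventually less_imp_le\<close>)
    from tendsto_diff[OF ulim[of z] this] show ?thesis by simp
  qed
  have "(\<lambda>k. complex_of_real (p k z)) \<longlonglongrightarrow> indicator K z" if z: "z \<in> circle" for z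
    using tendsto_of_real[OF plim[OF z], where 'a = complex] by (cases "z \<in> K") auto
  then show ?thesis
    using dp bd by (intro exI[of _ d] exI[of _ "\<lambda>k z. of_real (p k z)"]) auto
qed

lemma circle_compact_limits:
  assumes \<nu>: "finite_circle_measure \<nu>" and K: "compact K" "K \<subseteq> circle"
    and p: "\<And>k::nat. trig (d k) (p k)" "\<And>k z. z \<in> circle \<Longrightarrow> norm (p k z) \<le> 2"
      "\<And>z. z \<in> circle \<Longrightarrow> (\<lambda>k. p k z) \<longlonglongrightarrow> indicator K z"
  shows "(\<lambda>k. LINT z|\<nu>. p k z) \<longlonglongrightarrow> of_real (measure \<nu> K)"
    and "(\<lambda>k. LINT z|\<nu>. (norm (p k z))\<^sup>2) \<longlonglongrightarrow> measure \<nu> K"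
proof -
  interpret finite_measure \<nu> using \<nu> by (rule finite_circle_measureD)
  have KS: "K \<in> sets \<nu>"
    using K finite_circle_measureD[OF \<nu>] by (auto simp: sets_circle_borel compact_imp_closed)
  have m: "p k \<in> borel_measurable \<nu>" for k
    by (rule circle_measurable[OF \<nu> trig_continuous[OF p(1)]])
  have "(\<lambda>k. LINT z|\<nu>. p k z) \<longlonglongrightarrow> (LINT z|\<nu>. indicator K z)"
    by (rule integral_dominated_convergence[of _ _ _ "\<lambda>_. 2"])
       (use m KS p in \<open>auto simp: finite_circle_measureD[OF \<nu>] intro!: borel_measurable_indicator\<close>)
  moreover have "(LINT z|\<nu>. indicator K z) = complex_of_real (LINT z|\<nu>. indicator K z)"
    by (subst integral_complex_of_real[symmetric], rule Bochner_Integration.integral_cong)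
       (auto split: split_indicator)
  ultimately show "(\<lambda>k. LINT z|\<nu>. p k z) \<longlonglongrightarrow> of_real (measure \<nu> K)"
    using KS by simp
  have "(\<lambda>k. LINT z|\<nu>. (norm (p k z))\<^sup>2) \<longlonglongrightarrow> (LINT z|\<nu>. indicator K z)"
  proof (rule integral_dominated_convergence[of _ _ _ "\<lambda>_. 4"])
    show "AE z in \<nu>. (\<lambda>k. (norm (p k z))\<^sup>2) \<longlonglongrightarrow> indicator K z"
    proof (rule AE_I2)
      fix z assume "z \<in> space \<nu>"
      then have "(\<lambda>k. (norm (p k z))\<^sup>2) \<longlonglongrightarrow> (norm (indicator K z :: complex))\<^sup>2"
        using p(3) by (intro tendsto_intros) (auto simp: finite_circle_measureD[OF \<nu>])
      then show "(\<lambda>k. (norm (p k z))\<^sup>2) \<longlonglongrightarrow> indicator K z" by (simp split: split_indicator_asm)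
    qed
    show "AE z in \<nu>. norm ((norm (p k z))\<^sup>2) \<le> 4" for k
    proof (rule AE_I2)
      fix z assume "z \<in> space \<nu>"
      then have "(norm (p k z))\<^sup>2 \<le> 2\<^sup>2"
        using p(2) by (intro power_mono) (auto simp: finite_circle_measureD[OF \<nu>])
      then show "norm ((norm (p k z))\<^sup>2) \<le> 4" by simp
    qed
  qed (use m KS in auto)
  then show "(\<lambda>k. LINT z|\<nu>. (norm (p k z))\<^sup>2) \<longlonglongrightarrow> measure \<nu> K"
    using KS by simp
qed

text \<open>The measure is pushed forward to the Borel sets of the whole plane, where finite
  measures are inner regular.\<close>

lemma circle_inner_regular:
  assumes \<nu>: "finite_circle_measure \<nu>" and A: "A \<in> sets \<nu>"
  shows "emeasure \<nu> A = (SUP K\<in>{K. K \<subseteq> A \<and> compact K}. emeasure \<nu> K)"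
proof -
  interpret finite_measure \<nu> using \<nu> by (rule finite_circle_measureD)
  let ?N = "distr \<nu> borel (\<lambda>z. z)"
  have id: "(\<lambda>z. z) \<in> measurable \<nu> borel"
    by (rule circle_measurable[OF \<nu>]) (rule continuous_on_id)
  have A': "A \<subseteq> circle" "A \<in> sets borel"
    using A finite_circle_measureD[OF \<nu>] by (auto simp: sets_circle_borel)
  have em: "emeasure ?N B = emeasure \<nu> B" if "B \<in> sets borel" "B \<subseteq> circle" for B
    using that id by (simp add: emeasure_distr finite_circle_measureD[OF \<nu>] Int_absorb2)
  have "emeasure ?N A = (SUP K\<in>{K. K \<subseteq> A \<and> compact K}. emeasure ?N K)"
    using A' id by (intro inner_regular) (auto simp: emeasure_distr finite_circle_measureD[OF \<nu>] emeasure_eq_measure)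
  also have "\<dots> = (SUP K\<in>{K. K \<subseteq> A \<and> compact K}. emeasure \<nu> K)"
    using A' by (intro SUP_cong) (auto simp: compact_imp_closed em)
  finally show ?thesis using A' em by simp
qed

lemma circle_compact_subset:
  assumes \<nu>: "finite_circle_measure \<nu>" and A: "A \<in> sets \<nu>" "A \<notin> null_sets \<nu>"
  shows "\<exists>K. K \<subseteq> A \<and> compact K \<and> K \<subseteq> circle \<and> measure \<nu> K \<noteq> 0"
proof -
  interpret finite_measure \<nu> using \<nu> by (rule finite_circle_measureD)
  have "0 < (SUP K\<in>{K. K \<subseteq> A \<and> compact K}. emeasure \<nu> K)"
    using circle_inner_regular[OF \<nu> A(1)] A by (auto simp: null_sets_def zero_less_iff_neq_zero)
  then obtain K where "K \<subseteq> A" "compact K" "0 < emeasure \<nu> K"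
    unfolding less_SUP_iff by auto
  moreover have "A \<subseteq> circle"
    using A sets.sets_into_space finite_circle_measureD(3)[OF \<nu>] by blast
  ultimately show ?thesis by (intro exI[of _ K]) (auto simp: emeasure_eq_measure)
qed

lemma circle_trig_integral:
  assumes \<nu>: "finite_circle_measure \<nu>" and f: "\<And>z. z \<in> circle \<Longrightarrow> f z = (\<Sum>m\<in>I. c m * z powi m)"
  shows "(LINT z|\<nu>. f z) = (\<Sum>m\<in>I. c m * (LINT z|\<nu>. z powi m))"
proof -
  have "(LINT z|\<nu>. f z) = (LINT z|\<nu>. (\<Sum>m\<in>I. c m * z powi m))"
    by (rule Bochner_Integration.integral_cong) (auto simp: f finite_circle_measureD[OF \<nu>])
  also have "\<dots> = (\<Sum>m\<in>I. LINT z|\<nu>. c m * z powi m)"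
    by (intro Bochner_Integration.integral_sum circle_integrable[OF \<nu>] continuous_intros) auto
  finally show ?thesis by simp
qed

lemma circle_normsq_integral:
  assumes \<nu>: "finite_circle_measure \<nu>" and I: "finite I"
  shows "complex_of_real (LINT z|\<nu>. (norm (\<Sum>m\<in>I. c m * z powi m))\<^sup>2) =
    (\<Sum>m\<in>I. \<Sum>k\<in>I. c m * cnj (c k) * (LINT z|\<nu>. z powi (m - k)))"
proof -
  have "complex_of_real (LINT z|\<nu>. (norm (\<Sum>m\<in>I. c m * z powi m))\<^sup>2)
    = (LINT z|\<nu>. complex_of_real ((norm (\<Sum>m\<in>I. c m * z powi m))\<^sup>2))"
    by (rule integral_complex_of_real[symmetric])
  also have "\<dots> = (LINT z|\<nu>. (\<Sum>m\<in>I. \<Sum>k\<in>I. c m * cnj (c k) * z powi (m - k)))"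
  proof (rule Bochner_Integration.integral_cong)
    fix z assume "z \<in> space \<nu>"
    then have z: "z \<in> circle" by (simp add: finite_circle_measureD[OF \<nu>])
    show "complex_of_real ((norm (\<Sum>m\<in>I. c m * z powi m))\<^sup>2) =
        (\<Sum>m\<in>I. \<Sum>k\<in>I. c m * cnj (c k) * z powi (m - k))"
      using powi_circle_mult[OF z, of m "- k" for m k]
      unfolding complex_norm_square cnj_sum sum_product complex_cnj_mult cnj_powi_circle[OF z]
      by (intro sum.cong refl) (simp add: mult_ac)
  qed simp
  also have "\<dots> = (\<Sum>m\<in>I. \<Sum>k\<in>I. c m * cnj (c k) * (LINT z|\<nu>. z powi (m - k)))"
    by (subst Bochner_Integration.integral_sum,
        (intro circle_integrable[OF \<nu>] continuous_intros; fastforce), intro sum.cong refl,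
        subst Bochner_Integration.integral_sum,
        (intro circle_integrable[OF \<nu>] continuous_intros; fastforce)) simp
  finally show ?thesis .
qed

text \<open>Equal coefficients give equal integrals of trigonometric polynomials, hence equal
  measures of compact sets by approximation, hence equal measures by inner regularity.\<close>

lemma circle_measure_eqI:
  assumes \<nu>: "finite_circle_measure \<nu>" and \<rho>: "finite_circle_measure \<rho>"
    and eq: "\<And>m. (LINT z|\<nu>. z powi m) = (LINT z|\<rho>. z powi m)"
  shows "\<nu> = \<rho>"
proof (rule measure_eqI)
  show "sets \<nu> = sets \<rho>"
    using finite_circle_measureD[OF \<nu>] finite_circle_measureD[OF \<rho>] by simp
  fix A assume A: "A \<in> sets \<nu>"
  interpret V: finite_measure \<nu> using \<nu> by (rule finite_circle_measureD)
  interpret R: finite_measure \<rho> using \<rho> by (rule finite_circle_measureD)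
  have AR: "A \<in> sets \<rho>" "A \<subseteq> circle"
    using A finite_circle_measureD[OF \<nu>] finite_circle_measureD[OF \<rho>] by (auto simp: sets_circle_borel)
  have "emeasure \<nu> K = emeasure \<rho> K" if K: "compact K" "K \<subseteq> circle" for K
  proof -
    obtain d p where dp: "\<And>k::nat. trig (d k) (p k)" "\<And>k z. z \<in> circle \<Longrightarrow> norm (p k z) \<le> 2"
      "\<And>z. z \<in> circle \<Longrightarrow> (\<lambda>k. p k z) \<longlonglongrightarrow> indicator K z"
      using trig_approx_compact[OF K(1)] by blast
    have "(LINT z|\<nu>. p k z) = (LINT z|\<rho>. p k z)" for k
    proof -
      obtain c where "\<forall>z\<in>circle. p k z = (\<Sum>m\<in>{-d k..d k}. c m * z powi m)"
        using dp(1)[of k] unfolding trig_def by auto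
      then show ?thesis
        using circle_trig_integral[OF \<nu>, of "p k" c] circle_trig_integral[OF \<rho>, of "p k" c] eq by simp
    qed
    then have "complex_of_real (measure \<nu> K) = of_real (measure \<rho> K)"
      using circle_compact_limits(1)[OF \<nu> K dp] circle_compact_limits(1)[OF \<rho> K dp]
      by (metis (no_types, lifting) LIMSEQ_unique ext)
    then show ?thesis by (simp add: V.emeasure_eq_measure R.emeasure_eq_measure)
  qed
  then show "emeasure \<nu> A = emeasure \<rho> A"
    unfolding circle_inner_regular[OF \<nu> A] circle_inner_regular[OF \<rho> AR(1)]
    using AR by (intro SUP_cong) auto
qed


section \<open>Lebesgue measure on the circle\<close>

lemma circle_lebesgue_base:
  shows "finite_circle_measure circle_lebesgue"
    and "(f :: complex \<Rightarrow> complex) \<in> borel_measurable circle_borel \<Longrightarrow>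
      (LINT z|circle_lebesgue. f z) = (LINT t|restrict_space lborel {0..<2 * pi}. f (cis t))"
    and "cis \<in> measurable (restrict_space lborel {0..<2 * pi}) circle_borel"
proof -
  have "cis \<in> borel_measurable borel"
    by (intro borel_measurable_continuous_onI continuous_intros)
  then show c: "cis \<in> measurable (restrict_space lborel {0..<2 * pi}) circle_borel"
    unfolding circle_borel_def
    by (intro measurable_restrict_space2 measurable_restrict_space1) (auto simp: measurable_lborel1)
  show "f \<in> borel_measurable circle_borel \<Longrightarrow>
      (LINT z|circle_lebesgue. f z) = (LINT t|restrict_space lborel {0..<2 * pi}. f (cis t))"
    unfolding circle_lebesgue_def by (rule integral_distr[OF c])
  interpret L: finite_measure "restrict_space lborel {0..<2 * pi}"
    by (rule finite_measureI) (simp add: emeasure_restrict_space space_restrict_space)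
  show "finite_circle_measure circle_lebesgue"
    unfolding finite_circle_measure_def circle_lebesgue_def
    using L.finite_measure_distr[OF c] by simp
qed

text \<open>\<open>circle_lebesgue\<close> is not normalised. Its mass 2 * pi is the source of this
  factor in all later integrals.\<close>

lemma circle_lebesgue_powi:
  "(LINT z|circle_lebesgue. z powi m) = (if m = 0 then 2 * pi else 0)"
proof -
  have m: "(\<lambda>z::complex. z powi m) \<in> borel_measurable circle_borel"
    using borel_measurable_continuous_on_restrict[OF powi_continuous_circle]
    unfolding circle_borel_def .
  have cont: "continuous_on {0..2*pi} (\<lambda>t. cis (m * t))" for m :: int
    by (intro continuous_intros)
  have "(LINT z|circle_lebesgue. z powi m) = (LINT t|restrict_space lborel {0..<2 * pi}. cis (m * t))"
    by (subst circle_lebesgue_base(2)[OF m]) (simp add: cis_power_int)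
  also have "\<dots> = (LINT t:{0..<2*pi}|lborel. cis (m * t))"
    by (subst integral_restrict_space) (auto simp: set_lebesgue_integral_def)
  also have "\<dots> = (LINT t:{0..2*pi}|lborel. cis (m * t))"
  proof (rule set_integral_cong_set)
    have [measurable]: "(\<lambda>t::real. cis (m * t)) \<in> borel_measurable borel"
      by (intro borel_measurable_continuous_onI continuous_intros)
    show "set_borel_measurable lborel {0..<2*pi} (\<lambda>t. cis (m * t))"
      "set_borel_measurable lborel {0..2*pi} (\<lambda>t. cis (m * t))"
      unfolding set_borel_measurable_def by measurable
    have "AE t in lborel. t \<noteq> 2 * pi" by (rule AE_lborel_singleton)
    then show "AE t in lborel. (t \<in> {0..2 * pi}) = (t \<in> {0..<2 * pi})"
      by eventually_elim auto
  qed
  also have "\<dots> = (if m = 0 then 2 * pi else 0)"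
  proof (cases "m = 0")
    case True
    have "(LINT t|lborel. indicat_real {0..2*pi} t *\<^sub>R (1::complex)) =
        (LINT t|lborel. indicat_real {0..2*pi} t) *\<^sub>R 1"
      by (rule integral_scaleR_left) simp
    then show ?thesis using True by (simp add: set_lebesgue_integral_def scaleR_conv_of_real)
  next
    case False
    have "((\<lambda>t. cis (m * t) / (\<i> * m)) has_vector_derivative cis (m * t)) (at t within {0..2*pi})" for t :: real
      using False unfolding cis_conv_exp
      by (auto intro!: derivative_eq_intros has_vector_derivative_real_field simp: field_simps)
    then have "(LINT t:{0..2*pi}|lborel. cis (m * t)) = cis (m * (2 * pi)) / (\<i> * m) - cis (real_of_int m * 0) / (\<i> * m)"
      unfolding set_lebesgue_integral_def
      using cont[of m] by (intro integral_FTC_Icc) auto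
    also have "cis (m * (2 * pi)) = 1"
      using cis_power_int[of "2 * pi" m] by simp
    finally show ?thesis using False by simp
  qed
  finally show ?thesis .
qed

lemma circle_lebesgue_parseval:
  assumes "finite I"
  shows "(LINT z|circle_lebesgue. (norm (\<Sum>m\<in>I. c m * z powi m))\<^sup>2) = 2 * pi * (\<Sum>m\<in>I. (norm (c m))\<^sup>2)"
proof -
  have "complex_of_real (LINT z|circle_lebesgue. (norm (\<Sum>m\<in>I. c m * z powi m))\<^sup>2) =
      (\<Sum>m\<in>I. \<Sum>k\<in>I. if k = m then 2 * pi * c m * cnj (c k) else 0)"
    unfolding circle_normsq_integral[OF circle_lebesgue_base(1) assms]
    by (intro sum.cong) (auto simp: circle_lebesgue_powi)
  also have "\<dots> = of_real (2 * pi * (\<Sum>m\<in>I. (norm (c m))\<^sup>2))"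
    using assms by (simp add: sum_distrib_left complex_norm_square mult_ac del: of_real_power)
  finally show ?thesis by (simp only: of_real_eq_iff)
qed

text \<open>By Cauchy-Schwarz and Parseval, the integral of a trigonometric polynomial against
  \<open>\<nu>\<close> is at most its L2 norm for Lebesgue measure times sqrt B. Applied to
  approximations of the indicator of a Lebesgue-null compact set, this shows that
  \<open>\<nu>\<close> does not charge it.\<close>

lemma l2_coefficients_absolutely_continuous:
  assumes \<nu>: "finite_circle_measure \<nu>"
    and B: "\<And>I. finite I \<Longrightarrow> (\<Sum>m\<in>I. (norm (LINT z|\<nu>. z powi m))\<^sup>2) \<le> B"
  shows "absolutely_continuous circle_lebesgue \<nu>"
  unfolding absolutely_continuous_def
proof
  fix A assume A: "A \<in> null_sets circle_lebesgue"
  show "A \<in> null_sets \<nu>"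
  proof (rule ccontr)
    assume "A \<notin> null_sets \<nu>"
    moreover have AS: "A \<in> sets \<nu>"
      using A finite_circle_measureD[OF \<nu>] finite_circle_measureD[OF circle_lebesgue_base(1)] by (auto simp: null_sets_def)
    ultimately obtain K where K: "K \<subseteq> A" "compact K" "K \<subseteq> circle" "measure \<nu> K \<noteq> 0"
      using circle_compact_subset[OF \<nu>] by blast
    have "emeasure circle_lebesgue K \<le> emeasure circle_lebesgue A"
      using K A by (intro emeasure_mono) auto
    then have K0: "measure circle_lebesgue K = 0"
      using A by (auto simp: null_sets_def measure_def)
    obtain d p where dp: "\<And>k::nat. trig (d k) (p k)" "\<And>k z. z \<in> circle \<Longrightarrow> norm (p k z) \<le> 2"
      "\<And>z. z \<in> circle \<Longrightarrow> (\<lambda>k. p k z) \<longlonglongrightarrow> indicator K z"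
      using trig_approx_compact[OF K(2)] by blast
    have le: "norm (LINT z|\<nu>. p k z) \<le> sqrt (LINT z|circle_lebesgue. (norm (p k z))\<^sup>2) * sqrt B" for k
    proof -
      obtain c where c: "\<forall>z\<in>circle. p k z = (\<Sum>m\<in>{-d k..d k}. c m * z powi m)"
        using dp(1)[of k] unfolding trig_def by auto
      have "norm (LINT z|\<nu>. p k z) = norm (\<Sum>m\<in>{-d k..d k}. c m * (LINT z|\<nu>. z powi m))"
        using circle_trig_integral[OF \<nu>, of "p k" c] c by simp
      also have "\<dots> \<le> (\<Sum>m\<in>{-d k..d k}. norm (c m) * norm (LINT z|\<nu>. z powi m))"
        by (rule order_trans[OF norm_sum]) (simp add: norm_mult)
      also have "\<dots> \<le> sqrt (\<Sum>m\<in>{-d k..d k}. (norm (c m))\<^sup>2) *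
          sqrt (\<Sum>m\<in>{-d k..d k}. (norm (LINT z|\<nu>. z powi m))\<^sup>2)"
        using L2_set_mult_ineq[of "\<lambda>m. norm (c m)" "\<lambda>m. norm (LINT z|\<nu>. z powi m)" "{-d k..d k}"]
        by (simp add: L2_set_def)
      also have "\<dots> \<le> sqrt (LINT z|circle_lebesgue. (norm (p k z))\<^sup>2) * sqrt B"
      proof (intro mult_mono)
        have "(LINT z|circle_lebesgue. (norm (p k z))\<^sup>2) =
            (LINT z|circle_lebesgue. (norm (\<Sum>m\<in>{-d k..d k}. c m * z powi m))\<^sup>2)"
          using c by (intro Bochner_Integration.integral_cong)
            (auto simp: finite_circle_measureD[OF circle_lebesgue_base(1)])
        also have "\<dots> = 2 * pi * (\<Sum>m\<in>{-d k..d k}. (norm (c m))\<^sup>2)"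
          by (rule circle_lebesgue_parseval) simp
        also have "\<dots> \<ge> 1 * (\<Sum>m\<in>{-d k..d k}. (norm (c m))\<^sup>2)"
          using pi_gt3 by (intro mult_right_mono sum_nonneg) auto
        finally show "sqrt (\<Sum>m\<in>{-d k..d k}. (norm (c m))\<^sup>2) \<le> sqrt (LINT z|circle_lebesgue. (norm (p k z))\<^sup>2)"
          by simp
      qed (use B in \<open>auto simp: sum_nonneg\<close>)
      finally show ?thesis .
    qed
    have "(\<lambda>k. sqrt (LINT z|circle_lebesgue. (norm (p k z))\<^sup>2) * sqrt B) \<longlonglongrightarrow> sqrt (measure circle_lebesgue K) * sqrt B"
      by (intro tendsto_intros circle_compact_limits(2)[OF circle_lebesgue_base(1) K(2,3) dp])
    moreover have "(\<lambda>k. norm (LINT z|\<nu>. p k z)) \<longlonglongrightarrow> norm (complex_of_real (measure \<nu> K))"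
      by (intro tendsto_intros circle_compact_limits(1)[OF \<nu> K(2,3) dp])
    ultimately have "norm (complex_of_real (measure \<nu> K)) \<le> sqrt (measure circle_lebesgue K) * sqrt B"
      using le by (intro LIMSEQ_le) auto
    then show False using K0 K(4) measure_nonneg[of \<nu> K] by simp
  qed
qed

text \<open>With \<epsilon> = 2^(-n), the upper limit of the sets A n is null for
  \<open>\<nu>\<close> by Borel-Cantelli, and its complement is Lebesgue-null because it is a
  countable union of sets of arbitrarily small measure.\<close>

lemma mutually_singular_circleI:
  assumes \<nu>: "finite_circle_measure \<nu>"
    and e: "\<And>\<epsilon>::real. 0 < \<epsilon> \<Longrightarrow> \<exists>A\<in>sets circle_borel. measure \<nu> A \<le> \<epsilon> \<and> measure circle_lebesgue (circle - A) \<le> \<epsilon>"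
  shows "mutually_singular circle_lebesgue \<nu>"
proof -
  interpret V: finite_measure \<nu> using \<nu> by (rule finite_circle_measureD)
  interpret L: finite_measure circle_lebesgue using circle_lebesgue_base(1) by (rule finite_circle_measureD)
  have "\<exists>A\<in>sets circle_borel. measure \<nu> A \<le> (1/2)^n \<and> measure circle_lebesgue (circle - A) \<le> (1/2)^n" for n :: nat
    by (rule e) simp
  then obtain A where A: "\<And>n. A n \<in> sets circle_borel" "\<And>n. measure \<nu> (A n) \<le> (1/2)^n"
      "\<And>n. measure circle_lebesgue (circle - A n) \<le> (1/2)^n"
    by metis
  define B where "B = (\<Inter>N. \<Union>n\<in>{N..}. A n)"
  have AV: "A n \<in> sets \<nu>" "A n \<in> sets circle_lebesgue" "circle - A n \<in> sets circle_lebesgue" for n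
    using A(1) finite_circle_measureD[OF \<nu>] finite_circle_measureD[OF circle_lebesgue_base(1)]
    by (auto simp: sets_circle_borel)
  have small: "x = 0" if "\<And>n::nat. x \<le> c * (1/2)^n" "0 \<le> x" for x c :: real
  proof -
    have "(\<lambda>n. c * (1/2)^n) \<longlonglongrightarrow> c * 0"
      by (intro tendsto_intros LIMSEQ_realpow_zero) auto
    then have "x \<le> c * 0" using that(1) by (intro LIMSEQ_le_const) auto
    with that(2) show ?thesis by simp
  qed
  have BV: "B \<in> sets \<nu>" unfolding B_def using AV by auto
  have "measure \<nu> B \<le> 2 * (1/2)^N" for N
  proof -
    have s: "summable (\<lambda>n. measure \<nu> (A (n + N)))"
      by (rule summable_comparison_test'[of "\<lambda>n. (1/2::real)^(n+N)" 0])
         (use A(2) in \<open>auto simp: summable_ignore_initial_segment summable_geometric\<close>)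
    have "(\<Union>n\<in>{N..}. A n) \<subseteq> (\<Union>n. A (n + N))"
    proof
      fix x assume "x \<in> (\<Union>n\<in>{N..}. A n)"
      then obtain n where "N \<le> n" "x \<in> A n" by auto
      then have "x \<in> A ((n - N) + N)" by simp
      then show "x \<in> (\<Union>n. A (n + N))" by blast
    qed
    then have "measure \<nu> B \<le> measure \<nu> (\<Union>n. A (n + N))"
      by (intro V.finite_measure_mono) (auto simp: B_def AV)
    also have "\<dots> \<le> (\<Sum>n. measure \<nu> (A (n + N)))"
      by (rule V.finite_measure_subadditive_countably) (use AV s in auto)
    also have "\<dots> \<le> (\<Sum>n. (1/2::real)^(n+N))"
      by (intro suminf_le s A(2)) (auto simp: summable_ignore_initial_segment summable_geometric)
    also have "\<dots> = (\<Sum>n. (1/2::real)^n * (1/2)^N)"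
      by (simp add: power_add)
    also have "\<dots> = 2 * (1/2)^N"
      by (subst suminf_mult2[symmetric]) (auto simp: suminf_geometric summable_geometric)
    finally show ?thesis .
  qed
  then have "measure \<nu> B = 0" by (rule small) auto
  then have B0: "B \<in> null_sets \<nu>" using BV by (auto simp: null_sets_def V.emeasure_eq_measure)
  have "circle - B = (\<Union>N. \<Inter>n\<in>{N..}. circle - A n)"
    unfolding B_def by auto
  also have "\<dots> \<in> null_sets circle_lebesgue"
  proof (rule null_sets_UN)
    fix N
    let ?I = "\<Inter>n\<in>{N..}. circle - A n"
    have "measure circle_lebesgue ?I \<le> (1/2)^n" if "n \<ge> N" for n
      by (rule order_trans[OF L.finite_measure_mono A(3)[of n]]) (use AV that in auto)
    then have "measure circle_lebesgue ?I \<le> 2^N * (1/2)^n" for n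
    proof (cases "n \<ge> N")
      case False
      have "measure circle_lebesgue ?I \<le> (1/2)^N"
        using \<open>\<And>n. n \<ge> N \<Longrightarrow> _\<close> by blast
      also have "\<dots> \<le> (1/2)^n" using False by (intro power_decreasing) auto
      also have "\<dots> \<le> 2^N * (1/2)^n" by simp
      finally show ?thesis .
    next
      case True
      then have "measure circle_lebesgue ?I \<le> (1/2)^n"
        using \<open>\<And>n. n \<ge> N \<Longrightarrow> _\<close> by blast
      also have "\<dots> \<le> 2^N * (1/2)^n" by simp
      finally show ?thesis .
    qed
    then have "measure circle_lebesgue ?I = 0" by (rule small) auto
    moreover have "?I \<in> sets circle_lebesgue" using AV by (intro sets.countable_INT) auto
    ultimately show "?I \<in> null_sets circle_lebesgue"
      by (auto simp: null_sets_def L.emeasure_eq_measure)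
  qed
  finally have "circle - B \<in> null_sets circle_lebesgue" .
  moreover have "space \<nu> - (circle - B) \<in> null_sets \<nu>"
  proof -
    have "B \<subseteq> circle" using BV sets.sets_into_space finite_circle_measureD(3)[OF \<nu>] by blast
    then have "space \<nu> - (circle - B) = B" using finite_circle_measureD(3)[OF \<nu>] by auto
    then show ?thesis using B0 by simp
  qed
  ultimately show ?thesis unfolding mutually_singular_def by blast
qed

text \<open>A rotation multiplies the m-th coefficient by w^m, and the coefficients with m \<noteq>
  0 vanish, so uniqueness of coefficients gives invariance.\<close>

lemma circle_lebesgue_rotation:
  assumes w: "w \<in> circle" and f: "continuous_on circle (f :: complex \<Rightarrow> real)"
  shows "(LINT z|circle_lebesgue. f (z * w)) = (LINT z|circle_lebesgue. f z)"
proof -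
  interpret L: finite_measure circle_lebesgue using circle_lebesgue_base(1) by (rule finite_circle_measureD)
  note sp = finite_circle_measureD[OF circle_lebesgue_base(1)]
  have r: "(\<lambda>z. z * w) \<in> measurable circle_lebesgue circle_borel"
    unfolding circle_borel_def
    by (rule measurable_restrict_space2)
       (use w in \<open>auto simp: sp norm_mult intro!: circle_measurable[OF circle_lebesgue_base(1)] continuous_intros\<close>)
  let ?D = "distr circle_lebesgue circle_borel (\<lambda>z. z * w)"
  have fm: "f \<in> borel_measurable circle_borel"
    using borel_measurable_continuous_on_restrict[OF f] unfolding circle_borel_def .
  have D: "finite_circle_measure ?D"
    unfolding finite_circle_measure_def using L.finite_measure_distr[OF r] by simp
  have "?D = circle_lebesgue"
  proof (rule circle_measure_eqI[OF D circle_lebesgue_base(1)])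
    fix m
    have mm: "(\<lambda>z::complex. z powi m) \<in> borel_measurable circle_borel"
      using borel_measurable_continuous_on_restrict[OF powi_continuous_circle]
      unfolding circle_borel_def .
    have "(LINT z|?D. z powi m) = (LINT z|circle_lebesgue. w powi m * z powi m)"
      by (subst integral_distr[OF r mm]) (simp add: power_int_mult_distrib mult.commute)
    then show "(LINT z|?D. z powi m) = (LINT z|circle_lebesgue. z powi m)"
      by (simp add: circle_lebesgue_powi)
  qed
  then show ?thesis
    using integral_distr[OF r fm] by simp
qed


section \<open>Measures with prescribed coefficients, and mixtures\<close>

lemma circle_borel_powi_measurable [measurable]:
  "(\<lambda>z::complex. z powi m) \<in> borel_measurable circle_borel"
  using borel_measurable_continuous_on_restrict[OF powi_continuous_circle]
  unfolding circle_borel_def .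

lemma cis_measurable_circle: "cis \<in> measurable borel circle_borel"
  unfolding circle_borel_def
  by (rule measurable_restrict_space2)
     (auto intro!: borel_measurable_continuous_onI continuous_intros)

lemma cis_powi_iexp: "cis t powi m = iexp (real_of_int m * t)"
  by (simp only: cis_power_int) (rule cis_conv_exp)

text \<open>For N \<ge> |m| there are N - |m| pairs with difference m, so the quotient is a times
  the Fejer weight 1 - |m|/N.\<close>

lemma double_sum_diff_lim:
  fixes a :: complex
  shows "(\<lambda>N. (\<Sum>k<N. \<Sum>l<N. if int k - int l = m then a else 0) / of_nat N) \<longlonglongrightarrow> a"
proof -
  have inner: "(\<Sum>l<N. if int k - int l = m then a else 0) =
      (if 0 \<le> int k - m \<and> int k - m < int N then a else 0)" for k N :: nat
  proof -
    have "(\<Sum>l<N. if int k - int l = m then a else 0) =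
        (\<Sum>l<N. if l = nat (int k - m) then if 0 \<le> int k - m then a else 0 else 0)"
      by (intro sum.cong) auto
    also have "\<dots> = (if 0 \<le> int k - m \<and> int k - m < int N then a else 0)"
      by (subst sum.delta) (auto simp: nat_less_iff)
    finally show ?thesis .
  qed
  let ?c = "\<lambda>N. card {k\<in>{..<N}. 0 \<le> int k - m \<and> int k - m < int N}"
  have eq: "(\<Sum>k<N. \<Sum>l<N. if int k - int l = m then a else 0) = of_nat (?c N) * a" for N
    unfolding inner by (subst sum.inter_filter[symmetric]) auto
  have lower: "real N - \<bar>real_of_int m\<bar> \<le> real (?c N)" for N
  proof -
    have "{nat \<bar>m\<bar>..<N} \<subseteq> {k\<in>{..<N}. 0 \<le> int k - m \<and> int k - m < int N}" if "0 \<le> m"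
      using that by auto
    moreover have "{..<N - nat \<bar>m\<bar>} \<subseteq> {k\<in>{..<N}. 0 \<le> int k - m \<and> int k - m < int N}" if "m < 0"
      using that by auto
    ultimately have "N - nat \<bar>m\<bar> \<le> ?c N"
      using card_mono[of "{k\<in>{..<N}. 0 \<le> int k - m \<and> int k - m < int N}" "{nat \<bar>m\<bar>..<N}"]
        card_mono[of "{k\<in>{..<N}. 0 \<le> int k - m \<and> int k - m < int N}" "{..<N - nat \<bar>m\<bar>}"]
      by (cases "0 \<le> m") auto
    then show ?thesis by linarith
  qed
  have upper: "real (?c N) \<le> real N" for N
    using card_mono[of "{..<N}" "{k\<in>{..<N}. 0 \<le> int k - m \<and> int k - m < int N}"] by auto
  have "(\<lambda>N. real (?c N) / real N) \<longlonglongrightarrow> 1"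
  proof (rule tendsto_sandwich)
    show "\<forall>\<^sub>F N in sequentially. 1 - \<bar>real_of_int m\<bar> / real N \<le> real (?c N) / real N"
      using eventually_gt_at_top[of 0]
    proof eventually_elim
      case (elim N)
      have "1 - \<bar>real_of_int m\<bar> / real N = (real N - \<bar>real_of_int m\<bar>) / real N"
        using elim by (simp add: field_simps)
      then show ?case using lower[of N] elim by (simp add: divide_right_mono)
    qed
    show "\<forall>\<^sub>F N in sequentially. real (?c N) / real N \<le> 1"
      using eventually_gt_at_top[of 0]
      by eventually_elim (use upper in auto)
    have "(\<lambda>N. 1 - \<bar>real_of_int m\<bar> / real N) \<longlonglongrightarrow> 1 - 0"
      by (intro tendsto_intros lim_const_over_n)
    then show "(\<lambda>N. 1 - \<bar>real_of_int m\<bar> / real N) \<longlonglongrightarrow> 1" by simp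
  qed simp
  then have "(\<lambda>N. complex_of_real (real (?c N) / real N) * a) \<longlonglongrightarrow> complex_of_real 1 * a"
    by (intro tendsto_intros)
  then show ?thesis unfolding eq by simp
qed

text \<open>The Fejer means of the coefficients are the densities of probability measures on
  \<open>[0, 2\<pi>)\<close>; Helly selection gives a limit, and convergence of characteristic functions
  at the integers identifies its coefficients.\<close>

theorem herglotz:
  fixes a :: "int \<Rightarrow> complex"
  assumes a0: "a 0 = 1"
    and pos: "\<And>N z. z \<in> circle \<Longrightarrow>
      \<exists>x\<ge>0. (\<Sum>k<N. \<Sum>l<N. a (int k - int l) * z powi (int l - int k)) = complex_of_real x"
  shows "\<exists>\<nu>. finite_circle_measure \<nu> \<and> prob_space \<nu> \<and> (\<forall>m. (LINT z|\<nu>. z powi m) = a m)"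
proof -
  define S where "S N z = (\<Sum>k<N. \<Sum>l<N. a (int k - int l) * z powi (int l - int k))" for N :: nat and z
  define g where "g N z = Re (S N z) / (2 * pi * real N)" for N :: nat and z
  have S_real: "S N z = of_real (Re (S N z))" "0 \<le> Re (S N z)" if "z \<in> circle" for N z
    using pos[OF that, of N] unfolding S_def[symmetric] by auto
  note C = circle_lebesgue_base(1) and CD = finite_circle_measureD[OF circle_lebesgue_base(1)]
  have S_cont: "continuous_on circle (S N)" for N
    unfolding S_def by (intro continuous_intros) auto
  have g_cont: "continuous_on circle (g N)" for N
    unfolding g_def divide_inverse using S_cont by (auto intro!: continuous_intros)
  have gm[measurable]: "g N \<in> borel_measurable circle_borel" for N
    using borel_measurable_continuous_on_restrict[OF g_cont] unfolding circle_borel_def .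
  have coef: "(LINT z|circle_lebesgue. z powi m * of_real (g N z)) =
      (\<Sum>k<N. \<Sum>l<N. if int k - int l = m then a m else 0) / of_nat N" if "0 < N" for N m
  proof -
    have "(LINT z|circle_lebesgue. z powi m * of_real (g N z)) =
        (LINT z|circle_lebesgue. (\<Sum>k<N. \<Sum>l<N. a (int k - int l) * z powi (m + int l - int k)) / (2 * pi * real N))"
    proof (rule Bochner_Integration.integral_cong)
      fix z assume "z \<in> space circle_lebesgue"
      then have z: "z \<in> circle" by (simp add: CD)
      have "z powi m * of_real (g N z) = z powi m * S N z / (2 * pi * real N)"
        unfolding g_def using S_real(1)[OF z, of N] by simp
      also have "z powi m * S N z = (\<Sum>k<N. \<Sum>l<N. a (int k - int l) * z powi (m + int l - int k))"
        unfolding S_def sum_distrib_left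
        using powi_circle_mult[OF z, of m "int l - int k" for k l]
        by (intro sum.cong refl) (simp add: mult_ac algebra_simps)
      finally show "z powi m * of_real (g N z) =
          (\<Sum>k<N. \<Sum>l<N. a (int k - int l) * z powi (m + int l - int k)) / (2 * pi * real N)" .
    qed simp
    also have "\<dots> = (\<Sum>k<N. \<Sum>l<N. a (int k - int l) * (LINT z|circle_lebesgue. z powi (m + int l - int k))) / (2 * pi * real N)"
      by (simp, subst Bochner_Integration.integral_sum,
          (intro circle_integrable[OF C] continuous_intros; fastforce),
          subst Bochner_Integration.integral_sum,
          (intro circle_integrable[OF C] continuous_intros; fastforce)) simp
    also have "\<dots> = (\<Sum>k<N. \<Sum>l<N. (2 * pi) * (if int k - int l = m then a m else 0)) / (2 * pi * real N)"
      by (intro arg_cong2[of _ _ _ _ "(/)"] sum.cong refl) (auto simp: circle_lebesgue_powi)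
    also have "\<dots> = (\<Sum>k<N. \<Sum>l<N. if int k - int l = m then a m else 0) / of_nat N"
      using that by (simp add: sum_distrib_left[symmetric] field_simps)
    finally show ?thesis .
  qed
  let ?L = "restrict_space lborel {0..<2 * pi}"
  \<comment> \<open>The index \<open>Suc N\<close> keeps the normalising factor of the Fejer density
    nonzero.\<close>
  define \<mu> where "\<mu> N = distr (density ?L (\<lambda>t. g (Suc N) (cis t))) borel (\<lambda>t. t)" for N
  have idL: "(\<lambda>t. t) \<in> measurable ?L borel"
    by (intro measurable_restrict_space1) (simp add: measurable_lborel1)
  have gc[measurable]: "(\<lambda>t. g N (cis t)) \<in> borel_measurable ?L" for N
    using measurable_compose[OF circle_lebesgue_base(3) gm] by simp
  have g_nonneg: "0 \<le> g N (cis t)" for N t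
    unfolding g_def using S_real(2)[of "cis t" N] by simp
  have integral: "(LINT t|\<mu> N. f t) = (LINT t|?L. g (Suc N) (cis t) *\<^sub>R f t)"
    if f[measurable]: "f \<in> borel_measurable borel" for f :: "real \<Rightarrow> complex" and N
    unfolding \<mu>_def
    by (subst integral_distr) (use f idL g_nonneg measurable_compose[OF idL f] in \<open>auto intro!: integral_density\<close>)
  have char: "char (\<mu> N) (real_of_int m) = (\<Sum>k<Suc N. \<Sum>l<Suc N. if int k - int l = m then a m else 0) / of_nat (Suc N)" for N m
  proof -
    have "char (\<mu> N) (real_of_int m) = (LINT t|?L. g (Suc N) (cis t) *\<^sub>R iexp (m * t))"
      unfolding char_def by (rule integral) simp
    also have "\<dots> = (LINT t|?L. cis t powi m * of_real (g (Suc N) (cis t)))"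
      by (intro Bochner_Integration.integral_cong refl)
         (simp add: scaleR_conv_of_real cis_powi_iexp mult.commute)
    also have "\<dots> = (LINT z|circle_lebesgue. z powi m * of_real (g (Suc N) z))"
      by (rule circle_lebesgue_base(2)[symmetric]) measurable
    finally show ?thesis by (simp add: coef)
  qed
  have emu: "emeasure (\<mu> N) A = (\<integral>\<^sup>+t. ennreal (g (Suc N) (cis t)) * indicator A t \<partial>?L)" if "A \<in> sets borel" for A N
  proof -
    let ?A = "A \<inter> {0..<2 * pi}"
    have sp: "space ?L = {0..<2 * pi}" by (simp add: space_restrict_space)
    have A: "?A \<in> sets ?L"
      using measurable_sets[OF idL that] sp by simp
    have "emeasure (\<mu> N) A = emeasure (density ?L (\<lambda>t. g (Suc N) (cis t))) ?A"
      unfolding \<mu>_def using that idL sp by (subst emeasure_distr) simp_all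
    also have "\<dots> = (\<integral>\<^sup>+t. ennreal (g (Suc N) (cis t)) * indicator ?A t \<partial>?L)"
      by (rule emeasure_density) (use A in measurable)
    also have "\<dots> = (\<integral>\<^sup>+t. ennreal (g (Suc N) (cis t)) * indicator A t \<partial>?L)"
      by (intro nn_integral_cong) (auto simp: sp split: split_indicator)
    finally show ?thesis .
  qed
  \<comment> \<open>The interval from -1 to 8 contains [0, 2 pi), so that it serves for the
    tightness of the whole sequence.\<close>
  have "real_distribution (\<mu> N) \<and> measure (\<mu> N) {-1<..8} = 1" for N
  proof -
    have "(LINT t|?L. of_real (g (Suc N) (cis t))) = (LINT z|circle_lebesgue. z powi 0 * of_real (g (Suc N) z))"
      by (subst circle_lebesgue_base(2)) (simp_all, measurable)
    also have "\<dots> = (1::complex)"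
      unfolding coef[OF zero_less_Suc] using of_nat_neq_0[of N, where 'a = complex] by (simp add: a0)
    finally have "(LINT t|?L. g (Suc N) (cis t)) = 1"
      by (simp only: integral_complex_of_real of_real_eq_1_iff)
    moreover from this have "integrable ?L (\<lambda>t. g (Suc N) (cis t))"
      using not_integrable_integral_eq by fastforce
    ultimately have 1: "(\<integral>\<^sup>+t. ennreal (g (Suc N) (cis t)) \<partial>?L) = 1"
      by (subst nn_integral_eq_integral) (auto simp: g_nonneg)
    have "emeasure (\<mu> N) (space (\<mu> N)) = 1"
      using emu[of UNIV N] 1 by (simp add: \<mu>_def)
    then have "real_distribution (\<mu> N)"
      unfolding real_distribution_def real_distribution_axioms_def
      by (auto intro: prob_spaceI simp: \<mu>_def)
    moreover have "emeasure (\<mu> N) {-1<..8} = (\<integral>\<^sup>+t. ennreal (g (Suc N) (cis t)) \<partial>?L)"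
      using pi_less_4 pi_gt_zero
      by (subst emu) (auto intro!: nn_integral_cong simp: space_restrict_space split: split_indicator)
    ultimately show ?thesis using 1 by (simp add: measure_def)
  qed
  then have rd: "\<And>N. real_distribution (\<mu> N)" and tight1: "\<And>N. measure (\<mu> N) {-1<..8} = 1"
    by auto
  have "tight \<mu>"
    unfolding tight_def
    by (intro conjI allI impI rd exI[of _ "-1::real"] exI[of _ "8::real"]) (simp_all add: tight1)
  from tight_imp_convergent_subsubsequence[OF this strict_mono_id]
  obtain r M where r: "strict_mono r" and M: "real_distribution M" "weak_conv_m (\<mu> \<circ> id \<circ> r) M"
    by blast
  have cM: "char M (real_of_int m) = a m" for m
  proof -
    have "(\<lambda>n. char ((\<mu> \<circ> id \<circ> r) n) (real_of_int m)) \<longlonglongrightarrow> char M (real_of_int m)"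
      by (rule levy_continuity1[OF _ M]) (simp add: rd)
    moreover have "(\<lambda>n. char ((\<mu> \<circ> id \<circ> r) n) (real_of_int m)) \<longlonglongrightarrow> a m"
      using LIMSEQ_subseq_LIMSEQ[OF LIMSEQ_Suc[OF double_sum_diff_lim[of m "a m"]] r]
      by (simp add: char o_def)
    ultimately show ?thesis by (rule LIMSEQ_unique)
  qed
  interpret M: real_distribution M by fact
  have cisM: "cis \<in> measurable M circle_borel"
    using cis_measurable_circle by (simp cong: measurable_cong_sets)
  \<comment> \<open>The weak limit M may put mass at 2 pi, which \<open>cis\<close> identifies with
    0.\<close>
  let ?\<nu> = "distr M circle_borel cis"
  interpret V: prob_space ?\<nu> using cisM by (rule M.prob_space_distr)
  have "(LINT z|?\<nu>. z powi m) = a m" for m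
  proof -
    have "(LINT z|?\<nu>. z powi m) = (LINT t|M. cis t powi m)"
      by (rule integral_distr[OF cisM]) measurable
    also have "\<dots> = char M m"
      unfolding char_def cis_powi_iexp ..
    finally show ?thesis using cM by simp
  qed
  then show ?thesis
    by (intro exI[of _ ?\<nu>]) (auto simp: finite_circle_measure_def V.finite_measure_axioms V.prob_space_axioms)
qed

text \<open>A mixture with strictly positive weights, here those of a geometric distribution, has
  exactly the common null sets of its components.\<close>

lemma circle_mixture:
  assumes \<nu>: "\<And>j::nat. finite_circle_measure (\<nu> j)" "\<And>j. prob_space (\<nu> j)"
  shows "\<exists>\<sigma>. finite_circle_measure \<sigma> \<and>
    (\<forall>A\<in>sets circle_borel. A \<in> null_sets \<sigma> \<longleftrightarrow> (\<forall>j. A \<in> null_sets (\<nu> j)))"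
proof -
  let ?p = "geometric_pmf (1/2)"
  have sets: "sets (\<nu> j) = sets circle_borel" for j
    by (rule finite_circle_measureD) fact
  have k: "\<nu> \<in> measurable (measure_pmf ?p) (subprob_algebra circle_borel)"
    using \<nu>(2) by (auto simp: space_subprob_algebra sets prob_space_imp_subprob_space)
  let ?\<sigma> = "measure_pmf ?p \<bind> \<nu>"
  have sets\<sigma>: "sets ?\<sigma> = sets circle_borel"
    by (rule sets_bind[of _ _ circle_borel]) (auto simp: sets)
  have em: "emeasure ?\<sigma> A = (\<integral>\<^sup>+j. emeasure (\<nu> j) A \<partial>measure_pmf ?p)" if "A \<in> sets circle_borel" for A
    by (rule emeasure_bind[OF _ k that]) simp
  have "emeasure ?\<sigma> (space ?\<sigma>) \<le> 1"
  proof -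
    have "space ?\<sigma> = space circle_borel" by (rule sets_eq_imp_space_eq[OF sets\<sigma>])
    then have "emeasure ?\<sigma> (space ?\<sigma>) = (\<integral>\<^sup>+j. emeasure (\<nu> j) (space circle_borel) \<partial>measure_pmf ?p)"
      by (simp add: em)
    also have "\<dots> \<le> (\<integral>\<^sup>+j. 1 \<partial>measure_pmf ?p)"
      by (intro nn_integral_mono) (use \<nu>(2) prob_space.measure_le_1 prob_space_imp_subprob_space subprob_space.subprob_emeasure_le_1 in blast)
    finally show ?thesis by simp
  qed
  then have "finite_measure ?\<sigma>"
    by (intro finite_measureI) (auto simp: top_unique)
  moreover have "A \<in> null_sets ?\<sigma> \<longleftrightarrow> (\<forall>j. A \<in> null_sets (\<nu> j))" if "A \<in> sets circle_borel" for A
    using that sets sets\<sigma>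
    by (auto simp: null_sets_def em nn_integral_0_iff_AE AE_measure_pmf_iff set_pmf_geometric)
  ultimately show ?thesis
    unfolding finite_circle_measure_def using sets\<sigma> by blast
qed

section \<open>Square-integrable functions\<close>

lemma cnj_measurable [measurable (raw)]:
  "f \<in> borel_measurable M \<Longrightarrow> (\<lambda>x. cnj (f x)) \<in> borel_measurable M"
  by (rule borel_measurable_continuous_on) (intro continuous_intros)

definition sqnorm :: "'a measure \<Rightarrow> ('a \<Rightarrow> complex) \<Rightarrow> real" where
  "sqnorm M f = (LINT x|M. (cmod (f x))\<^sup>2)"

lemma sqnorm_nonneg: "0 \<le> sqnorm M f"
  unfolding sqnorm_def by simp

lemma L2D: assumes "f \<in> L2 M"
  shows "f \<in> borel_measurable M" "integrable M (\<lambda>x. (cmod (f x))\<^sup>2)"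
  using assms unfolding L2_def by auto

lemma L2_dominated:
  assumes "f \<in> borel_measurable M" "integrable M g" "\<And>x. x \<in> space M \<Longrightarrow> (cmod (f x))\<^sup>2 \<le> g x"
  shows "f \<in> L2 M"
  unfolding L2_def using assms
  by (auto intro!: Bochner_Integration.integrable_bound[OF assms(2)] AE_I2 order_trans[OF assms(3)])

lemma cmod_add_square_le: "(cmod (a + b))\<^sup>2 \<le> 2 * (cmod a)\<^sup>2 + 2 * (cmod b)\<^sup>2"
proof -
  have "(cmod (a + b))\<^sup>2 \<le> (cmod a + cmod b)\<^sup>2"
    by (intro power_mono norm_triangle_ineq) auto
  also have "\<dots> \<le> 2 * (cmod a)\<^sup>2 + 2 * (cmod b)\<^sup>2"
    using sum_squares_bound[of "cmod a" "cmod b"] by (simp add: power2_sum)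
  finally show ?thesis .
qed

lemma L2_add: assumes "f \<in> L2 M" "g \<in> L2 M" shows "(\<lambda>x. f x + g x) \<in> L2 M"
  by (rule L2_dominated[where g = "\<lambda>x. 2 * (cmod (f x))\<^sup>2 + 2 * (cmod (g x))\<^sup>2"])
     (use L2D[OF assms(1)] L2D[OF assms(2)] cmod_add_square_le in auto)

lemma L2_cmult: assumes "f \<in> L2 M" shows "(\<lambda>x. c * f x) \<in> L2 M"
  by (rule L2_dominated[where g = "\<lambda>x. (cmod c)\<^sup>2 * (cmod (f x))\<^sup>2"])
     (use L2D[OF assms] in \<open>auto simp: norm_mult power_mult_distrib\<close>)

lemma L2_diff: assumes "f \<in> L2 M" "g \<in> L2 M" shows "(\<lambda>x. f x - g x) \<in> L2 M"
  using L2_add[OF assms(1) L2_cmult[OF assms(2), of "-1"]] by simp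

lemma L2_zero: "(\<lambda>x. 0) \<in> L2 M"
  unfolding L2_def by simp

lemma L2_sum: "(\<And>i. i \<in> I \<Longrightarrow> f i \<in> L2 M) \<Longrightarrow> (\<lambda>x. \<Sum>i\<in>I. f i x) \<in> L2 M"
  by (induction I rule: infinite_finite_induct) (auto intro!: L2_add L2_zero)

lemma L2_indicator:
  assumes "A \<in> sets M" "emeasure M A < \<infinity>" shows "indicator A \<in> L2 M"
proof -
  have "integrable M (indicat_real A)"
    using assms by (simp add: integrable_indicator_iff)
  then show ?thesis
    by (rule L2_dominated[rotated]) (use assms in \<open>auto split: split_indicator\<close>)
qed

lemma sqnorm_indicator: "A \<in> sets M \<Longrightarrow> sqnorm M (indicator A) = measure M A"
proof -
  assume A: "A \<in> sets M"
  have "sqnorm M (indicator A) = (LINT x|M. indicat_real A x)"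
    unfolding sqnorm_def by (intro Bochner_Integration.integral_cong) (auto split: split_indicator)
  then show ?thesis using A by (simp add: sets.Int_space_eq2)
qed

lemma L2_inner_integrable: assumes "f \<in> L2 M" "g \<in> L2 M" shows "integrable M (\<lambda>x. f x * cnj (g x))"
proof (rule Bochner_Integration.integrable_bound)
  show "integrable M (\<lambda>x. (cmod (f x))\<^sup>2 + (cmod (g x))\<^sup>2)"
    using L2D[OF assms(1)] L2D[OF assms(2)] by auto
  have "cmod a * cmod b \<le> (cmod a)\<^sup>2 + (cmod b)\<^sup>2" for a b
  proof -
    have "0 \<le> cmod a * cmod b" by simp
    then show ?thesis using sum_squares_bound[of "cmod a" "cmod b"] unfolding mult.assoc by linarith
  qed
  then show "AE x in M. norm (f x * cnj (g x)) \<le> norm ((cmod (f x))\<^sup>2 + (cmod (g x))\<^sup>2)"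
    by (simp add: norm_mult)
qed (use L2D[OF assms(1)] L2D[OF assms(2)] in measurable)

lemma L2_inner_self: "L2_inner M f f = of_real (sqnorm M f)"
  unfolding L2_inner_def sqnorm_def complex_norm_square[symmetric] by (rule integral_complex_of_real)

lemma L2_inner_diff_right: "f \<in> L2 M \<Longrightarrow> g \<in> L2 M \<Longrightarrow> g' \<in> L2 M \<Longrightarrow>
   L2_inner M f (\<lambda>x. g x - g' x) = L2_inner M f g - L2_inner M f g'"
  unfolding L2_inner_def by (simp add: right_diff_distrib L2_inner_integrable)

lemma L2_inner_add_right: "f \<in> L2 M \<Longrightarrow> g \<in> L2 M \<Longrightarrow> g' \<in> L2 M \<Longrightarrow>
   L2_inner M f (\<lambda>x. g x + g' x) = L2_inner M f g + L2_inner M f g'"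
  unfolding L2_inner_def by (simp add: distrib_left L2_inner_integrable)

lemma L2_inner_cmult_left: "L2_inner M (\<lambda>x. c * f x) g = c * L2_inner M f g"
  unfolding L2_inner_def by (simp add: mult.assoc)

lemma L2_inner_cmult_right: "L2_inner M f (\<lambda>x. c * g x) = cnj c * L2_inner M f g"
  unfolding L2_inner_def by (simp add: mult.left_commute)

lemma L2_inner_sum_left: "(\<And>i. i \<in> I \<Longrightarrow> f i \<in> L2 M) \<Longrightarrow> g \<in> L2 M \<Longrightarrow>
   L2_inner M (\<lambda>x. \<Sum>i\<in>I. f i x) g = (\<Sum>i\<in>I. L2_inner M (f i) g)"
  unfolding L2_inner_def sum_distrib_right
  by (rule Bochner_Integration.integral_sum) (rule L2_inner_integrable)

lemma L2_inner_sum_right: "f \<in> L2 M \<Longrightarrow> (\<And>i. i \<in> I \<Longrightarrow> g i \<in> L2 M) \<Longrightarrow>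
   L2_inner M f (\<lambda>x. \<Sum>i\<in>I. g i x) = (\<Sum>i\<in>I. L2_inner M f (g i))"
  unfolding L2_inner_def cnj_sum sum_distrib_left
  by (rule Bochner_Integration.integral_sum) (rule L2_inner_integrable)

lemma L2_Cauchy_Schwarz:
  assumes f: "f \<in> L2 M" and g: "g \<in> L2 M"
  shows "cmod (L2_inner M f g) \<le> sqrt (sqnorm M f) * sqrt (sqnorm M g)"
proof -
  have [measurable]: "f \<in> borel_measurable M" "g \<in> borel_measurable M"
    using L2D f g by auto
  have i: "integrable M (\<lambda>x. cmod (f x) * cmod (g x))"
    using integrable_norm[OF L2_inner_integrable[OF f g]] by (simp add: norm_mult)
  have "(\<integral>\<^sup>+x. ennreal (cmod (f x)) * ennreal (cmod (g x)) \<partial>M)\<^sup>2 \<le>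
      (\<integral>\<^sup>+x. (ennreal (cmod (f x)))\<^sup>2 \<partial>M) * (\<integral>\<^sup>+x. (ennreal (cmod (g x)))\<^sup>2 \<partial>M)"
    by (rule Cauchy_Schwarz_nn_integral) measurable
  then have "(ennreal (LINT x|M. cmod (f x) * cmod (g x)))\<^sup>2 \<le> ennreal (sqnorm M f) * ennreal (sqnorm M g)"
    using L2D[OF f] L2D[OF g] i
    by (simp add: ennreal_mult'[symmetric] ennreal_power sqnorm_def nn_integral_eq_integral)
  then have "(LINT x|M. cmod (f x) * cmod (g x))\<^sup>2 \<le> sqnorm M f * sqnorm M g"
    by (simp add: ennreal_power ennreal_mult'[symmetric] sqnorm_nonneg)
  then have "(LINT x|M. cmod (f x) * cmod (g x)) \<le> sqrt (sqnorm M f * sqnorm M g)"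
    by (rule real_le_rsqrt)
  moreover have "cmod (L2_inner M f g) \<le> (LINT x|M. cmod (f x) * cmod (g x))"
    unfolding L2_inner_def using integral_norm_bound[of M "\<lambda>x. f x * cnj (g x)"] by (simp add: norm_mult)
  ultimately show ?thesis by (simp add: real_sqrt_mult)
qed

text \<open>What spectral theory needs to know about boxes of levels. Only nonempty intersections
  are required to be test sets, because boxes are nested or disjoint and the empty set need not be a
  box.\<close>

locale test_sets =
  fixes M :: "'a measure" and \<Q> :: "'a set set" and C :: "nat \<Rightarrow> 'a set"
  assumes Int_closed: "\<And>q q'. q \<in> \<Q> \<Longrightarrow> q' \<in> \<Q> \<Longrightarrow> q \<inter> q' \<noteq> {} \<Longrightarrow> q \<inter> q' \<in> \<Q>"
    and test_space: "\<Q> \<subseteq> Pow (space M)"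
    and generated: "sets M = sigma_sets (space M) \<Q>"
    and test_finite: "\<And>q. q \<in> \<Q> \<Longrightarrow> emeasure M q < \<infinity>"
    and cover: "range C \<subseteq> \<Q>" "(\<Union>i. C i) = space M"
begin

lemma test_sets: "q \<in> \<Q> \<Longrightarrow> q \<in> sets M"
  unfolding generated by auto

text \<open>A bounded sequence in \<open>L\<^sub>2\<close> that tends to zero weakly on the test sets does so on the
  whole of \<open>L\<^sub>2\<close>, because the set of limits is a closed subspace.\<close>

lemma weakly_null:
  assumes F: "\<And>k::nat. F k \<in> L2 M" "\<And>k. sqnorm M (F k) \<le> B"
    and lim: "\<And>q. q \<in> \<Q> \<Longrightarrow> (\<lambda>k. L2_inner M (F k) (indicator q)) \<longlonglongrightarrow> 0"
    and h: "h \<in> L2 M"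
  shows "(\<lambda>k. L2_inner M (F k) h) \<longlonglongrightarrow> 0"
proof -
  define W where "W = {g \<in> L2 M. (\<lambda>k. L2_inner M (F k) g) \<longlonglongrightarrow> 0}"
  have W_closed: "f \<in> W" if f: "f \<in> L2 M" and app: "\<And>e. 0 < e \<Longrightarrow> \<exists>g\<in>W. sqnorm M (\<lambda>x. f x - g x) \<le> e" for f
    unfolding W_def
  proof (safe intro!: f LIMSEQ_I)
    fix r :: real assume r: "0 < r"
    \<comment> \<open>Chosen so that the Cauchy-Schwarz bound (sqrt |B| + 1) * sqrt e equals r / 2;
      the summand 1 keeps the denominator positive.\<close>
    define e where "e = (r / (2 * (sqrt \<bar>B\<bar> + 1)))\<^sup>2"
    have B1: "0 < sqrt \<bar>B\<bar> + 1" by (simp add: add_nonneg_pos)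
    have e: "0 < e" using r B1 unfolding e_def by (intro zero_less_power divide_pos_pos mult_pos_pos) auto
    then obtain g where g: "g \<in> L2 M" "(\<lambda>k. L2_inner M (F k) g) \<longlonglongrightarrow> 0" "sqnorm M (\<lambda>x. f x - g x) \<le> e"
      using app unfolding W_def by auto
    obtain N where N: "\<And>k. k \<ge> N \<Longrightarrow> cmod (L2_inner M (F k) g) < r / 2"
      using LIMSEQ_D[OF g(2), of "r / 2"] r by auto
    have "cmod (L2_inner M (F k) f) < r" if k: "k \<ge> N" for k
    proof -
      have "cmod (L2_inner M (F k) (\<lambda>x. f x - g x)) \<le> sqrt (sqnorm M (F k)) * sqrt (sqnorm M (\<lambda>x. f x - g x))"
        by (intro L2_Cauchy_Schwarz F L2_diff f g)
      also have "\<dots> \<le> (sqrt \<bar>B\<bar> + 1) * sqrt e"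
      proof (intro mult_mono)
        have "sqrt (sqnorm M (F k)) \<le> sqrt \<bar>B\<bar>"
          using F(2)[of k] by (intro real_sqrt_le_mono) linarith
        then show "sqrt (sqnorm M (F k)) \<le> sqrt \<bar>B\<bar> + 1" by linarith
      qed (use g(3) B1 in \<open>auto simp: sqnorm_nonneg\<close>)
      also have "sqrt e = r / (2 * (sqrt \<bar>B\<bar> + 1))"
        unfolding e_def by (rule real_sqrt_unique) (use r B1 in \<open>auto intro!: divide_nonneg_pos\<close>)
      also have "(sqrt \<bar>B\<bar> + 1) * (r / (2 * (sqrt \<bar>B\<bar> + 1))) = r / 2"
        using B1 by (simp add: field_simps)
      finally have "cmod (L2_inner M (F k) f - L2_inner M (F k) g) \<le> r / 2"
        using L2_inner_diff_right[OF F(1) f g(1)] by simp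
      then show ?thesis
        using N[OF k] norm_triangle_sub[of "L2_inner M (F k) f" "L2_inner M (F k) g"] by linarith
    qed
    then show "\<exists>no. \<forall>n\<ge>no. norm (L2_inner M (F n) f - 0) < r" by auto
  qed
  have W_L2: "g \<in> L2 M" if "g \<in> W" for g using that unfolding W_def by auto
  have W_zero: "(\<lambda>x. 0) \<in> W" unfolding W_def by (auto simp: L2_zero L2_inner_def)
  have W_add: "(\<lambda>x. f x + g x) \<in> W" if "f \<in> W" "g \<in> W" for f g
    using that tendsto_add[of "\<lambda>k. L2_inner M (F k) f" 0 _ "\<lambda>k. L2_inner M (F k) g" 0]
    unfolding W_def by (auto simp: L2_add L2_inner_add_right F)
  have W_cmult: "(\<lambda>x. c * f x) \<in> W" if "f \<in> W" for f c
    using that tendsto_mult_left[of "\<lambda>k. L2_inner M (F k) f" 0 _ "cnj c"]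
    unfolding W_def by (auto simp: L2_cmult L2_inner_cmult_right)
  have W_diff: "(\<lambda>x. f x - g x) \<in> W" if "f \<in> W" "g \<in> W" for f g
    using W_add[OF that(1) W_cmult[OF that(2), of "-1"]] by simp
  have W_sum: "(\<lambda>x. \<Sum>i\<in>I. f i x) \<in> W" if "\<And>i. i \<in> I \<Longrightarrow> f i \<in> W" for I :: "'i set" and f
    using that by (induction I rule: infinite_finite_induct) (auto intro!: W_add W_zero)
  have W_UN: "indicator (\<Union>i. A i) \<in> W"
    if A: "\<And>i::nat. A i \<in> sets M" "disjoint_family A" "emeasure M (\<Union>i. A i) < \<infinity>" "\<And>i. indicator (A i) \<in> W" for A
  proof (rule W_closed)
    show "indicator (\<Union>i. A i) \<in> L2 M"
      using A by (intro L2_indicator) auto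
    fix e :: real assume e: "0 < e"
    define D where "D N = (\<Union>i. A i) - (\<Union>i<N. A i)" for N
    have DS: "D N \<in> sets M" for N unfolding D_def using A by auto
    have "(\<lambda>N. measure M (D N)) \<longlonglongrightarrow> measure M (\<Inter>N. D N)"
    proof (rule Lim_measure_decseq)
      show "decseq D" unfolding D_def decseq_def by fastforce
      show "emeasure M (D N) \<noteq> \<infinity>" for N
        using emeasure_mono[of "D N" "\<Union>i. A i" M] A(1,3) unfolding D_def by (auto simp: top_unique less_top)
    qed (use DS in auto)
    moreover have "(\<Inter>N. D N) = {}" unfolding D_def by fastforce
    ultimately have "(\<lambda>N. measure M (D N)) \<longlonglongrightarrow> 0" by simp
    from LIMSEQ_D[OF this e] obtain N where N: "measure M (D N) < e" by auto
    have eq: "indicator (\<Union>i. A i) x - (\<Sum>i<N. indicator (A i) x) = (indicator (D N) x :: complex)" for x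
    proof -
      have "(\<Sum>i<N. indicator (A i) x) = (indicator (\<Union>i<N. A i) x :: complex)"
        using A(2) by (intro indicator_UN_disjoint[symmetric]) (auto simp: disjoint_family_on_def)
      then show ?thesis unfolding D_def by (auto split: split_indicator)
    qed
    have "(\<lambda>x. \<Sum>i<N. indicator (A i) x) \<in> W"
      by (intro W_sum A)
    moreover have "sqnorm M (\<lambda>x. indicator (\<Union>i. A i) x - (\<Sum>i<N. indicator (A i) x)) \<le> e"
      unfolding eq using sqnorm_indicator[OF DS] N by simp
    ultimately show "\<exists>g\<in>W. sqnorm M (\<lambda>x. indicator (\<Union>i. A i) x - g x) \<le> e"
      by (intro bexI[where x = "\<lambda>x. \<Sum>i<N. indicator (A i) x"])
  qed
  \<comment> \<open>A Dynkin argument inside a fixed test set q: all measures are finite there, so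
    that complements become differences of indicators in L2.\<close>
  have W_test: "indicator (A \<inter> q) \<in> W" if "A \<in> sets M" "q \<in> \<Q>" for A q
  proof -
    have st: "Int_stable (insert {} \<Q>)"
      unfolding Int_stable_def using Int_closed by auto
    have gen: "sets M = sigma_sets (space M) (insert {} \<Q>)"
      unfolding generated by (rule sigma_sets_eqI) (auto intro: sigma_sets.Empty)
    have fin: "emeasure M (A \<inter> q) < \<infinity>" if "A \<in> sets M" for A
      using emeasure_mono[of "A \<inter> q" q M] test_finite[OF \<open>q \<in> \<Q>\<close>] test_sets[OF \<open>q \<in> \<Q>\<close>]
      by (auto simp: less_top[symmetric] top_unique)
    have q: "indicator q \<in> W" if "q \<in> \<Q>" for q
      using lim[OF that] test_finite[OF that] test_sets[OF that] unfolding W_def by (auto intro: L2_indicator)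
    have "indicator {} = (\<lambda>x::'a. 0::complex)" by (simp add: fun_eq_iff)
    then have 0: "indicator {} \<in> W" using W_zero by simp
    have cl: "insert {} \<Q> \<subseteq> Pow (space M)" using test_space by auto
    show ?thesis
      using st cl \<open>A \<in> sets M\<close>[unfolded gen]
    proof (induction rule: sigma_sets_induct_disjoint)
      case (basic A)
      then show ?case using q[OF Int_closed[OF _ \<open>q \<in> \<Q>\<close>]] 0 W_zero by (cases "A \<inter> q = {}") auto
    next
      case empty
      then show ?case using W_zero by simp
    next
      case (compl A)
      have "(indicator ((space M - A) \<inter> q) :: _ \<Rightarrow> complex) = (\<lambda>x. indicator q x - indicator (A \<inter> q) x)"
        using test_space \<open>q \<in> \<Q>\<close> by (auto simp: fun_eq_iff split: split_indicator)
      then show ?case using W_diff[OF q[OF \<open>q \<in> \<Q>\<close>] compl(2)] by simp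
    next
      case (union A)
      have "(\<Union>i. A i) \<inter> q = (\<Union>i. A i \<inter> q)" by auto
      moreover have "range A \<subseteq> sets M" using union unfolding gen by auto
      then have "indicator (\<Union>i. A i \<inter> q) \<in> W"
        using union test_sets[OF \<open>q \<in> \<Q>\<close>] fin[of "\<Union>i. A i"]
        by (intro W_UN) (auto simp: disjoint_family_on_def)
      ultimately show ?case by simp
    qed
  qed
  \<comment> \<open>The countable cover by test sets is made disjoint, which reduces a set of finite
    measure to its pieces inside test sets.\<close>
  have W_ind: "indicator A \<in> W" if A: "A \<in> sets M" "emeasure M A < \<infinity>" for A
  proof -
    have CS: "C i \<in> sets M" "C i \<in> \<Q>" for i using cover test_sets by auto
    have eq: "(\<Union>i. (A \<inter> disjointed C i) \<inter> C i) = A"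
    proof
      have *: "A \<subseteq> (\<Union>i. disjointed C i)"
        using sets.sets_into_space[OF A(1)] unfolding UN_disjointed_eq cover(2) .
      show "A \<subseteq> (\<Union>i. (A \<inter> disjointed C i) \<inter> C i)"
      proof
        fix x assume x: "x \<in> A"
        with * obtain i where "x \<in> disjointed C i" by auto
        with x show "x \<in> (\<Union>i. (A \<inter> disjointed C i) \<inter> C i)"
          using disjointed_subset[of C i] by auto
      qed
    qed auto
    have "indicator (\<Union>i. (A \<inter> disjointed C i) \<inter> C i) \<in> W"
    proof (rule W_UN)
      have "disjointed C i \<in> sets M" for i
        using sets.range_disjointed_sets[of C M] CS by auto
      then show "indicator ((A \<inter> disjointed C i) \<inter> C i) \<in> W" "(A \<inter> disjointed C i) \<inter> C i \<in> sets M" for i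
        using A CS by (auto intro!: W_test)
      show "disjoint_family (\<lambda>i. (A \<inter> disjointed C i) \<inter> C i)"
        using disjoint_family_disjointed[of C] by (auto simp: disjoint_family_on_def)
      show "emeasure M (\<Union>i. A \<inter> disjointed C i \<inter> C i) < \<infinity>" using A(2) unfolding eq .
    qed
    then show ?thesis unfolding eq .
  qed
  \<comment> \<open>Simple functions with |s| \<le> 2 |h| converge to h pointwise, and then in L2,
    since |h - s|^2 \<le> 9 |h|^2.\<close>
  have "h \<in> W"
  proof (rule W_closed[OF h])
    fix e :: real assume e: "0 < e"
    note hm = L2D[OF h]
    obtain s where s: "\<And>i. simple_function M (s i)" "\<And>x. x \<in> space M \<Longrightarrow> (\<lambda>i. s i x) \<longlonglongrightarrow> h x"
        "\<And>i x. x \<in> space M \<Longrightarrow> dist (s i x) 0 \<le> 2 * dist (h x) 0"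
      using borel_measurable_implies_sequence_metric[OF hm(1), of 0] by blast
    have sm: "s i \<in> borel_measurable M" for i using s(1) by (rule borel_measurable_simple_function)
    have sL2: "s i \<in> L2 M" for i
    proof (rule L2_dominated[OF sm])
      show "integrable M (\<lambda>x. 4 * (cmod (h x))\<^sup>2)" using hm by simp
      fix x assume "x \<in> space M"
      then have "(cmod (s i x))\<^sup>2 \<le> (2 * cmod (h x))\<^sup>2" using s(3)[of x i] by (intro power_mono) auto
      then show "(cmod (s i x))\<^sup>2 \<le> 4 * (cmod (h x))\<^sup>2" by (simp add: power_mult_distrib)
    qed
    have sW: "s i \<in> W" for i
    proof -
      define P where "P y = s i -` {y} \<inter> space M" for y
      have PS: "P y \<in> sets M" for y
        unfolding P_def using s(1) by (rule simple_functionD)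
      have PW: "indicator (P y) \<in> W" if y: "y \<noteq> 0" for y
      proof (rule W_ind[OF PS])
        have "integrable M (indicat_real (P y))"
        proof (rule Bochner_Integration.integrable_bound)
          show "integrable M (\<lambda>x. (cmod (s i x))\<^sup>2 / (cmod y)\<^sup>2)" using L2D[OF sL2] by simp
          show "AE x in M. norm (indicat_real (P y) x) \<le> norm ((cmod (s i x))\<^sup>2 / (cmod y)\<^sup>2)"
            using y by (intro AE_I2) (auto simp: P_def split: split_indicator)
        qed (use PS in auto)
        then show "emeasure M (P y) < \<infinity>" using PS by (simp add: integrable_indicator_iff)
      qed
      define g where "g x = (\<Sum>y\<in>s i ` space M - {0}. y * indicator (P y) x)" for x
      have "g \<in> W"
        unfolding g_def by (intro W_sum W_cmult PW) auto
      have fin: "finite (s i ` space M)" using s(1) by (rule simple_functionD)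
      have g: "g x = s i x" if x: "x \<in> space M" for x
      proof -
        have "g x = (\<Sum>y\<in>s i ` space M - {0}. if y = s i x then y else 0)"
          unfolding g_def P_def using x by (intro sum.cong) (auto split: split_indicator)
        then show ?thesis using fin x by (subst (asm) sum.delta) auto
      qed
      show ?thesis
      proof (rule W_closed[OF sL2])
        fix e :: real assume "0 < e"
        have "sqnorm M (\<lambda>x. s i x - g x) = (LINT x|M. 0)"
          unfolding sqnorm_def by (rule Bochner_Integration.integral_cong) (auto simp: g)
        then show "\<exists>g\<in>W. sqnorm M (\<lambda>x. s i x - g x) \<le> e"
          using \<open>g \<in> W\<close> \<open>0 < e\<close> by (intro bexI[of _ g]) simp_all
      qed
    qed
    have "(\<lambda>i. LINT x|M. (cmod (h x - s i x))\<^sup>2) \<longlonglongrightarrow> (LINT x|M. 0)"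
    proof (rule integral_dominated_convergence[where w = "\<lambda>x. 9 * (cmod (h x))\<^sup>2"])
      show "AE x in M. (\<lambda>i. (cmod (h x - s i x))\<^sup>2) \<longlonglongrightarrow> 0"
      proof (rule AE_I2)
        fix x assume "x \<in> space M"
        then have "(\<lambda>i. (cmod (h x - s i x))\<^sup>2) \<longlonglongrightarrow> (cmod (h x - h x))\<^sup>2"
          by (intro tendsto_intros s(2))
        then show "(\<lambda>i. (cmod (h x - s i x))\<^sup>2) \<longlonglongrightarrow> 0" by simp
      qed
      show "AE x in M. norm ((cmod (h x - s i x))\<^sup>2) \<le> 9 * (cmod (h x))\<^sup>2" for i
      proof (rule AE_I2)
        fix x assume "x \<in> space M"
        then have "cmod (h x - s i x) \<le> 3 * cmod (h x)"
          using s(3)[of x i] norm_triangle_ineq4[of "h x" "s i x"] by simp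
        then have "(cmod (h x - s i x))\<^sup>2 \<le> (3 * cmod (h x))\<^sup>2" by (intro power_mono) auto
        then show "norm ((cmod (h x - s i x))\<^sup>2) \<le> 9 * (cmod (h x))\<^sup>2" by (simp add: power_mult_distrib)
      qed
      show "(\<lambda>x. (cmod (h x - s i x))\<^sup>2) \<in> borel_measurable M" for i
        using hm(1) sm[of i] by measurable
    qed (use hm in auto)
    then have "(\<lambda>i. LINT x|M. (cmod (h x - s i x))\<^sup>2) \<longlonglongrightarrow> 0" by simp
    from LIMSEQ_D[OF this e] obtain N where "norm (LINT x|M. (cmod (h x - s N x))\<^sup>2) < e" by auto
    then have "sqnorm M (\<lambda>x. h x - s N x) \<le> e" unfolding sqnorm_def by simp
    then show "\<exists>g\<in>W. sqnorm M (\<lambda>x. h x - g x) \<le> e" using sW by (rule bexI)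
  qed
  then show ?thesis unfolding W_def by simp
qed

end

section \<open>Powers of an automorphism and spectral measures\<close>

locale measure_automorphism =
  fixes M :: "'a measure" and S :: "'a \<Rightarrow> 'a"
  assumes aut: "automorphism M S"
begin

abbreviation act :: "int \<Rightarrow> 'a \<Rightarrow> 'a" where "act \<equiv> int_iterate (space M) S"

abbreviation Sinv :: "'a \<Rightarrow> 'a" where "Sinv \<equiv> inv_into (space M) S"

lemma bij: "bij_betw S (space M) (space M)"
  using aut unfolding automorphism_def by simp

lemma S_space: "x \<in> space M \<Longrightarrow> S x \<in> space M" "x \<in> space M \<Longrightarrow> Sinv x \<in> space M"
  using bij bij_betw_inv_into[OF bij] by (auto simp: bij_betw_def)

lemma S_inv: "x \<in> space M \<Longrightarrow> S (Sinv x) = x" "x \<in> space M \<Longrightarrow> Sinv (S x) = x"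
  using bij by (auto simp: bij_betw_def intro: f_inv_into_f)

lemma funpow_space: "x \<in> space M \<Longrightarrow> (S ^^ k) x \<in> space M" "x \<in> space M \<Longrightarrow> (Sinv ^^ k) x \<in> space M"
  by (induction k) (auto simp: S_space)

lemma act_0 [simp]: "act 0 x = x"
  by (simp add: int_iterate_def)

lemma act_nat: "act (int k) = S ^^ k"
  by (simp add: int_iterate_def)

lemma act_space: "x \<in> space M \<Longrightarrow> act m x \<in> space M"
  by (simp add: int_iterate_def funpow_space)

lemma act_Suc: assumes x: "x \<in> space M" shows "act (m + 1) x = S (act m x)"
proof (cases "0 \<le> m")
  case True
  then have "nat (m + 1) = Suc (nat m)" by simp
  with True show ?thesis by (simp add: int_iterate_def)
next
  case False
  then have *: "nat (- m) = Suc (nat (- (m + 1)))" by simp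
  show ?thesis
  proof (cases "m = -1")
    case True
    then show ?thesis using x S_inv by (simp add: int_iterate_def)
  next
    case False
    with \<open>\<not> 0 \<le> m\<close> have "\<not> 0 \<le> m + 1" by simp
    then show ?thesis
      using \<open>\<not> 0 \<le> m\<close> S_inv(1)[OF funpow_space(2)[OF x]] unfolding int_iterate_def * by simp
  qed
qed

lemma act_pred: assumes x: "x \<in> space M" shows "act (m - 1) x = Sinv (act m x)"
  using act_Suc[OF x, of "m - 1"] S_inv(2)[OF act_space[OF x, of "m - 1"]] by simp

lemma act_add: assumes x: "x \<in> space M" shows "act (m + k) x = act m (act k x)"
proof (induction m rule: int_induct[of _ 0])
  case base
  then show ?case by simp
next
  case (step1 i)
  then show ?case
    using act_Suc[OF x, of "i + k"] act_Suc[OF act_space[OF x], of i k] by (simp add: algebra_simps)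
next
  case (step2 i)
  then show ?case
    using act_pred[OF x, of "i + k"] act_pred[OF act_space[OF x], of i k] by (simp add: algebra_simps)
qed

lemma act_cancel [simp]: "x \<in> space M \<Longrightarrow> act m (act (- m) x) = x" "x \<in> space M \<Longrightarrow> act (- m) (act m x) = x"
  using act_add[of x m "- m"] act_add[of x "- m" m] by auto

lemma S_measurable [measurable]: "S \<in> measurable M M" "Sinv \<in> measurable M M"
  using aut unfolding automorphism_def by auto

lemma act_measurable [measurable]: "act m \<in> measurable M M"
  unfolding int_iterate_def by simp

lemma distr_funpow: assumes "f \<in> measurable M M" "distr M M f = M" shows "distr M M (f ^^ k) = M"
proof (induction k)
  case 0
  then show ?case by (simp add: distr_id2 id_def)
next
  case (Suc k)
  have "distr M M (f ^^ Suc k) = distr (distr M M (f ^^ k)) M f"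
    using assms(1) by (subst distr_distr) auto
  then show ?case using Suc assms by (simp add: o_def)
qed

lemma act_distr: "distr M M (act m) = M"
proof -
  have S: "distr M M S = M" using aut unfolding automorphism_def by simp
  have "distr M M Sinv = distr (distr M M S) M Sinv" using S by simp
  also have "\<dots> = distr M M (Sinv \<circ> S)" by (rule distr_distr) measurable
  also have "\<dots> = distr M M (\<lambda>x. x)" by (rule distr_cong) (auto simp: S_inv)
  also have "\<dots> = M" by (simp add: distr_id2)
  finally show ?thesis
    unfolding int_iterate_def using S by (auto intro!: distr_funpow)
qed

lemma act_image: assumes "A \<subseteq> space M" shows "act m ` A = {x \<in> space M. act (- m) x \<in> A}"
proof -
  have "x \<in> act m ` A" if "x \<in> space M" "act (- m) x \<in> A" for x
    using that by (intro image_eqI[of _ _ "act (- m) x"]) auto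
  then show ?thesis
    using assms by (auto simp: act_space subset_iff)
qed

lemma act_image_sets: assumes "A \<in> sets M" shows "act m ` A \<in> sets M"
proof -
  have "act m ` A = act (- m) -` A \<inter> space M"
    using act_image[OF sets.sets_into_space[OF assms], of m] by auto
  then show ?thesis using assms by simp
qed

lemma emeasure_act_image: assumes "A \<in> sets M" shows "emeasure M (act m ` A) = emeasure M A"
proof -
  have "act m ` A = act (- m) -` A \<inter> space M"
    using act_image[OF sets.sets_into_space[OF assms], of m] by auto
  then show ?thesis
    using emeasure_distr[of "act (- m)" M M A] assms act_distr[of "- m"] by simp
qed

lemma act_inj: "inj_on (act m) (space M)"
  by (rule inj_on_inverseI[of _ "act (- m)"]) simp

lemma act_act_image: "A \<subseteq> space M \<Longrightarrow> act m ` act k ` A = act (m + k) ` A"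
  unfolding image_image by (intro image_cong) (auto simp: act_add)

lemma integral_act:
  fixes f :: "'a \<Rightarrow> 'c::{banach, second_countable_topology}"
  assumes [measurable]: "f \<in> borel_measurable M"
  shows "(LINT x|M. f (act m x)) = (LINT x|M. f x)"
  using integral_distr[of "act m" M M f] act_distr[of m] by simp

lemma integrable_act:
  fixes f :: "'a \<Rightarrow> 'c::{banach, second_countable_topology}"
  assumes "integrable M f" shows "integrable M (\<lambda>x. f (act m x))"
  using integrable_distr[of "act m" M M f] act_distr[of m] assms by simp

lemma L2_act: assumes "f \<in> L2 M" shows "(\<lambda>x. f (act m x)) \<in> L2 M"
  using L2D[OF assms] integrable_act[OF L2D(2)[OF assms]]
  unfolding L2_def by (auto intro: measurable_compose[OF act_measurable])

lemma L2_inner_shift: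
  assumes f: "f \<in> L2 M" and g: "g \<in> L2 M"
  shows "L2_inner M (\<lambda>x. f (act m x)) (\<lambda>x. g (act k x)) = L2_inner M (\<lambda>x. f (act (m - k) x)) g"
proof -
  have fg [measurable]: "f \<in> borel_measurable M" "g \<in> borel_measurable M" using L2D f g by auto
  have "L2_inner M (\<lambda>x. f (act m x)) (\<lambda>x. g (act k x)) =
      (LINT x|M. (\<lambda>y. f (act (m - k) y) * cnj (g y)) (act k x))"
    unfolding L2_inner_def
    by (rule Bochner_Integration.integral_cong) (auto simp: act_add[symmetric])
  also have "\<dots> = (LINT y|M. f (act (m - k) y) * cnj (g y))"
    by (rule integral_act) measurable
  finally show ?thesis unfolding L2_inner_def .
qed

text \<open>The operator p(U) applied to f, where U is the Koopman operator and p the trigonometric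
  polynomial with coefficients c on I.\<close>

definition polyact :: "(int \<Rightarrow> complex) \<Rightarrow> int set \<Rightarrow> ('a \<Rightarrow> complex) \<Rightarrow> 'a \<Rightarrow> complex" where
  "polyact c I f x = (\<Sum>m\<in>I. c m * f (act m x))"

lemma polyact_L2: "f \<in> L2 M \<Longrightarrow> polyact c I f \<in> L2 M"
  unfolding polyact_def by (intro L2_sum L2_cmult L2_act)

lemma L2_inner_polyact_left: "f \<in> L2 M \<Longrightarrow> g \<in> L2 M \<Longrightarrow>
    L2_inner M (polyact c I f) g = (\<Sum>m\<in>I. c m * L2_inner M (\<lambda>x. f (act m x)) g)"
  unfolding polyact_def
  by (subst L2_inner_sum_left) (auto intro: L2_cmult L2_act simp: L2_inner_cmult_left)

lemma L2_inner_polyact_adjoint: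
  assumes f: "f \<in> L2 M" and g: "g \<in> L2 M" and I: "finite I"
  shows "L2_inner M (polyact c I f) g = L2_inner M f (polyact (\<lambda>m. cnj (c (- m))) (uminus ` I) g)"
proof -
  have "L2_inner M f (polyact (\<lambda>m. cnj (c (- m))) (uminus ` I) g) =
      (\<Sum>m\<in>uminus ` I. c (- m) * L2_inner M f (\<lambda>x. g (act m x)))"
    unfolding polyact_def using f g
    by (subst L2_inner_sum_right) (auto intro: L2_cmult L2_act simp: L2_inner_cmult_right)
  also have "\<dots> = (\<Sum>m\<in>I. c m * L2_inner M f (\<lambda>x. g (act (- m) x)))"
    by (subst sum.reindex) auto
  also have "\<dots> = L2_inner M (polyact c I f) g"
    unfolding L2_inner_polyact_left[OF f g] using L2_inner_shift[OF f g, of 0 "- m" for m] by simp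
  finally show ?thesis ..
qed

text \<open>The spectral isometry. The factor \<open>\<kappa>\<close> allows f to be an unnormalised
  indicator while \<open>\<nu>\<close> is a probability measure.\<close>

lemma sqnorm_polyact:
  assumes f: "f \<in> L2 M" and I: "finite I" and \<nu>: "finite_circle_measure \<nu>"
    and coef: "\<And>m. L2_inner M (\<lambda>x. f (act m x)) f = of_real \<kappa> * (LINT z|\<nu>. z powi m)"
  shows "sqnorm M (polyact c I f) = \<kappa> * (LINT z|\<nu>. (norm (\<Sum>m\<in>I. c m * z powi m))\<^sup>2)"
proof -
  have "complex_of_real (sqnorm M (polyact c I f)) = L2_inner M (polyact c I f) (polyact c I f)"
    by (rule L2_inner_self[symmetric])
  also have "\<dots> = (\<Sum>m\<in>I. c m * L2_inner M (\<lambda>x. f (act m x)) (polyact c I f))"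
    by (intro L2_inner_polyact_left f polyact_L2)
  also have "\<dots> = (\<Sum>m\<in>I. \<Sum>k\<in>I. c m * cnj (c k) * L2_inner M (\<lambda>x. f (act (m - k) x)) f)"
    unfolding polyact_def using f
    by (subst L2_inner_sum_right)
       (auto intro!: L2_cmult L2_act sum.cong simp: L2_inner_cmult_right L2_inner_shift sum_distrib_left mult_ac)
  also have "\<dots> = of_real \<kappa> * (\<Sum>m\<in>I. \<Sum>k\<in>I. c m * cnj (c k) * (LINT z|\<nu>. z powi (m - k)))"
    unfolding coef by (simp add: sum_distrib_left mult_ac)
  also have "\<dots> = of_real (\<kappa> * (LINT z|\<nu>. (norm (\<Sum>m\<in>I. c m * z powi m))\<^sup>2))"
    unfolding of_real_mult circle_normsq_integral[OF \<nu> I] ..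
  finally show ?thesis by (simp only: of_real_eq_iff)
qed

lemma koopman_eq: "koopman_power M S m f = (\<lambda>x. f (act m x))"
  by (simp add: koopman_power_def o_def)

text \<open>Let p_k tend to the indicator of K. For a test set q, the norm of the adjoint of p_k(U)
  applied to the indicator of q tends to 0, as its square is \<open>\<kappa>\<close> times the
  integral of |p_k|^2 against \<open>\<rho>\<close>. So p_k(U) f tends to 0 weakly on test sets,
  hence on all of L2, and pairing it with f itself gives \<open>\<nu>\<close> K = 0.\<close>

lemma spectral_null:
  assumes "test_sets M \<Q> C"
    and K: "compact K" "K \<subseteq> circle"
    and test: "\<And>q. q \<in> \<Q> \<Longrightarrow> \<exists>\<kappa> \<rho>. finite_circle_measure \<rho> \<and> measure \<rho> K = 0 \<and>
      (\<forall>m. L2_inner M (\<lambda>x. indicator q (act m x)) (indicator q) = of_real \<kappa> * (LINT z|\<rho>. z powi m))"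
    and f: "f \<in> L2 M" and \<nu>: "is_spectral_measure M S f \<nu>"
  shows "measure \<nu> K = 0"
proof -
  interpret test_sets M \<Q> C by fact
  have \<nu>c: "finite_circle_measure \<nu>"
    and \<nu>f: "\<And>m. L2_inner M (\<lambda>x. f (act m x)) f = of_real 1 * (LINT z|\<nu>. z powi m)"
    using \<nu> unfolding is_spectral_measure_def koopman_eq by auto
  obtain d p where dp: "\<And>k::nat. trig (d k) (p k)" "\<And>k z. z \<in> circle \<Longrightarrow> norm (p k z) \<le> 2"
      "\<And>z. z \<in> circle \<Longrightarrow> (\<lambda>k. p k z) \<longlonglongrightarrow> indicator K z"
    using trig_approx_compact[OF K(1)] by blast
  have "\<forall>k. \<exists>c. \<forall>z\<in>circle. p k z = (\<Sum>m\<in>{-d k..d k}. c m * z powi m)"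
    using dp(1) unfolding trig_def by auto
  then obtain c where c: "\<And>k z. z \<in> circle \<Longrightarrow> p k z = (\<Sum>m\<in>{-d k..d k}. c k m * z powi m)"
    by metis
  define F where "F k = polyact (c k) {-d k..d k} f" for k
  have FL2: "F k \<in> L2 M" for k unfolding F_def by (intro polyact_L2 f)
  interpret V: finite_measure \<nu> using \<nu>c by (rule finite_circle_measureD)
  have pint: "(LINT z|\<rho>. (norm (\<Sum>m\<in>{-d k..d k}. c k m * z powi m))\<^sup>2) = (LINT z|\<rho>. (norm (p k z))\<^sup>2)"
    if "finite_circle_measure \<rho>" for \<rho> k
    by (rule Bochner_Integration.integral_cong) (auto simp: c finite_circle_measureD[OF that])
  have "sqnorm M (F k) \<le> 4 * measure \<nu> circle" for k
  proof -
    have "sqnorm M (F k) = (LINT z|\<nu>. (norm (p k z))\<^sup>2)"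
      unfolding F_def using sqnorm_polyact[OF f _ \<nu>c \<nu>f] pint[OF \<nu>c] by simp
    also have "\<dots> \<le> (LINT z|\<nu>. 4)"
    proof (rule integral_mono)
      show "integrable \<nu> (\<lambda>z. (norm (p k z))\<^sup>2)"
        by (intro circle_integrable[OF \<nu>c] continuous_intros trig_continuous[OF dp(1)])
      fix z assume "z \<in> space \<nu>"
      then have "(norm (p k z))\<^sup>2 \<le> 2\<^sup>2"
        using dp(2) finite_circle_measureD[OF \<nu>c] by (intro power_mono) auto
      then show "(norm (p k z))\<^sup>2 \<le> 4" by simp
    qed simp
    finally show ?thesis using finite_circle_measureD(3)[OF \<nu>c] by (simp add: mult.commute)
  qed
  moreover have "(\<lambda>k. L2_inner M (F k) (indicator q)) \<longlonglongrightarrow> 0" if q: "q \<in> \<Q>" for q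
  proof -
    obtain \<kappa> \<rho> where \<rho>: "finite_circle_measure \<rho>" "measure \<rho> K = 0"
      and coef: "\<And>m. L2_inner M (\<lambda>x. indicator q (act m x)) (indicator q) = of_real \<kappa> * (LINT z|\<rho>. z powi m)"
      using test[OF q] by blast
    define G where "G k = polyact (\<lambda>m. cnj (c k (- m))) (uminus ` {-d k..d k}) (indicator q)" for k
    have qL2: "indicator q \<in> L2 M" using q by (intro L2_indicator test_sets test_finite)
    have "sqnorm M (G k) = \<kappa> * (LINT z|\<rho>. (norm (p k z))\<^sup>2)" for k
    proof -
      have "sqnorm M (G k) = \<kappa> * (LINT z|\<rho>. (norm (\<Sum>m\<in>uminus ` {-d k..d k}. cnj (c k (- m)) * z powi m))\<^sup>2)"
        unfolding G_def by (rule sqnorm_polyact[OF qL2 _ \<rho>(1) coef]) simp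
      also have "(LINT z|\<rho>. (norm (\<Sum>m\<in>uminus ` {-d k..d k}. cnj (c k (- m)) * z powi m))\<^sup>2) = (LINT z|\<rho>. (norm (p k z))\<^sup>2)"
      proof (rule Bochner_Integration.integral_cong)
        fix z assume "z \<in> space \<rho>"
        then have z: "z \<in> circle" using finite_circle_measureD[OF \<rho>(1)] by simp
        have "(\<Sum>m\<in>uminus ` {-d k..d k}. cnj (c k (- m)) * z powi m) = cnj (p k z)"
          using c[OF z, of k] cnj_powi_circle[OF z]
          by (subst sum.reindex) (auto simp del: complex_cnj_power_int)
        then show "(norm (\<Sum>m\<in>uminus ` {-d k..d k}. cnj (c k (- m)) * z powi m))\<^sup>2 = (norm (p k z))\<^sup>2" by simp
      qed simp
      finally show ?thesis .
    qed
    then have "(\<lambda>k. sqnorm M (G k)) \<longlonglongrightarrow> 0"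
      using tendsto_mult_left[OF circle_compact_limits(2)[OF \<rho>(1) K dp], of \<kappa>] \<rho>(2) by simp
    then have "(\<lambda>k. sqrt (sqnorm M f) * sqrt (sqnorm M (G k))) \<longlonglongrightarrow> sqrt (sqnorm M f) * sqrt 0"
      by (intro tendsto_intros)
    then have lim0: "(\<lambda>k. sqrt (sqnorm M f) * sqrt (sqnorm M (G k))) \<longlonglongrightarrow> 0" by simp
    have bd: "cmod (L2_inner M (F k) (indicator q)) \<le> sqrt (sqnorm M f) * sqrt (sqnorm M (G k))" for k
    proof -
      have "L2_inner M (F k) (indicator q) = L2_inner M f (G k)"
        unfolding F_def G_def by (rule L2_inner_polyact_adjoint[OF f qL2]) simp
      then show ?thesis
        using L2_Cauchy_Schwarz[OF f polyact_L2[OF qL2]] unfolding G_def by simp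
    qed
    show ?thesis by (rule Lim_null_comparison[OF always_eventually[OF allI[OF bd]] lim0])
  qed
  ultimately have "(\<lambda>k. L2_inner M (F k) f) \<longlonglongrightarrow> 0"
    by (rule weakly_null[OF FL2 _ _ f])
  moreover have "L2_inner M (F k) f = (LINT z|\<nu>. p k z)" for k
  proof -
    have "L2_inner M (F k) f = (\<Sum>m\<in>{-d k..d k}. c k m * (LINT z|\<nu>. z powi m))"
      unfolding F_def L2_inner_polyact_left[OF f f] using \<nu>f by (intro sum.cong) simp_all
    also have "\<dots> = (LINT z|\<nu>. p k z)"
      by (rule circle_trig_integral[OF \<nu>c c, symmetric])
    finally show ?thesis .
  qed
  ultimately have "(\<lambda>k. LINT z|\<nu>. p k z) \<longlonglongrightarrow> 0" by (simp only:)
  with circle_compact_limits(1)[OF \<nu>c K dp] have "complex_of_real (measure \<nu> K) = 0"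
    by (rule LIMSEQ_unique)
  then show ?thesis by (simp only: of_real_eq_0_iff)
qed

text \<open>The mixture of the measures \<open>\<nu> j\<close> is an upper bound by
  \<open>spectral_null\<close>, tested on compact sets through inner regularity. It is the least one
  because each \<open>\<nu> j\<close> is itself a spectral measure.\<close>

lemma maximal_spectral_type:
  assumes test: "test_sets M \<Q> C"
    and \<nu>: "\<And>j::nat. finite_circle_measure (\<nu> j)" "\<And>j. prob_space (\<nu> j)"
    and spec: "\<And>j. \<exists>f\<in>L2 M. is_spectral_measure M S f (\<nu> j)"
    and coef: "\<And>q. q \<in> \<Q> \<Longrightarrow> \<exists>\<kappa> j. \<forall>m. L2_inner M (\<lambda>x. indicator q (act m x)) (indicator q) =
        of_real \<kappa> * (LINT z|\<nu> j. z powi m)"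
  shows "\<exists>\<sigma>. is_maximal_spectral_type M S \<sigma> \<and>
    (\<forall>A\<in>sets circle_borel. A \<in> null_sets \<sigma> \<longleftrightarrow> (\<forall>j. A \<in> null_sets (\<nu> j)))"
proof -
  obtain \<sigma> where \<sigma>: "finite_circle_measure \<sigma>"
      "\<And>A. A \<in> sets circle_borel \<Longrightarrow> A \<in> null_sets \<sigma> \<longleftrightarrow> (\<forall>j. A \<in> null_sets (\<nu> j))"
    using circle_mixture[of \<nu>] \<nu> by blast
  have "absolutely_continuous \<sigma> \<rho>" if f: "f \<in> L2 M" and \<rho>: "is_spectral_measure M S f \<rho>" for f \<rho>
    unfolding absolutely_continuous_def
  proof
    fix A assume A: "A \<in> null_sets \<sigma>"
    have \<rho>c: "finite_circle_measure \<rho>" using \<rho> unfolding is_spectral_measure_def by simp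
    have AS: "A \<in> sets circle_borel" using A finite_circle_measureD[OF \<sigma>(1)] by auto
    show "A \<in> null_sets \<rho>"
    proof (rule ccontr)
      assume "A \<notin> null_sets \<rho>"
      then obtain K where K: "K \<subseteq> A" "compact K" "K \<subseteq> circle" "measure \<rho> K \<noteq> 0"
        using circle_compact_subset[OF \<rho>c, of A] AS finite_circle_measureD(2)[OF \<rho>c] by blast
      have KS: "K \<in> sets circle_borel" using K by (auto simp: sets_circle_borel compact_imp_closed)
      have "K \<in> null_sets \<sigma>"
        using A K(1) KS finite_circle_measureD[OF \<sigma>(1)] by (intro null_sets_subset[OF A]) auto
      then have *: "measure (\<nu> j) K = 0" for j
        using \<sigma>(2)[OF KS] by (auto simp: null_sets_def measure_def)
      have "measure \<rho> K = 0"
      proof (rule spectral_null[OF test K(2,3) _ f \<rho>])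
        fix q assume "q \<in> \<Q>"
        from coef[OF this] obtain \<kappa> j where c: "\<forall>m. L2_inner M (\<lambda>x. indicator q (act m x)) (indicator q) =
            of_real \<kappa> * (LINT z|\<nu> j. z powi m)"
          by (elim exE)
        show "\<exists>\<kappa> \<rho>. finite_circle_measure \<rho> \<and> measure \<rho> K = 0 \<and>
            (\<forall>m. L2_inner M (\<lambda>x. indicator q (act m x)) (indicator q) = of_real \<kappa> * (LINT z|\<rho>. z powi m))"
          by (rule exI[of _ \<kappa>], rule exI[of _ "\<nu> j"], intro conjI \<nu>(1) * c)
      qed
      then show False using K(4) by simp
    qed
  qed
  moreover have "absolutely_continuous \<tau> \<sigma>" if "dominates_spectral_measures M S \<tau>" for \<tau>
    unfolding absolutely_continuous_def
  proof
    fix A assume A: "A \<in> null_sets \<tau>"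
    have \<tau>: "finite_circle_measure \<tau>" using that unfolding dominates_spectral_measures_def by simp
    have "A \<in> null_sets (\<nu> j)" for j
    proof -
      from spec[of j] obtain f where "f \<in> L2 M" "is_spectral_measure M S f (\<nu> j)" by (elim bexE)
      with that have "absolutely_continuous \<tau> (\<nu> j)" unfolding dominates_spectral_measures_def by simp
      with A show ?thesis unfolding absolutely_continuous_def by (rule subsetD[rotated])
    qed
    moreover have "A \<in> sets circle_borel" using A finite_circle_measureD[OF \<tau>] by auto
    ultimately show "A \<in> null_sets \<sigma>" by (intro \<sigma>(2)[THEN iffD2] allI)
  qed
  ultimately have "is_maximal_spectral_type M S \<sigma>"
    using \<sigma>(1) unfolding is_maximal_spectral_type_def dominates_spectral_measures_def by (intro conjI ballI allI impI)
  then show ?thesis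
    by (intro exI[of _ \<sigma>] conjI ballI \<sigma>(2))
qed

lemma singular_spectrumI:
  assumes "test_sets M \<Q> C" "\<And>j::nat. finite_circle_measure (\<nu> j)" "\<And>j. prob_space (\<nu> j)"
    and "\<And>j. \<exists>f\<in>L2 M. is_spectral_measure M S f (\<nu> j)"
    and "\<And>q. q \<in> \<Q> \<Longrightarrow> \<exists>\<kappa> j. \<forall>m. L2_inner M (\<lambda>x. indicator q (act m x)) (indicator q) =
        of_real \<kappa> * (LINT z|\<nu> j. z powi m)"
    and sing: "\<And>j. mutually_singular circle_lebesgue (\<nu> j)"
  shows "singular_spectrum M S"
proof -
  have "\<exists>\<sigma>. is_maximal_spectral_type M S \<sigma> \<and>
      (\<forall>A\<in>sets circle_borel. A \<in> null_sets \<sigma> \<longleftrightarrow> (\<forall>j. A \<in> null_sets (\<nu> j)))"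
    by (rule maximal_spectral_type[OF assms(1-4)]) (rule assms(5))
  then obtain \<sigma> where *: "is_maximal_spectral_type M S \<sigma> \<and>
      (\<forall>A\<in>sets circle_borel. A \<in> null_sets \<sigma> \<longleftrightarrow> (\<forall>j. A \<in> null_sets (\<nu> j)))"
    by (rule exE)
  note \<sigma> = conjunct1[OF *] bspec[OF conjunct2[OF *]]
  have \<sigma>c: "finite_circle_measure \<sigma>"
    using \<sigma>(1) unfolding is_maximal_spectral_type_def dominates_spectral_measures_def by simp
  obtain A where A: "\<And>j. A j \<in> null_sets circle_lebesgue" "\<And>j. circle - A j \<in> null_sets (\<nu> j)"
    using sing finite_circle_measureD(3)[OF assms(2)] unfolding mutually_singular_def by metis
  have AS: "A j \<in> sets circle_borel" for j
    using A(1) finite_circle_measureD[OF circle_lebesgue_base(1)] by auto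
  have "circle - (\<Union>j. A j) \<in> sets circle_borel"
    using AS by (intro sets.Diff sets.countable_UN) (auto simp: sets_circle_borel)
  moreover have "circle - (\<Union>j. A j) \<in> null_sets (\<nu> j)" for j
    using A(2)[of j] calculation finite_circle_measureD(2)[OF assms(2)[of j]]
    by (intro null_sets_subset[OF A(2)[of j]]) auto
  ultimately have "circle - (\<Union>j. A j) \<in> null_sets \<sigma>" by (intro \<sigma>(2)[THEN iffD2] allI)
  then have "space \<sigma> - (\<Union>j. A j) \<in> null_sets \<sigma>" using finite_circle_measureD(3)[OF \<sigma>c] by simp
  moreover have "(\<Union>j. A j) \<in> null_sets circle_lebesgue" using A(1) by auto
  ultimately show ?thesis
    using \<sigma>(1) unfolding singular_spectrum_def mutually_singular_def by blast
qed

lemma absolutely_continuous_spectrumI: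
  assumes "test_sets M \<Q> C" "\<And>j::nat. finite_circle_measure (\<nu> j)" "\<And>j. prob_space (\<nu> j)"
    and "\<And>j. \<exists>f\<in>L2 M. is_spectral_measure M S f (\<nu> j)"
    and "\<And>q. q \<in> \<Q> \<Longrightarrow> \<exists>\<kappa> j. \<forall>m. L2_inner M (\<lambda>x. indicator q (act m x)) (indicator q) =
        of_real \<kappa> * (LINT z|\<nu> j. z powi m)"
    and ac: "\<And>j. absolutely_continuous circle_lebesgue (\<nu> j)"
  shows "absolutely_continuous_spectrum M S"
proof -
  have "\<exists>\<sigma>. is_maximal_spectral_type M S \<sigma> \<and>
      (\<forall>A\<in>sets circle_borel. A \<in> null_sets \<sigma> \<longleftrightarrow> (\<forall>j. A \<in> null_sets (\<nu> j)))"
    by (rule maximal_spectral_type[OF assms(1-4)]) (rule assms(5))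
  then obtain \<sigma> where *: "is_maximal_spectral_type M S \<sigma> \<and>
      (\<forall>A\<in>sets circle_borel. A \<in> null_sets \<sigma> \<longleftrightarrow> (\<forall>j. A \<in> null_sets (\<nu> j)))"
    by (rule exE)
  note \<sigma> = conjunct1[OF *] bspec[OF conjunct2[OF *]]
  have "absolutely_continuous circle_lebesgue \<sigma>"
    unfolding absolutely_continuous_def
  proof
    fix A assume A: "A \<in> null_sets circle_lebesgue"
    then have "A \<in> sets circle_borel"
      using finite_circle_measureD(2)[OF circle_lebesgue_base(1)] by auto
    moreover have "\<forall>j. A \<in> null_sets (\<nu> j)"
      using ac A unfolding absolutely_continuous_def by blast
    ultimately show "A \<in> null_sets \<sigma>" by (rule \<sigma>(2)[THEN iffD2])
  qed
  then show ?thesis using \<sigma>(1) unfolding absolutely_continuous_spectrum_def by blast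
qed

end

section \<open>Geometry of rank one constructions\<close>

lemma space_lebesgue_space [simp]: "space (lebesgue_space X) = X"
  by (simp add: lebesgue_space_def space_restrict_space)

sublocale rank_one_construction \<subseteq> measure_automorphism "lebesgue_space X" T
  by unfold_locales (rule automorphism)

context rank_one_construction
begin

abbreviation M :: "real measure" where "M \<equiv> lebesgue_space X"

definition tr :: "int \<Rightarrow> real \<Rightarrow> real" where "tr = int_iterate X T"

text \<open>Defined for every integer m, also outside the tower, so that shifts add indices without
  side conditions. Only the indices from 0 to h j - 1 are levels of the tower.\<close>

definition lv :: "nat \<Rightarrow> int \<Rightarrow> real set" where "lv j m = tr m ` E j"

lemmas tr_0 = act_0[unfolded space_lebesgue_space, folded tr_def] and tr_nat = act_nat[unfolded space_lebesgue_space, folded tr_def]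
  and tr_space = act_space[unfolded space_lebesgue_space, folded tr_def]
  and tr_add = act_add[unfolded space_lebesgue_space, folded tr_def]
  and tr_cancel = act_cancel[unfolded space_lebesgue_space, folded tr_def]
  and tr_image = act_image[unfolded space_lebesgue_space, folded tr_def]
  and tr_image_sets = act_image_sets[unfolded space_lebesgue_space, folded tr_def]
  and emeasure_tr_image = emeasure_act_image[unfolded space_lebesgue_space, folded tr_def]
  and tr_inj = act_inj[unfolded space_lebesgue_space, folded tr_def]
  and tr_tr_image = act_act_image[unfolded space_lebesgue_space, folded tr_def]

text \<open>The height in the tower of stage j + 1 at which the i-th column of stage j
  begins.\<close>

definition pos :: "nat \<Rightarrow> nat \<Rightarrow> nat" where "pos j i = (\<Sum>k\<in>{1..<i}. h j + s j k)"

abbreviation tow :: "nat \<Rightarrow> real set" where "tow j \<equiv> tower h T E j"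

abbreviation col :: "nat \<Rightarrow> nat \<Rightarrow> real set" where "col j i \<equiv> column h T B i j"

abbreviation eps :: "nat \<Rightarrow> real" where "eps j \<equiv> measure M (E j)"

lemma h_pos: "1 \<le> j \<Longrightarrow> 1 \<le> h j"
proof (induction j rule: dec_induct)
  case base
  show ?case by (rule height_pos)
next
  case (step j)
  then have "1 * 1 \<le> h j * r j" using cuts_pos[of j] by (intro mult_le_mono) auto
  then show ?case using height_Suc[of j] step by linarith
qed

lemma half_interval_measure:
  assumes "half_interval X l A"
  shows "A \<in> sets M" "emeasure M A = ennreal l" "measure M A = l" "A \<subseteq> X" "0 < l"
proof -
  from assms obtain a where a: "0 < l" "A = X \<inter> {a..<a + l}" "{a..<a + l} - X \<in> null_sets lborel"
    unfolding half_interval_def by auto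
  have XB: "X \<inter> space lborel \<in> sets lborel" using space_borel by simp
  show A: "A \<in> sets M"
    unfolding lebesgue_space_def sets_restrict_space_iff[OF XB] using a space_borel by auto
  have "emeasure M A = emeasure lborel A"
    unfolding lebesgue_space_def using a XB by (intro emeasure_restrict_space) auto
  also have "\<dots> = emeasure lborel ({a..<a + l} - ({a..<a + l} - X))"
    using a by (intro arg_cong[of _ _ "emeasure lborel"]) auto
  also have "\<dots> = emeasure lborel {a..<a + l}"
    by (rule emeasure_Diff_null_set[OF a(3)]) simp
  finally show "emeasure M A = ennreal l" using a(1) by simp
  then show "measure M A = l" using a(1) by (simp add: measure_def)
  show "A \<subseteq> X" "0 < l" using a by auto
qed

lemma E_base:
  assumes j: "1 \<le> j"
  shows E_sets: "E j \<in> sets M" and E_finite: "emeasure M (E j) = ennreal (eps j)"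
    and E_sub: "E j \<subseteq> X" and eps_pos: "0 < eps j"
proof -
  from levels[OF j] obtain l where "\<forall>k<h j. half_interval X l ((T ^^ k) ` E j)" by auto
  then have "half_interval X l ((T ^^ 0) ` E j)" using h_pos[OF j] by (metis less_le_trans zero_less_one)
  then have *: "half_interval X l (E j)" by simp
  show "E j \<in> sets M" "emeasure M (E j) = ennreal (eps j)" "E j \<subseteq> X" "0 < eps j"
    using half_interval_measure[OF *] by auto
qed

lemma lv_nat: "lv j (int k) = (T ^^ k) ` E j"
  by (simp add: tr_nat lv_def)

lemma lv_0: "lv j 0 = E j"
  by (simp add: tr_0 lv_def)

lemma mem_lv: "1 \<le> j \<Longrightarrow> x \<in> lv j m \<longleftrightarrow> x \<in> X \<and> tr (- m) x \<in> E j"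
  using tr_image[of "E j" m] E_sub[of j] by (auto simp: lv_def)

lemma lv_sets: "1 \<le> j \<Longrightarrow> lv j m \<in> sets M"
  unfolding lv_def by (intro tr_image_sets E_sets)

lemma lv_sub: "1 \<le> j \<Longrightarrow> lv j m \<subseteq> X"
  using mem_lv[of j] by auto

lemma lv_measure:
  assumes "1 \<le> j"
  shows "emeasure M (lv j m) = ennreal (eps j)" "measure M (lv j m) = eps j"
proof -
  have *: "emeasure M (lv j m) = emeasure M (E j)"
    unfolding lv_def by (rule emeasure_tr_image[OF E_sets[OF assms]])
  then show "emeasure M (lv j m) = ennreal (eps j)" using E_finite[OF assms] by (rule trans)
  show "measure M (lv j m) = eps j" unfolding measure_def * ..
qed

lemma tr_lv: "1 \<le> j \<Longrightarrow> tr m ` lv j k = lv j (m + k)"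
  unfolding lv_def using tr_tr_image[of "E j" m k] E_sub by simp

lemma mem_lv_shift: "1 \<le> j \<Longrightarrow> x \<in> X \<Longrightarrow> tr a x \<in> lv j m \<longleftrightarrow> x \<in> lv j (m - a)"
  using tr_add[of x "- m" a] by (simp add: mem_lv tr_space)

text \<open>Shifting by the smaller index brings both sets into the tower, where distinct levels are
  disjoint.\<close>

lemma lv_disjoint:
  assumes j: "1 \<le> j" and x: "x \<in> lv j m" "x \<in> lv j k" and d: "\<bar>m - k\<bar> < int (h j)"
  shows "m = k"
  using x d
proof (induction m k rule: linorder_wlog)
  case (le a b)
  have xX: "x \<in> X" using le(2) j by (simp add: mem_lv)
  have "tr (- a) x \<in> lv j (int (nat (b - a)))" "tr (- a) x \<in> lv j (int 0)"
    using le j xX by (auto simp: mem_lv_shift)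
  moreover have "nat (b - a) < h j" "0 < h j" using le h_pos[OF j] by auto
  ultimately have "nat (b - a) = 0"
    using levels_disjoint[OF j] unfolding disjoint_family_on_def lv_nat by blast
  then show ?case using le(1) by simp
next
  case (sym a b)
  then show ?case by (simp add: abs_minus_commute)
qed

lemma pos_1 [simp]: "pos j (Suc 0) = 0"
  by (simp add: pos_def)

lemma pos_Suc: "1 \<le> i \<Longrightarrow> pos j (Suc i) = pos j i + h j + s j i"
  by (simp add: pos_def)

lemma pos_mono: "1 \<le> i \<Longrightarrow> i < k \<Longrightarrow> pos j i + h j + s j i \<le> pos j k"
proof (induction k)
  case (Suc k)
  then show ?case using pos_Suc[of k j] by (cases "i = k") auto
qed simp

lemma pos_height: "1 \<le> j \<Longrightarrow> pos j (Suc (r j)) = h (Suc j)"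
proof -
  assume "1 \<le> j"
  have "{1..<Suc (r j)} = {1..r j}" by auto
  then show ?thesis
    unfolding pos_def height_Suc[OF \<open>1 \<le> j\<close>] by (simp add: sum.distrib mult.commute)
qed

lemma pos_top: "1 \<le> j \<Longrightarrow> 1 \<le> i \<Longrightarrow> i \<le> r j \<Longrightarrow> pos j i + h j + s j i \<le> h (Suc j)"
  using pos_mono[of i "Suc (r j)" j] pos_height[of j] by simp

lemma shift_range:
  assumes "1 \<le> j" "1 \<le> i" "i \<le> r j" "k \<in> {0..<int (h j)}"
  shows "k + int (pos j i) \<in> {0..<int (h (Suc j))}"
  using pos_top[OF assms(1-3)] assms(4) by simp

text \<open>From here on the geometry of columns is arithmetic of level indices of the next
  stage.\<close>

lemma B_eq:
  assumes j: "1 \<le> j" and i: "1 \<le> i" "i \<le> r j"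
  shows "B j i = lv (Suc j) (int (pos j i))"
  using i
proof (induction i rule: dec_induct)
  case base
  then show ?case using base_Suc[OF j] by (simp add: lv_0)
next
  case (step i)
  then have "B j (Suc i) = (T ^^ (h j + s j i)) ` B j i" using stacking[OF j, of i] by simp
  also have "\<dots> = tr (int (h j + s j i)) ` lv (Suc j) (int (pos j i))"
    using step unfolding tr_nat by simp
  also have "\<dots> = lv (Suc j) (int (pos j (Suc i)))"
    using step pos_Suc[of i j] by (subst tr_lv) (auto simp: algebra_simps)
  finally show ?case .
qed

lemma E_split: "1 \<le> j \<Longrightarrow> E j = (\<Union>i\<in>{1..r j}. lv (Suc j) (int (pos j i)))"
  using base_split[of j] B_eq[of j] by auto

lemma lv_split: "1 \<le> j \<Longrightarrow> lv j m = (\<Union>i\<in>{1..r j}. lv (Suc j) (m + int (pos j i)))"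
  using E_split[of j] tr_lv[of "Suc j" m] by (simp add: lv_def[of j m] image_UN)

lemma measure_UN_lv:
  assumes j: "1 \<le> j" and fin: "finite L" and inj: "\<And>a b. a \<in> L \<Longrightarrow> b \<in> L \<Longrightarrow> \<bar>a - b\<bar> < int (h j)"
  shows "measure M (\<Union>k\<in>L. lv j k) = real (card L) * eps j"
proof -
  have "measure M (\<Union>k\<in>L. lv j k) = (\<Sum>k\<in>L. measure M (lv j k))"
  proof (intro measure_finite_Union fin)
    show "disjoint_family_on (lv j) L"
      unfolding disjoint_family_on_def using lv_disjoint[OF j] inj by blast
  qed (use lv_sets[OF j] lv_measure[OF j] in auto)
  then show ?thesis using lv_measure[OF j] by simp
qed

lemma eps_Suc: assumes j: "1 \<le> j" shows "eps j = real (r j) * eps (Suc j)"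
proof -
  let ?L = "(\<lambda>i. int (pos j i)) ` {1..r j}"
  have inj: "inj_on (\<lambda>i. int (pos j i)) {1..r j}"
  proof (rule linorder_inj_onI')
    fix a b assume "a \<in> {1..r j}" "b \<in> {1..r j}" "a < b"
    then show "int (pos j a) \<noteq> int (pos j b)" using pos_mono[of a b j] h_pos[OF j] by auto
  qed
  have "eps j = measure M (\<Union>k\<in>?L. lv (Suc j) k)"
    using E_split[OF j] by simp
  also have "\<dots> = real (card ?L) * eps (Suc j)"
  proof (rule measure_UN_lv)
    fix a b assume "a \<in> ?L" "b \<in> ?L"
    then obtain i k where "a = int (pos j i)" "b = int (pos j k)" "1 \<le> i" "i \<le> r j" "1 \<le> k" "k \<le> r j" by auto
    then show "\<bar>a - b\<bar> < int (h (Suc j))"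
      using pos_top[OF j, of i] pos_top[OF j, of k] h_pos[OF j] by linarith
  qed auto
  finally show ?thesis using card_image[OF inj] by simp
qed

lemma h_Suc_ge: "1 \<le> j \<Longrightarrow> h j * r j \<le> h (Suc j)"
  using height_Suc[of j] by simp

lemma h_mono: assumes "1 \<le> j" "j \<le> k" shows "h j \<le> h k"
  using assms(2)
proof (induction k rule: dec_induct)
  case (step k)
  then have "h k * 1 \<le> h k * r k" using cuts_pos[of k] assms(1) by (intro mult_le_mono2) simp
  then show ?case using h_Suc_ge[of k] step assms(1) by linarith
qed simp

lemma tow_eq: "tow j = (\<Union>k\<in>{0..<int (h j)}. lv j k)"
proof -
  have "x \<in> tow j" if "0 \<le> k" "k < int (h j)" "x \<in> lv j k" for x k
    using that lv_nat[of j "nat k"] unfolding tower_def by (auto intro!: bexI[of _ "nat k"])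
  moreover have "\<exists>k\<in>{0..<int (h j)}. x \<in> lv j k" if "x \<in> tow j" for x
  proof -
    from that obtain k where "k < h j" "x \<in> lv j (int k)" unfolding tower_def lv_nat by auto
    then show ?thesis by (intro bexI[of _ "int k"]) auto
  qed
  ultimately show ?thesis by auto
qed

lemma mem_col:
  assumes j: "1 \<le> j" and i: "1 \<le> i" "i \<le> r j"
  shows "x \<in> col j i \<longleftrightarrow> x \<in> X \<and> (\<exists>k. 0 \<le> k \<and> k < int (h j) \<and> x \<in> lv (Suc j) (k + int (pos j i)))"
proof -
  have "(T ^^ k) ` B j i = lv (Suc j) (int k + int (pos j i))" for k
  proof -
    have "(T ^^ k) ` B j i = tr (int k) ` lv (Suc j) (int (pos j i))"
      unfolding B_eq[OF j i] tr_nat ..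
    then show ?thesis using tr_lv[of "Suc j" "int k" "int (pos j i)"] by simp
  qed
  then have "x \<in> col j i \<longleftrightarrow> (\<exists>k<h j. x \<in> lv (Suc j) (int k + int (pos j i)))"
    unfolding column_def by auto
  also have "\<dots> \<longleftrightarrow> (\<exists>k. 0 \<le> k \<and> k < int (h j) \<and> x \<in> lv (Suc j) (k + int (pos j i)))"
  proof
    assume "\<exists>k<h j. x \<in> lv (Suc j) (int k + int (pos j i))"
    then obtain k where "k < h j" "x \<in> lv (Suc j) (int k + int (pos j i))" by auto
    then show "\<exists>k. 0 \<le> k \<and> k < int (h j) \<and> x \<in> lv (Suc j) (k + int (pos j i))"
      by (intro exI[of _ "int k"]) auto
  next
    assume "\<exists>k. 0 \<le> k \<and> k < int (h j) \<and> x \<in> lv (Suc j) (k + int (pos j i))"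
    then obtain k where "0 \<le> k" "k < int (h j)" "x \<in> lv (Suc j) (k + int (pos j i))" by auto
    then show "\<exists>k<h j. x \<in> lv (Suc j) (int k + int (pos j i))"
      by (intro exI[of _ "nat k"]) auto
  qed
  finally show ?thesis using mem_lv[of "Suc j"] by auto
qed

lemma col_tow: assumes "1 \<le> j" "1 \<le> i" "i \<le> r j" shows "col j i \<subseteq> tow j"
proof
  fix x assume "x \<in> col j i"
  then obtain k where k: "x \<in> X" "0 \<le> k" "k < int (h j)" "x \<in> lv (Suc j) (k + int (pos j i))"
    using mem_col[OF assms] by auto
  then have "x \<in> lv j k" using lv_split[OF assms(1), of k] assms by auto
  then show "x \<in> tow j" unfolding tow_eq using k by auto
qed

lemma lv_col:
  assumes j: "1 \<le> j" and i: "1 \<le> i" "i \<le> r j" and k: "0 \<le> k" "k < int (h j)"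
  shows "lv j k \<inter> col j i = lv (Suc j) (k + int (pos j i))"
proof
  show "lv (Suc j) (k + int (pos j i)) \<subseteq> lv j k \<inter> col j i"
    using lv_split[OF j, of k] i k mem_col[OF j i] mem_lv[of "Suc j"] by auto
  show "lv j k \<inter> col j i \<subseteq> lv (Suc j) (k + int (pos j i))"
  proof
    fix x assume x: "x \<in> lv j k \<inter> col j i"
    then obtain k' where k': "0 \<le> k'" "k' < int (h j)" "x \<in> lv (Suc j) (k' + int (pos j i))"
      using mem_col[OF j i] by auto
    then have "x \<in> lv j k'" using lv_split[OF j, of k'] i by auto
    then have "k = k'" using lv_disjoint[OF j, of x k k'] x k k' by auto
    then show "x \<in> lv (Suc j) (k + int (pos j i))" using k' by simp
  qed
qed

lemma col_disjoint:
  assumes j: "1 \<le> j" and i: "1 \<le> i" "i \<le> r j" and i': "1 \<le> i'" "i' \<le> r j"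
    and x: "x \<in> col j i" "x \<in> col j i'"
  shows "i = i'"
proof -
  obtain k where k: "0 \<le> k" "k < int (h j)" "x \<in> lv (Suc j) (k + int (pos j i))"
    using x mem_col[OF j i] by auto
  obtain k' where k': "0 \<le> k'" "k' < int (h j)" "x \<in> lv (Suc j) (k' + int (pos j i'))"
    using x mem_col[OF j i'] by auto
  have "k + int (pos j i) = k' + int (pos j i')"
    using pos_top[OF j i] pos_top[OF j i'] k k'
    by (intro lv_disjoint[of "Suc j" x]) auto
  then show ?thesis
    using pos_mono[of i i' j] pos_mono[of i' i j] i i' k k' by (cases i i' rule: linorder_cases) auto
qed

lemma lv_cover: "1 \<le> j \<Longrightarrow> 0 \<le> k \<Longrightarrow> k < int (h j) \<Longrightarrow> lv j k \<subseteq> (\<Union>i\<in>{1..r j}. col j i)"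
  using lv_col[of j _ k] lv_split[of j k] by fastforce

lemma col_cover: "1 \<le> j \<Longrightarrow> tow j = (\<Union>i\<in>{1..r j}. col j i)"
  using lv_cover[of j] col_tow[of j] unfolding tow_eq by fastforce

text \<open>A set of this kind keeps the property at all later stages, so that a set fixed at an
  early stage can be analysed at any stage that is convenient.\<close>

definition levelset :: "nat \<Rightarrow> real set \<Rightarrow> bool" where
  "levelset j Z \<longleftrightarrow> (\<exists>L\<subseteq>{0..<int (h j)}. Z = (\<Union>k\<in>L. lv j k))"

lemma levelset_lv: "0 \<le> k \<Longrightarrow> k < int (h j) \<Longrightarrow> levelset j (lv j k)"
  unfolding levelset_def by (intro exI[of _ "{k}"]) auto

lemma levelset_E: "1 \<le> j \<Longrightarrow> levelset j (E j)"
  using levelset_lv[of 0 j] h_pos[of j] by (simp add: lv_0)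

lemma levelset_tow: "levelset j (tow j)"
  unfolding levelset_def tow_eq by auto

lemma levelset_Suc: assumes j: "1 \<le> j" and Z: "levelset j Z" shows "levelset (Suc j) Z"
proof -
  from Z obtain L where L: "L \<subseteq> {0..<int (h j)}" "Z = (\<Union>k\<in>L. lv j k)" unfolding levelset_def by auto
  have "Z = (\<Union>k\<in>(\<Union>k\<in>L. (\<lambda>i. k + int (pos j i)) ` {1..r j}). lv (Suc j) k)"
    unfolding L(2) using lv_split[OF j] by auto
  moreover have "(\<Union>k\<in>L. (\<lambda>i. k + int (pos j i)) ` {1..r j}) \<subseteq> {0..<int (h (Suc j))}"
  proof (clarify)
    fix x k i assume "k \<in> L" "i \<in> {1..r j}"
    then show "k + int (pos j i) \<in> {0..<int (h (Suc j))}" using L(1) j by (intro shift_range) auto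
  qed
  ultimately show ?thesis unfolding levelset_def by blast
qed

lemma levelset_mono: assumes "1 \<le> j" "levelset j Z" "j \<le> k" shows "levelset k Z"
  using assms(3) by (induction k rule: dec_induct) (use assms(1,2) levelset_Suc in auto)

lemma levelset_sub_tow: "levelset j Z \<Longrightarrow> Z \<subseteq> tow j"
  unfolding levelset_def tow_eq by auto

lemma levelset_sets: "1 \<le> j \<Longrightarrow> levelset j Z \<Longrightarrow> Z \<in> sets M"
  unfolding levelset_def using lv_sets[of j]
  by (auto intro!: sets.finite_UN intro: finite_subset[of _ "{0..<int (h j)}"])

lemma levelset_finite: assumes j: "1 \<le> j" and Z: "levelset j Z" shows "emeasure M Z < \<infinity>"
proof -
  from Z obtain L where L: "L \<subseteq> {0..<int (h j)}" "Z = (\<Union>k\<in>L. lv j k)" unfolding levelset_def by auto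
  have "finite L" using L(1) by (rule finite_subset) simp
  then have "emeasure M Z \<le> (\<Sum>k\<in>L. emeasure M (lv j k))"
    unfolding L(2) using lv_sets[OF j] by (intro emeasure_subadditive_finite) auto
  also have "\<dots> < \<infinity>" using lv_measure(1)[OF j] by (simp add: ennreal_mult_less_top of_nat_less_top)
  finally show ?thesis .
qed

lemma range_diff: "L \<subseteq> {0..<int H} \<Longrightarrow> a \<in> L \<Longrightarrow> b \<in> L \<Longrightarrow> \<bar>a - b\<bar> < int H"
proof -
  assume "L \<subseteq> {0..<int H}" "a \<in> L" "b \<in> L"
  then have "a \<in> {0..<int H}" "b \<in> {0..<int H}" by (blast dest: subsetD)+
  then show ?thesis by auto
qed

text \<open>Each level of stage j meets each column in exactly one level of stage j + 1. This
  uniform distribution over the columns is the source of all independence used below.\<close>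

lemma levelset_col:
  assumes j: "1 \<le> j" and i: "1 \<le> i" "i \<le> r j" and Z: "levelset j Z"
  shows "measure M (Z \<inter> col j i) = measure M Z / real (r j)" "levelset (Suc j) (Z \<inter> col j i)"
proof -
  from Z obtain L where L: "L \<subseteq> {0..<int (h j)}" "Z = (\<Union>k\<in>L. lv j k)" unfolding levelset_def by auto
  have fin: "finite L" using L(1) by (rule finite_subset) simp
  let ?L = "(\<lambda>k. k + int (pos j i)) ` L"
  have eq: "Z \<inter> col j i = (\<Union>k\<in>?L. lv (Suc j) k)"
  proof -
    have "Z \<inter> col j i = (\<Union>k\<in>L. lv j k \<inter> col j i)" unfolding L(2) by blast
    also have "\<dots> = (\<Union>k\<in>L. lv (Suc j) (k + int (pos j i)))"
      using L(1) by (intro SUP_cong refl lv_col[OF j i]) auto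
    finally show ?thesis by simp
  qed
  have sub: "?L \<subseteq> {0..<int (h (Suc j))}" using L(1) shift_range[OF j i] by blast
  have "measure M (Z \<inter> col j i) = real (card ?L) * eps (Suc j)"
    unfolding eq using fin by (intro measure_UN_lv range_diff[OF sub]) auto
  moreover have "card ?L = card L" by (intro card_image inj_onI) simp
  moreover have "measure M Z = real (card L) * eps j"
    unfolding L(2) using fin by (intro measure_UN_lv range_diff[OF L(1)] j) auto
  ultimately show "measure M (Z \<inter> col j i) = measure M Z / real (r j)"
    using eps_Suc[OF j] cuts_pos[OF j] by simp
  show "levelset (Suc j) (Z \<inter> col j i)" unfolding levelset_def eq using sub by blast
qed

lemma tow_mono: assumes "1 \<le> j" "j \<le> k" shows "tow j \<subseteq> tow k"
  using levelset_sub_tow[OF levelset_mono[OF assms(1) levelset_tow assms(2)]] .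

lemma col_sets: "1 \<le> j \<Longrightarrow> 1 \<le> i \<Longrightarrow> i \<le> r j \<Longrightarrow> col j i \<in> sets M"
  using levelset_sets[OF _ levelset_col(2)[of j i "tow j"]] levelset_tow[of j] col_tow[of j i]
  by (simp add: Int_absorb1)

text \<open>Successive visits to \<open>E j\<close> are at least \<open>h j\<close> apart.\<close>

lemma window_sum_le:
  assumes j: "1 \<le> j" and A: "A \<in> sets M" "emeasure M A < \<infinity>"
  shows "(\<Sum>D\<in>{a..<a + int (h j)}. measure M (A \<inter> lv j D)) \<le> measure M A"
proof -
  have fin: "emeasure M S \<noteq> \<infinity>" if "S \<subseteq> A" for S
    using emeasure_mono[OF that A(1)] A(2) by (auto simp: top_unique)
  have "(\<Sum>D\<in>{a..<a + int (h j)}. measure M (A \<inter> lv j D)) = measure M (\<Union>D\<in>{a..<a + int (h j)}. A \<inter> lv j D)"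
  proof (intro measure_finite_Union[symmetric])
    show "disjoint_family_on (\<lambda>D. A \<inter> lv j D) {a..<a + int (h j)}"
      unfolding disjoint_family_on_def
    proof (intro ballI impI)
      fix m n assume mn: "m \<in> {a..<a + int (h j)}" "n \<in> {a..<a + int (h j)}" "m \<noteq> n"
      then have "\<bar>m - n\<bar> < int (h j)" by auto
      then have "x \<notin> lv j n" if "x \<in> lv j m" for x
        using lv_disjoint[OF j that, of n] mn(3) by blast
      then show "A \<inter> lv j m \<inter> (A \<inter> lv j n) = {}" by blast
    qed
    show "(\<lambda>D. A \<inter> lv j D) ` {a..<a + int (h j)} \<subseteq> sets M"
      using A(1) lv_sets[OF j] by auto
    show "emeasure M (A \<inter> lv j D) \<noteq> \<infinity>" for D by (rule fin) simp
  qed simp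
  also have "\<dots> \<le> measure M A"
    unfolding measure_def using A(1) lv_sets[OF j] fin[of A]
    by (intro enn2real_mono emeasure_mono) (auto simp: less_top)
  finally show ?thesis .
qed

section \<open>Correlations of the bases\<close>

definition corr :: "nat \<Rightarrow> int \<Rightarrow> real" where
  "corr j m = measure M (E j \<inter> lv j m) / eps j"

lemma corr_0: "1 \<le> j \<Longrightarrow> corr j 0 = 1"
  unfolding corr_def using eps_pos[of j] by (simp add: lv_0)

lemma corr_nonneg: "0 \<le> corr j m"
  unfolding corr_def by simp

lemma measure_tr_Int:
  assumes "A \<in> sets M" "B' \<in> sets M"
  shows "measure M (tr k ` A \<inter> tr k ` B') = measure M (A \<inter> B')"
proof -
  have "tr k ` A \<inter> tr k ` B' = tr k ` (A \<inter> B')"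
    using inj_on_image_Int[OF tr_inj] sets.sets_into_space[OF assms(1)] sets.sets_into_space[OF assms(2)] by simp
  then show ?thesis using emeasure_tr_image[of "A \<inter> B'" k] assms by (simp add: measure_def)
qed

text \<open>Because only the difference of the indices matters, \<open>corr\<close> is the
  normalised correlation of every level of the stage, not just of the base.\<close>

lemma measure_lv_Int: "1 \<le> j \<Longrightarrow> measure M (lv j a \<inter> lv j b) = measure M (E j \<inter> lv j (b - a))"
  using measure_tr_Int[of "E j" "lv j (b - a)" a] tr_lv[of j a "b - a"] by (simp add: E_sets lv_sets lv_def[of j a])

lemma corr_minus: "1 \<le> j \<Longrightarrow> corr j (- m) = corr j m"
  unfolding corr_def using measure_lv_Int[of j m 0] by (simp add: Int_commute lv_0)

lemma corr_zero_small: "1 \<le> j \<Longrightarrow> m \<noteq> 0 \<Longrightarrow> \<bar>m\<bar> < int (h j) \<Longrightarrow> corr j m = 0"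
proof -
  assume j: "1 \<le> j" and m: "m \<noteq> 0" "\<bar>m\<bar> < int (h j)"
  have "x \<notin> lv j m" if "x \<in> E j" for x
    using lv_disjoint[OF j, of x 0 m] that m unfolding lv_0 by linarith
  then have "E j \<inter> lv j m = {}" by blast
  then show ?thesis unfolding corr_def by simp
qed

end

section \<open>Correlations of Sidon constructions\<close>

text \<open>Jensen's inequality with unnormalised weights. An even power is convex on the whole
  line, so x may have any sign.\<close>

lemma weighted_power_mean:
  fixes w x :: "'b \<Rightarrow> real"
  assumes fin: "finite S" and w: "\<And>i. i \<in> S \<Longrightarrow> 0 \<le> w i" and N: "even N" "0 < N"
  shows "(\<Sum>i\<in>S. w i * x i) ^ N \<le> (\<Sum>i\<in>S. w i) ^ (N - 1) * (\<Sum>i\<in>S. w i * x i ^ N)"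
proof (cases "(\<Sum>i\<in>S. w i) = 0")
  case True
  then have "\<And>i. i \<in> S \<Longrightarrow> w i = 0" using fin w by (simp add: sum_nonneg_eq_0_iff)
  then show ?thesis using N by (simp add: power_0_left)
next
  case False
  define W where "W = (\<Sum>i\<in>S. w i)"
  have W: "0 < W" unfolding W_def using False sum_nonneg[of S w] w by simp
  have S: "S \<noteq> {}" using False by auto
  have "(\<Sum>i\<in>S. (w i / W) *\<^sub>R x i) ^ N \<le> (\<Sum>i\<in>S. (w i / W) * x i ^ N)"
  proof (rule convex_on_sum[OF fin S convex_power_even[OF N(1)]])
    show "(\<Sum>i\<in>S. w i / W) = 1" unfolding sum_divide_distrib[symmetric] W_def[symmetric] using W by simp
  qed (use w W in auto)
  also have "(\<Sum>i\<in>S. (w i / W) *\<^sub>R x i) = (\<Sum>i\<in>S. w i * x i) / W"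
    by (simp add: sum_divide_distrib)
  also have "(\<Sum>i\<in>S. (w i / W) * x i ^ N) = (\<Sum>i\<in>S. w i * x i ^ N) / W"
    by (simp add: sum_divide_distrib)
  finally have "(\<Sum>i\<in>S. w i * x i) ^ N \<le> W ^ N * ((\<Sum>i\<in>S. w i * x i ^ N) / W)"
    using W by (simp add: power_divide field_simps)
  also have "\<dots> = W ^ (N - 1) * (\<Sum>i\<in>S. w i * x i ^ N)"
    using W power_minus_mult[OF N(2), of W] by (simp add: field_simps)
  finally show ?thesis unfolding W_def .
qed

context rank_one_construction
begin

lemma levelsetE:
  assumes "levelset j Z"
  obtains L where "L \<subseteq> {0..<int (h j)}" "finite L" "Z = (\<Union>k\<in>L. lv j k)"
  using assms finite_subset[of _ "{0..<int (h j)}"] unfolding levelset_def by blast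

lemma measure_mono_fin:
  assumes "A \<subseteq> B'" "A \<in> sets M" "B' \<in> sets M" "emeasure M B' < \<infinity>" shows "measure M A \<le> measure M B'"
  using assms by (intro measure_mono_fmeasurable) (auto simp: fmeasurable_def)

lemma measure_union_lv_le:
  assumes j: "1 \<le> j" and L: "L \<subseteq> {0..<int (h j)}" and sub: "(\<Union>k\<in>L. lv j k) \<subseteq> A"
    and A: "A \<in> sets M" "emeasure M A < \<infinity>"
  shows "real (card L) * eps j \<le> measure M A"
proof -
  have fin: "finite L" using L by (rule finite_subset) simp
  have "real (card L) * eps j = measure M (\<Union>k\<in>L. lv j k)"
    by (rule measure_UN_lv[OF j fin range_diff[OF L], symmetric])
  also have "\<dots> \<le> measure M A"
    using fin lv_sets[OF j] by (intro measure_mono_fin sub A) auto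
  finally show ?thesis .
qed

lemma E_inter_sets: "1 \<le> j0 \<Longrightarrow> E j0 \<inter> lv j0 m \<in> sets M"
  by (intro sets.Int E_sets lv_sets)

lemma E_inter_finite: assumes "1 \<le> j0" shows "emeasure M (E j0 \<inter> lv j0 m) < \<infinity>"
proof -
  have "emeasure M (E j0 \<inter> lv j0 m) \<le> emeasure M (E j0)"
    using assms by (intro emeasure_mono E_sets) auto
  also have "\<dots> < \<infinity>" using E_finite[OF assms] by simp
  finally show ?thesis .
qed

lemma measure_E_inter: "1 \<le> j0 \<Longrightarrow> measure M (E j0 \<inter> lv j0 m) = eps j0 * corr j0 m"
  unfolding corr_def using eps_pos[of j0] by simp

lemma lv_levelset:
  assumes j: "1 \<le> j" and Z: "Z = (\<Union>k\<in>L. lv j k)" "L \<subseteq> {0..<int (h j)}"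
    and x: "x \<in> Z" "x \<in> lv j k" and k: "0 \<le> k" "k < int (h j)"
  shows "k \<in> L"
proof -
  from x(1) obtain k' where k': "k' \<in> L" "x \<in> lv j k'" unfolding Z by auto
  then have "k' \<in> {0..<int (h j)}" using Z(2) by blast
  then have "k = k'" using k by (intro lv_disjoint[OF j x(2) k'(2)]) auto
  then show ?thesis using k' by simp
qed

text \<open>Let L be the set of levels of stage j that form E j0. The pair a, b of L contributes the
  correlation of stage j at D = m + b - a, within h j of m. The number of pairs with a given D,
  times the measure of a level, is at most the overlap of E j0 with its shift by D - m.\<close>

lemma corr_convolution:
  assumes j0: "1 \<le> j0" "j0 \<le> j"
  shows "corr j0 m \<le> (\<Sum>D\<in>{m - int (h j)<..<m + int (h j)}. corr j D * corr j0 (D - m))"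
proof -
  have j: "1 \<le> j" using j0 by simp
  from levelset_mono[OF j0(1) levelset_E[OF j0(1)] j0(2)]
  obtain L where L: "L \<subseteq> {0..<int (h j)}" "finite L" "E j0 = (\<Union>k\<in>L. lv j k)"
    by (rule levelsetE)
  have lvm: "lv j0 m = (\<Union>k\<in>L. lv j (k + m))"
    unfolding lv_def[of j0 m] L(3) image_UN using tr_lv[OF j, of m] by (simp add: add.commute)
  have eq: "E j0 \<inter> lv j0 m = (\<Union>p\<in>L \<times> L. lv j (fst p) \<inter> lv j (snd p + m))"
    unfolding lvm unfolding L(3) by auto
  let ?W = "{m - int (h j)<..<m + int (h j)}"
  let ?g = "\<lambda>p. m + snd p - fst p"
  have "eps j0 * corr j0 m = measure M (E j0 \<inter> lv j0 m)" using measure_E_inter[OF j0(1)] by simp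
  also have "\<dots> \<le> (\<Sum>p\<in>L \<times> L. measure M (lv j (fst p) \<inter> lv j (snd p + m)))"
    unfolding eq
  proof (rule measure_subadditive_finite)
    fix p
    have "emeasure M (lv j (fst p) \<inter> lv j (snd p + m)) \<le> emeasure M (lv j (fst p))"
      by (intro emeasure_mono lv_sets[OF j]) auto
    then show "emeasure M (lv j (fst p) \<inter> lv j (snd p + m)) \<noteq> \<infinity>"
      using lv_measure(1)[OF j] by (auto simp: top_unique)
  qed (use L(2) lv_sets[OF j] in auto)
  also have "\<dots> = (\<Sum>p\<in>L \<times> L. eps j * corr j (?g p))"
    using measure_lv_Int[OF j] measure_E_inter[OF j] by (intro sum.cong) (simp_all add: algebra_simps)
  also have "\<dots> = (\<Sum>D\<in>?W. \<Sum>p\<in>{p \<in> L \<times> L. ?g p = D}. eps j * corr j (?g p))"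
  proof (rule sum.group[symmetric])
    show "?g ` (L \<times> L) \<subseteq> ?W"
    proof
      fix y assume "y \<in> ?g ` (L \<times> L)"
      then obtain a b where "a \<in> L" "b \<in> L" "y = m + b - a" by auto
      then show "y \<in> ?W" using range_diff[OF L(1), of a b] by auto
    qed
  qed (use L(2) in auto)
  also have "\<dots> = (\<Sum>D\<in>?W. real (card {p \<in> L \<times> L. ?g p = D}) * (eps j * corr j D))"
    by (intro sum.cong refl) simp
  also have "\<dots> \<le> (\<Sum>D\<in>?W. eps j0 * (corr j D * corr j0 (D - m)))"
  proof (rule sum_mono)
    fix D
    let ?K = "{b \<in> L. b - (D - m) \<in> L}"
    have "card {p \<in> L \<times> L. ?g p = D} \<le> card ?K"
    proof (rule card_inj_on_le[of snd])
      show "inj_on snd {p \<in> L \<times> L. ?g p = D}" by (rule inj_onI) (auto simp: prod_eq_iff)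
      show "snd ` {p \<in> L \<times> L. ?g p = D} \<subseteq> ?K" by auto
      show "finite ?K" using L(2) by simp
    qed
    moreover have "real (card ?K) * eps j \<le> measure M (E j0 \<inter> lv j0 (D - m))"
    proof (rule measure_union_lv_le[OF j _ _ E_inter_sets[OF j0(1)] E_inter_finite[OF j0(1)]])
      have lvD: "lv j0 (D - m) = (\<Union>k\<in>L. lv j (k + (D - m)))"
        unfolding lv_def[of j0 "D - m"] L(3) image_UN using tr_lv[OF j, of "D - m"] by (simp add: add.commute)
      show "(\<Union>k\<in>?K. lv j k) \<subseteq> E j0 \<inter> lv j0 (D - m)"
      proof
        fix x assume "x \<in> (\<Union>k\<in>?K. lv j k)"
        then obtain b where b: "b \<in> L" "b - (D - m) \<in> L" "x \<in> lv j b" by auto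
        have "x \<in> lv j ((b - (D - m)) + (D - m))" using b(3) by simp
        then show "x \<in> E j0 \<inter> lv j0 (D - m)" unfolding lvD using b L(3) by blast
      qed
    qed (use L(1) in auto)
    ultimately have "real (card {p \<in> L \<times> L. ?g p = D}) * eps j \<le> eps j0 * corr j0 (D - m)"
      unfolding measure_E_inter[OF j0(1)] using eps_pos[OF j]
      by (meson mult_right_mono of_nat_mono order_trans less_imp_le)
    then have "real (card {p \<in> L \<times> L. ?g p = D}) * eps j * corr j D \<le> eps j0 * corr j0 (D - m) * corr j D"
      by (rule mult_right_mono) (rule corr_nonneg)
    then show "real (card {p \<in> L \<times> L. ?g p = D}) * (eps j * corr j D) \<le> eps j0 * (corr j D * corr j0 (D - m))"
      by (simp add: mult_ac)
  qed
  also have "\<dots> = eps j0 * (\<Sum>D\<in>?W. corr j D * corr j0 (D - m))"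
    by (rule sum_distrib_left[symmetric])
  finally show ?thesis using eps_pos[OF j0(1)] by simp
qed

text \<open>E j consists of r j levels of stage j + 1, and a point visits each of them at most once
  in h (j + 1) consecutive steps. The double window is the range that arises in
  \<open>corr_power_step\<close>.\<close>

lemma corr_visits:
  assumes j: "1 \<le> j"
  shows "(\<Sum>D\<in>{a..<a + 2 * int (h (Suc j))}. corr j D) \<le> 2 * real (r j)"
proof -
  let ?H = "int (h (Suc j))"
  have j': "1 \<le> Suc j" by simp
  have Ef: "emeasure M (E j) < \<infinity>" using E_finite[OF j] by simp
  have "eps j * (\<Sum>D\<in>{b..<b + ?H}. corr j D) \<le> real (r j) * eps j" for b
  proof -
    have "eps j * (\<Sum>D\<in>{b..<b + ?H}. corr j D) = (\<Sum>D\<in>{b..<b + ?H}. measure M (E j \<inter> lv j D))"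
      unfolding sum_distrib_left measure_E_inter[OF j] ..
    also have "\<dots> \<le> (\<Sum>D\<in>{b..<b + ?H}. \<Sum>i\<in>{1..r j}. measure M (E j \<inter> lv (Suc j) (D + int (pos j i))))"
    proof (rule sum_mono)
      fix D
      have "E j \<inter> lv j D = (\<Union>i\<in>{1..r j}. E j \<inter> lv (Suc j) (D + int (pos j i)))"
        unfolding lv_split[OF j] by blast
      also have "measure M \<dots> \<le> (\<Sum>i\<in>{1..r j}. measure M (E j \<inter> lv (Suc j) (D + int (pos j i))))"
      proof (rule measure_subadditive_finite)
        fix i
        have "emeasure M (E j \<inter> lv (Suc j) (D + int (pos j i))) \<le> emeasure M (E j)"
          by (intro emeasure_mono E_sets[OF j]) auto
        then show "emeasure M (E j \<inter> lv (Suc j) (D + int (pos j i))) \<noteq> \<infinity>"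
          using Ef by auto
      qed (use E_sets[OF j] lv_sets[OF j'] in auto)
      finally show "measure M (E j \<inter> lv j D) \<le> (\<Sum>i\<in>{1..r j}. measure M (E j \<inter> lv (Suc j) (D + int (pos j i))))" .
    qed
    also have "\<dots> = (\<Sum>i\<in>{1..r j}. \<Sum>D\<in>{b..<b + ?H}. measure M (E j \<inter> lv (Suc j) (D + int (pos j i))))"
      by (rule sum.swap)
    also have "\<dots> \<le> (\<Sum>i\<in>{1..r j}. eps j)"
    proof (rule sum_mono)
      fix i
      have "(\<Sum>D\<in>{b..<b + ?H}. measure M (E j \<inter> lv (Suc j) (D + int (pos j i)))) =
          (\<Sum>D\<in>{b + int (pos j i)..<b + int (pos j i) + ?H}. measure M (E j \<inter> lv (Suc j) D))"
        by (rule sum.reindex_bij_witness[of _ "\<lambda>D. D - int (pos j i)" "\<lambda>D. D + int (pos j i)"]) auto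
      also have "\<dots> \<le> eps j"
        by (rule window_sum_le[OF j' E_sets[OF j] Ef])
      finally show "(\<Sum>D\<in>{b..<b + ?H}. measure M (E j \<inter> lv (Suc j) (D + int (pos j i)))) \<le> eps j" .
    qed
    finally show ?thesis by simp
  qed
  then have half: "(\<Sum>D\<in>{b..<b + ?H}. corr j D) \<le> real (r j)" for b
    using eps_pos[OF j] by (simp add: mult.commute)
  have "{a..<a + 2 * ?H} = {a..<a + ?H} \<union> {a + ?H..<a + ?H + ?H}" by auto
  then have "(\<Sum>D\<in>{a..<a + 2 * ?H}. corr j D) \<le> (\<Sum>D\<in>{a..<a + ?H}. corr j D) + (\<Sum>D\<in>{a + ?H..<a + ?H + ?H}. corr j D)"
    by (simp add: sum.union_disjoint)
  then show ?thesis using half[of a] half[of "a + ?H"] by linarith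
qed

end

section \<open>The Sidon property as a statement about positions of columns\<close>

context sidon_construction
begin

lemma sidon_tr:
  assumes j: "1 \<le> j" and m: "int (h j) < m" "m \<le> int (h (Suc j))"
  shows "\<exists>i\<in>{1..r j}. \<forall>x\<in>tow j. tr m x \<in> tow j \<longrightarrow> tr m x \<in> col j i"
proof -
  have mn: "h j < nat m" "nat m \<le> h (Suc j)" "int (nat m) = m" using m by auto
  from sidon[OF j mn(1,2)] obtain i where i: "i \<in> {1..r j}"
    "(T ^^ nat m) ` tow j \<inter> tow j \<subseteq> col j i" by (elim bexE)
  have *: "tr m = T ^^ nat m" using tr_nat[of "nat m"] mn(3) by simp
  show ?thesis
  proof (intro bexI[OF _ i(1)] ballI impI)
    fix x assume x: "x \<in> tow j" "tr m x \<in> tow j"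
    have "tr m x \<in> (T ^^ nat m) ` tow j" unfolding * using x(1) by (rule imageI)
    then show "tr m x \<in> col j i" using x(2) i(2) by (intro subsetD[OF i(2)] IntI)
  qed
qed

text \<open>One test point identifies the column that the Sidon property provides: a point of column
  i moved by T^m into column i', which exists because m is within h j of the distance between the
  two bases.\<close>

lemma sidon_col:
  assumes j: "1 \<le> j" and M: "int (h j) < m" "m \<le> int (h (Suc j))"
    and i: "1 \<le> i" "i \<le> r j" and i': "1 \<le> i'" "i' \<le> r j"
    and near: "\<bar>m - (int (pos j i') - int (pos j i))\<bar> < int (h j)"
    and x: "x \<in> tow j" "tr m x \<in> tow j"
  shows "tr m x \<in> col j i'"
proof -
  obtain c where c: "c \<in> {1..r j}" "\<And>x. x \<in> tow j \<Longrightarrow> tr m x \<in> tow j \<Longrightarrow> tr m x \<in> col j c"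
    using sidon_tr[OF j M] by blast
  have "E (Suc j) \<noteq> {}" using eps_pos[of "Suc j"] by auto
  then obtain y where y: "y \<in> E (Suc j)" by blast
  then have yX: "y \<in> X" using E_sub[of "Suc j"] by auto
  define u where "u = int (pos j i') - int (pos j i) - m"
  \<comment> \<open>Level l of column i is carried to level l - u of column i'; this choice keeps
    both between 0 and h j - 1.\<close>
  define l where "l = max u 0"
  have l: "0 \<le> l" "l < int (h j)" "0 \<le> l - u" "l - u < int (h j)" using near unfolding l_def u_def by auto
  let ?z = "tr (l + int (pos j i)) y"
  have zX: "?z \<in> X" using yX by (rule tr_space)
  have "?z \<in> lv (Suc j) (l + int (pos j i))" using y unfolding lv_def by blast
  then have "?z \<in> col j i" unfolding mem_col[OF j i] using zX l by blast
  then have z: "?z \<in> tow j" using col_tow[OF j i] by blast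
  have "tr m ?z = tr (m + (l + int (pos j i))) y" using tr_add[OF yX] by simp
  also have "m + (l + int (pos j i)) = (l - u) + int (pos j i')" unfolding u_def by simp
  finally have "tr m ?z \<in> lv (Suc j) ((l - u) + int (pos j i'))" using y unfolding lv_def by auto
  moreover have "tr m ?z \<in> X" using zX by (rule tr_space)
  ultimately have mz: "tr m ?z \<in> col j i'" unfolding mem_col[OF j i'] using l by blast
  then have "tr m ?z \<in> col j c" using c(2)[OF z] col_tow[OF j i'] by blast
  then have "c = i'" using col_disjoint[OF j _ _ i' _ mz, of c] c(1) by auto
  then show ?thesis using c(2)[OF x] by simp
qed

text \<open>The times at which T^m moves one column over another determine the target, since all
  returns at time m fall into a single column.\<close>

lemma sidon_target:
  assumes j: "1 \<le> j" and M: "int (h j) < m" "m \<le> int (h (Suc j))"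
    and i: "1 \<le> i" "i \<le> r j" "1 \<le> i'" "i' \<le> r j" "1 \<le> k" "k \<le> r j" "1 \<le> k'" "k' \<le> r j"
    and near: "\<bar>m - (int (pos j i') - int (pos j i))\<bar> < int (h j)" "\<bar>m - (int (pos j k') - int (pos j k))\<bar> < int (h j)"
  shows "i' = k'"
proof -
  have "E (Suc j) \<noteq> {}" using eps_pos[of "Suc j"] by auto
  then obtain y where y: "y \<in> E (Suc j)" by blast
  then have yX: "y \<in> X" using E_sub[of "Suc j"] by auto
  define u where "u = int (pos j i') - int (pos j i) - m"
  define l where "l = max u 0"
  have l: "0 \<le> l" "l < int (h j)" "0 \<le> l - u" "l - u < int (h j)" using near unfolding l_def u_def by auto
  let ?z = "tr (l + int (pos j i)) y"
  have zX: "?z \<in> X" using yX by (rule tr_space)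
  have "?z \<in> lv (Suc j) (l + int (pos j i))" using y unfolding lv_def by blast
  then have "?z \<in> col j i" unfolding mem_col[OF j i(1,2)] using zX l by blast
  then have z: "?z \<in> tow j" using col_tow[OF j i(1,2)] by blast
  have "tr m ?z = tr (m + (l + int (pos j i))) y" using tr_add[OF yX] by simp
  also have "m + (l + int (pos j i)) = (l - u) + int (pos j i')" unfolding u_def by simp
  finally have "tr m ?z \<in> lv (Suc j) ((l - u) + int (pos j i'))" using y unfolding lv_def by auto
  moreover have "tr m ?z \<in> X" using zX by (rule tr_space)
  ultimately have mz: "tr m ?z \<in> col j i'" unfolding mem_col[OF j i(3,4)] using l by blast
  then have mt: "tr m ?z \<in> tow j" using col_tow[OF j i(3,4)] by blast
  have "tr m ?z \<in> col j k'" by (rule sidon_col[OF j M i(5-8) near(2) z mt])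
  then show ?thesis using col_disjoint[OF j i(3,4) i(7,8) mz] by blast
qed

lemma two_columns: "1 \<le> j \<Longrightarrow> 2 \<le> r j \<Longrightarrow> 2 * h j \<le> h (Suc j)"
  using h_Suc_ge[of j] mult_le_mono2[of 2 "r j" "h j"] by linarith

text \<open>Passing from column i to the next takes about h j + s j i steps. With two small spacers,
  both passages would be close to one common time and so would have the same target.\<close>

lemma small_spacer_unique:
  assumes j: "1 \<le> j" "2 \<le> h j" and i: "1 \<le> i" "i < r j" "s j i < h j" and k: "1 \<le> k" "k < r j" "s j k < h j"
  shows "i = k"
proof -
  \<comment> \<open>The Sidon property needs m > h j, hence the maximum with 1, which is within
    reach of both passages since 2 \<le> h j.\<close>
  define m where "m = int (h j) + max 1 (max (int (s j i)) (int (s j k)))"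
  have "2 * h j \<le> h (Suc j)" using i by (intro two_columns j) simp
  moreover have "int (pos j (Suc i)) - int (pos j i) = int (h j) + int (s j i)"
    "int (pos j (Suc k)) - int (pos j k) = int (h j) + int (s j k)"
    using pos_Suc[OF i(1), of j] pos_Suc[OF k(1), of j] by auto
  ultimately have "Suc i = Suc k"
    using i k j(2) by (intro sidon_target[OF j(1), of m i "Suc i" k "Suc k"]) (auto simp: m_def)
  then show ?thesis by simp
qed

lemma pos_gap: "1 \<le> i \<Longrightarrow> i < k \<Longrightarrow> int (pos j i) + int (h j) \<le> int (pos j k)"
  using pos_mono[of i k j] by simp

lemma pos_close: "1 \<le> i \<Longrightarrow> 1 \<le> k \<Longrightarrow> \<bar>int (pos j i) - int (pos j k)\<bar> < int (h j) \<Longrightarrow> i = k"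
  using pos_gap[of i k j] pos_gap[of k i j] by (cases i k rule: linorder_cases) auto

lemma sidon_pairs:
  assumes j: "1 \<le> j" "2 \<le> h j"
    and i: "1 \<le> l" "l < i" "i \<le> r j" and k: "1 \<le> k" "k < i'" "i' \<le> r j"
    and near: "\<bar>(int (pos j i) - int (pos j l)) - (int (pos j i') - int (pos j k))\<bar> < int (h j)"
  shows "i = i'"
proof -
  let ?a = "int (pos j i) - int (pos j l)" and ?b = "int (pos j i') - int (pos j k)"
  have ab: "int (h j) \<le> ?a" "int (h j) \<le> ?b"
    using pos_gap[OF i(1,2), of j] pos_gap[OF k(1,2), of j] by auto
  have H: "2 * int (h j) \<le> int (h (Suc j))"
    using two_columns[OF j(1)] i by simp
  have top: "?a \<le> int (h (Suc j))" "?b \<le> int (h (Suc j))"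
    using pos_top[OF j(1), of i] pos_top[OF j(1), of i'] i k by auto
  \<comment> \<open>The maximum with h j + 1 is needed because adjacent columns without spacers are
    exactly h j apart, one below the range of the Sidon property.\<close>
  define m where "m = max (int (h j) + 1) (max ?a ?b)"
  show ?thesis
    by (rule sidon_target[OF j(1), of m l i k i']) (use i k ab top H near j(2) in \<open>auto simp: m_def\<close>)
qed

text \<open>Near equality of two sums is near equality of the differences p_i - p_k and p_l - p_q.
  If they are not trivial they have the same sign, and \<open>sidon_pairs\<close> makes their upper
  ends equal. This is what yields Gaussian fourth moments later.\<close>

lemma sidon_quadruple:
  assumes j: "1 \<le> j" "2 \<le> h j"
    and i: "1 \<le> i" "i \<le> r j" "1 \<le> q" "q \<le> r j" "1 \<le> k" "k \<le> r j" "1 \<le> l" "l \<le> r j"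
    and near: "\<bar>int (pos j i) + int (pos j q) - int (pos j k) - int (pos j l)\<bar> < int (h j)"
  shows "i = k \<and> q = l \<or> i = l \<and> q = k"
proof (rule ccontr)
  assume not: "\<not> ?thesis"
  have 1: "i \<noteq> k" using pos_close[of q l j] near not i by auto
  have 2: "i \<noteq> l" using pos_close[of q k j] near not i by auto
  have 3: "q \<noteq> k" using pos_close[of i l j] near not i by auto
  have 4: "q \<noteq> l" using pos_close[of i k j] near not i by auto
  show False
  proof (cases "k < i")
    case True
    then have "q < l"
      using pos_gap[of k i j] pos_gap[of l q j] near i 4 by (cases q l rule: linorder_cases) auto
    then have "i = l"
      using sidon_pairs[OF j, of k i q l] True near i by (simp add: algebra_simps)
    then show False using 2 by simp
  next
    case False
    then have ik: "i < k" using 1 by simp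
    then have "l < q"
      using pos_gap[of i k j] pos_gap[of q l j] near i 4 by (cases q l rule: linorder_cases) auto
    then have "k = q"
      using sidon_pairs[OF j, of i k l q] ik near i by (simp add: algebra_simps)
    then show False using 3 by simp
  qed
qed

text \<open>The returning points lie in one column, and a column holds the fraction 1 / r j of E
  j0.\<close>

lemma corr_le_inverse:
  assumes j0: "1 \<le> j0" "j0 \<le> j" and m: "int (h j) < \<bar>m\<bar>" "\<bar>m\<bar> \<le> int (h (Suc j))"
  shows "corr j0 m \<le> 1 / real (r j)"
proof -
  have j: "1 \<le> j" using j0 by simp
  have lev: "levelset j (E j0)" by (rule levelset_mono[OF j0(1) levelset_E[OF j0(1)] j0(2)])
  have "corr j0 m \<le> 1 / real (r j)" if m: "int (h j) < m" "m \<le> int (h (Suc j))" for m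
  proof -
    obtain c where c: "1 \<le> c" "c \<le> r j" "\<And>x. x \<in> tow j \<Longrightarrow> tr m x \<in> tow j \<Longrightarrow> tr m x \<in> col j c"
      using sidon_tr[OF j m] by auto
    have "E j0 \<inter> lv j0 m \<subseteq> E j0 \<inter> col j c"
    proof
      fix y assume y: "y \<in> E j0 \<inter> lv j0 m"
      then have yX: "y \<in> X" "tr (- m) y \<in> E j0" using mem_lv[OF j0(1)] by auto
      have "tr m (tr (- m) y) \<in> col j c"
        using c(3)[of "tr (- m) y"] yX y levelset_sub_tow[OF lev] tr_cancel(1)[OF yX(1), of m] by auto
      then show "y \<in> E j0 \<inter> col j c" using y tr_cancel(1)[OF yX(1), of m] by simp
    qed
    moreover have "emeasure M (E j0 \<inter> col j c) < \<infinity>"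
      by (rule levelset_finite[OF _ levelset_col(2)[OF j c(1,2) lev]]) simp
    ultimately have "measure M (E j0 \<inter> lv j0 m) \<le> measure M (E j0 \<inter> col j c)"
      using E_inter_sets[OF j0(1)] col_sets[OF j c(1,2)] E_sets[OF j0(1)]
      by (intro measure_mono_fin) auto
    also have "\<dots> = eps j0 / real (r j)" by (rule levelset_col(1)[OF j c(1,2) lev])
    finally show ?thesis unfolding measure_E_inter[OF j0(1)] using eps_pos[OF j0(1)] cuts_pos[OF j]
      by (simp add: field_simps)
  qed
  from this[of "\<bar>m\<bar>"] m show ?thesis using corr_minus[OF j0(1), of m] by (cases "0 \<le> m") auto
qed

text \<open>Every overlap at a time D within h j of m lies in the column that belongs to m. The
  window is covered by two windows of length h j, and each of them meets the part of E j in this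
  column at most once, whence the factor 2.\<close>

lemma corr_window:
  assumes j: "1 \<le> j" and m: "int (h j) < m" "m \<le> int (h (Suc j))"
  shows "(\<Sum>D\<in>{m - int (h j)<..<m + int (h j)}. corr j D) \<le> 2 / real (r j)"
proof -
  obtain c where c: "1 \<le> c" "c \<le> r j" "\<And>x. x \<in> tow j \<Longrightarrow> tr m x \<in> tow j \<Longrightarrow> tr m x \<in> col j c"
    using sidon_tr[OF j m] by auto
  let ?W = "{m - int (h j)<..<m + int (h j)}"
  have lev: "levelset j (E j)" by (rule levelset_E[OF j])
  let ?A = "E j \<inter> col j c"
  have A: "?A \<in> sets M" "emeasure M ?A < \<infinity>"
    using E_sets[OF j] col_sets[OF j c(1,2)] levelset_finite[OF _ levelset_col(2)[OF j c(1,2) lev]] by auto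
  have sub: "E j \<inter> lv j D = ?A \<inter> lv j D" if D: "D \<in> ?W" for D
  proof -
    have "y \<in> col j c" if y: "y \<in> E j" "y \<in> lv j D" for y
    proof -
      have yX: "y \<in> X" using y(2) mem_lv[OF j] by blast
      have y0: "y \<in> lv j 0" using y(1) by (simp add: lv_0)
      \<comment> \<open>Moves y up inside the tower so that the preimage of the new point under T^m
        is in the tower too, although D differs from m.\<close>
      define v where "v = max 0 (m - D)"
      have v: "0 \<le> v" "v < int (h j)" "0 \<le> v + D - m" "v + D - m < int (h j)" using D unfolding v_def by auto
      let ?y = "tr v y"
      have yv: "?y \<in> X" "?y \<in> lv j v" "tr (- m) ?y \<in> X" using yX y0 j by (auto simp: tr_space mem_lv_shift)
      have "tr (- m) ?y \<in> lv j (v + D - m)"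
        using mem_lv_shift[OF j yv(1), of "- m" "v + D - m"] mem_lv_shift[OF j yX, of v "v + D"] y(2)
        by (simp add: algebra_simps)
      then have "tr (- m) ?y \<in> tow j" unfolding tow_eq using v by auto
      moreover have "?y \<in> tow j" unfolding tow_eq using v yv by auto
      ultimately have "?y \<in> col j c" using c(3)[of "tr (- m) ?y"] tr_cancel(1)[OF yv(1)] by simp
      then have "?y \<in> lv (Suc j) (v + int (pos j c))" using lv_col[OF j c(1,2) v(1,2)] yv(2) by blast
      then have "y \<in> lv (Suc j) (0 + int (pos j c))" using mem_lv_shift[of "Suc j" y v] yX by simp
      then show ?thesis unfolding mem_col[OF j c(1,2)] using yX h_pos[OF j] by (auto intro!: exI[of _ 0])
    qed
    then show ?thesis by blast
  qed
  have "eps j * (\<Sum>D\<in>?W. corr j D) = (\<Sum>D\<in>?W. measure M (?A \<inter> lv j D))"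
    unfolding sum_distrib_left measure_E_inter[OF j, symmetric] using sub by simp
  also have "\<dots> \<le> (\<Sum>D\<in>{m - int (h j)..<m - int (h j) + int (h j)} \<union> {m..<m + int (h j)}. measure M (?A \<inter> lv j D))"
    by (rule sum_mono2) auto
  also have "\<dots> = (\<Sum>D\<in>{m - int (h j)..<m - int (h j) + int (h j)}. measure M (?A \<inter> lv j D)) +
      (\<Sum>D\<in>{m..<m + int (h j)}. measure M (?A \<inter> lv j D))"
    by (rule sum.union_disjoint) auto
  also have "\<dots> \<le> measure M ?A + measure M ?A"
    by (intro add_mono window_sum_le[OF j A])
  also have "\<dots> = eps j * (2 / real (r j))"
    using levelset_col(1)[OF j c(1,2) lev] by simp
  finally show ?thesis by (rule mult_left_le_imp_le) (rule eps_pos[OF j])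
qed

text \<open>Jensen with the total weight 2 / r j of a window gives the power N - 1 of this weight.
  Exchanging the sums then leaves at most 2 r j visits for each u. Altogether a stage multiplies the
  sum by a constant times r j ^ (2 - N).\<close>

lemma corr_power_step:
  assumes j0: "1 \<le> j0" "j0 \<le> j" and N: "even N" "0 < N"
  shows "(\<Sum>m\<in>{int (h j)<..int (h (Suc j))}. corr j0 m ^ N) \<le>
    (2 / real (r j)) ^ (N - 1) * (2 * real (r j)) * (\<Sum>u\<in>{- int (h j)..int (h j)}. corr j0 u ^ N)"
proof -
  have j: "1 \<le> j" using j0 by simp
  let ?h = "int (h j)" and ?H = "int (h (Suc j))"
  let ?S = "\<Sum>u\<in>{- ?h..?h}. corr j0 u ^ N"
  let ?R = "(2 / real (r j)) ^ (N - 1)"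
  have pw: "0 \<le> corr j D * corr j0 u ^ N" for D u
    by (intro mult_nonneg_nonneg zero_le_power corr_nonneg)
  have hH: "?h \<le> ?H" using h_mono[OF j, of "Suc j"] by simp
  have 1: "corr j0 m ^ N \<le> ?R * (\<Sum>D\<in>{m - ?h<..<m + ?h}. corr j D * corr j0 (D - m) ^ N)"
    if m: "m \<in> {?h<..?H}" for m
  proof -
    have "corr j0 m ^ N \<le> (\<Sum>D\<in>{m - ?h<..<m + ?h}. corr j D * corr j0 (D - m)) ^ N"
      by (intro power_mono corr_convolution[OF j0] corr_nonneg)
    also have "\<dots> \<le> (\<Sum>D\<in>{m - ?h<..<m + ?h}. corr j D) ^ (N - 1) * (\<Sum>D\<in>{m - ?h<..<m + ?h}. corr j D * corr j0 (D - m) ^ N)"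
      by (intro weighted_power_mean N corr_nonneg) simp
    also have "\<dots> \<le> ?R * (\<Sum>D\<in>{m - ?h<..<m + ?h}. corr j D * corr j0 (D - m) ^ N)"
      using m by (intro mult_right_mono power_mono corr_window[OF j] sum_nonneg corr_nonneg pw) auto
    finally show ?thesis .
  qed
  have 2: "(\<Sum>D\<in>{m - ?h<..<m + ?h}. corr j D * corr j0 (D - m) ^ N) =
      (\<Sum>u\<in>{- ?h<..<?h}. corr j (m + u) * corr j0 u ^ N)" for m
    by (rule sum.reindex_bij_witness[of _ "\<lambda>u. m + u" "\<lambda>D. D - m"]) auto
  have "(\<Sum>m\<in>{?h<..?H}. corr j0 m ^ N) \<le> (\<Sum>m\<in>{?h<..?H}. ?R * (\<Sum>u\<in>{- ?h<..<?h}. corr j (m + u) * corr j0 u ^ N))"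
    by (rule sum_mono) (use 1 2 in simp)
  also have "\<dots> = ?R * (\<Sum>u\<in>{- ?h<..<?h}. (\<Sum>m\<in>{?h<..?H}. corr j (m + u)) * corr j0 u ^ N)"
    unfolding sum_distrib_left[symmetric] sum_distrib_right by (subst sum.swap) simp
  also have "\<dots> \<le> ?R * (\<Sum>u\<in>{- ?h<..<?h}. (2 * real (r j)) * corr j0 u ^ N)"
  proof (intro mult_left_mono sum_mono mult_right_mono zero_le_power corr_nonneg)
    fix u assume u: "u \<in> {- ?h<..<?h}"
    have "(\<Sum>m\<in>{?h<..?H}. corr j (m + u)) = (\<Sum>D\<in>{?h + u<..?H + u}. corr j D)"
      by (rule sum.reindex_bij_witness[of _ "\<lambda>D. D - u" "\<lambda>m. m + u"]) auto
    also have "\<dots> \<le> (\<Sum>D\<in>{0..<0 + 2 * ?H}. corr j D)"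
      using u hH by (intro sum_mono2 corr_nonneg) auto
    also have "\<dots> \<le> 2 * real (r j)" by (rule corr_visits[OF j])
    finally show "(\<Sum>m\<in>{?h<..?H}. corr j (m + u)) \<le> 2 * real (r j)" .
  qed auto
  also have "\<dots> = ?R * (2 * real (r j)) * (\<Sum>u\<in>{- ?h<..<?h}. corr j0 u ^ N)"
    by (simp add: sum_distrib_left mult.assoc)
  also have "\<dots> \<le> ?R * (2 * real (r j)) * ?S"
    by (intro mult_left_mono sum_mono2 zero_le_power corr_nonneg) auto
  finally show ?thesis .
qed

text \<open>The partial sums over |u| \<le> h j grow from one stage to the next by a factor 1 + K r
  j ^ (2 - N), so that their product is bounded by an exponential of the series.\<close>

lemma corr_power_bounded:
  assumes j0: "1 \<le> j0" and N: "even N" "2 \<le> N"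
    and B: "\<And>J. (\<Sum>j\<in>{j0..<J}. 1 / real (r j) ^ (N - 2)) \<le> Bd" and hinf: "\<And>m::int. \<exists>j\<ge>j0. m \<le> int (h j)"
  shows "\<exists>Cst. \<forall>I. finite I \<longrightarrow> (\<Sum>m\<in>I. corr j0 m ^ N) \<le> Cst"
proof -
  define U where "U j = (\<Sum>u\<in>{- int (h j)..int (h j)}. corr j0 u ^ N)" for j
  \<comment> \<open>2 ^ N is the constant left in (2 / r j) ^ (N - 1) * (2 r j); the other factor 2
    accounts for both signs of m.\<close>
  let ?K = "2 * 2 ^ N :: real"
  have Upos: "0 \<le> U j" for j unfolding U_def by (intro sum_nonneg zero_le_power corr_nonneg)
  have step: "U (Suc j) \<le> U j * exp (?K * (1 / real (r j) ^ (N - 2)))" if j: "j0 \<le> j" for j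
  proof -
    let ?h = "int (h j)" and ?H = "int (h (Suc j))"
    have hH: "?h \<le> ?H" using h_mono[of j "Suc j"] j0 j by simp
    have rp: "0 < real (r j)" using cuts_pos[of j] j0 j by simp
    have split: "{- ?H..?H} = {- ?h..?h} \<union> ({?h<..?H} \<union> {- ?H..<- ?h})" using hH by auto
    have "U (Suc j) = U j + ((\<Sum>m\<in>{?h<..?H}. corr j0 m ^ N) + (\<Sum>m\<in>{- ?H..<- ?h}. corr j0 m ^ N))"
      unfolding U_def split by (subst sum.union_disjoint; (subst sum.union_disjoint)?) auto
    also have "(\<Sum>m\<in>{- ?H..<- ?h}. corr j0 m ^ N) = (\<Sum>m\<in>{?h<..?H}. corr j0 m ^ N)"
      by (rule sum.reindex_bij_witness[of _ uminus uminus]) (auto simp: corr_minus[OF j0])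
    also have "(\<Sum>m\<in>{?h<..?H}. corr j0 m ^ N) \<le> (2 / real (r j)) ^ (N - 1) * (2 * real (r j)) * U j"
      unfolding U_def using N by (intro corr_power_step[OF j0 j]) auto
    also have "(2 / real (r j)) ^ (N - 1) * (2 * real (r j)) = 2 ^ N * (1 / real (r j) ^ (N - 2))"
    proof -
      have "N = Suc (Suc (N - 2))" using N(2) by simp
      then obtain k where k: "N = Suc (Suc k)" by blast
      show ?thesis unfolding k using rp by (simp add: power_divide field_simps)
    qed
    finally have "U (Suc j) \<le> U j * (1 + ?K * (1 / real (r j) ^ (N - 2)))"
      by (simp add: algebra_simps)
    also have "\<dots> \<le> U j * exp (?K * (1 / real (r j) ^ (N - 2)))"
      by (intro mult_left_mono exp_ge_add_one_self Upos)
    finally show ?thesis .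
  qed
  have "U J \<le> U j0 * exp (?K * (\<Sum>j\<in>{j0..<J}. 1 / real (r j) ^ (N - 2)))" if "j0 \<le> J" for J
    using that
  proof (induction J rule: dec_induct)
    case (step J)
    have "U (Suc J) \<le> U J * exp (?K * (1 / real (r J) ^ (N - 2)))" by (rule \<open>\<And>j. j0 \<le> j \<Longrightarrow> _\<close>) fact
    also have "\<dots> \<le> U j0 * exp (?K * (\<Sum>j\<in>{j0..<J}. 1 / real (r j) ^ (N - 2))) * exp (?K * (1 / real (r J) ^ (N - 2)))"
      by (intro mult_right_mono step) simp
    also have "\<dots> = U j0 * exp (?K * (\<Sum>j\<in>{j0..<Suc J}. 1 / real (r j) ^ (N - 2)))"
      using step(1) by (simp add: exp_add[symmetric] algebra_simps)
    finally show ?case .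
  qed simp
  moreover have "U j0 * exp (?K * (\<Sum>j\<in>{j0..<J}. 1 / real (r j) ^ (N - 2))) \<le> U j0 * exp (?K * Bd)" for J
    using B[of J] by (intro mult_left_mono Upos) simp
  ultimately have UB: "U J \<le> U j0 * exp (?K * Bd)" if "j0 \<le> J" for J using that order_trans by blast
  have "(\<Sum>m\<in>I. corr j0 m ^ N) \<le> U j0 * exp (?K * Bd)" if I: "finite I" for I
  proof -
    have m: "\<bar>x\<bar> \<le> Max (abs ` I)" if "x \<in> I" for x
      using I that by (intro Max_ge) auto
    define m where "m = Max (abs ` I)"
    note m = m[folded m_def]
    obtain J where J: "j0 \<le> J" "m \<le> int (h J)" using hinf by blast
    have "(\<Sum>m\<in>I. corr j0 m ^ N) \<le> U J"
      unfolding U_def using J m by (intro sum_mono2 zero_le_power corr_nonneg) (use J m in force)+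
    also have "\<dots> \<le> U j0 * exp (?K * Bd)" by (rule UB) fact
    finally show ?thesis .
  qed
  then show ?thesis by blast
qed

end

section \<open>Singularity for powers at least two\<close>

lemma circle_normsq_family:
  assumes \<nu>: "finite_circle_measure \<nu>" and I: "finite I"
  shows "complex_of_real (LINT z|\<nu>. (norm (\<Sum>p\<in>I. c p * z powi (f p)))\<^sup>2) =
    (\<Sum>p\<in>I. \<Sum>q\<in>I. c p * cnj (c q) * (LINT z|\<nu>. z powi (f p - f q)))"
proof -
  have i: "integrable \<nu> (\<lambda>z. c p * cnj (c q) * z powi (f p - f q))" for p q
    by (intro circle_integrable[OF \<nu>] continuous_intros) auto
  have "complex_of_real (LINT z|\<nu>. (norm (\<Sum>p\<in>I. c p * z powi (f p)))\<^sup>2)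
    = (LINT z|\<nu>. complex_of_real ((norm (\<Sum>p\<in>I. c p * z powi (f p)))\<^sup>2))"
    by (rule integral_complex_of_real[symmetric])
  also have "\<dots> = (LINT z|\<nu>. (\<Sum>p\<in>I. \<Sum>q\<in>I. c p * cnj (c q) * z powi (f p - f q)))"
  proof (rule Bochner_Integration.integral_cong)
    fix z assume "z \<in> space \<nu>"
    then have z: "z \<in> circle" by (simp add: finite_circle_measureD[OF \<nu>])
    show "complex_of_real ((norm (\<Sum>p\<in>I. c p * z powi (f p)))\<^sup>2) =
        (\<Sum>p\<in>I. \<Sum>q\<in>I. c p * cnj (c q) * z powi (f p - f q))"
      using powi_circle_mult[OF z, of "f p" "- f q" for p q]
      unfolding complex_norm_square cnj_sum sum_product complex_cnj_mult cnj_powi_circle[OF z]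
      by (intro sum.cong refl) (simp add: mult_ac)
  qed simp
  also have "\<dots> = (\<Sum>p\<in>I. \<Sum>q\<in>I. LINT z|\<nu>. c p * cnj (c q) * z powi (f p - f q))"
    by (subst Bochner_Integration.integral_sum, intro Bochner_Integration.integrable_sum i)
       (intro sum.cong refl Bochner_Integration.integral_sum i)
  finally show ?thesis by simp
qed

lemma circle_markov:
  assumes \<nu>: "finite_circle_measure \<nu>" and g: "continuous_on circle (g :: complex \<Rightarrow> real)"
    and pos: "\<And>z. z \<in> circle \<Longrightarrow> 0 \<le> g z" and A: "A \<in> sets circle_borel"
    and c: "0 < c" "\<And>z. z \<in> A \<Longrightarrow> c \<le> g z"
  shows "measure \<nu> A \<le> (LINT z|\<nu>. g z) / c"
proof -
  interpret finite_measure \<nu> using \<nu> by (rule finite_circle_measureD)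
  have AS: "A \<in> sets \<nu>" "A \<subseteq> circle" using A finite_circle_measureD[OF \<nu>] by (auto simp: sets_circle_borel)
  have "measure \<nu> A = (LINT z|\<nu>. indicator A z)"
    using AS sets.sets_into_space[OF AS(1)] by (simp add: Int_absorb2)
  also have "\<dots> \<le> (LINT z|\<nu>. g z / c)"
  proof (rule integral_mono)
    show "integrable \<nu> (\<lambda>z. g z / c)"
      using c(1) by (intro circle_integrable[OF \<nu>] continuous_intros g) auto
    show "integrable \<nu> (indicat_real A)" using AS by (simp add: integrable_indicator_iff emeasure_eq_measure)
    fix z assume "z \<in> space \<nu>"
    then show "indicat_real A z \<le> g z / c"
      using c pos[of z] finite_circle_measureD[OF \<nu>] by (auto split: split_indicator simp: field_simps)
  qed
  finally show ?thesis by simp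
qed

text \<open>On the set where |\<phi>| < 1/2 one has |\<phi> - 1| \<ge> 1/2, and |\<phi>| \<ge> 1/2
  off it, so Markov's inequality separates the two measures at the cost of a factor 4.\<close>

lemma singular_by_polynomials:
  assumes \<nu>: "finite_circle_measure \<nu>"
    and ex: "\<And>\<epsilon>::real. 0 < \<epsilon> \<Longrightarrow> \<exists>\<phi>::complex \<Rightarrow> complex. continuous_on circle \<phi> \<and>
      (LINT z|\<nu>. (norm (\<phi> z - 1))\<^sup>2) \<le> \<epsilon> \<and> (LINT z|circle_lebesgue. (norm (\<phi> z))\<^sup>2) \<le> \<epsilon>"
  shows "mutually_singular circle_lebesgue \<nu>"
proof (rule mutually_singular_circleI[OF \<nu>])
  fix \<epsilon> :: real assume "0 < \<epsilon>"
  then obtain \<phi> :: "complex \<Rightarrow> complex" where \<phi>: "continuous_on circle \<phi>" "(LINT z|\<nu>. (norm (\<phi> z - 1))\<^sup>2) \<le> \<epsilon> / 4"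
      "(LINT z|circle_lebesgue. (norm (\<phi> z))\<^sup>2) \<le> \<epsilon> / 4"
    using ex[of "\<epsilon> / 4"] by (metis divide_pos_pos zero_less_numeral)
  have m: "(\<lambda>z. norm (\<phi> z)) \<in> borel_measurable (restrict_space borel circle)"
    by (intro borel_measurable_continuous_on_restrict continuous_intros \<phi>(1))
  define A where "A = {z \<in> circle. norm (\<phi> z) < 1 / 2}"
  have "{z \<in> space (restrict_space borel circle). norm (\<phi> z) < 1 / 2} \<in> sets (restrict_space borel circle)"
    using m by measurable
  then have A: "A \<in> sets circle_borel" unfolding A_def circle_borel_def by (simp add: space_restrict_space)
  then have A': "circle - A \<in> sets circle_borel" by (auto simp: sets_circle_borel)
  have "measure \<nu> A \<le> (LINT z|\<nu>. (norm (\<phi> z - 1))\<^sup>2) / (1 / 4)"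
  proof (rule circle_markov[OF \<nu> _ _ A])
    fix z assume "z \<in> A"
    then have "1 / 2 \<le> norm (\<phi> z - 1)"
      using norm_triangle_sub[of 1 "\<phi> z"] by (simp add: A_def norm_minus_commute)
    then have "(1 / 2)\<^sup>2 \<le> (norm (\<phi> z - 1))\<^sup>2" by (intro power_mono) auto
    then show "1 / 4 \<le> (norm (\<phi> z - 1))\<^sup>2" by (simp add: power2_eq_square)
  qed (auto intro!: continuous_intros \<phi>(1))
  then have 1: "measure \<nu> A \<le> \<epsilon>" using \<phi>(2) by simp
  have "measure circle_lebesgue (circle - A) \<le> (LINT z|circle_lebesgue. (norm (\<phi> z))\<^sup>2) / (1 / 4)"
  proof (rule circle_markov[OF circle_lebesgue_base(1) _ _ A'])
    fix z assume "z \<in> circle - A"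
    then have "(1 / 2)\<^sup>2 \<le> (norm (\<phi> z))\<^sup>2" by (intro power_mono) (auto simp: A_def)
    then show "1 / 4 \<le> (norm (\<phi> z))\<^sup>2" by (simp add: power2_eq_square)
  qed (auto intro!: continuous_intros \<phi>(1))
  then have "measure circle_lebesgue (circle - A) \<le> \<epsilon>" using \<phi>(3) by simp
  with 1 A show "\<exists>A\<in>sets circle_borel. measure \<nu> A \<le> \<epsilon> \<and> measure circle_lebesgue (circle - A) \<le> \<epsilon>" by blast
qed

context sidon_construction
begin

text \<open>Sources are taken from the first half of the columns and targets from the second, so
  that all differences are positive. The tall spacer makes the differences at least 2 h j, separates
  them, and catches the points pushed over the top of a source column in
  \<open>corr_delta_cross\<close>.\<close>

definition sources :: "nat \<Rightarrow> nat set" where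
  "sources j = {i \<in> {1..r j div 2}. h j \<le> s j i}"

definition pairs :: "nat \<Rightarrow> (nat \<times> nat) set" where
  "pairs j = sources j \<times> {r j div 2 + 1..r j}"

definition delta :: "nat \<Rightarrow> nat \<times> nat \<Rightarrow> int" where
  "delta j p = int (pos j (snd p)) - int (pos j (fst p))"

lemma pairsD:
  assumes "p \<in> pairs j"
  shows "1 \<le> fst p" "fst p < snd p" "snd p \<le> r j" "fst p < r j" "h j \<le> s j (fst p)" "fst p \<le> r j" "1 \<le> snd p"
  using assms by (auto simp: pairs_def sources_def)

lemma finite_pairs: "finite (pairs j)"
  unfolding pairs_def sources_def by auto

lemma delta_bounds:
  assumes j: "1 \<le> j" and p: "p \<in> pairs j"
  shows "2 * int (h j) \<le> delta j p" "delta j p < int (h (Suc j))"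
proof -
  show "2 * int (h j) \<le> delta j p"
    using pos_mono[of "fst p" "snd p" j] pairsD[OF p] unfolding delta_def by simp
  have "pos j (snd p) < h (Suc j)" using pos_top[OF j, of "snd p"] pairsD[OF p] h_pos[OF j] by simp
  then show "delta j p < int (h (Suc j))" unfolding delta_def by simp
qed

text \<open>Close differences have the same target, and distinct sources lie more than h j apart on
  account of their spacers.\<close>

lemma delta_separated:
  assumes j: "1 \<le> j" "2 \<le> h j" and p: "p \<in> pairs j" and q: "q \<in> pairs j" and ne: "p \<noteq> q"
  shows "int (h j) < \<bar>delta j p - delta j q\<bar>"
proof (rule ccontr)
  assume "\<not> int (h j) < \<bar>delta j p - delta j q\<bar>"
  then have near: "\<bar>delta j p - delta j q\<bar> \<le> int (h j)" by simp
  note P = pairsD[OF p] and Q = pairsD[OF q]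
  note pd = delta_bounds[OF j(1) p] and qd = delta_bounds[OF j(1) q]
  have s: "snd p = snd q"
  proof (cases "delta j p = delta j q")
    case True
    then show ?thesis
      using j pd by (intro sidon_target[OF j(1) _ _ P(1,6,7,3) Q(1,6,7,3), of "delta j p"]) (auto simp: delta_def)
  next
    case False
    \<comment> \<open>The two differences may be exactly h j apart, while
      \<open>sidon_target\<close> asks for less than h j. The point just above the smaller one is
      strictly within reach of both.\<close>
    define m where "m = min (delta j p) (delta j q) + 1"
    show ?thesis
    proof (rule sidon_target[OF j(1) _ _ P(1,6,7,3) Q(1,6,7,3), of m])
      show "int (h j) < m" "m \<le> int (h (Suc j))" using pd qd False unfolding m_def by auto
      show "\<bar>m - (int (pos j (snd p)) - int (pos j (fst p)))\<bar> < int (h j)"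
        using near j(2) False unfolding m_def delta_def[symmetric] by auto
      show "\<bar>m - (int (pos j (snd q)) - int (pos j (fst q)))\<bar> < int (h j)"
        using near j(2) False unfolding m_def delta_def[symmetric] by auto
    qed
  qed
  have "fst p \<noteq> fst q" using ne s by (auto simp: prod_eq_iff)
  then have "int (h j) < \<bar>int (pos j (fst p)) - int (pos j (fst q))\<bar>"
    using pos_mono[of "fst p" "fst q" j] pos_mono[of "fst q" "fst p" j] P Q h_pos[OF j(1)]
    by (cases "fst p" "fst q" rule: linorder_cases) auto
  then show False using near s unfolding delta_def by auto
qed

text \<open>By \<open>small_spacer_unique\<close> at most one column of the first half is not a
  source.\<close>

lemma card_pairs:
  assumes j: "1 \<le> j" "2 \<le> h j" and r: "4 \<le> r j"
  shows "real (card (pairs j)) \<le> (real (r j))\<^sup>2" "(real (r j))\<^sup>2 / 16 \<le> real (card (pairs j))"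
proof -
  have fin: "finite (sources j)" unfolding sources_def by simp
  have card: "card (pairs j) = card (sources j) * (r j - r j div 2)"
    unfolding pairs_def by (simp add: card_cartesian_product)
  have ssub: "sources j \<subseteq> {1..r j div 2}" unfolding sources_def by blast
  then have "card (sources j) \<le> r j div 2"
    using card_mono[of "{1..r j div 2}" "sources j"] by simp
  then have "card (pairs j) \<le> r j * r j"
    unfolding card by (intro mult_le_mono) auto
  then have "real (card (pairs j)) \<le> real (r j * r j)" by (rule of_nat_mono)
  then show "real (card (pairs j)) \<le> (real (r j))\<^sup>2" by (simp add: power2_eq_square)
  have "card ({1..r j div 2} - sources j) \<le> 1"
  proof -
    have "i = k" if "i \<in> {1..r j div 2} - sources j" "k \<in> {1..r j div 2} - sources j" for i k
      using that r by (intro small_spacer_unique[OF j]) (auto simp: sources_def)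
    then show ?thesis by (intro card_le_Suc0_iff_eq[THEN iffD2, simplified One_nat_def[symmetric]]) auto
  qed
  moreover have "card ({1..r j div 2} - sources j) = r j div 2 - card (sources j)"
    using card_Diff_subset[OF fin ssub] by simp
  ultimately have "r j div 2 \<le> card (sources j) + 1" by simp
  then have "r j \<le> 2 * card (sources j) + 3" by linarith
  then have "real (r j) \<le> real (2 * card (sources j) + 3)" by (rule of_nat_mono)
  then have a: "(real (r j) - 3) / 2 \<le> real (card (sources j))" by simp
  have b: "real (r j) / 2 \<le> real (r j - r j div 2)" by linarith
  have "(real (r j) - 3) / 2 * (real (r j) / 2) \<le> real (card (sources j)) * real (r j - r j div 2)"
    using r by (intro mult_mono a b) auto
  \<comment> \<open>This is equivalent to r j \<ge> 4, and it fixes the constant 16.\<close>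
  moreover have "(real (r j))\<^sup>2 / 16 \<le> (real (r j) - 3) / 2 * (real (r j) / 2)"
  proof -
    have "real (r j) * 4 \<le> real (r j) * real (r j)" using r by (intro mult_left_mono) auto
    then show ?thesis by (simp add: power2_eq_square field_simps)
  qed
  ultimately show "(real (r j))\<^sup>2 / 16 \<le> real (card (pairs j))" unfolding card by simp
qed

text \<open>The returning points are exactly those in the target column: the Sidon property gives
  one inclusion, and going down from the target to the source column keeps the level of stage j,
  which gives the other.\<close>

lemma corr_delta:
  assumes j0: "1 \<le> j0" "j0 \<le> j" and p: "p \<in> pairs j"
  shows "corr j0 (delta j p) = 1 / real (r j)"
proof -
  have j: "1 \<le> j" using j0 by simp
  note P = pairsD[OF p]
  have lev: "levelset j (E j0)" by (rule levelset_mono[OF j0(1) levelset_E[OF j0(1)] j0(2)])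
  obtain L where L: "L \<subseteq> {0..<int (h j)}" "finite L" "E j0 = (\<Union>k\<in>L. lv j k)" using lev by (rule levelsetE)
  have db: "int (h j) < delta j p" "delta j p \<le> int (h (Suc j))"
    using delta_bounds[OF j p] h_pos[OF j] by auto
  have "E j0 \<inter> lv j0 (delta j p) = E j0 \<inter> col j (snd p)"
  proof (intro equalityI subsetI)
    fix y assume y: "y \<in> E j0 \<inter> lv j0 (delta j p)"
    then have yX: "y \<in> X" "tr (- delta j p) y \<in> E j0" using mem_lv[OF j0(1)] by auto
    have "tr (delta j p) (tr (- delta j p) y) \<in> col j (snd p)"
    proof (rule sidon_col[OF j db P(1,6,7,3)])
      show "tr (- delta j p) y \<in> tow j" using levelset_sub_tow[OF lev] yX by auto
      show "tr (delta j p) (tr (- delta j p) y) \<in> tow j"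
        using levelset_sub_tow[OF lev] y tr_cancel(1)[OF yX(1)] by auto
    qed (use h_pos[OF j] in \<open>auto simp: delta_def\<close>)
    then show "y \<in> E j0 \<inter> col j (snd p)" using y tr_cancel(1)[OF yX(1)] by simp
  next
    fix y assume y: "y \<in> E j0 \<inter> col j (snd p)"
    then obtain k where k: "k \<in> L" "y \<in> lv j k" unfolding L(3) by auto
    then have k0: "0 \<le> k" "k < int (h j)" using L(1) by auto
    have yX: "y \<in> X" using k(2) mem_lv[OF j] by blast
    have "y \<in> lv (Suc j) (k + int (pos j (snd p)))" using lv_col[OF j P(7,3) k0] y k by blast
    then have "tr (- delta j p) y \<in> lv (Suc j) (k + int (pos j (fst p)))"
      using mem_lv_shift[of "Suc j" y "- delta j p"] yX by (simp add: delta_def algebra_simps)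
    then have "tr (- delta j p) y \<in> lv j k" unfolding lv_split[OF j, of k] using P(1,6) by auto
    then have "tr (- delta j p) y \<in> E j0" unfolding L(3) using k(1) by blast
    then show "y \<in> E j0 \<inter> lv j0 (delta j p)" using y yX mem_lv[OF j0(1)] by auto
  qed
  then have "measure M (E j0 \<inter> lv j0 (delta j p)) = eps j0 / real (r j)"
    using levelset_col(1)[OF j P(7,3) lev] by simp
  then show ?thesis unfolding measure_E_inter[OF j0(1)] using eps_pos[OF j0(1)] cuts_pos[OF j]
    by (simp add: nonzero_divide_eq_eq nonzero_eq_divide_eq)
qed

text \<open>A positive correlation at \<open>m' - m\<close>, with \<open>m'\<close> of a later stage than \<open>m\<close>, forces the point
  to lie in the target column of \<open>m'\<close> and to return after \<open>m\<close> steps without leaving its column.\<close>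

lemma corr_delta_cross:
  assumes j0: "1 \<le> j0" "j0 \<le> j" and jk: "j < k" and p: "p \<in> pairs j" and q: "q \<in> pairs k"
  shows "corr j0 (delta k q - delta j p) \<le> corr j0 (delta k q) * corr j0 (delta j p)"
proof -
  have j: "1 \<le> j" and k: "1 \<le> k" "j0 \<le> k" using j0 jk by auto
  note Q = pairsD[OF q]
  have lev: "levelset k (E j0)" by (rule levelset_mono[OF j0(1) levelset_E[OF j0(1)] k(2)])
  obtain L where L: "L \<subseteq> {0..<int (h k)}" "finite L" "E j0 = (\<Union>l\<in>L. lv k l)" using lev by (rule levelsetE)
  define m where "m = delta j p"
  define D where "D = delta k q - m"
  have "h (Suc j) \<le> h k" using h_mono[of "Suc j" k] jk by simp
  then have m: "0 < m" "m < int (h k)" using delta_bounds[OF j p] h_pos[OF j] unfolding m_def by auto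
  have Db: "int (h k) < D" "D \<le> int (h (Suc k))"
    using delta_bounds[OF k(1) q] m unfolding D_def by auto
  \<comment> \<open>The levels of E j0 at stage k that are again levels of E j0 after m steps
    upwards.\<close>
  define K where "K = {l \<in> L. l + m \<in> L}"
  let ?Z = "\<Union>l\<in>K. lv k l"
  have KL: "K \<subseteq> {0..<int (h k)}" using L(1) unfolding K_def by auto
  have levZ: "levelset k ?Z" unfolding levelset_def using KL by blast
  have sub: "E j0 \<inter> lv j0 D \<subseteq> ?Z \<inter> col k (snd q)"
  proof
    fix y assume y: "y \<in> E j0 \<inter> lv j0 D"
    then have yX: "y \<in> X" "tr (- D) y \<in> E j0" using mem_lv[OF j0(1)] by auto
    let ?x = "tr (- D) y"
    have xX: "?x \<in> X" using yX(1) by (rule tr_space)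
    have xt: "?x \<in> tow k" using levelset_sub_tow[OF lev] yX(2) by auto
    have "tr D ?x \<in> col k (snd q)"
    proof (rule sidon_col[OF k(1) Db Q(1,6,7,3) _ xt])
      show "tr D ?x \<in> tow k" using levelset_sub_tow[OF lev] y tr_cancel(1)[OF yX(1)] by auto
      show "\<bar>D - (int (pos k (snd q)) - int (pos k (fst q)))\<bar> < int (h k)"
        using m unfolding D_def delta_def[of k] by simp
    qed
    then have yc: "y \<in> col k (snd q)" using tr_cancel(1)[OF yX(1)] by simp
    obtain l where l: "l \<in> L" "y \<in> lv k l" using y unfolding L(3) by auto
    then have l0: "0 \<le> l" "l < int (h k)" using L(1) by auto
    have "y \<in> lv (Suc k) (l + int (pos k (snd q)))" using lv_col[OF k(1) Q(7,3) l0] yc l by blast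
    then have x1: "?x \<in> lv (Suc k) (l + m + int (pos k (fst q)))"
      using mem_lv_shift[of "Suc k" y "- D"] yX(1) unfolding D_def delta_def[of k] by (simp add: algebra_simps)
    \<comment> \<open>If l + m reached h k, the preimage would sit in the spacer above the source
      column of q, which is at least h k high, although it belongs to the tower.\<close>
    have lm: "l + m < int (h k)"
    proof (rule ccontr)
      assume nlm: "\<not> l + m < int (h k)"
      obtain c where c: "1 \<le> c" "c \<le> r k" "?x \<in> col k c" using xt unfolding col_cover[OF k(1)] by auto
      then obtain l' where l': "0 \<le> l'" "l' < int (h k)" "?x \<in> lv (Suc k) (l' + int (pos k c))"
        using mem_col[OF k(1) c(1,2)] by auto
      have sp: "h k \<le> s k (fst q)" by (rule Q(5))
      have eq: "l + m + int (pos k (fst q)) = l' + int (pos k c)"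
      proof (rule lv_disjoint[OF _ x1 l'(3)])
        have "l + m + int (pos k (fst q)) < int (h (Suc k))"
          using pos_top[OF k(1) Q(1,6)] sp l0 m by linarith
        moreover have "l' + int (pos k c) < int (h (Suc k))" using pos_top[OF k(1) c(1,2)] l' by linarith
        ultimately show "\<bar>l + m + int (pos k (fst q)) - (l' + int (pos k c))\<bar> < int (h (Suc k))"
          using l0 l' m by linarith
      qed simp
      show False
      proof (cases c "fst q" rule: linorder_cases)
        case less
        then show False using pos_mono[OF c(1) less, of k] eq l' nlm by linarith
      next
        case equal
        then show False using eq l' nlm by simp
      next
        case greater
        then show False using pos_mono[OF Q(1) greater, of k] eq l' l0 m sp by linarith
      qed
    qed
    then have "?x \<in> lv k (l + m)" unfolding lv_split[OF k(1), of "l + m"] using x1 Q(1,6) by auto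
    then have "l + m \<in> L"
      using l0 m lm by (intro lv_levelset[OF k(1) L(3) L(1) yX(2)]) auto
    then have "y \<in> ?Z" using l unfolding K_def by blast
    with yc show "y \<in> ?Z \<inter> col k (snd q)" by simp
  qed
  have ZE: "?Z \<subseteq> E j0 \<inter> lv j0 (- m)"
  proof
    fix y assume "y \<in> ?Z"
    then obtain l where l: "l \<in> L" "l + m \<in> L" "y \<in> lv k l" unfolding K_def by auto
    have yX: "y \<in> X" using l(3) mem_lv[OF k(1)] by blast
    have "tr m y \<in> lv k (l + m)" using mem_lv_shift[OF k(1) yX, of m "l + m"] l(3) by simp
    then have "tr m y \<in> E j0" unfolding L(3) using l(2) by blast
    moreover have "y \<in> E j0" unfolding L(3) using l by blast
    ultimately show "y \<in> E j0 \<inter> lv j0 (- m)" using yX mem_lv[OF j0(1)] by auto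
  qed
  have "eps j0 * corr j0 D = measure M (E j0 \<inter> lv j0 D)" using measure_E_inter[OF j0(1)] by simp
  also have "\<dots> \<le> measure M (?Z \<inter> col k (snd q))"
  proof (rule measure_mono_fin[OF sub E_inter_sets[OF j0(1)]])
    have lz: "levelset (Suc k) (?Z \<inter> col k (snd q))" by (rule levelset_col(2)[OF k(1) Q(7,3) levZ])
    show "?Z \<inter> col k (snd q) \<in> sets M" "emeasure M (?Z \<inter> col k (snd q)) < \<infinity>"
      using levelset_sets[OF _ lz] levelset_finite[OF _ lz] by auto
  qed
  also have "\<dots> = measure M ?Z / real (r k)" by (rule levelset_col(1)[OF k(1) Q(7,3) levZ])
  also have "\<dots> \<le> measure M (E j0 \<inter> lv j0 (- m)) / real (r k)"
    by (intro divide_right_mono measure_mono_fin[OF ZE] levelset_sets[OF k(1) levZ] E_inter_sets[OF j0(1)]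
        E_inter_finite[OF j0(1)]) simp
  also have "\<dots> = eps j0 * (corr j0 (delta k q) * corr j0 m)"
    unfolding measure_E_inter[OF j0(1)] corr_delta[OF j0(1) k(2) q] corr_minus[OF j0(1)] by simp
  finally have "corr j0 D \<le> corr j0 (delta k q) * corr j0 m"
    by (rule mult_left_le_imp_le) (rule eps_pos[OF j0(1)])
  then show ?thesis unfolding D_def m_def .
qed

text \<open>The weights are proportional to the means r j ^ (- n) of the characters, the choice that
  minimises the Lebesgue norm for a given mean. With \<Theta> = sum of R j / r j ^ (2 n), the
  polynomial has mean 1, Lebesgue norm squared 2 pi / \<Theta> and mean square distance at most 2 /
  \<Theta> from 1.\<close>

lemma singular_power_ge2:
  assumes j0: "1 \<le> j0" and n: "2 \<le> n" and \<nu>: "finite_circle_measure \<nu>"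
    and coef: "\<And>m. (LINT z|\<nu>. z powi m) = complex_of_real (corr j0 m ^ n)"
    and large: "\<And>j. j0 \<le> j \<Longrightarrow> 4 \<le> r j \<and> 2 \<le> h j"
    and div: "\<And>b. \<exists>J. b \<le> (\<Sum>j\<in>{j0..<J}. 1 / real (r j) ^ (2 * n - 2))"
  shows "mutually_singular circle_lebesgue \<nu>"
proof (rule singular_by_polynomials[OF \<nu>])
  fix \<epsilon> :: real assume e: "0 < \<epsilon>"
  \<comment> \<open>8 exceeds 2 pi, so that both 2 / \<Theta> and 2 pi / \<Theta> end below
    \<epsilon>. The factor 16 in the next line is the loss in \<open>card_pairs\<close>.\<close>
  define b where "b = 8 / \<epsilon> + 1"
  obtain J where J: "16 * b \<le> (\<Sum>j\<in>{j0..<J}. 1 / real (r j) ^ (2 * n - 2))" using div by blast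
  have jge: "1 \<le> j" "4 \<le> r j" "2 \<le> h j" "j0 \<le> j" if "j \<in> {j0..<J}" for j using that j0 large[of j] by auto
  define R where "R j = real (card (pairs j))" for j
  define \<Theta> where "\<Theta> = (\<Sum>j\<in>{j0..<J}. R j / real (r j) ^ (2 * n))"
  have "(\<Sum>j\<in>{j0..<J}. (1 / real (r j) ^ (2 * n - 2)) / 16) \<le> \<Theta>"
    unfolding \<Theta>_def
  proof (rule sum_mono)
    fix j assume j: "j \<in> {j0..<J}"
    have rp: "0 < real (r j)" using jge[OF j] by simp
    have "2 * n = (2 * n - 2) + 2" using n by simp
    then have pw: "real (r j) ^ (2 * n) = real (r j) ^ (2 * n - 2) * (real (r j))\<^sup>2" by (metis power_add)
    have "(1 / real (r j) ^ (2 * n - 2)) / 16 = ((real (r j))\<^sup>2 / 16) / real (r j) ^ (2 * n)"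
      unfolding pw using rp by (simp add: field_simps)
    also have "\<dots> \<le> R j / real (r j) ^ (2 * n)"
      unfolding R_def using card_pairs(2)[of j] jge[OF j] by (intro divide_right_mono) auto
    finally show "(1 / real (r j) ^ (2 * n - 2)) / 16 \<le> R j / real (r j) ^ (2 * n)" .
  qed
  then have "(\<Sum>j\<in>{j0..<J}. 1 / real (r j) ^ (2 * n - 2)) / 16 \<le> \<Theta>" unfolding sum_divide_distrib .
  then have \<Theta>b: "b \<le> \<Theta>" using J by linarith
  have "0 < 8 / \<epsilon>" using e by simp
  then have \<Theta>: "8 / \<epsilon> < \<Theta>" "0 < \<Theta>" using \<Theta>b unfolding b_def by linarith+
  define K where "K = (SIGMA j:{j0..<J}. pairs j)"
  define a where "a x = 1 / (\<Theta> * real (r (fst x)) ^ n)" for x :: "nat \<times> nat \<times> nat"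
  define f where "f x = delta (fst x) (snd x)" for x :: "nat \<times> nat \<times> nat"
  have finK: "finite K" unfolding K_def by (intro finite_SigmaI finite_pairs) simp
  have KD: "fst x \<in> {j0..<J}" "snd x \<in> pairs (fst x)" if "x \<in> K" for x using that unfolding K_def by auto
  have a0: "0 \<le> a x" for x unfolding a_def using \<Theta> by simp
  have cf: "corr j0 (f x) = 1 / real (r (fst x))" if "x \<in> K" for x
    unfolding f_def using KD[OF that] jge[OF KD(1)[OF that]] by (intro corr_delta[OF j0]) auto
  have sumK: "(\<Sum>x\<in>K. g (fst x)) = (\<Sum>j\<in>{j0..<J}. R j * g j)" for g :: "nat \<Rightarrow> real"
  proof -
    have "(\<Sum>x\<in>K. g (fst x)) = (\<Sum>(j, p)\<in>K. g j)" by (intro sum.cong) auto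
    also have "\<dots> = (\<Sum>j\<in>{j0..<J}. \<Sum>p\<in>pairs j. g j)"
      unfolding K_def by (intro sum.Sigma[symmetric]) (auto simp: finite_pairs)
    finally show ?thesis by (simp add: R_def)
  qed
  have mean: "(\<Sum>x\<in>K. a x * corr j0 (f x) ^ n) = 1"
  proof -
    have "(\<Sum>x\<in>K. a x * corr j0 (f x) ^ n) = (\<Sum>x\<in>K. (1 / real (r (fst x)) ^ (2 * n)) / \<Theta>)"
    proof (intro sum.cong refl)
      fix x assume "x \<in> K"
      have pw: "real (r (fst x)) ^ (2 * n) = real (r (fst x)) ^ n * real (r (fst x)) ^ n"
        by (simp add: mult_2 power_add)
      show "a x * corr j0 (f x) ^ n = (1 / real (r (fst x)) ^ (2 * n)) / \<Theta>"
        unfolding pw cf[OF \<open>x \<in> K\<close>] a_def by (simp add: power_divide mult_ac)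
    qed
    also have "\<dots> = (\<Sum>j\<in>{j0..<J}. R j * ((1 / real (r j) ^ (2 * n)) / \<Theta>))" by (rule sumK)
    also have "\<dots> = (\<Sum>j\<in>{j0..<J}. R j / real (r j) ^ (2 * n)) / \<Theta>"
      unfolding sum_divide_distrib by (intro sum.cong) auto
    also have "\<dots> = \<Theta> / \<Theta>" unfolding \<Theta>_def[symmetric] ..
    finally show ?thesis using \<Theta> by simp
  qed
  have mean2: "(\<Sum>x\<in>K. (a x)\<^sup>2) = 1 / \<Theta>"
  proof -
    have "(\<Sum>x\<in>K. (a x)\<^sup>2) = (\<Sum>x\<in>K. (1 / real (r (fst x)) ^ (2 * n)) / \<Theta>\<^sup>2)"
      by (intro sum.cong refl) (simp add: a_def power_divide power_mult_distrib power_mult[symmetric] mult.commute)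
    also have "\<dots> = (\<Sum>j\<in>{j0..<J}. R j * ((1 / real (r j) ^ (2 * n)) / \<Theta>\<^sup>2))" by (rule sumK)
    also have "\<dots> = (\<Sum>j\<in>{j0..<J}. R j / real (r j) ^ (2 * n)) / \<Theta>\<^sup>2"
      unfolding sum_divide_distrib by (intro sum.cong) auto
    also have "\<dots> = \<Theta> / \<Theta>\<^sup>2" unfolding \<Theta>_def[symmetric] ..
    finally show ?thesis using \<Theta> by (simp add: power2_eq_square)
  qed
  define \<phi> where "\<phi> z = (\<Sum>x\<in>K. complex_of_real (a x) * z powi (f x))" for z
  have cont: "continuous_on circle \<phi>"
    unfolding \<phi>_def by (intro continuous_intros) auto
  have finj: "f x \<noteq> f y" if "x \<in> K" "y \<in> K" "x \<noteq> y" for x y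
  proof (cases "fst x = fst y")
    case True
    then have "snd x \<noteq> snd y" using that by (auto simp: prod_eq_iff)
    then show ?thesis
      using delta_separated[of "fst x" "snd x" "snd y"] KD[OF that(1)] KD[OF that(2)] jge[OF KD(1)[OF that(1)]] True
      unfolding f_def by auto
  next
    case False
    have *: "f x < f y" if "x \<in> K" "y \<in> K" "fst x < fst y" for x y
      using delta_bounds(2)[OF jge(1)[OF KD(1)[OF that(1)]] KD(2)[OF that(1)]]
        delta_bounds(1)[OF jge(1)[OF KD(1)[OF that(2)]] KD(2)[OF that(2)]]
        h_mono[of "Suc (fst x)" "fst y"] that(3) unfolding f_def by simp
    show ?thesis using *[of x y] *[of y x] that False by (cases "fst x" "fst y" rule: linorder_cases) auto
  qed
  have "complex_of_real (LINT z|circle_lebesgue. (norm (\<phi> z))\<^sup>2) =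
      (\<Sum>x\<in>K. \<Sum>y\<in>K. complex_of_real (a x) * cnj (complex_of_real (a y)) * (LINT z|circle_lebesgue. z powi (f x - f y)))"
    unfolding \<phi>_def by (rule circle_normsq_family[OF circle_lebesgue_base(1) finK])
  also have "\<dots> = (\<Sum>x\<in>K. \<Sum>y\<in>K. if y = x then complex_of_real (2 * pi * (a x)\<^sup>2) else 0)"
  proof (intro sum.cong refl)
    fix x y assume xy: "x \<in> K" "y \<in> K"
    show "complex_of_real (a x) * cnj (complex_of_real (a y)) * (LINT z|circle_lebesgue. z powi (f x - f y)) =
        (if y = x then complex_of_real (2 * pi * (a x)\<^sup>2) else 0)"
      unfolding circle_lebesgue_powi using finj[OF xy] by (cases "y = x") (auto simp: power2_eq_square)
  qed
  also have "\<dots> = complex_of_real (2 * pi * (\<Sum>x\<in>K. (a x)\<^sup>2))"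
    using finK by (simp add: sum_distrib_left)
  finally have lam: "(LINT z|circle_lebesgue. (norm (\<phi> z))\<^sup>2) = 2 * pi / \<Theta>"
    unfolding mean2 of_real_eq_iff by simp
  have norm2: "(LINT z|\<nu>. (norm (\<phi> z))\<^sup>2) = (\<Sum>x\<in>K. \<Sum>y\<in>K. a x * a y * corr j0 (f x - f y) ^ n)"
  proof -
    have "complex_of_real (LINT z|\<nu>. (norm (\<phi> z))\<^sup>2) =
        complex_of_real (\<Sum>x\<in>K. \<Sum>y\<in>K. a x * a y * corr j0 (f x - f y) ^ n)"
      unfolding \<phi>_def circle_normsq_family[OF \<nu> finK] coef by simp
    then show ?thesis by (simp only: of_real_eq_iff)
  qed
  \<comment> \<open>Three kinds of pairs: equal ones have correlation 1, distinct ones of one stage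
    at most 1 / r, and those of different stages at most the product of the means.\<close>
  have key: "a x * a y * corr j0 (f x - f y) ^ n \<le> (a x * corr j0 (f x) ^ n) * (a y * corr j0 (f y) ^ n) +
      (if x = y then (a x)\<^sup>2 else 0) + (if fst x = fst y then (a x)\<^sup>2 / real (r (fst x)) ^ n else 0)"
    if x: "x \<in> K" and y: "y \<in> K" for x y
  proof -
    have nn: "0 \<le> (a x * corr j0 (f x) ^ n) * (a y * corr j0 (f y) ^ n)"
      "0 \<le> (a x)\<^sup>2 / real (r (fst x)) ^ n"
      using a0 corr_nonneg by (auto intro!: mult_nonneg_nonneg)
    note X' = KD[OF x] jge[OF KD(1)[OF x]] and Y' = KD[OF y] jge[OF KD(1)[OF y]]
    consider "x = y" | "fst x = fst y" "x \<noteq> y" | "fst x \<noteq> fst y" by blast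
    then show ?thesis
    proof cases
      case 1
      then have "a x * a y * corr j0 (f x - f y) ^ n = (a x)\<^sup>2"
        by (simp add: corr_0[OF j0] power2_eq_square)
      then show ?thesis using nn 1 by simp
    next
      case 2
      then have ne: "snd x \<noteq> snd y" by (auto simp: prod_eq_iff)
      have far: "int (h (fst x)) < \<bar>f x - f y\<bar>"
        unfolding f_def using delta_separated[of "fst x" "snd x" "snd y"] ne X' Y' 2 by simp
      have "\<bar>f x - f y\<bar> \<le> int (h (Suc (fst x)))"
        using delta_bounds[of "fst x" "snd x"] delta_bounds[of "fst x" "snd y"] X' Y' 2 unfolding f_def by auto
      then have "corr j0 (f x - f y) \<le> 1 / real (r (fst x))"
        using X' by (intro corr_le_inverse[OF j0 _ far]) auto
      then have "corr j0 (f x - f y) ^ n \<le> (1 / real (r (fst x))) ^ n"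
        by (intro power_mono corr_nonneg)
      then have "(a x * a y) * corr j0 (f x - f y) ^ n \<le> (a x * a y) * (1 / real (r (fst x))) ^ n"
        using a0 by (intro mult_left_mono) auto
      also have "\<dots> = (a x)\<^sup>2 / real (r (fst x)) ^ n"
        using 2 by (simp add: a_def power2_eq_square power_divide)
      finally show ?thesis using nn 2 by simp
    next
      case 3
      have *: "corr j0 (f x - f y) \<le> corr j0 (f x) * corr j0 (f y)"
      proof (cases "fst y < fst x")
        case True
        then show ?thesis unfolding f_def using X' Y' by (intro corr_delta_cross[OF j0]) auto
      next
        case False
        then have "corr j0 (f y - f x) \<le> corr j0 (f y) * corr j0 (f x)"
          unfolding f_def using X' Y' 3 by (intro corr_delta_cross[OF j0]) auto
        then show ?thesis using corr_minus[OF j0, of "f y - f x"] by (simp add: mult.commute)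
      qed
      have "corr j0 (f x - f y) ^ n \<le> (corr j0 (f x) * corr j0 (f y)) ^ n"
        by (intro power_mono * corr_nonneg)
      then have "(a x * a y) * corr j0 (f x - f y) ^ n \<le> (a x * a y) * (corr j0 (f x) * corr j0 (f y)) ^ n"
        using a0 by (intro mult_left_mono) auto
      also have "\<dots> = (a x * corr j0 (f x) ^ n) * (a y * corr j0 (f y) ^ n)"
        by (simp add: power_mult_distrib mult_ac)
      finally show ?thesis using 3 by auto
    qed
  qed
  have "(LINT z|\<nu>. (norm (\<phi> z))\<^sup>2) \<le> (\<Sum>x\<in>K. \<Sum>y\<in>K. (a x * corr j0 (f x) ^ n) * (a y * corr j0 (f y) ^ n) +
      (if x = y then (a x)\<^sup>2 else 0) + (if fst x = fst y then (a x)\<^sup>2 / real (r (fst x)) ^ n else 0))"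
    unfolding norm2 by (intro sum_mono key)
  also have "\<dots> = (\<Sum>x\<in>K. a x * corr j0 (f x) ^ n) * (\<Sum>y\<in>K. a y * corr j0 (f y) ^ n) +
      (\<Sum>x\<in>K. (a x)\<^sup>2) + (\<Sum>x\<in>K. \<Sum>y\<in>K. if fst x = fst y then (a x)\<^sup>2 / real (r (fst x)) ^ n else 0)"
    unfolding sum.distrib sum_product using finK by simp
  also have "(\<Sum>x\<in>K. \<Sum>y\<in>K. if fst x = fst y then (a x)\<^sup>2 / real (r (fst x)) ^ n else 0) \<le> (\<Sum>x\<in>K. (a x)\<^sup>2)"
  proof (rule sum_mono)
    fix x assume x: "x \<in> K"
    note X' = KD[OF x] jge[OF KD(1)[OF x]]
    have "{y \<in> K. fst x = fst y} = {fst x} \<times> pairs (fst x)" using X'(1) unfolding K_def by auto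
    then have "(\<Sum>y\<in>K. if fst x = fst y then (a x)\<^sup>2 / real (r (fst x)) ^ n else 0) =
        R (fst x) * ((a x)\<^sup>2 / real (r (fst x)) ^ n)"
      using finK by (subst sum.inter_filter[symmetric]) (auto simp: card_cartesian_product R_def)
    also have "\<dots> \<le> real (r (fst x)) ^ n * ((a x)\<^sup>2 / real (r (fst x)) ^ n)"
    proof (rule mult_right_mono)
      have "R (fst x) \<le> (real (r (fst x)))\<^sup>2" unfolding R_def using X' by (intro card_pairs) auto
      \<comment> \<open>For n = 1 this fails: the pairs of one stage are too many for their
        correlations to be absorbed by the diagonal.\<close>
      also have "\<dots> \<le> real (r (fst x)) ^ n" using X' n by (intro power_increasing) auto
      finally show "R (fst x) \<le> real (r (fst x)) ^ n" .
    qed simp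
    also have "\<dots> = (a x)\<^sup>2" using X' by simp
    finally show "(\<Sum>y\<in>K. if fst x = fst y then (a x)\<^sup>2 / real (r (fst x)) ^ n else 0) \<le> (a x)\<^sup>2" .
  qed
  finally have n2: "(LINT z|\<nu>. (norm (\<phi> z))\<^sup>2) \<le> 1 + 2 / \<Theta>"
    unfolding mean mean2 by simp
  have phi_int: "(LINT z|\<nu>. \<phi> z) = 1"
  proof -
    have "(LINT z|\<nu>. \<phi> z) = (\<Sum>x\<in>K. LINT z|\<nu>. complex_of_real (a x) * z powi (f x))"
      unfolding \<phi>_def by (intro Bochner_Integration.integral_sum circle_integrable[OF \<nu>] continuous_intros) auto
    also have "\<dots> = complex_of_real (\<Sum>x\<in>K. a x * corr j0 (f x) ^ n)" by (simp add: coef)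
    finally show ?thesis unfolding mean by simp
  qed
  have tot: "(LINT z|\<nu>. (1::real)) = 1"
  proof -
    have "(LINT z|\<nu>. (1::complex)) = 1" using coef[of 0] corr_0[OF j0] by simp
    then show ?thesis by (simp add: scaleR_conv_of_real)
  qed
  have "(LINT z|\<nu>. (norm (\<phi> z - 1))\<^sup>2) = (LINT z|\<nu>. (norm (\<phi> z))\<^sup>2 - 2 * Re (\<phi> z) + 1)"
    unfolding cmod_power2
    by (intro Bochner_Integration.integral_cong refl) (simp add: power2_eq_square algebra_simps)
  also have "\<dots> = (LINT z|\<nu>. (norm (\<phi> z))\<^sup>2) - 2 * (LINT z|\<nu>. Re (\<phi> z)) + (LINT z|\<nu>. 1)"
    using circle_integrable[OF \<nu>, of "\<lambda>z. (norm (\<phi> z))\<^sup>2"] circle_integrable[OF \<nu>, of "\<lambda>z. Re (\<phi> z)"]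
      circle_integrable[OF \<nu>, of "\<lambda>z. 1::real"] cont
    by (simp add: continuous_intros)
  also have "(LINT z|\<nu>. Re (\<phi> z)) = 1"
    using integral_Re[OF circle_integrable[OF \<nu> cont]] phi_int by simp
  finally have nu: "(LINT z|\<nu>. (norm (\<phi> z - 1))\<^sup>2) \<le> 2 / \<Theta>" using n2 tot by simp
  have t: "2 / \<Theta> \<le> \<epsilon>" "2 * pi / \<Theta> \<le> \<epsilon>"
  proof -
    have "8 < \<epsilon> * \<Theta>" using \<Theta> e by (simp add: field_simps)
    then show "2 / \<Theta> \<le> \<epsilon>" "2 * pi / \<Theta> \<le> \<epsilon>" using \<Theta>(2) pi_less_4 by (auto simp: field_simps)
  qed
  show "\<exists>\<phi>::complex \<Rightarrow> complex. continuous_on circle \<phi> \<and> (LINT z|\<nu>. (norm (\<phi> z - 1))\<^sup>2) \<le> \<epsilon> \<and>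
      (LINT z|circle_lebesgue. (norm (\<phi> z))\<^sup>2) \<le> \<epsilon>"
    using cont nu lam t by (intro exI[of _ \<phi>]) auto
qed

end

section \<open>Sidon sums are not flat\<close>

lemma trig_lebesgue_orthogonal:
  assumes F: "trig d F" and m: "d < \<bar>m\<bar>"
  shows "(LINT z|circle_lebesgue. F z * z powi m) = 0"
proof -
  obtain c where c: "\<forall>z\<in>circle. F z = (\<Sum>k\<in>{-d..d}. c k * z powi k)" using F unfolding trig_def by auto
  note C = circle_lebesgue_base(1)
  have "(LINT z|circle_lebesgue. F z * z powi m) = (LINT z|circle_lebesgue. (\<Sum>k\<in>{-d..d}. c k * z powi (k + m)))"
  proof (rule Bochner_Integration.integral_cong)
    fix z assume "z \<in> space circle_lebesgue"
    then have z: "z \<in> circle" by (simp add: finite_circle_measureD[OF C])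
    show "F z * z powi m = (\<Sum>k\<in>{-d..d}. c k * z powi (k + m))"
      unfolding bspec[OF c z] sum_distrib_right
      by (intro sum.cong refl) (simp add: powi_circle_mult[OF z, symmetric])
  qed simp
  also have "\<dots> = (\<Sum>k\<in>{-d..d}. LINT z|circle_lebesgue. c k * z powi (k + m))"
    by (intro Bochner_Integration.integral_sum circle_integrable[OF C] continuous_intros) auto
  also have "\<dots> = 0"
    using m by (intro sum.neutral) (auto simp: circle_lebesgue_powi)
  finally show ?thesis .
qed

lemma circle_lebesgue_const: "(LINT z|circle_lebesgue. (c::real)) = 2 * pi * c"
proof -
  have "complex_of_real (measure circle_lebesgue (space circle_lebesgue)) = complex_of_real (2 * pi)"
    using circle_lebesgue_powi[of 0] by (simp add: scaleR_conv_of_real)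
  then have "measure circle_lebesgue (space circle_lebesgue) = 2 * pi" by (simp only: of_real_eq_iff)
  then show ?thesis by simp
qed

text \<open>The sum over the two pairings of four indices in Wick's formula. Four equal indices
  belong to both pairings but are counted once, hence S - {i} in the second sum.\<close>

lemma delta_sum4:
  fixes A :: "nat \<Rightarrow> nat \<Rightarrow> complex"
  assumes fin: "finite S"
  shows "(\<Sum>i\<in>S. \<Sum>k\<in>S. \<Sum>l\<in>S. \<Sum>q\<in>S. if i = k \<and> q = l \<or> i = l \<and> q = k then A i k * cnj (A l q) else 0) =
    complex_of_real ((norm (\<Sum>i\<in>S. A i i))\<^sup>2 + (\<Sum>i\<in>S. \<Sum>k\<in>S - {i}. (norm (A i k))\<^sup>2))"
proof -
  have "(\<Sum>i\<in>S. \<Sum>k\<in>S. \<Sum>l\<in>S. \<Sum>q\<in>S. if i = k \<and> q = l \<or> i = l \<and> q = k then A i k * cnj (A l q) else 0) =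
      (\<Sum>i\<in>S. \<Sum>k\<in>S. (if k = i then A i i * (\<Sum>l\<in>S. cnj (A l l)) else A i k * cnj (A i k)))"
  proof (intro sum.cong refl)
    fix i k assume ik: "i \<in> S" "k \<in> S"
    show "(\<Sum>l\<in>S. \<Sum>q\<in>S. if i = k \<and> q = l \<or> i = l \<and> q = k then A i k * cnj (A l q) else 0) =
        (if k = i then A i i * (\<Sum>l\<in>S. cnj (A l l)) else A i k * cnj (A i k))"
    proof (cases "k = i")
      case True
      have "(\<Sum>q\<in>S. if i = k \<and> q = l \<or> i = l \<and> q = k then A i k * cnj (A l q) else 0) = A i i * cnj (A l l)"
        if "l \<in> S" for l
      proof -
        have "(\<Sum>q\<in>S. if i = k \<and> q = l \<or> i = l \<and> q = k then A i k * cnj (A l q) else 0) =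
            (\<Sum>q\<in>S. if q = l then A i i * cnj (A l q) else 0)"
          using True by (intro sum.cong) auto
        then show ?thesis using fin that by simp
      qed
      then show ?thesis using True by (simp add: sum_distrib_left)
    next
      case False
      have "(\<Sum>l\<in>S. \<Sum>q\<in>S. if i = k \<and> q = l \<or> i = l \<and> q = k then A i k * cnj (A l q) else 0) =
          (\<Sum>l\<in>S. if l = i then (\<Sum>q\<in>S. if q = k then A i k * cnj (A l q) else 0) else 0)"
        using False by (intro sum.cong) (auto intro!: sum.neutral)
      then show ?thesis using fin ik False by simp
    qed
  qed
  also have "\<dots> = (\<Sum>i\<in>S. A i i * (\<Sum>l\<in>S. cnj (A l l)) + (\<Sum>k\<in>S - {i}. A i k * cnj (A i k)))"
  proof (intro sum.cong refl)
    fix i assume i: "i \<in> S"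
    show "(\<Sum>k\<in>S. if k = i then A i i * (\<Sum>l\<in>S. cnj (A l l)) else A i k * cnj (A i k)) =
        A i i * (\<Sum>l\<in>S. cnj (A l l)) + (\<Sum>k\<in>S - {i}. A i k * cnj (A i k))"
      using sum.remove[OF fin i, of "\<lambda>k. if k = i then A i i * (\<Sum>l\<in>S. cnj (A l l)) else A i k * cnj (A i k)"] by simp
  qed
  also have "\<dots> = (\<Sum>i\<in>S. A i i) * cnj (\<Sum>l\<in>S. A l l) + (\<Sum>i\<in>S. \<Sum>k\<in>S - {i}. A i k * cnj (A i k))"
    by (simp add: sum.distrib sum_distrib_right)
  finally show ?thesis by (simp only: complex_norm_square[symmetric] of_real_add of_real_sum)
qed

text \<open>For |p| = |q| = 1 the first two terms on the right give equality: with x = 2 - 2 \<rho>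
  one has 4 x = 4 (1 - \<rho>^2) + x^2. The other terms pay for the deviation of the moduli from
  1.\<close>

lemma unimodular_defect:
  fixes p q :: complex
  shows "4 * (norm (p - q))\<^sup>2 \<le> (norm (p * cnj q - cnj p * q))\<^sup>2 + (norm (p - q)) ^ 4 +
    4 * (norm p - norm q)\<^sup>2 + 16 * (\<bar>1 - norm p\<bar> + \<bar>1 - norm q\<bar>)"
proof -
  define a b \<rho> x where "a = norm p" and "b = norm q" and "\<rho> = Re (p * cnj q)" and "x = (norm (p - q))\<^sup>2"
  have a0: "0 \<le> a" "0 \<le> b" unfolding a_def b_def by auto
  have x: "x = a\<^sup>2 + b\<^sup>2 - 2 * \<rho>"
    unfolding x_def a_def b_def \<rho>_def cmod_power2 by (simp add: power2_eq_square algebra_simps)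
  have \<rho>: "\<rho> \<le> a * b"
    unfolding \<rho>_def a_def b_def using complex_Re_le_cmod[of "p * cnj q"] by (simp add: norm_mult)
  have \<rho>2: "- (a * b) \<le> \<rho>"
    unfolding \<rho>_def a_def b_def using abs_Re_le_cmod[of "p * cnj q"] by (simp add: norm_mult)
  have im: "(norm (p * cnj q - cnj p * q))\<^sup>2 = 4 * (a\<^sup>2 * b\<^sup>2 - \<rho>\<^sup>2)"
  proof -
    have "a\<^sup>2 * b\<^sup>2 = (Re (p * cnj q))\<^sup>2 + (Im (p * cnj q))\<^sup>2"
      unfolding a_def b_def cmod_power2[symmetric] by (simp add: norm_mult power_mult_distrib)
    moreover have "(norm (p * cnj q - cnj p * q))\<^sup>2 = 4 * (Im (p * cnj q))\<^sup>2"
      unfolding cmod_power2 by (simp add: power2_eq_square algebra_simps)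
    ultimately show ?thesis unfolding \<rho>_def by simp
  qed
  \<comment> \<open>The part of |p - q|^2 that remains after removing (a - b)^2, that is, the
    contribution of the angle between p and q.\<close>
  define y where "y = 2 * (a * b - \<rho>)"
  have y: "0 \<le> y" "x = y + (a - b)\<^sup>2" "y \<le> 4 * (a * b)"
    using \<rho> \<rho>2 unfolding y_def x by (auto simp: power2_eq_square algebra_simps)
  have eq: "4 * (a\<^sup>2 * b\<^sup>2 - \<rho>\<^sup>2) + x\<^sup>2 = 2 * y * (a\<^sup>2 + b\<^sup>2) + (a - b) ^ 4"
    unfolding x y_def by (simp add: power2_eq_square power4_eq_xxxx algebra_simps)
  \<comment> \<open>Only a^2 + b^2 < 2 costs something. Then y \<le> 4, and 1 - c^2 \<le> 2 |1 - c|
    for c = a and c = b; this makes 2 * 4 * 2 = 16.\<close>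
  have "4 * y \<le> 2 * y * (a\<^sup>2 + b\<^sup>2) + 16 * (\<bar>1 - a\<bar> + \<bar>1 - b\<bar>)"
  proof (cases "2 \<le> a\<^sup>2 + b\<^sup>2")
    case True
    then have "2 * y * 2 \<le> 2 * y * (a\<^sup>2 + b\<^sup>2)" using y by (intro mult_left_mono) auto
    then have "4 * y \<le> 2 * y * (a\<^sup>2 + b\<^sup>2)" by simp
    also have "\<dots> \<le> 2 * y * (a\<^sup>2 + b\<^sup>2) + 16 * (\<bar>1 - a\<bar> + \<bar>1 - b\<bar>)" by simp
    finally show ?thesis .
  next
    case False
    have "2 * (a * b) \<le> a\<^sup>2 + b\<^sup>2" using sum_squares_bound[of a b] by simp
    then have y4: "y \<le> 4" using y False by linarith
    have one: "1 - c\<^sup>2 \<le> 2 * \<bar>1 - c\<bar>" if "0 \<le> c" for c :: real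
    proof (cases "c \<le> 1")
      case True
      have "1 - c\<^sup>2 = (1 - c) * (1 + c)" by (simp add: power2_eq_square algebra_simps)
      also have "\<dots> \<le> (1 - c) * 2" using True that by (intro mult_left_mono) auto
      finally show ?thesis using True by simp
    next
      case False
      then have "1 \<le> c\<^sup>2" by (simp add: one_le_power)
      then have "1 - c\<^sup>2 \<le> 0" by simp
      also have "0 \<le> 2 * \<bar>1 - c\<bar>" by simp
      finally show ?thesis .
    qed
    have "2 * y * (2 - (a\<^sup>2 + b\<^sup>2)) \<le> 8 * (2 - (a\<^sup>2 + b\<^sup>2))"
      using y4 False by (intro mult_right_mono) auto
    also have "\<dots> \<le> 16 * (\<bar>1 - a\<bar> + \<bar>1 - b\<bar>)" using one[OF a0(1)] one[OF a0(2)] by simp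
    finally show ?thesis by (simp add: algebra_simps)
  qed
  moreover have "0 \<le> (a - b) ^ 4" by simp
  moreover have "x\<^sup>2 = (norm (p - q)) ^ 4" unfolding x_def by (simp add: power_mult[symmetric])
  ultimately show ?thesis
    unfolding im using eq y(2) unfolding x_def[symmetric] a_def[symmetric] b_def[symmetric] by linarith
qed

lemma circle_abs_le_sqrt:
  assumes f: "continuous_on circle (f :: complex \<Rightarrow> real)" "\<And>z. z \<in> circle \<Longrightarrow> 0 \<le> f z"
    and g: "continuous_on circle (g :: complex \<Rightarrow> real)"
  shows "(LINT z|circle_lebesgue. f z * \<bar>g z\<bar>) \<le> sqrt (LINT z|circle_lebesgue. f z) * sqrt (LINT z|circle_lebesgue. f z * (g z)\<^sup>2)"
proof -
  note C = circle_lebesgue_base(1) and sp = finite_circle_measureD[OF circle_lebesgue_base(1)]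
  let ?u = "\<lambda>z. complex_of_real (sqrt (f z))" and ?v = "\<lambda>z. complex_of_real (sqrt (f z) * \<bar>g z\<bar>)"
  have cu: "continuous_on circle ?u" "continuous_on circle ?v" by (intro continuous_intros f g)+
  have L: "?u \<in> L2 circle_lebesgue" "?v \<in> L2 circle_lebesgue"
    unfolding L2_def by (auto intro!: circle_measurable[OF C] circle_integrable[OF C] continuous_intros f g)
  have "cmod (L2_inner circle_lebesgue ?u ?v) \<le> sqrt (sqnorm circle_lebesgue ?u) * sqrt (sqnorm circle_lebesgue ?v)"
    by (rule L2_Cauchy_Schwarz[OF L])
  moreover have "L2_inner circle_lebesgue ?u ?v = complex_of_real (LINT z|circle_lebesgue. f z * \<bar>g z\<bar>)"
    unfolding L2_inner_def integral_complex_of_real[symmetric]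
    by (rule Bochner_Integration.integral_cong) (auto simp: sp f(2) of_real_mult[symmetric] mult.assoc[symmetric] simp del: of_real_mult)
  moreover have "sqnorm circle_lebesgue ?u = (LINT z|circle_lebesgue. f z)"
    unfolding sqnorm_def by (rule Bochner_Integration.integral_cong) (auto simp: sp f(2))
  moreover have "sqnorm circle_lebesgue ?v = (LINT z|circle_lebesgue. f z * (g z)\<^sup>2)"
    unfolding sqnorm_def by (rule Bochner_Integration.integral_cong) (auto simp: sp f(2) norm_mult power_mult_distrib)
  ultimately show ?thesis by simp
qed

section \<open>Second and fourth moments of Sidon sums\<close>

context sidon_construction
begin

text \<open>General coefficients, because a rotation of the variable and a phase factor are absorbed
  in them.\<close>

definition polyn :: "nat \<Rightarrow> (nat \<Rightarrow> complex) \<Rightarrow> complex \<Rightarrow> complex" where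
  "polyn j x z = (\<Sum>i\<in>{1..r j}. x i * z powi int (pos j i))"

lemma polyn_continuous: "continuous_on circle (polyn j x)"
  unfolding polyn_def by (intro continuous_intros) auto

lemma polyn_product:
  assumes z: "z \<in> circle"
  shows "polyn j x z * cnj (polyn j y z) =
    (\<Sum>i\<in>{1..r j}. \<Sum>k\<in>{1..r j}. (x i * cnj (y k)) * z powi (int (pos j i) - int (pos j k)))"
  using powi_circle_mult[OF z, of "int (pos j i)" "- int (pos j k)" for i k]
  unfolding polyn_def cnj_sum sum_product complex_cnj_mult cnj_powi_circle[OF z]
  by (intro sum.cong refl) (simp add: mult_ac)

text \<open>Distinct positions are at least h j apart, so a factor F of degree below h j is
  orthogonal to everything off the diagonal.\<close>

lemma sidon_wick_linear:
  assumes j: "1 \<le> j" and F: "trig d F" "d < int (h j)"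
  shows "(LINT z|circle_lebesgue. F z * (\<Sum>i\<in>{1..r j}. \<Sum>k\<in>{1..r j}. A i k * z powi (int (pos j i) - int (pos j k)))) =
    (\<Sum>i\<in>{1..r j}. A i i) * (LINT z|circle_lebesgue. F z)"
proof -
  note C = circle_lebesgue_base(1)
  have cF: "continuous_on circle F" by (rule trig_continuous[OF F(1)])
  have i: "integrable circle_lebesgue (\<lambda>z. A i k * (F z * z powi (int (pos j i) - int (pos j k))))" for i k
    by (intro circle_integrable[OF C] continuous_intros cF) auto
  have "(LINT z|circle_lebesgue. F z * (\<Sum>i\<in>{1..r j}. \<Sum>k\<in>{1..r j}. A i k * z powi (int (pos j i) - int (pos j k)))) =
      (LINT z|circle_lebesgue. (\<Sum>i\<in>{1..r j}. \<Sum>k\<in>{1..r j}. A i k * (F z * z powi (int (pos j i) - int (pos j k)))))"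
    by (intro Bochner_Integration.integral_cong refl) (simp add: sum_distrib_left mult_ac)
  also have "\<dots> = (\<Sum>i\<in>{1..r j}. \<Sum>k\<in>{1..r j}. LINT z|circle_lebesgue. A i k * (F z * z powi (int (pos j i) - int (pos j k))))"
    by (subst Bochner_Integration.integral_sum, intro Bochner_Integration.integrable_sum i)
       (intro sum.cong refl Bochner_Integration.integral_sum i)
  also have "\<dots> = (\<Sum>i\<in>{1..r j}. \<Sum>k\<in>{1..r j}. if k = i then A i i * (LINT z|circle_lebesgue. F z) else 0)"
  proof (intro sum.cong refl)
    fix i k assume ik: "i \<in> {1..r j}" "k \<in> {1..r j}"
    show "(LINT z|circle_lebesgue. A i k * (F z * z powi (int (pos j i) - int (pos j k)))) =
        (if k = i then A i i * (LINT z|circle_lebesgue. F z) else 0)"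
    proof (cases "k = i")
      case False
      then have "int (h j) \<le> \<bar>int (pos j i) - int (pos j k)\<bar>"
        using pos_close[of i k j] ik by force
      then show ?thesis using False F trig_lebesgue_orthogonal[OF F(1)] by simp
    qed simp
  qed
  also have "\<dots> = (\<Sum>i\<in>{1..r j}. A i i) * (LINT z|circle_lebesgue. F z)"
    by (simp add: sum_distrib_right)
  finally show ?thesis .
qed

text \<open>By \<open>sidon_quadruple\<close> only the two trivial pairings have a frequency below h
  j, and for these the frequency is 0.\<close>

lemma sidon_wick_square:
  assumes j: "1 \<le> j" "2 \<le> h j" and f: "trig d (\<lambda>z. complex_of_real (f z))" "d < int (h j)"
  shows "(LINT z|circle_lebesgue. f z * (norm (\<Sum>i\<in>{1..r j}. \<Sum>k\<in>{1..r j}. A i k * z powi (int (pos j i) - int (pos j k))))\<^sup>2) =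
    ((norm (\<Sum>i\<in>{1..r j}. A i i))\<^sup>2 + (\<Sum>i\<in>{1..r j}. \<Sum>k\<in>{1..r j} - {i}. (norm (A i k))\<^sup>2)) * (LINT z|circle_lebesgue. f z)"
proof -
  note C = circle_lebesgue_base(1)
  let ?S = "{1..r j}"
  let ?p = "\<lambda>i. int (pos j i)"
  let ?F = "\<lambda>z. complex_of_real (f z)"
  let ?I = "LINT z|circle_lebesgue. ?F z"
  have cF: "continuous_on circle ?F" by (rule trig_continuous[OF f(1)])
  let ?t = "\<lambda>i k l q z. (A i k * cnj (A l q)) * (?F z * z powi (?p i + ?p q - ?p k - ?p l))"
  have int: "integrable circle_lebesgue (?t i k l q)" for i k l q
    by (intro circle_integrable[OF C] continuous_intros cF) auto
  have "complex_of_real (LINT z|circle_lebesgue. f z * (norm (\<Sum>i\<in>?S. \<Sum>k\<in>?S. A i k * z powi (?p i - ?p k)))\<^sup>2) =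
      (LINT z|circle_lebesgue. complex_of_real (f z * (norm (\<Sum>i\<in>?S. \<Sum>k\<in>?S. A i k * z powi (?p i - ?p k)))\<^sup>2))"
    by (rule integral_complex_of_real[symmetric])
  also have "\<dots> = (LINT z|circle_lebesgue. (\<Sum>i\<in>?S. \<Sum>k\<in>?S. \<Sum>l\<in>?S. \<Sum>q\<in>?S. ?t i k l q z))"
  proof (rule Bochner_Integration.integral_cong)
    fix z assume "z \<in> space circle_lebesgue"
    then have z: "z \<in> circle" by (simp add: finite_circle_measureD[OF C])
    have e: "z powi (?p i + ?p q - ?p k - ?p l) = z powi (?p i - ?p k) * z powi (?p q - ?p l)" for i k l q
      unfolding powi_circle_mult[OF z] by (simp add: algebra_simps)
    have c: "cnj (z powi (?p l - ?p q)) = z powi (?p q - ?p l)" for l q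
      using cnj_powi_circle[OF z, of "?p l - ?p q"] by simp
    have "complex_of_real (f z * (norm (\<Sum>i\<in>?S. \<Sum>k\<in>?S. A i k * z powi (?p i - ?p k)))\<^sup>2) =
        ?F z * ((\<Sum>i\<in>?S. \<Sum>k\<in>?S. A i k * z powi (?p i - ?p k)) * (\<Sum>l\<in>?S. \<Sum>q\<in>?S. cnj (A l q) * z powi (?p q - ?p l)))"
      unfolding of_real_mult complex_norm_square cnj_sum complex_cnj_mult c ..
    also have "\<dots> = (\<Sum>i\<in>?S. \<Sum>k\<in>?S. \<Sum>l\<in>?S. \<Sum>q\<in>?S. ?t i k l q z)"
      unfolding sum_distrib_right unfolding sum_distrib_left e by (simp add: mult_ac)
    finally show "complex_of_real (f z * (norm (\<Sum>i\<in>?S. \<Sum>k\<in>?S. A i k * z powi (?p i - ?p k)))\<^sup>2) =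
        (\<Sum>i\<in>?S. \<Sum>k\<in>?S. \<Sum>l\<in>?S. \<Sum>q\<in>?S. ?t i k l q z)" .
  qed simp
  also have "\<dots> = (\<Sum>i\<in>?S. \<Sum>k\<in>?S. \<Sum>l\<in>?S. \<Sum>q\<in>?S. LINT z|circle_lebesgue. ?t i k l q z)"
    by (subst Bochner_Integration.integral_sum, intro Bochner_Integration.integrable_sum int, intro sum.cong refl)+
  also have "\<dots> = (\<Sum>i\<in>?S. \<Sum>k\<in>?S. \<Sum>l\<in>?S. \<Sum>q\<in>?S. (if i = k \<and> q = l \<or> i = l \<and> q = k then A i k * cnj (A l q) else 0) * ?I)"
  proof (intro sum.cong refl)
    fix i k l q assume S: "i \<in> ?S" "k \<in> ?S" "l \<in> ?S" "q \<in> ?S"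
    show "(LINT z|circle_lebesgue. ?t i k l q z) = (if i = k \<and> q = l \<or> i = l \<and> q = k then A i k * cnj (A l q) else 0) * ?I"
    proof (cases "i = k \<and> q = l \<or> i = l \<and> q = k")
      case True
      then have "?p i + ?p q - ?p k - ?p l = 0" by auto
      then show ?thesis using True by simp
    next
      case False
      have "int (h j) \<le> \<bar>?p i + ?p q - ?p k - ?p l\<bar>"
        using sidon_quadruple[OF j, of i q k l] S False by force
      then have z: "(LINT z|circle_lebesgue. ?F z * z powi (?p i + ?p q - ?p k - ?p l)) = 0"
        using f(2) by (intro trig_lebesgue_orthogonal[OF f(1)]) simp
      show ?thesis unfolding if_not_P[OF False] integral_mult_right_zero z by simp
    qed
  qed
  also have "\<dots> = (\<Sum>i\<in>?S. \<Sum>k\<in>?S. \<Sum>l\<in>?S. \<Sum>q\<in>?S. (if i = k \<and> q = l \<or> i = l \<and> q = k then A i k * cnj (A l q) else 0)) * ?I"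
    by (simp only: sum_distrib_right)
  also have "\<dots> = complex_of_real (((norm (\<Sum>i\<in>?S. A i i))\<^sup>2 + (\<Sum>i\<in>?S. \<Sum>k\<in>?S - {i}. (norm (A i k))\<^sup>2)) * (LINT z|circle_lebesgue. f z))"
    by (subst delta_sum4) (simp_all only: finite_atLeastAtMost of_real_mult integral_complex_of_real)
  finally show ?thesis by (simp only: of_real_eq_iff)
qed

lemma polyn_norm_integral:
  assumes j: "1 \<le> j" and f: "trig d (\<lambda>z. complex_of_real (f z))" "d < int (h j)"
  shows "(LINT z|circle_lebesgue. f z * (norm (polyn j x z))\<^sup>2) = (\<Sum>i\<in>{1..r j}. (norm (x i))\<^sup>2) * (LINT z|circle_lebesgue. f z)"
proof -
  have "complex_of_real (LINT z|circle_lebesgue. f z * (norm (polyn j x z))\<^sup>2) =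
      (LINT z|circle_lebesgue. complex_of_real (f z * (norm (polyn j x z))\<^sup>2))"
    by (rule integral_complex_of_real[symmetric])
  also have "\<dots> = (LINT z|circle_lebesgue. complex_of_real (f z) *
      (\<Sum>i\<in>{1..r j}. \<Sum>k\<in>{1..r j}. (x i * cnj (x k)) * z powi (int (pos j i) - int (pos j k))))"
  proof (rule Bochner_Integration.integral_cong)
    fix z assume "z \<in> space circle_lebesgue"
    then have z: "z \<in> circle" by (simp add: finite_circle_measureD[OF circle_lebesgue_base(1)])
    show "complex_of_real (f z * (norm (polyn j x z))\<^sup>2) = complex_of_real (f z) *
      (\<Sum>i\<in>{1..r j}. \<Sum>k\<in>{1..r j}. (x i * cnj (x k)) * z powi (int (pos j i) - int (pos j k)))"
      unfolding polyn_product[OF z, symmetric] of_real_mult complex_norm_square ..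
  qed simp
  also have "\<dots> = (\<Sum>i\<in>{1..r j}. x i * cnj (x i)) * (LINT z|circle_lebesgue. complex_of_real (f z))"
    by (rule sidon_wick_linear[OF j f])
  also have "\<dots> = complex_of_real ((\<Sum>i\<in>{1..r j}. (norm (x i))\<^sup>2) * (LINT z|circle_lebesgue. f z))"
    by (simp only: complex_norm_square[symmetric] of_real_sum of_real_mult integral_complex_of_real)
  finally show ?thesis by (simp only: of_real_eq_iff)
qed

text \<open>Flatness of the sum at two nearby points contradicts its second and fourth moments, which
  are those of a Gaussian vector: for unimodular numbers \<open>4 \<bar>p - q\<bar>\<^sup>2 = 4 (Im (p cnj q))\<^sup>2 + \<bar>p - q\<bar>\<^sup>4\<close>,
  while for a Gaussian vector with correlation \<open>2/3\<close> the left-hand side has mean \<open>8/3\<close> and the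
  right-hand side mean \<open>10/9 + 8/9\<close>.\<close>

lemma sidon_not_flat:
  assumes j: "1 \<le> j" "2 \<le> h j" and f: "trig d (\<lambda>z. complex_of_real (f z))" "d < int (h j)"
    and nonneg: "\<And>z. z \<in> circle \<Longrightarrow> 0 \<le> f z" and I: "0 < (LINT z|circle_lebesgue. f z)"
    and x: "(\<Sum>i\<in>{1..r j}. (norm (x i))\<^sup>2) = 1" and y: "(\<Sum>i\<in>{1..r j}. (norm (y i))\<^sup>2) = 1"
    and xy: "(\<Sum>i\<in>{1..r j}. x i * cnj (y i)) = 2 / 3"
  shows "(LINT z|circle_lebesgue. f z * norm (polyn j x z)) \<le> (1 - 1 / 5000) * (LINT z|circle_lebesgue. f z) \<or>
    (LINT z|circle_lebesgue. f z * norm (polyn j y z)) \<le> (1 - 1 / 5000) * (LINT z|circle_lebesgue. f z)"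
proof (rule ccontr)
  assume flat: "\<not> ?thesis"
  define avg where "avg g = (LINT z|circle_lebesgue. f z * g z)" for g :: "complex \<Rightarrow> real"
  define I where "I = (LINT z|circle_lebesgue. f z)"
  note C = circle_lebesgue_base(1) and sp = finite_circle_measureD[OF circle_lebesgue_base(1)]
  let ?S = "{1..r j}"
  define p q where "p = polyn j x" and "q = polyn j y"
  have I0: "0 < I" using I unfolding I_def .
  have big: "(1 - 1 / 5000) * I \<le> avg (\<lambda>z. norm (p z))" "(1 - 1 / 5000) * I \<le> avg (\<lambda>z. norm (q z))"
    using flat unfolding avg_def I_def p_def q_def by auto
  have cf: "continuous_on circle f"
    using trig_continuous[OF f(1)] by (auto dest: continuous_on_Re)
  have cp: "continuous_on circle p" "continuous_on circle q" unfolding p_def q_def by (rule polyn_continuous)+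
  have itg: "integrable circle_lebesgue (\<lambda>z. f z * g z)" if "continuous_on circle g" for g :: "complex \<Rightarrow> real"
    by (intro circle_integrable[OF C] continuous_intros cf that)
  have avg_mono: "avg g \<le> avg g'" if "continuous_on circle g" "continuous_on circle g'" "\<And>z. z \<in> circle \<Longrightarrow> g z \<le> g' z" for g g'
    unfolding avg_def using that by (intro integral_mono itg) (auto simp: sp nonneg intro!: mult_left_mono)
  have avg_add: "avg (\<lambda>z. g z + g' z) = avg g + avg g'" if "continuous_on circle g" "continuous_on circle g'" for g g'
    unfolding avg_def using itg[OF that(1)] itg[OF that(2)] by (simp add: distrib_left)
  have avg_diff: "avg (\<lambda>z. g z - g' z) = avg g - avg g'" if "continuous_on circle g" "continuous_on circle g'" for g g'
    unfolding avg_def using itg[OF that(1)] itg[OF that(2)] by (simp add: right_diff_distrib)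
  have avg_cmult: "avg (\<lambda>z. c * g z) = c * avg g" for c g
    unfolding avg_def by (simp add: mult.left_commute)
  have avg_1: "avg (\<lambda>z. 1) = I" unfolding avg_def I_def by simp
  have pq: "p z - q z = polyn j (\<lambda>i. x i - y i) z" for z
    unfolding p_def q_def polyn_def by (simp add: sum_subtractf left_diff_distrib)
  have n2: "avg (\<lambda>z. (norm (p z))\<^sup>2) = I" "avg (\<lambda>z. (norm (q z))\<^sup>2) = I"
    unfolding avg_def I_def p_def q_def using polyn_norm_integral[OF j(1) f] x y by auto
  have xmy: "(\<Sum>i\<in>?S. (norm (x i - y i))\<^sup>2) = 2 / 3"
  proof -
    have "(\<Sum>i\<in>?S. (norm (x i - y i))\<^sup>2) = (\<Sum>i\<in>?S. (norm (x i))\<^sup>2 + (norm (y i))\<^sup>2 - 2 * Re (x i * cnj (y i)))"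
      unfolding cmod_power2 by (intro sum.cong refl) (simp add: power2_eq_square algebra_simps)
    also have "\<dots> = 2 - 2 * Re (\<Sum>i\<in>?S. x i * cnj (y i))"
      using x y by (simp add: sum.distrib sum_subtractf sum_distrib_left)
    finally show ?thesis unfolding xy by simp
  qed
  have m2: "avg (\<lambda>z. (norm (p z - q z))\<^sup>2) = 2 / 3 * I"
    unfolding avg_def I_def pq using polyn_norm_integral[OF j(1) f, of "\<lambda>i. x i - y i"] xmy by simp
  have m4: "avg (\<lambda>z. (norm (p z - q z)) ^ 4) \<le> 8 / 9 * I"
  proof -
    let ?w = "\<lambda>i. x i - y i"
    have "avg (\<lambda>z. (norm (p z - q z)) ^ 4) = (LINT z|circle_lebesgue. f z *
        (norm (\<Sum>i\<in>?S. \<Sum>k\<in>?S. (?w i * cnj (?w k)) * z powi (int (pos j i) - int (pos j k))))\<^sup>2)"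
      unfolding avg_def
    proof (rule Bochner_Integration.integral_cong)
      fix z assume "z \<in> space circle_lebesgue"
      then have z: "z \<in> circle" by (simp add: sp)
      have "(norm (p z - q z)) ^ 4 = (norm (polyn j ?w z * cnj (polyn j ?w z)))\<^sup>2"
        unfolding pq by (simp add: norm_mult power2_eq_square power4_eq_xxxx)
      then show "f z * (norm (p z - q z)) ^ 4 = f z *
          (norm (\<Sum>i\<in>?S. \<Sum>k\<in>?S. (?w i * cnj (?w k)) * z powi (int (pos j i) - int (pos j k))))\<^sup>2"
        unfolding polyn_product[OF z] by simp
    qed simp
    also have "\<dots> = ((norm (\<Sum>i\<in>?S. ?w i * cnj (?w i)))\<^sup>2 + (\<Sum>i\<in>?S. \<Sum>k\<in>?S - {i}. (norm (?w i * cnj (?w k)))\<^sup>2)) * I"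
      unfolding I_def by (rule sidon_wick_square[OF j f])
    also have "\<dots> \<le> ((2 / 3)\<^sup>2 + (2 / 3)\<^sup>2) * I"
    proof (intro mult_right_mono add_mono)
      have "(\<Sum>i\<in>?S. ?w i * cnj (?w i)) = complex_of_real (2 / 3)"
        unfolding xmy[symmetric] of_real_sum complex_norm_square ..
      then have "norm (\<Sum>i\<in>?S. ?w i * cnj (?w i)) = \<bar>2 / 3\<bar>" by (simp only: norm_of_real)
      then show "(norm (\<Sum>i\<in>?S. ?w i * cnj (?w i)))\<^sup>2 \<le> (2 / 3)\<^sup>2" by (simp only: power2_abs order_refl)
      have "(\<Sum>i\<in>?S. \<Sum>k\<in>?S - {i}. (norm (?w i * cnj (?w k)))\<^sup>2) \<le> (\<Sum>i\<in>?S. \<Sum>k\<in>?S. (norm (?w i))\<^sup>2 * (norm (?w k))\<^sup>2)"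
        unfolding norm_mult power_mult_distrib complex_mod_cnj by (intro sum_mono sum_mono2) auto
      also have "\<dots> = (2 / 3)\<^sup>2"
        unfolding sum_product[symmetric] xmy by (simp add: power2_eq_square)
      finally show "(\<Sum>i\<in>?S. \<Sum>k\<in>?S - {i}. (norm (?w i * cnj (?w k)))\<^sup>2) \<le> (2 / 3)\<^sup>2" .
    qed (use I0 in auto)
    finally show ?thesis by (simp add: power2_eq_square)
  qed
  have mi: "avg (\<lambda>z. (norm (p z * cnj (q z) - cnj (p z) * q z))\<^sup>2) \<le> 10 / 9 * I"
  proof -
    let ?A = "\<lambda>i k. x i * cnj (y k) - y i * cnj (x k)"
    have "avg (\<lambda>z. (norm (p z * cnj (q z) - cnj (p z) * q z))\<^sup>2) = (LINT z|circle_lebesgue. f z *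
        (norm (\<Sum>i\<in>?S. \<Sum>k\<in>?S. ?A i k * z powi (int (pos j i) - int (pos j k))))\<^sup>2)"
      unfolding avg_def
    proof (rule Bochner_Integration.integral_cong)
      fix z assume "z \<in> space circle_lebesgue"
      then have z: "z \<in> circle" by (simp add: sp)
      have "p z * cnj (q z) - cnj (p z) * q z = p z * cnj (q z) - q z * cnj (p z)" by (simp add: mult.commute)
      also have "\<dots> = (\<Sum>i\<in>?S. \<Sum>k\<in>?S. ?A i k * z powi (int (pos j i) - int (pos j k)))"
        unfolding p_def q_def polyn_product[OF z] by (simp add: sum_subtractf[symmetric] left_diff_distrib)
      finally show "f z * (norm (p z * cnj (q z) - cnj (p z) * q z))\<^sup>2 = f z *
          (norm (\<Sum>i\<in>?S. \<Sum>k\<in>?S. ?A i k * z powi (int (pos j i) - int (pos j k))))\<^sup>2" by simp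
    qed simp
    also have "\<dots> = ((norm (\<Sum>i\<in>?S. ?A i i))\<^sup>2 + (\<Sum>i\<in>?S. \<Sum>k\<in>?S - {i}. (norm (?A i k))\<^sup>2)) * I"
      unfolding I_def by (rule sidon_wick_square[OF j f])
    also have "\<dots> \<le> (0 + 10 / 9) * I"
    proof (intro mult_right_mono add_mono)
      have "(\<Sum>i\<in>?S. ?A i i) = (\<Sum>i\<in>?S. x i * cnj (y i)) - cnj (\<Sum>i\<in>?S. x i * cnj (y i))"
        by (simp add: sum_subtractf mult.commute)
      then show "(norm (\<Sum>i\<in>?S. ?A i i))\<^sup>2 \<le> 0" unfolding xy by simp
      have "(\<Sum>i\<in>?S. \<Sum>k\<in>?S - {i}. (norm (?A i k))\<^sup>2) \<le> (\<Sum>i\<in>?S. \<Sum>k\<in>?S. (norm (?A i k))\<^sup>2)"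
        by (intro sum_mono sum_mono2) auto
      also have "\<dots> = (\<Sum>i\<in>?S. \<Sum>k\<in>?S. (norm (x i))\<^sup>2 * (norm (y k))\<^sup>2 + (norm (y i))\<^sup>2 * (norm (x k))\<^sup>2
          - 2 * Re ((x i * cnj (y i)) * (x k * cnj (y k))))"
        unfolding cmod_power2 by (intro sum.cong refl) (simp add: power2_eq_square algebra_simps)
      also have "\<dots> = 1 * 1 + 1 * 1 - 2 * Re ((2 / 3) * (2 / 3))"
      proof -
        have "(\<Sum>i\<in>?S. \<Sum>k\<in>?S. (x i * cnj (y i)) * (x k * cnj (y k))) = (2 / 3) * (2 / 3)"
          unfolding sum_product[symmetric] xy ..
        then have "Re ((2 / 3) * (2 / 3)) = (\<Sum>i\<in>?S. \<Sum>k\<in>?S. Re ((x i * cnj (y i)) * (x k * cnj (y k))))"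
          by (simp only: Re_sum[symmetric])
        moreover have "(\<Sum>i\<in>?S. \<Sum>k\<in>?S. (norm (x i))\<^sup>2 * (norm (y k))\<^sup>2) = 1 * 1"
          "(\<Sum>i\<in>?S. \<Sum>k\<in>?S. (norm (y i))\<^sup>2 * (norm (x k))\<^sup>2) = 1 * 1"
          unfolding sum_product[symmetric] x y by (rule refl)+
        ultimately show ?thesis
          by (simp only: sum.distrib sum_subtractf sum_distrib_left[symmetric])
      qed
      finally show "(\<Sum>i\<in>?S. \<Sum>k\<in>?S - {i}. (norm (?A i k))\<^sup>2) \<le> 10 / 9" by simp
    qed (use I0 in auto)
    finally show ?thesis by simp
  qed
  \<comment> \<open>The first bound is 2 I - 2 avg |w| \<le> 2 I / 5000; Cauchy-Schwarz turns it
    into 1 / 50 for the absolute value.\<close>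
  have dev: "avg (\<lambda>z. (1 - norm (w z))\<^sup>2) \<le> I / 2500" "avg (\<lambda>z. \<bar>1 - norm (w z)\<bar>) \<le> I / 50"
    if w: "continuous_on circle w" "avg (\<lambda>z. (norm (w z))\<^sup>2) = I" "(1 - 1 / 5000) * I \<le> avg (\<lambda>z. norm (w z))" for w :: "complex \<Rightarrow> complex"
  proof -
    have "avg (\<lambda>z. (1 - norm (w z))\<^sup>2) = avg (\<lambda>z. (1 - 2 * norm (w z)) + (norm (w z))\<^sup>2)"
      by (rule arg_cong[of _ _ avg]) (auto simp: power2_eq_square algebra_simps)
    also have "\<dots> = (I - 2 * avg (\<lambda>z. norm (w z))) + I"
      using w by (subst avg_add; (subst avg_diff)?; (intro continuous_intros)?) (auto simp: avg_cmult avg_1 intro: continuous_intros)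
    finally show 1: "avg (\<lambda>z. (1 - norm (w z))\<^sup>2) \<le> I / 2500" using w(3) by simp
    have "avg (\<lambda>z. \<bar>1 - norm (w z)\<bar>) \<le> sqrt I * sqrt (avg (\<lambda>z. (1 - norm (w z))\<^sup>2))"
      unfolding avg_def I_def by (intro circle_abs_le_sqrt cf nonneg continuous_intros w)
    also have "\<dots> \<le> sqrt I * sqrt (I / 2500)" using 1 I0 by (intro mult_left_mono real_sqrt_le_mono) auto
    also have "\<dots> = I / 50"
    proof -
      have "sqrt (2500::real) = 50" by (rule real_sqrt_unique) auto
      then show ?thesis using I0 by (simp add: real_sqrt_divide)
    qed
    finally show "avg (\<lambda>z. \<bar>1 - norm (w z)\<bar>) \<le> I / 50" .
  qed
  have ab: "(norm (p z) - norm (q z))\<^sup>2 \<le> 2 * (1 - norm (p z))\<^sup>2 + 2 * (1 - norm (q z))\<^sup>2" for z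
    using zero_le_power2[of "(1 - norm (p z)) + (1 - norm (q z))"] by (simp add: power2_eq_square algebra_simps)
  have "4 * (2 / 3 * I) = avg (\<lambda>z. 4 * (norm (p z - q z))\<^sup>2)" unfolding avg_cmult m2 ..
  also have "\<dots> \<le> avg (\<lambda>z. (norm (p z * cnj (q z) - cnj (p z) * q z))\<^sup>2 + (norm (p z - q z)) ^ 4 +
      (8 * (1 - norm (p z))\<^sup>2 + 8 * (1 - norm (q z))\<^sup>2) + (16 * \<bar>1 - norm (p z)\<bar> + 16 * \<bar>1 - norm (q z)\<bar>))"
  proof (rule avg_mono)
    fix z
    show "4 * (norm (p z - q z))\<^sup>2 \<le> (norm (p z * cnj (q z) - cnj (p z) * q z))\<^sup>2 + (norm (p z - q z)) ^ 4 +
      (8 * (1 - norm (p z))\<^sup>2 + 8 * (1 - norm (q z))\<^sup>2) + (16 * \<bar>1 - norm (p z)\<bar> + 16 * \<bar>1 - norm (q z)\<bar>)"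
      using unimodular_defect[of "p z" "q z"] ab[of z] by simp
  qed (intro continuous_intros cp)+
  also have "\<dots> = avg (\<lambda>z. (norm (p z * cnj (q z) - cnj (p z) * q z))\<^sup>2) + avg (\<lambda>z. (norm (p z - q z)) ^ 4) +
      (8 * avg (\<lambda>z. (1 - norm (p z))\<^sup>2) + 8 * avg (\<lambda>z. (1 - norm (q z))\<^sup>2)) +
      (16 * avg (\<lambda>z. \<bar>1 - norm (p z)\<bar>) + 16 * avg (\<lambda>z. \<bar>1 - norm (q z)\<bar>))"
    unfolding avg_cmult[symmetric] using cp by (simp add: avg_add continuous_intros)
  \<comment> \<open>The right-hand side is (2 + 0.0064 + 0.64) I, less than the 8/3 I on the left.
    This gap determines the constant 1 / 5000.\<close>
  also have "\<dots> \<le> 10 / 9 * I + 8 / 9 * I + (8 * (I / 2500) + 8 * (I / 2500)) + (16 * (I / 50) + 16 * (I / 50))"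
    by (intro add_mono mult_left_mono mi m4 dev cp n2 big) auto
  finally show False using I0 by simp
qed

end

section \<open>Riesz products and the singular spectrum of Sidon constructions\<close>

text \<open>Meant for a measure of the spectral family: by \<open>corr_zero_small\<close> its
  coefficients vanish strictly between 0 and the height of its stage.\<close>

lemma trig_integral_mean:
  fixes F :: "complex \<Rightarrow> complex"
  assumes \<nu>: "finite_circle_measure \<nu>" "prob_space \<nu>" and F: "trig d F"
    and small: "\<And>m. m \<noteq> 0 \<Longrightarrow> \<bar>m\<bar> \<le> d \<Longrightarrow> (LINT z|\<nu>. z powi m) = 0"
  shows "(LINT z|circle_lebesgue. F z) = 2 * pi * (LINT z|\<nu>. F z)"
proof -
  obtain c where c: "\<And>z::complex. z \<in> circle \<Longrightarrow> F z = (\<Sum>m\<in>{-d..d}. c m * z powi m)" using F unfolding trig_def by auto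
  have 0: "(LINT z|\<nu>. z powi 0) = 1"
    using prob_space.prob_space[OF \<nu>(2)] by (simp add: scaleR_conv_of_real)
  have "(LINT z|circle_lebesgue. F z) = (\<Sum>m\<in>{-d..d}. c m * (LINT z|circle_lebesgue. z powi m))"
    by (rule circle_trig_integral[OF circle_lebesgue_base(1) c])
  also have "\<dots> = (\<Sum>m\<in>{-d..d}. 2 * pi * (c m * (LINT z|\<nu>. z powi m)))"
  proof (rule sum.cong)
    fix m assume m: "m \<in> {-d..d}"
    show "c m * (LINT z|circle_lebesgue. z powi m) = 2 * pi * (c m * (LINT z|\<nu>. z powi m))"
    proof (cases "m = 0")
      case False
      then have "(LINT z|\<nu>. z powi m) = 0" using m by (intro small) auto
      then show ?thesis using False by (simp add: circle_lebesgue_powi)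
    next
      case True
      have "(LINT z|circle_lebesgue. z powi 0) = 2 * pi" unfolding circle_lebesgue_powi by simp
      then show ?thesis unfolding True 0 by (simp add: mult.commute del: of_real_mult power_int_0_right)
    qed
  qed simp
  also have "\<dots> = 2 * pi * (LINT z|\<nu>. F z)"
  proof -
    have "(LINT z|\<nu>. F z) = (\<Sum>m\<in>{-d..d}. c m * (LINT z|\<nu>. z powi m))"
      by (rule circle_trig_integral[OF \<nu>(1) c])
    then show ?thesis by (simp only: sum_distrib_left)
  qed
  finally show ?thesis .
qed

context rank_one_construction
begin

text \<open>Cutting both copies of E j into levels of stage j + 1. On the side of measures this is
  multiplication by the density |P_j|^2, see \<open>riesz_density\<close>.\<close>

lemma corr_Suc:
  assumes j: "1 \<le> j"
  shows "corr j m = (\<Sum>i\<in>{1..r j}. \<Sum>k\<in>{1..r j}. corr (Suc j) (m + int (pos j i) - int (pos j k))) / real (r j)"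
proof -
  let ?S = "{1..r j} \<times> {1..r j}"
  let ?Z = "\<lambda>(i, k). lv (Suc j) (int (pos j k)) \<inter> lv (Suc j) (m + int (pos j i))"
  have near: "i = i'" if "i \<in> {1..r j}" "i' \<in> {1..r j}" "x \<in> lv (Suc j) (a + int (pos j i))" "x \<in> lv (Suc j) (a + int (pos j i'))" for i i' x a
  proof -
    have *: "a + int (pos j i) = a + int (pos j i')"
      using that pos_top[OF j, of i] pos_top[OF j, of i'] h_pos[OF j]
      by (intro lv_disjoint[OF _ that(3,4)]) auto
    show ?thesis
      using * that pos_mono[of i i' j] pos_mono[of i' i j] h_pos[OF j] by (cases i i' rule: linorder_cases) auto
  qed
  have m: "measure M (?Z (i, k)) = eps (Suc j) * corr (Suc j) (m + int (pos j i) - int (pos j k))" for i k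
    using measure_lv_Int[of "Suc j" "int (pos j k)" "m + int (pos j i)"] measure_E_inter[of "Suc j"] by simp
  have "E j \<inter> lv j m = (\<Union>p\<in>?S. ?Z p)"
    unfolding lv_split[OF j, of m] E_split[OF j] by auto
  then have "measure M (E j \<inter> lv j m) = (\<Sum>p\<in>?S. measure M (?Z p))"
  proof (simp only:, intro measure_finite_Union)
    show "disjoint_family_on ?Z ?S"
      unfolding disjoint_family_on_def
    proof (intro ballI impI)
      fix p q assume pq: "p \<in> ?S" "q \<in> ?S" "p \<noteq> q"
      obtain i k i' k' where e: "p = (i, k)" "q = (i', k')" by (cases p, cases q)
      have "x \<notin> ?Z q" if "x \<in> ?Z p" for x
        using near[of i i' x m] near[of k k' x 0] that pq unfolding e by auto
      then show "?Z p \<inter> ?Z q = {}" by blast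
    qed
    show "?Z ` ?S \<subseteq> sets M" using lv_sets[of "Suc j"] by auto
    show "emeasure M (?Z p) \<noteq> \<infinity>" if "p \<in> ?S" for p
    proof -
      have "emeasure M (?Z p) \<le> emeasure M (lv (Suc j) (int (pos j (snd p))))"
        by (intro emeasure_mono lv_sets) auto
      then show ?thesis using lv_measure(1)[of "Suc j"] by (auto simp: top_unique)
    qed
  qed simp
  also have "\<dots> = (\<Sum>i\<in>{1..r j}. \<Sum>k\<in>{1..r j}. measure M (?Z (i, k)))"
    by (simp only: sum.cartesian_product split_def fst_conv snd_conv)
  also have "\<dots> = eps (Suc j) * (\<Sum>i\<in>{1..r j}. \<Sum>k\<in>{1..r j}. corr (Suc j) (m + int (pos j i) - int (pos j k)))"
    unfolding m sum_distrib_left ..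
  finally show ?thesis
    unfolding corr_def[of j] eps_Suc[OF j] using eps_pos[of "Suc j"] by simp
qed

end

context sidon_construction
begin

text \<open>At t = 0 the modulus is r j. Since positions are h j apart, the mean of its square over
  [0, \<tau>] is at most r j + r j ^ 2 / 6, which is below (2/3 r j)^2 when r j \<ge> 9. The
  intermediate value theorem yields 2/3 r j, the correlation that \<open>sidon_not_flat\<close>
  requires.\<close>

lemma phase_exists:
  assumes j: "1 \<le> j" and r9: "9 \<le> r j" and \<tau>: "0 < \<tau>" "6 \<le> \<tau> * real (h j)"
  shows "\<exists>t\<in>{0..\<tau>}. norm (\<Sum>i\<in>{1..r j}. cis (t * real (pos j i))) = 2 / 3 * real (r j)"
proof -
  let ?S = "{1..r j}"
  define R where "R = real (r j)"
  have R: "9 \<le> R" using r9 unfolding R_def by simp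
  define d where "d i k = real (pos j i) - real (pos j k)" for i k
  have dh: "real (h j) \<le> \<bar>d i k\<bar>" if "i \<in> ?S" "k \<in> ?S" "i \<noteq> k" for i k
  proof -
    have "\<not> \<bar>int (pos j i) - int (pos j k)\<bar> < int (h j)" using pos_close[of i k j] that by auto
    then have "int (h j) \<le> \<bar>int (pos j i) - int (pos j k)\<bar>" by simp
    then have "real_of_int (int (h j)) \<le> real_of_int \<bar>int (pos j i) - int (pos j k)\<bar>" by (simp only: of_int_le_iff)
    then show ?thesis unfolding d_def by simp
  qed
  have h0: "0 < real (h j)" using h_pos[OF j] by simp
  define \<phi> where "\<phi> t = norm (\<Sum>i\<in>?S. cis (t * real (pos j i)))" for t
  \<comment> \<open>A primitive of the square of \<phi>, so that the mean value theorem finds a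
    point where the square equals its mean.\<close>
  define \<Psi> where "\<Psi> t = (\<Sum>i\<in>?S. \<Sum>k\<in>?S. if i = k then t else sin (t * d i k) / d i k)" for t
  have sq: "(\<phi> t)\<^sup>2 = (\<Sum>i\<in>?S. \<Sum>k\<in>?S. cos (t * d i k))" for t
  proof -
    have "complex_of_real ((\<phi> t)\<^sup>2) = (\<Sum>i\<in>?S. \<Sum>k\<in>?S. cis (t * d i k))"
      unfolding \<phi>_def complex_norm_square cnj_sum sum_product cis_cnj cis_mult d_def
      by (intro sum.cong refl) (simp add: algebra_simps)
    then have "(\<phi> t)\<^sup>2 = Re (\<Sum>i\<in>?S. \<Sum>k\<in>?S. cis (t * d i k))" by (metis Re_complex_of_real)
    then show ?thesis by simp
  qed
  have der: "(\<Psi> has_real_derivative (\<phi> t)\<^sup>2) (at t)" for t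
    unfolding \<Psi>_def sq
  proof (intro DERIV_sum)
    fix i k assume ik: "i \<in> ?S" "k \<in> ?S"
    show "((\<lambda>t. if i = k then t else sin (t * d i k) / d i k) has_real_derivative cos (t * d i k)) (at t)"
    proof (cases "i = k")
      case True
      then show ?thesis by (simp add: d_def)
    next
      case False
      then have "d i k \<noteq> 0" using dh[OF ik] h0 by auto
      then show ?thesis using False by (auto intro!: derivative_eq_intros)
    qed
  qed
  obtain \<xi> where \<xi>: "0 < \<xi>" "\<xi> < \<tau>" "\<Psi> \<tau> - \<Psi> 0 = (\<tau> - 0) * (\<phi> \<xi>)\<^sup>2"
    using MVT2[OF \<tau>(1), of \<Psi> "\<lambda>t. (\<phi> t)\<^sup>2"] der by auto
  have "\<Psi> 0 = 0" unfolding \<Psi>_def by (auto intro!: sum.neutral)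
  then have "\<tau> * (\<phi> \<xi>)\<^sup>2 = \<Psi> \<tau>" using \<xi>(3) by simp
  also have "\<dots> \<le> (\<Sum>i\<in>?S. \<Sum>k\<in>?S. (if i = k then \<tau> else 0) + 1 / real (h j))"
    unfolding \<Psi>_def
  proof (intro sum_mono)
    fix i k assume ik: "i \<in> ?S" "k \<in> ?S"
    show "(if i = k then \<tau> else sin (\<tau> * d i k) / d i k) \<le> (if i = k then \<tau> else 0) + 1 / real (h j)"
    proof (cases "i = k")
      case False
      have "sin (\<tau> * d i k) / d i k \<le> \<bar>sin (\<tau> * d i k)\<bar> / \<bar>d i k\<bar>" by (metis abs_divide abs_ge_self)
      also have "\<dots> \<le> 1 / real (h j)" using dh[OF ik False] h0 by (intro frac_le) auto
      finally show ?thesis using False by simp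
    qed simp
  qed
  also have "\<dots> = R * \<tau> + R * R / real (h j)"
    by (simp add: sum.distrib R_def distrib_left)
  also have "\<dots> \<le> R * \<tau> + R * R * (\<tau> / 6)"
  proof -
    have "1 / real (h j) \<le> \<tau> / 6" using \<tau> h0 by (simp add: field_simps)
    then have "R * R * (1 / real (h j)) \<le> R * R * (\<tau> / 6)" using R by (intro mult_left_mono) auto
    then show ?thesis by simp
  qed
  also have "\<dots> = \<tau> * (R + R * R / 6)" by (simp add: algebra_simps)
  finally have "(\<phi> \<xi>)\<^sup>2 \<le> R + R * R / 6" by (rule mult_left_le_imp_le[OF _ \<tau>(1)])
  also have "\<dots> \<le> (2 / 3 * R)\<^sup>2"
  proof -
    have "9 * R \<le> R * R" using R by (intro mult_right_mono) auto
    moreover have "(2 / 3 * R)\<^sup>2 = 4 / 9 * (R * R)" by (simp add: power2_eq_square)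
    ultimately show ?thesis using R by linarith
  qed
  finally have le: "\<phi> \<xi> \<le> 2 / 3 * R" by (rule power2_le_imp_le) (use R in simp)
  have ge: "2 / 3 * R \<le> \<phi> 0" unfolding \<phi>_def R_def by simp
  have "\<exists>t\<ge>0. t \<le> \<xi> \<and> \<phi> t = 2 / 3 * R"
  proof (rule IVT2'[of \<phi>, OF le ge])
    show "continuous_on {0..\<xi>} \<phi>" unfolding \<phi>_def by (intro continuous_intros)
  qed (use \<xi> in simp)
  then obtain t where "0 \<le> t" "t \<le> \<xi>" "\<phi> t = 2 / 3 * R" by auto
  then show ?thesis using \<xi>(2) unfolding \<phi>_def R_def by (intro bexI[of _ t]) auto
qed

definition riesz :: "nat \<Rightarrow> complex \<Rightarrow> complex" where
  "riesz j = polyn j (\<lambda>_. complex_of_real (1 / sqrt (real (r j))))"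

lemma riesz_continuous: "continuous_on A (riesz j)"
  unfolding riesz_def polyn_def power_int_of_nat by (intro continuous_intros)

lemma riesz_weights: "1 \<le> j \<Longrightarrow> (\<Sum>i\<in>{1..r j}. (norm (complex_of_real (1 / sqrt (real (r j)))))\<^sup>2) = 1"
  using cuts_pos[of j] by (simp add: norm_divide power_divide)

text \<open>\<open>sidon_not_flat\<close> is applied to P_j and to its rotation by t; one of the
  angles 0 and t works. As \<tau> may be taken small, the rotation hardly changes a continuous
  weight.\<close>

lemma riesz_not_flat:
  assumes j: "1 \<le> j" "2 \<le> h j" "9 \<le> r j" and \<tau>: "0 < \<tau>" "6 \<le> \<tau> * real (h j)"
    and f: "trig d (\<lambda>z. complex_of_real (f z))" "d < int (h j)"
    and nonneg: "\<And>z. z \<in> circle \<Longrightarrow> 0 \<le> f z" and I: "0 < (LINT z|circle_lebesgue. f z)"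
  shows "\<exists>t\<in>{0..\<tau>}. (LINT z|circle_lebesgue. f z * norm (riesz j (z * cis t))) \<le> (1 - 1 / 5000) * (LINT z|circle_lebesgue. f z)"
proof -
  let ?S = "{1..r j}"
  define R where "R = real (r j)"
  have R: "9 \<le> R" using j unfolding R_def by simp
  obtain t where t: "t \<in> {0..\<tau>}" "norm (\<Sum>i\<in>?S. cis (t * real (pos j i))) = 2 / 3 * R"
    using phase_exists[OF j(1,3) \<tau>] unfolding R_def by auto
  define c where "c = (\<Sum>i\<in>?S. cis (t * real (pos j i)))"
  \<comment> \<open>This phase makes the correlation of the two coefficient vectors real and
    positive without changing the modulus of the rotated sum.\<close>
  define \<omega> where "\<omega> = cnj c / complex_of_real (norm c)"
  have nc: "norm c = 2 / 3 * R" "norm c \<noteq> 0" using t(2) R unfolding c_def by auto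
  have \<omega>: "norm \<omega> = 1" unfolding \<omega>_def using nc(2) by (simp add: norm_divide)
  have \<omega>c: "\<omega> * c = complex_of_real (norm c)"
  proof -
    have "cnj c * c = complex_of_real (norm c) * complex_of_real (norm c)"
      using complex_norm_square[of c] by (simp add: power2_eq_square mult.commute)
    then show ?thesis unfolding \<omega>_def using nc(2) by simp
  qed
  define x where "x = (\<lambda>_::nat. complex_of_real (1 / sqrt R))"
  define y where "y i = \<omega> * (cis (t * real (pos j i)) * complex_of_real (1 / sqrt R))" for i
  have nx: "(\<Sum>i\<in>?S. (norm (x i))\<^sup>2) = 1" using riesz_weights[OF j(1)] unfolding x_def R_def .
  have ny: "(\<Sum>i\<in>?S. (norm (y i))\<^sup>2) = 1"
    using riesz_weights[OF j(1)] unfolding y_def norm_mult \<omega> norm_cis R_def by simp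
  have "(\<Sum>i\<in>?S. x i * cnj (y i)) = cnj (\<Sum>i\<in>?S. \<omega> * (cis (t * real (pos j i)) * (complex_of_real (1 / sqrt R) * complex_of_real (1 / sqrt R))))"
    unfolding x_def y_def cnj_sum by (intro sum.cong refl) simp
  also have "\<dots> = cnj (\<omega> * c * complex_of_real (1 / R))"
    unfolding of_real_mult[symmetric] c_def sum_distrib_left[symmetric] sum_distrib_right[symmetric]
    using R by (simp add: mult.assoc)
  also have "\<dots> = complex_of_real (2 / 3)"
    unfolding \<omega>c of_real_mult[symmetric] complex_cnj_complex_of_real nc(1) using R by simp
  finally have xy: "(\<Sum>i\<in>?S. x i * cnj (y i)) = 2 / 3" by simp
  have px: "norm (polyn j x z) = norm (riesz j (z * cis 0))" for z
    unfolding riesz_def x_def R_def by simp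
  have cis: "cis (t * real p) = cis t ^ p" for p
    by (simp only: Complex.DeMoivre mult.commute)
  have "polyn j y z = \<omega> * riesz j (z * cis t)" for z
    unfolding polyn_def riesz_def y_def sum_distrib_left R_def
    by (intro sum.cong refl) (simp add: power_mult_distrib cis mult_ac)
  then have py: "norm (polyn j y z) = norm (riesz j (z * cis t))" for z by (simp add: norm_mult \<omega>)
  from sidon_not_flat[OF j(1,2) f nonneg I nx ny xy] show ?thesis
    unfolding px py using t(1) \<tau>(1) by (auto intro: bexI[of _ 0] bexI[of _ t])
qed

lemma riesz_norm_integral:
  assumes j: "1 \<le> j" and f: "trig d (\<lambda>z. complex_of_real (f z))" "d < int (h j)"
  shows "(LINT z|circle_lebesgue. f z * (norm (riesz j z))\<^sup>2) = (LINT z|circle_lebesgue. f z)"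
  using polyn_norm_integral[OF j f, of "\<lambda>_. complex_of_real (1 / sqrt (real (r j)))"] riesz_weights[OF j]
  unfolding riesz_def by simp

text \<open>The weight G is replaced by a slightly larger trigonometric polynomial, and j is taken
  so large that h j exceeds its degree and that small rotations suffice. Rotating the whole
  integrand back costs only the modulus of continuity of G.\<close>

lemma riesz_step:
  assumes r: "filterlim r at_top sequentially" and h: "filterlim h at_top sequentially"
    and G: "continuous_on UNIV (G :: complex \<Rightarrow> real)" "\<And>z. z \<in> circle \<Longrightarrow> 0 \<le> G z" and \<delta>: "0 < \<delta>"
  shows "\<exists>j\<ge>J. (LINT z|circle_lebesgue. G z * norm (riesz j z)) \<le> (1 - 1 / 5000) * (LINT z|circle_lebesgue. G z) + \<delta>"
proof -
  note C = circle_lebesgue_base(1) and sp = finite_circle_measureD[OF circle_lebesgue_base(1)]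
  have cG: "continuous_on A G" for A using G(1) by (rule continuous_on_subset) simp
  \<comment> \<open>The polynomial will lie between G + \<eta> and G + 3 \<eta>. The lower margin
    absorbs the rotation, and the upper one costs 3 \<eta> * 2 pi = 3/4 \<delta>.\<close>
  define \<eta> where "\<eta> = \<delta> / (8 * pi)"
  have \<eta>: "0 < \<eta>" unfolding \<eta>_def using \<delta> by simp
  have "continuous_on circle (\<lambda>z. G z + 2 * \<eta>)" by (intro continuous_intros cG)
  from trig_approx[OF this \<eta>] obtain d p where p: "trig d (\<lambda>z. complex_of_real (p z))" "0 \<le> d"
    "\<And>z. z \<in> circle \<Longrightarrow> \<bar>G z + 2 * \<eta> - p z\<bar> < \<eta>" by auto
  have cp: "continuous_on circle p" using trig_continuous[OF p(1)] by (auto dest: continuous_on_Re)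
  have pG: "G z + \<eta> \<le> p z" "p z \<le> G z + 3 * \<eta>" if "z \<in> circle" for z using p(3)[OF that] by auto
  have p0: "0 \<le> p z" if "z \<in> circle" for z using pG(1)[OF that] G(2)[OF that] \<eta> by simp
  have pos: "0 < (LINT z|circle_lebesgue. p z)"
  proof -
    have "0 < (LINT z|circle_lebesgue. \<eta>)" unfolding circle_lebesgue_const using \<eta> by simp
    also have "\<dots> \<le> (LINT z|circle_lebesgue. p z)"
    proof (intro integral_mono circle_integrable[OF C] cp continuous_intros)
      fix z assume "z \<in> space circle_lebesgue"
      then show "\<eta> \<le> p z" using pG(1)[of z] G(2)[of z] by (simp add: sp)
    qed
    finally show ?thesis .
  qed
  have int_p: "(LINT z|circle_lebesgue. p z) \<le> (LINT z|circle_lebesgue. G z) + 6 * pi * \<eta>"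
  proof -
    have "(LINT z|circle_lebesgue. p z) \<le> (LINT z|circle_lebesgue. G z + 3 * \<eta>)"
      by (intro integral_mono circle_integrable[OF C] cp continuous_intros cG) (use pG(2) in \<open>auto simp: sp\<close>)
    also have "\<dots> = (LINT z|circle_lebesgue. G z) + (LINT z|circle_lebesgue. 3 * \<eta>)"
      by (intro Bochner_Integration.integral_add circle_integrable[OF C] continuous_intros cG)
    finally show ?thesis unfolding circle_lebesgue_const by simp
  qed
  have "uniformly_continuous_on circle G" by (intro compact_uniformly_continuous cG compact_sphere)
  then obtain e where e: "0 < e" "\<And>z w. z \<in> circle \<Longrightarrow> w \<in> circle \<Longrightarrow> dist w z < e \<Longrightarrow> dist (G w) (G z) < \<eta>"
    using \<eta> unfolding uniformly_continuous_on_def by metis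
  have "continuous_on UNIV cis" by (intro continuous_intros)
  then have "isCont cis 0" by (simp add: continuous_on_eq_continuous_at)
  then obtain \<tau> where \<tau>: "0 < \<tau>" "\<And>t. \<bar>t\<bar> < \<tau> \<Longrightarrow> dist (cis t) 1 < e"
    using e(1) unfolding continuous_at_eps_delta by (auto simp: dist_real_def)
  have "eventually (\<lambda>j. 9 \<le> r j \<and> nat \<lceil>12 / \<tau>\<rceil> + nat d + 2 \<le> h j \<and> J + 1 \<le> j) sequentially"
    using r h by (intro eventually_conj eventually_ge_at_top) (auto simp: filterlim_at_top)
  then obtain j where j: "9 \<le> r j" "nat \<lceil>12 / \<tau>\<rceil> + nat d + 2 \<le> h j" "J + 1 \<le> j"
    unfolding eventually_sequentially by blast
  have dh: "d < int (h j)" using j(2) p(2) by linarith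
  have \<tau>h: "6 \<le> (\<tau> / 2) * real (h j)"
  proof -
    have "12 / \<tau> \<le> real (h j)" using j(2) by linarith
    then show ?thesis using \<tau>(1) by (simp add: field_simps)
  qed
  have j1: "1 \<le> j" "2 \<le> h j" "0 < \<tau> / 2" using j \<tau>(1) by auto
  obtain t where t: "t \<in> {0..\<tau> / 2}" and
    small: "(LINT z|circle_lebesgue. p z * norm (riesz j (z * cis t))) \<le> (1 - 1 / 5000) * (LINT z|circle_lebesgue. p z)"
    using riesz_not_flat[OF j1(1,2) j(1) j1(3) \<tau>h p(1) dh p0 pos] by blast
  define w where "w = cis t"
  have w: "w \<in> circle" "cnj w \<in> circle" "w * cnj w = 1" unfolding w_def by (auto simp: cis_cnj cis_mult)
  have wc: "z * w \<in> circle" if "z \<in> circle" for z using that w by (simp add: norm_mult)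
  have near: "G (z * w) \<le> G z + \<eta>" if z: "z \<in> circle" for z
  proof -
    have "dist (z * w) z = dist w 1"
      using z unfolding dist_norm by (metis mem_sphere_0 mult.right_neutral mult_1 norm_mult right_diff_distrib)
    also have "\<dots> < e" unfolding w_def using t \<tau> by (intro \<tau>(2)) auto
    finally show ?thesis using e(2)[OF z wc[OF z]] by (simp add: dist_real_def)
  qed
  have cR: "continuous_on A (\<lambda>z. riesz j (z * w))" for A
    by (intro continuous_on_compose2[OF riesz_continuous[of UNIV]] continuous_intros) auto
  have cGw: "continuous_on A (\<lambda>z. G (z * w))" for A
    by (intro continuous_on_compose2[OF cG[of UNIV]] continuous_intros) auto
  have "(LINT z|circle_lebesgue. G z * norm (riesz j z)) = (LINT z|circle_lebesgue. G (z * w) * norm (riesz j (z * w)))"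
    by (rule circle_lebesgue_rotation[OF w(1), symmetric]) (intro continuous_intros cG riesz_continuous)
  also have "\<dots> \<le> (LINT z|circle_lebesgue. p z * norm (riesz j (z * w)))"
  proof (intro integral_mono circle_integrable[OF C] continuous_intros cp cR cGw)
    fix z assume "z \<in> space circle_lebesgue"
    then have z: "z \<in> circle" by (simp add: sp)
    show "G (z * w) * norm (riesz j (z * w)) \<le> p z * norm (riesz j (z * w))"
      using near[OF z] pG(1)[OF z] by (intro mult_right_mono) auto
  qed
  also have "\<dots> \<le> (1 - 1 / 5000) * (LINT z|circle_lebesgue. p z)" using small unfolding w_def .
  also have "\<dots> \<le> (1 - 1 / 5000) * (LINT z|circle_lebesgue. G z) + 6 * pi * \<eta>"
  proof -
    have "(1 - 1 / 5000) * (LINT z|circle_lebesgue. p z) \<le> (1 - 1 / 5000) * ((LINT z|circle_lebesgue. G z) + 6 * pi * \<eta>)"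
      using int_p by (intro mult_left_mono) auto
    also have "\<dots> = (1 - 1 / 5000) * (LINT z|circle_lebesgue. G z) + (1 - 1 / 5000) * (6 * pi * \<eta>)"
      by (rule distrib_left)
    also have "(1 - 1 / 5000) * (6 * pi * \<eta>) \<le> 6 * pi * \<eta>"
      using \<eta> by (intro mult_left_le_one_le) auto
    finally show ?thesis by simp
  qed
  also have "\<dots> \<le> (1 - 1 / 5000) * (LINT z|circle_lebesgue. G z) + \<delta>"
    unfolding \<eta>_def using \<delta> by simp
  finally show ?thesis using j(3) by (intro exI[of _ j]) auto
qed

text \<open>Each new factor, taken from a far later stage, multiplies the mean by a, up to an error
  chosen so that \<epsilon> / 2 is the fixed point of the recursion.\<close>

lemma riesz_product_small:
  assumes r: "filterlim r at_top sequentially" and h: "filterlim h at_top sequentially" and \<epsilon>: "0 < \<epsilon>"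
  shows "\<exists>N. finite N \<and> N \<subseteq> {j0..} \<and> (LINT z|circle_lebesgue. (\<Prod>j\<in>N. norm (riesz j z))) \<le> \<epsilon>"
proof -
  define a where "a = (1 - 1 / 5000 :: real)"
  have a: "0 < a" "a < 1" unfolding a_def by auto
  have "\<exists>N. finite N \<and> N \<subseteq> {j0..} \<and> (LINT z|circle_lebesgue. (\<Prod>j\<in>N. norm (riesz j z))) \<le> 2 * pi * a ^ k + \<epsilon> / 2" for k
  proof (induction k)
    case 0
    show ?case using \<epsilon> circle_lebesgue_const[of 1] by (intro exI[of _ "{}"]) simp
  next
    case (Suc k)
    then obtain N where N: "finite N" "N \<subseteq> {j0..}"
      "(LINT z|circle_lebesgue. (\<Prod>j\<in>N. norm (riesz j z))) \<le> 2 * pi * a ^ k + \<epsilon> / 2" by auto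
    have G: "continuous_on UNIV (\<lambda>z. \<Prod>j\<in>N. norm (riesz j z))" "\<And>z. 0 \<le> (\<Prod>j\<in>N. norm (riesz j z))"
      by (intro continuous_on_prod continuous_on_norm riesz_continuous) (intro prod_nonneg norm_ge_zero)
    have "0 < \<epsilon> / 2 * (1 - a)" using \<epsilon> a by simp
    from riesz_step[OF r h G this, of "Max (insert j0 N) + 1"]
    obtain j where j: "Max (insert j0 N) + 1 \<le> j"
      "(LINT z|circle_lebesgue. (\<Prod>j\<in>N. norm (riesz j z)) * norm (riesz j z)) \<le>
        (1 - 1 / 5000) * (LINT z|circle_lebesgue. (\<Prod>j\<in>N. norm (riesz j z))) + \<epsilon> / 2 * (1 - a)" by blast
    have jN: "j \<notin> N" "j0 \<le> j"
    proof -
      have "k < j" if "k \<in> insert j0 N" for k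
        using Max_ge[OF _ that] j(1) N(1) by auto
      then show "j \<notin> N" "j0 \<le> j" by (blast, simp add: less_imp_le)
    qed
    have "(LINT z|circle_lebesgue. (\<Prod>j\<in>insert j N. norm (riesz j z))) \<le>
        a * (LINT z|circle_lebesgue. (\<Prod>j\<in>N. norm (riesz j z))) + \<epsilon> / 2 * (1 - a)"
      using j(2) N(1) jN(1) unfolding a_def[symmetric] by (simp add: mult.commute)
    also have "\<dots> \<le> a * (2 * pi * a ^ k + \<epsilon> / 2) + \<epsilon> / 2 * (1 - a)"
      using N(3) a \<epsilon> by (intro add_mono mult_left_mono) auto
    also have "\<dots> = 2 * pi * a ^ Suc k + \<epsilon> / 2" by (simp add: field_simps)
    finally show ?case using N jN by (intro exI[of _ "insert j N"]) auto
  qed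
  moreover obtain k where "a ^ k < \<epsilon> / 2 / (2 * pi)"
    using real_arch_pow_inv[of "\<epsilon> / 2 / (2 * pi)" a] \<epsilon> a pi_gt_zero by auto
  then have "2 * pi * a ^ k + \<epsilon> / 2 \<le> \<epsilon>" by (simp add: field_simps)
  ultimately show ?thesis by (meson order_trans)
qed

text \<open>By \<open>corr_Suc\<close> multiplication by |P_j|^2 turns the coefficients of stage j +
  1 into those of stage j, and coefficients determine the measure.\<close>

lemma riesz_density:
  assumes j: "1 \<le> j"
    and \<nu>: "finite_circle_measure \<nu>" "\<And>m. (LINT z|\<nu>. z powi m) = complex_of_real (corr j m)"
    and \<nu>': "finite_circle_measure \<nu>'" "\<And>m. (LINT z|\<nu>'. z powi m) = complex_of_real (corr (Suc j) m)"
  shows "\<nu> = density \<nu>' (\<lambda>z. ennreal ((norm (riesz j z))\<^sup>2))"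
proof -
  let ?\<rho> = "density \<nu>' (\<lambda>z. ennreal ((norm (riesz j z))\<^sup>2))"
  let ?S = "{1..r j}"
  note sp' = finite_circle_measureD[OF \<nu>'(1)]
  have m: "(\<lambda>z. (norm (riesz j z))\<^sup>2) \<in> borel_measurable \<nu>'"
    by (intro circle_measurable[OF \<nu>'(1)] continuous_intros riesz_continuous)
  have "finite_measure ?\<rho>"
  proof (rule finite_measureI)
    have "emeasure ?\<rho> (space ?\<rho>) = (\<integral>\<^sup>+z. ennreal ((norm (riesz j z))\<^sup>2) \<partial>\<nu>')"
      using m by (subst emeasure_density) (auto intro!: nn_integral_cong)
    also have "\<dots> = ennreal (LINT z|\<nu>'. (norm (riesz j z))\<^sup>2)"
      by (intro nn_integral_eq_integral circle_integrable[OF \<nu>'(1)] continuous_intros riesz_continuous) auto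
    finally show "emeasure ?\<rho> (space ?\<rho>) \<noteq> \<infinity>" by simp
  qed
  then have F: "finite_circle_measure ?\<rho>" unfolding finite_circle_measure_def using sp' by simp
  show ?thesis
  proof (rule circle_measure_eqI[OF \<nu>(1) F])
    fix m' :: int
    have pm: "(\<lambda>z::complex. z powi m') \<in> borel_measurable \<nu>'"
      by (intro circle_measurable[OF \<nu>'(1)] continuous_intros) auto
    have rj: "complex_of_real (1 / sqrt (real (r j))) * cnj (complex_of_real (1 / sqrt (real (r j)))) = complex_of_real (1 / real (r j))"
      unfolding complex_cnj_complex_of_real of_real_mult[symmetric] by simp
    have "(LINT z|?\<rho>. z powi m') = (LINT z|\<nu>'. (norm (riesz j z))\<^sup>2 *\<^sub>R z powi m')"
      using m pm by (intro integral_density) auto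
    also have "\<dots> = (LINT z|\<nu>'. (\<Sum>i\<in>?S. \<Sum>k\<in>?S. complex_of_real (1 / real (r j)) * z powi (m' + int (pos j i) - int (pos j k))))"
    proof (rule Bochner_Integration.integral_cong)
      fix z assume "z \<in> space \<nu>'"
      then have z: "z \<in> circle" by (simp add: sp')
      have e: "z powi m' * z powi (a - b) = z powi (m' + a - b)" for a b
        unfolding powi_circle_mult[OF z] by (simp add: algebra_simps)
      have "(norm (riesz j z))\<^sup>2 *\<^sub>R z powi m' = z powi m' * (riesz j z * cnj (riesz j z))"
        by (simp only: scaleR_conv_of_real complex_norm_square mult.commute)
      also have "\<dots> = (\<Sum>i\<in>?S. \<Sum>k\<in>?S. complex_of_real (1 / real (r j)) * z powi (m' + int (pos j i) - int (pos j k)))"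
        unfolding riesz_def polyn_product[OF z] rj sum_distrib_left mult.left_commute[of "z powi m'"] e ..
      finally show "(norm (riesz j z))\<^sup>2 *\<^sub>R z powi m' = (\<Sum>i\<in>?S. \<Sum>k\<in>?S. complex_of_real (1 / real (r j)) * z powi (m' + int (pos j i) - int (pos j k)))" .
    qed simp
    also have "\<dots> = (\<Sum>i\<in>?S. \<Sum>k\<in>?S. LINT z|\<nu>'. complex_of_real (1 / real (r j)) * z powi (m' + int (pos j i) - int (pos j k)))"
    proof -
      have I: "integrable \<nu>' (\<lambda>z. complex_of_real (1 / real (r j)) * z powi (m' + int (pos j i) - int (pos j k)))" for i k
        by (intro circle_integrable[OF \<nu>'(1)] continuous_intros) auto
      show ?thesis
        by (subst Bochner_Integration.integral_sum, intro Bochner_Integration.integrable_sum I)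
          (intro sum.cong refl Bochner_Integration.integral_sum I)
    qed
    also have "\<dots> = (\<Sum>i\<in>?S. \<Sum>k\<in>?S. complex_of_real (1 / real (r j) * corr (Suc j) (m' + int (pos j i) - int (pos j k))))"
      unfolding integral_mult_right_zero \<nu>'(2) of_real_mult ..
    also have "\<dots> = complex_of_real (corr j m')"
      unfolding corr_Suc[OF j, of m'] of_real_sum[symmetric] sum_distrib_left[symmetric] by simp
    finally show "(LINT z|\<nu>. z powi m') = (LINT z|?\<rho>. z powi m')" unfolding \<nu>(2) by simp
  qed
qed

lemma riesz_trig: assumes j: "1 \<le> j" shows "trig (int (h (Suc j)) - int (h j)) (\<lambda>z. complex_of_real ((norm (riesz j z))\<^sup>2))"
proof -
  let ?a = "complex_of_real (1 / sqrt (real (r j))) * cnj (complex_of_real (1 / sqrt (real (r j))))"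
  have "trig (int (h (Suc j)) - int (h j)) (\<lambda>z. \<Sum>i\<in>{1..r j}. \<Sum>k\<in>{1..r j}. ?a * z powi (int (pos j i) - int (pos j k)))"
  proof (intro trig_sum trig_monom)
    fix i k assume "i \<in> {1..r j}" "k \<in> {1..r j}"
    then show "\<bar>int (pos j i) - int (pos j k)\<bar> \<le> int (h (Suc j)) - int (h j)"
      using pos_top[OF j, of i] pos_top[OF j, of k] by auto
  qed (use h_mono[OF j, of "Suc j"] in auto)
  then show ?thesis
  proof (rule trig_cong)
    fix z :: complex assume "z \<in> circle"
    then show "(\<Sum>i\<in>{1..r j}. \<Sum>k\<in>{1..r j}. ?a * z powi (int (pos j i) - int (pos j k))) = complex_of_real ((norm (riesz j z))\<^sup>2)"
      unfolding riesz_def complex_norm_square by (rule polyn_product[symmetric])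
  qed
qed

text \<open>The degrees telescope: any product of factors from stages j0 to l - 1 has degree at most
  h l - h j0 < h l, so the factor of stage l enters only through its mean 1. The set N selects
  arbitrary stages.\<close>

lemma riesz_product_mean:
  assumes j0: "1 \<le> j0" "j0 \<le> l"
  shows "trig (int (h l) - int (h j0)) (\<lambda>z. complex_of_real (\<Prod>j\<in>N \<inter> {j0..<l}. (norm (riesz j z))\<^sup>2)) \<and>
    (LINT z|circle_lebesgue. (\<Prod>j\<in>N \<inter> {j0..<l}. (norm (riesz j z))\<^sup>2)) = 2 * pi"
  using j0(2)
proof (induction l rule: dec_induct)
  case base
  show ?case using circle_lebesgue_const[of 1] trig_const[of 0 1] by simp
next
  case (step l)
  then have l: "1 \<le> l" using j0 by simp
  let ?F = "\<lambda>z. \<Prod>j\<in>N \<inter> {j0..<l}. (norm (riesz j z))\<^sup>2"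
  from step have F: "trig (int (h l) - int (h j0)) (\<lambda>z. complex_of_real (?F z))" "(LINT z|circle_lebesgue. ?F z) = 2 * pi"
    by auto
  have hm: "h j0 \<le> h l" "h l \<le> h (Suc l)" using h_mono[OF j0(1), of l] h_mono[OF l, of "Suc l"] step by auto
  show ?case
  proof (cases "l \<in> N")
    case True
    have "N \<inter> {j0..<Suc l} = insert l (N \<inter> {j0..<l})" using True step by auto
    then have e: "(\<Prod>j\<in>N \<inter> {j0..<Suc l}. (norm (riesz j z))\<^sup>2) = ?F z * (norm (riesz l z))\<^sup>2" for z
      by (simp add: mult.commute)
    have "trig (int (h l) - int (h j0) + (int (h (Suc l)) - int (h l))) (\<lambda>z. complex_of_real (?F z) * complex_of_real ((norm (riesz l z))\<^sup>2))"
      by (rule trig_mult[OF F(1) riesz_trig[OF l]]) (use hm in auto)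
    moreover have "(LINT z|circle_lebesgue. ?F z * (norm (riesz l z))\<^sup>2) = 2 * pi"
      using riesz_norm_integral[OF l F(1)] F(2) h_pos[OF j0(1)] by simp
    ultimately show ?thesis unfolding e by simp
  next
    case False
    then have "N \<inter> {j0..<Suc l} = N \<inter> {j0..<l}" by (auto simp: less_Suc_eq)
    then show ?thesis using F hm trig_mono[OF F(1), of "int (h (Suc l)) - int (h j0)"] by simp
  qed
qed

text \<open>Bourgain's argument: \<open>\<nu>\<close> has the density \<open>Q\<^sup>2 R\<^sup>2\<close> with respect to a later member of the family, where
  \<open>Q\<close> is the product over \<open>N\<close> and \<open>R\<^sup>2\<close> has mean one, so \<open>\<nu>\<close> gives little mass to the set where \<open>Q\<close> is small,
  while \<open>Q\<close> is small on most of the circle.\<close>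

lemma singular_power_1:
  assumes j0: "1 \<le> j0" and r: "filterlim r at_top sequentially" and h: "filterlim h at_top sequentially"
    and \<nu>: "\<And>j. j0 \<le> j \<Longrightarrow> finite_circle_measure (\<nu> j)" "\<And>j. j0 \<le> j \<Longrightarrow> prob_space (\<nu> j)"
    and coef: "\<And>j m. j0 \<le> j \<Longrightarrow> (LINT z|\<nu> j. z powi m) = complex_of_real (corr j m)"
  shows "mutually_singular circle_lebesgue (\<nu> j0)"
proof (rule mutually_singular_circleI[OF \<nu>(1)[OF order_refl]])
  fix \<epsilon> :: real assume e: "0 < \<epsilon>"
  \<comment> \<open>Where Q \<le> \<delta> the mass of \<open>\<nu> j0\<close> is at most \<delta>^2
    \<le> \<epsilon>; elsewhere Markov's inequality divides the mean \<delta> * \<epsilon> of Q by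
    \<delta>.\<close>
  define \<delta> where "\<delta> = min 1 \<epsilon>"
  have \<delta>: "0 < \<delta>" "\<delta> \<le> 1" "\<delta> \<le> \<epsilon>" unfolding \<delta>_def using e by auto
  obtain N where N: "finite N" "N \<subseteq> {j0..}" "(LINT z|circle_lebesgue. (\<Prod>j\<in>N. norm (riesz j z))) \<le> \<delta> * \<epsilon>"
    using riesz_product_small[OF r h, of "\<delta> * \<epsilon>" j0] \<delta> e by auto
  define Q where "Q z = (\<Prod>j\<in>N. norm (riesz j z))" for z
  have cQ: "continuous_on A Q" for A unfolding Q_def by (intro continuous_intros riesz_continuous)
  have Q0: "0 \<le> Q z" for z unfolding Q_def by (intro prod_nonneg) auto
  define l where "l = Suc (Max (insert j0 N))"
  have l: "j0 \<le> l" "N \<subseteq> {j0..<l}"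
    using N(1,2) Max_ge[of "insert j0 N"] unfolding l_def by (auto simp: le_imp_less_Suc le_SucI)
  define R where "R z = (\<Prod>j\<in>(- N) \<inter> {j0..<l}. (norm (riesz j z))\<^sup>2)" for z
  have cR: "continuous_on A R" for A unfolding R_def by (intro continuous_intros riesz_continuous)
  have R0: "0 \<le> R z" for z unfolding R_def by (intro prod_nonneg) auto
  have QR: "(\<Prod>j\<in>{j0..<l}. (norm (riesz j z))\<^sup>2) = (Q z)\<^sup>2 * R z" for z
  proof -
    have "{j0..<l} = N \<union> ((- N) \<inter> {j0..<l})" using l(2) by auto
    then have "(\<Prod>j\<in>{j0..<l}. (norm (riesz j z))\<^sup>2) = (\<Prod>j\<in>N. (norm (riesz j z))\<^sup>2) * R z"
      unfolding R_def using N(1) by (subst prod.union_disjoint[symmetric]) auto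
    then show ?thesis unfolding Q_def by (simp add: prod_power_distrib)
  qed
  have dens: "\<nu> j0 = density (\<nu> k) (\<lambda>z. ennreal (\<Prod>j\<in>{j0..<k}. (norm (riesz j z))\<^sup>2))" if "j0 \<le> k" for k
    using that
  proof (induction k rule: dec_induct)
    case base
    show ?case by (simp add: density_1)
  next
    case (step k)
    have k: "1 \<le> k" "j0 \<le> Suc k" using j0 step by auto
    have m: "(\<lambda>z. ennreal ((norm (riesz k z))\<^sup>2)) \<in> borel_measurable (\<nu> (Suc k))"
      "(\<lambda>z. ennreal (\<Prod>j\<in>{j0..<k}. (norm (riesz j z))\<^sup>2)) \<in> borel_measurable (\<nu> (Suc k))"
      by (intro measurable_compose[OF _ measurable_ennreal] circle_measurable[OF \<nu>(1)[OF k(2)]] continuous_intros riesz_continuous)+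
    have "\<nu> j0 = density (density (\<nu> (Suc k)) (\<lambda>z. ennreal ((norm (riesz k z))\<^sup>2))) (\<lambda>z. ennreal (\<Prod>j\<in>{j0..<k}. (norm (riesz j z))\<^sup>2))"
      using step riesz_density[OF k(1) \<nu>(1)[OF step(1)] coef[OF step(1)] \<nu>(1)[OF k(2)] coef[OF k(2)]] by simp
    also have "\<dots> = density (\<nu> (Suc k)) (\<lambda>z. ennreal (\<Prod>j\<in>{j0..<Suc k}. (norm (riesz j z))\<^sup>2))"
      unfolding density_density_eq[OF m] using step
      by (simp add: ennreal_mult[symmetric] prod_nonneg mult.commute)
    finally show ?case .
  qed
  \<comment> \<open>R has degree below h l, and the correlations of stage l vanish at nonzero times
    below h l, so \<open>\<nu> l\<close> integrates R like normalised Lebesgue measure.\<close>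
  have meanR: "(LINT z|\<nu> l. R z) = 1"
  proof -
    have t: "trig (int (h l) - int (h j0)) (\<lambda>z. complex_of_real (R z))" "(LINT z|circle_lebesgue. R z) = 2 * pi"
      using riesz_product_mean[OF j0 l(1), of "- N"] unfolding R_def by auto
    have "(LINT z|circle_lebesgue. complex_of_real (R z)) = 2 * pi * (LINT z|\<nu> l. complex_of_real (R z))"
    proof (rule trig_integral_mean[OF \<nu>[OF l(1)] t(1)])
      fix m :: int assume m: "m \<noteq> 0" "\<bar>m\<bar> \<le> int (h l) - int (h j0)"
      have "corr l m = 0" using m h_pos[OF j0] j0 l by (intro corr_zero_small) auto
      then show "(LINT z|\<nu> l. z powi m) = 0" unfolding coef[OF l(1)] by simp
    qed
    then have "2 * pi = 2 * pi * (LINT z|\<nu> l. R z)"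
      unfolding integral_complex_of_real t(2) of_real_mult[symmetric] of_real_eq_iff
      by (metis of_real_eq_iff of_real_mult of_real_numeral)
    then show ?thesis by simp
  qed
  define A where "A = {z \<in> circle. Q z \<le> \<delta>}"
  have A: "A \<in> sets circle_borel"
  proof -
    have "closed A" unfolding A_def Collect_conj_eq Collect_mem_eq by (intro closed_Int closed_Collect_le closed_sphere cQ continuous_on_const)
    then show ?thesis unfolding sets_circle_borel A_def by auto
  qed
  note spl = finite_circle_measureD[OF \<nu>(1)[OF l(1)]]
  interpret L: prob_space "\<nu> l" by (rule \<nu>(2)[OF l(1)])
  have "emeasure (\<nu> j0) A = (\<integral>\<^sup>+z. ennreal ((Q z)\<^sup>2 * R z) * indicator A z \<partial>\<nu> l)"
    unfolding dens[OF l(1)] QR using A spl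
    by (intro emeasure_density measurable_compose[OF _ measurable_ennreal] circle_measurable[OF \<nu>(1)[OF l(1)]] continuous_intros cQ cR) auto
  also have "\<dots> \<le> (\<integral>\<^sup>+z. ennreal (\<delta>\<^sup>2 * R z) \<partial>\<nu> l)"
  proof (intro nn_integral_mono)
    fix z
    show "ennreal ((Q z)\<^sup>2 * R z) * indicator A z \<le> ennreal (\<delta>\<^sup>2 * R z)"
    proof (cases "z \<in> A")
      case True
      then have "Q z \<le> \<delta>" unfolding A_def by simp
      then have "(Q z)\<^sup>2 * R z \<le> \<delta>\<^sup>2 * R z" using Q0 R0 by (intro mult_right_mono power_mono)
      then show ?thesis using True by (simp add: ennreal_leI)
    qed simp
  qed
  also have "\<dots> = ennreal (LINT z|\<nu> l. \<delta>\<^sup>2 * R z)"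
    using R0 by (intro nn_integral_eq_integral circle_integrable[OF \<nu>(1)[OF l(1)]] continuous_intros cR) auto
  also have "\<dots> = ennreal (\<delta>\<^sup>2)" using meanR by simp
  finally have "measure (\<nu> j0) A \<le> \<delta>\<^sup>2" by (simp add: measure_def enn2real_leI)
  also have "\<dots> \<le> \<epsilon>" using \<delta> mult_mono[of \<delta> 1 \<delta> \<epsilon>] by (simp add: power2_eq_square)
  finally have 1: "measure (\<nu> j0) A \<le> \<epsilon>" .
  have cA: "circle - A \<in> sets circle_borel" using A unfolding sets_circle_borel by auto
  have "measure circle_lebesgue (circle - A) \<le> (LINT z|circle_lebesgue. Q z) / \<delta>"
    by (rule circle_markov[OF circle_lebesgue_base(1) cQ Q0 cA \<delta>(1)]) (auto simp: A_def)
  also have "\<dots> \<le> \<epsilon>" using N(3) \<delta>(1) unfolding Q_def by (simp add: field_simps)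
  finally show "\<exists>A\<in>sets circle_borel. measure (\<nu> j0) A \<le> \<epsilon> \<and> measure circle_lebesgue (circle - A) \<le> \<epsilon>"
    using A 1 by blast
qed

end

section \<open>Tensor powers\<close>

text \<open>Positivity holds because the double sum is the squared norm of the sum over k < N of
  z^(-k) U^k f.\<close>

lemma (in measure_automorphism) spectral_measure_exists:
  assumes f: "f \<in> L2 M" and norm: "sqnorm M f = 1"
  shows "\<exists>\<nu>. prob_space \<nu> \<and> is_spectral_measure M S f \<nu>"
proof -
  define a where "a m = L2_inner M (\<lambda>x. f (act m x)) f" for m
  have "\<exists>\<nu>. finite_circle_measure \<nu> \<and> prob_space \<nu> \<and> (\<forall>m. (LINT z|\<nu>. z powi m) = a m)"
  proof (rule herglotz)
    show "a 0 = 1" unfolding a_def act_0 L2_inner_self norm by simp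
    fix N :: nat and z :: complex assume z: "z \<in> circle"
    define g where "g x = (\<Sum>k<N. z powi (- int k) * f (act (int k) x))" for x
    have gL: "(\<lambda>x. z powi (- int k) * f (act (int k) x)) \<in> L2 M" for k
      by (intro L2_cmult L2_act f)
    have g: "g \<in> L2 M" unfolding g_def by (intro L2_sum gL)
    have "(\<Sum>k<N. \<Sum>l<N. a (int k - int l) * z powi (int l - int k)) =
        (\<Sum>k<N. \<Sum>l<N. L2_inner M (\<lambda>x. z powi (- int k) * f (act (int k) x)) (\<lambda>x. z powi (- int l) * f (act (int l) x)))"
    proof (intro sum.cong refl)
      fix k l
      have "z powi (int l - int k) = z powi (- int k) * cnj (z powi (- int l))"
        unfolding cnj_powi_circle[OF z] powi_circle_mult[OF z] by simp
      then show "a (int k - int l) * z powi (int l - int k) =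
          L2_inner M (\<lambda>x. z powi (- int k) * f (act (int k) x)) (\<lambda>x. z powi (- int l) * f (act (int l) x))"
        unfolding L2_inner_cmult_left L2_inner_cmult_right L2_inner_shift[OF f f] a_def by (simp only: mult_ac)
    qed
    also have "\<dots> = (\<Sum>k<N. L2_inner M (\<lambda>x. z powi (- int k) * f (act (int k) x)) g)"
      unfolding g_def by (intro sum.cong refl L2_inner_sum_right[symmetric] gL)
    also have "\<dots> = L2_inner M g g"
      unfolding g_def[of _, abs_def] by (intro L2_inner_sum_left[symmetric] gL g[unfolded g_def])
    finally show "\<exists>x\<ge>0. (\<Sum>k<N. \<Sum>l<N. a (int k - int l) * z powi (int l - int k)) = complex_of_real x"
      unfolding L2_inner_self by (intro exI[of _ "sqnorm M g"] conjI sqnorm_nonneg)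
  qed
  then show ?thesis
    unfolding is_spectral_measure_def koopman_power_def a_def o_def by blast
qed

lemma space_tensor: "space (tensor_space n M) = PiE {..<n} (\<lambda>_. space M)"
  unfolding tensor_space_def by (rule space_PiM)

lemma sets_tensor_PiE: "(\<And>a. a < n \<Longrightarrow> A a \<in> sets M) \<Longrightarrow> PiE {..<n} A \<in> sets (tensor_space n M)"
  unfolding tensor_space_def by (intro sets_PiM_I_finite) auto

lemma (in sigma_finite_measure) emeasure_tensor_PiE:
  "(\<And>a. a < n \<Longrightarrow> A a \<in> sets M) \<Longrightarrow> emeasure (tensor_space n M) (PiE {..<n} A) = (\<Prod>a<n. emeasure M (A a))"
proof -
  interpret product_sigma_finite "\<lambda>_. M" by (simp add: product_sigma_finite_def sigma_finite_measure_axioms)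
  assume "\<And>a. a < n \<Longrightarrow> A a \<in> sets M"
  then show ?thesis unfolding tensor_space_def by (intro emeasure_PiM) auto
qed

lemma (in sigma_finite_measure) measure_tensor_PiE:
  assumes "\<And>a. a < n \<Longrightarrow> A a \<in> sets M" "\<And>a. a < n \<Longrightarrow> emeasure M (A a) < \<infinity>"
  shows "emeasure (tensor_space n M) (PiE {..<n} A) = ennreal (\<Prod>a<n. measure M (A a))"
    "measure (tensor_space n M) (PiE {..<n} A) = (\<Prod>a<n. measure M (A a))"
proof -
  have "emeasure (tensor_space n M) (PiE {..<n} A) = (\<Prod>a<n. emeasure M (A a))"
    by (rule emeasure_tensor_PiE) (rule assms(1))
  also have "\<dots> = (\<Prod>a<n. ennreal (measure M (A a)))"
  proof (intro prod.cong refl emeasure_eq_ennreal_measure)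
    fix a assume "a \<in> {..<n}"
    then show "emeasure M (A a) \<noteq> top" using assms(2)[of a] by simp
  qed
  also have "\<dots> = ennreal (\<Prod>a<n. measure M (A a))" by (intro prod_ennreal) auto
  finally show *: "emeasure (tensor_space n M) (PiE {..<n} A) = ennreal (\<Prod>a<n. measure M (A a))" .
  then show "measure (tensor_space n M) (PiE {..<n} A) = (\<Prod>a<n. measure M (A a))"
    by (intro measure_eq_emeasure_eq_ennreal prod_nonneg) auto
qed

context measure_automorphism
begin

lemma tensor_act_space: "x \<in> space (tensor_space n M) \<Longrightarrow> tensor_power n (act m) x \<in> space (tensor_space n M)"
  unfolding space_tensor tensor_power_def by (auto simp: PiE_iff act_space)

lemma tensor_act_measurable: "tensor_power n (act m) \<in> measurable (tensor_space n M) (tensor_space n M)"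
  unfolding tensor_power_def tensor_space_def by measurable

lemma tensor_act_add:
  "x \<in> space (tensor_space n M) \<Longrightarrow> tensor_power n (act m) (tensor_power n (act k) x) = tensor_power n (act (m + k)) x"
  unfolding space_tensor tensor_power_def by (auto simp: PiE_iff act_add intro!: restrict_ext)

lemma tensor_act_0: "x \<in> space (tensor_space n M) \<Longrightarrow> tensor_power n (act 0) x = x"
  unfolding space_tensor tensor_power_def by (auto simp: fun_eq_iff PiE_iff extensional_def)

lemma tensor_act_1: "tensor_power n S = tensor_power n (act 1)"
  using act_nat[of 1] by simp

lemma tensor_automorphism:
  assumes "sigma_finite_measure M"
  shows "automorphism (tensor_space n M) (tensor_power n S)"
proof -
  interpret sigma_finite_measure M by fact
  let ?N = "tensor_space n M"
  let ?R = "tensor_power n (act (-1))"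
  have bij: "bij_betw (tensor_power n S) (space ?N) (space ?N)"
    unfolding tensor_act_1
    by (rule bij_betw_byWitness[of _ ?R]) (auto simp: tensor_act_add tensor_act_0 tensor_act_space)
  have inv: "inv_into (space ?N) (tensor_power n S) x = ?R x" if x: "x \<in> space ?N" for x
  proof -
    have "tensor_power n S (?R x) = x" unfolding tensor_act_1 using x by (simp add: tensor_act_add tensor_act_0)
    then show ?thesis
      using inv_into_f_f[OF bij_betw_imp_inj_on[OF bij] tensor_act_space[OF x, of "-1"]] by simp
  qed
  have "inv_into (space ?N) (tensor_power n S) \<in> measurable ?N ?N"
    using tensor_act_measurable[of n "-1"] by (subst measurable_cong[OF inv])
  moreover have "distr ?N ?N (tensor_power n S) = ?N"
    unfolding tensor_act_1
  proof -
    interpret product_sigma_finite "\<lambda>_. M" by (simp add: product_sigma_finite_def sigma_finite_measure_axioms)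
    have "distr ?N ?N (tensor_power n (act 1)) = PiM {..<n} (\<lambda>_. M)"
    proof (rule PiM_eqI)
      show "sets (distr ?N ?N (tensor_power n (act 1))) = sets (PiM {..<n} (\<lambda>_. M))"
        by (simp add: tensor_space_def)
      fix A assume A: "\<And>i. i \<in> {..<n} \<Longrightarrow> A i \<in> sets M"
      have sub: "A i \<subseteq> space M" if "i < n" for i using sets.sets_into_space[OF A] that by simp
      have "emeasure (distr ?N ?N (tensor_power n (act 1))) (PiE {..<n} A) =
          emeasure ?N (tensor_power n (act 1) -` PiE {..<n} A \<inter> space ?N)"
        using A by (intro emeasure_distr tensor_act_measurable sets_tensor_PiE) auto
      also have "tensor_power n (act 1) -` PiE {..<n} A \<inter> space ?N = PiE {..<n} (\<lambda>i. act (-1) ` A i)"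
        using sub unfolding space_tensor tensor_power_def by (auto simp: PiE_iff act_image)
      also have "emeasure ?N \<dots> = (\<Prod>i<n. emeasure M (act (-1) ` A i))"
        using A by (intro emeasure_tensor_PiE act_image_sets) auto
      also have "\<dots> = (\<Prod>i<n. emeasure M (A i))"
        using A by (intro prod.cong refl emeasure_act_image) auto
      finally show "emeasure (distr ?N ?N (tensor_power n (act 1))) (PiE {..<n} A) = (\<Prod>i<n. emeasure M (A i))" .
    qed simp
    then show "distr ?N ?N (tensor_power n (act 1)) = ?N" unfolding tensor_space_def .
  qed
  ultimately show ?thesis
    unfolding automorphism_def using bij tensor_act_measurable[of n 1] unfolding tensor_act_1 by blast
qed

text \<open>Induction covers the nonnegative powers. A negative power is then recognised by
  cancelling it with its inverse, which avoids the inverse of the product map.\<close>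

lemma tensor_iterate:
  assumes "sigma_finite_measure M" and x: "x \<in> space (tensor_space n M)"
  shows "int_iterate (space (tensor_space n M)) (tensor_power n S) m x = tensor_power n (act m) x"
proof -
  interpret N: measure_automorphism "tensor_space n M" "tensor_power n S"
    by standard (rule tensor_automorphism[OF assms(1)])
  have nat: "N.act (int k) y = tensor_power n (act (int k)) y" if y: "y \<in> space (tensor_space n M)" for k y
  proof (induction k)
    case 0
    show ?case unfolding of_nat_0 N.act_0 tensor_act_0[OF y] ..
  next
    case (Suc k)
    have "N.act (int (Suc k)) y = tensor_power n S (N.act (int k) y)" unfolding N.act_nat by simp
    also have "\<dots> = tensor_power n (act (1 + int k)) y"
      unfolding Suc unfolding tensor_act_1 using y by (rule tensor_act_add)
    finally show ?case by simp
  qed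
  show ?thesis
  proof (cases "0 \<le> m")
    case True
    then show ?thesis using nat[OF x, of "nat m"] by simp
  next
    case False
    let ?y = "tensor_power n (act m) x"
    have y: "?y \<in> space (tensor_space n M)" by (rule tensor_act_space[OF x])
    have "N.act (- m) ?y = tensor_power n (act (- m)) ?y" using nat[OF y, of "nat (- m)"] False by simp
    also have "\<dots> = x" using x by (simp add: tensor_act_add tensor_act_0)
    finally have "N.act m x = N.act m (N.act (- m) ?y)" by simp
    then show ?thesis using y by simp
  qed
qed

end

sublocale rank_one_construction \<subseteq> sigma_finite_measure "lebesgue_space X"
  unfolding lebesgue_space_def
  by (intro sigma_finite_measure_restrict_space sigma_finite_lborel) (simp add: space_borel)

section \<open>Boxes of levels in the product space\<close>

context rank_one_construction
begin

abbreviation tensor :: "nat \<Rightarrow> (nat \<Rightarrow> real) measure" where "tensor n \<equiv> tensor_space n M"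

lemma tensor_locale: "measure_automorphism (tensor n) (tensor_power n T)"
  by standard (rule tensor_automorphism[OF sigma_finite_measure_axioms])

lemma tensor_tr: "x \<in> space (tensor n) \<Longrightarrow>
    int_iterate (space (tensor n)) (tensor_power n T) m x = tensor_power n (tr m) x"
  using tensor_iterate[OF sigma_finite_measure_axioms] by (simp add: tr_def)

lemma space_tensorX: "space (tensor n) = PiE {..<n} (\<lambda>_. X)"
  by (simp add: space_tensor)

definition box :: "nat \<Rightarrow> nat \<Rightarrow> (nat \<Rightarrow> int) \<Rightarrow> (nat \<Rightarrow> real) set" where
  "box n j k = PiE {..<n} (\<lambda>a. lv j (k a))"

text \<open>All coordinates use the same stage. The starting stage j1 allows the finitely many early
  stages, where r j or h j may be small, to be ignored.\<close>

definition boxes :: "nat \<Rightarrow> nat \<Rightarrow> (nat \<Rightarrow> real) set set" where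
  "boxes n j1 = (\<Union>j\<in>{j1..}. box n j ` PiE {..<n} (\<lambda>_. {0..<int (h j)}))"

lemma boxesE:
  assumes "q \<in> boxes n j1"
  obtains j k where "j1 \<le> j" "\<And>a. a < n \<Longrightarrow> 0 \<le> k a \<and> k a < int (h j)" "q = box n j k"
proof -
  from assms obtain j k where "j1 \<le> j" "k \<in> PiE {..<n} (\<lambda>_. {0..<int (h j)})" "q = box n j k"
    unfolding boxes_def by blast
  then show ?thesis by (intro that[of j k]) (auto simp: PiE_iff)
qed

lemma box_boxes:
  assumes "j1 \<le> j" "\<And>a. a < n \<Longrightarrow> 0 \<le> k a \<and> k a < int (h j)"
  shows "box n j k \<in> boxes n j1"
proof -
  have "box n j k = box n j (restrict k {..<n})" unfolding box_def by (intro PiE_cong) auto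
  moreover have "restrict k {..<n} \<in> PiE {..<n} (\<lambda>_. {0..<int (h j)})" using assms by auto
  ultimately show ?thesis using assms(1) unfolding boxes_def by blast
qed

lemma countable_boxes: "countable (boxes n j1)"
  unfolding boxes_def by (intro countable_UN countableI_type countable_image countable_finite[OF finite_PiE]) auto

lemma box_sets: "1 \<le> j \<Longrightarrow> box n j k \<in> sets (tensor n)"
  unfolding box_def by (intro sets_tensor_PiE lv_sets)

lemma box_measure:
  assumes "1 \<le> j" shows "emeasure (tensor n) (box n j k) = ennreal (eps j ^ n)"
  unfolding box_def using measure_tensor_PiE(1)[of n "\<lambda>a. lv j (k a)"] lv_sets[OF assms] lv_measure[OF assms] by simp

text \<open>The coordinates factorise, and each factor depends only on m. So the levels k do not
  matter, and one measure per stage describes all boxes of that stage.\<close>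

lemma box_correlation:
  assumes j: "1 \<le> j"
  shows "L2_inner (tensor n) (\<lambda>x. indicator (box n j k) (int_iterate (space (tensor n)) (tensor_power n T) m x)) (indicator (box n j k)) =
    complex_of_real (eps j ^ n * corr j m ^ n)"
proof -
  let ?D = "PiE {..<n} (\<lambda>a. lv j (k a - m) \<inter> lv j (k a))"
  have D: "lv j (k a - m) \<inter> lv j (k a) \<in> sets M" "emeasure M (lv j (k a - m) \<inter> lv j (k a)) < \<infinity>" for a
  proof -
    show "lv j (k a - m) \<inter> lv j (k a) \<in> sets M" by (intro sets.Int lv_sets j)
    have "emeasure M (lv j (k a - m) \<inter> lv j (k a)) \<le> emeasure M (lv j (k a))" by (intro emeasure_mono lv_sets j) auto
    then show "emeasure M (lv j (k a - m) \<inter> lv j (k a)) < \<infinity>"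
      using lv_measure(1)[OF j, of "k a"] by (simp add: le_less_trans)
  qed
  have "L2_inner (tensor n) (\<lambda>x. indicator (box n j k) (int_iterate (space (tensor n)) (tensor_power n T) m x)) (indicator (box n j k)) =
      (LINT x|tensor n. complex_of_real (indicator ?D x))"
    unfolding L2_inner_def
  proof (rule Bochner_Integration.integral_cong)
    fix x assume x: "x \<in> space (tensor n)"
    have "tensor_power n (tr m) x \<in> box n j k \<and> x \<in> box n j k \<longleftrightarrow> x \<in> ?D"
      using x mem_lv_shift[OF j] unfolding box_def space_tensorX tensor_power_def by (auto simp: PiE_iff)
    then show "indicator (box n j k) (int_iterate (space (tensor n)) (tensor_power n T) m x) * cnj (indicator (box n j k) x) =
        complex_of_real (indicator ?D x)"
      unfolding tensor_tr[OF x] by (auto split: split_indicator)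
  qed simp
  also have "\<dots> = complex_of_real (measure (tensor n) ?D)"
    unfolding integral_complex_of_real using sets_tensor_PiE[of n "\<lambda>a. lv j (k a - m) \<inter> lv j (k a)" M] D(1)
    by (simp add: sets.Int_space_eq2)
  also have "measure (tensor n) ?D = (\<Prod>a<n. measure M (lv j (k a - m) \<inter> lv j (k a)))"
    by (rule measure_tensor_PiE(2)) (rule D)+
  also have "\<dots> = (\<Prod>a<n. eps j * corr j m)"
    using measure_lv_Int[OF j, of "k a - m" "k a" for a] measure_E_inter[OF j, of m] by simp
  finally show ?thesis by (simp add: power_mult_distrib)
qed

lemma lv_nested:
  assumes j: "1 \<le> j" "j \<le> j'" and k: "0 \<le> k" "k < int (h j)" "0 \<le> k'" "k' < int (h j')"
    and x: "x \<in> lv j k" "x \<in> lv j' k'"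
  shows "lv j' k' \<subseteq> lv j k"
proof -
  obtain L where L: "L \<subseteq> {0..<int (h j')}" "finite L" "lv j k = (\<Union>k\<in>L. lv j' k)"
    using levelset_mono[OF j(1) levelset_lv[OF k(1,2)] j(2)] by (rule levelsetE)
  have "k' \<in> L" by (rule lv_levelset[OF _ L(3) L(1) x k(3,4)]) (use j in simp)
  then show ?thesis unfolding L(3) by blast
qed

text \<open>Boxes with a common point are nested, coordinate by coordinate, since each level is a
  union of levels of any later stage.\<close>

lemma boxes_Int:
  assumes j1: "1 \<le> j1" and q: "q \<in> boxes n j1" "q' \<in> boxes n j1" "q \<inter> q' \<noteq> {}"
  shows "q \<inter> q' \<in> boxes n j1"
proof -
  obtain j k where jk: "j1 \<le> j" "\<And>a. a < n \<Longrightarrow> 0 \<le> k a \<and> k a < int (h j)" "q = box n j k" using q(1) by (rule boxesE) blast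
  obtain j' k' where jk': "j1 \<le> j'" "\<And>a. a < n \<Longrightarrow> 0 \<le> k' a \<and> k' a < int (h j')" "q' = box n j' k'" using q(2) by (rule boxesE) blast
  obtain x where x: "x \<in> box n j k" "x \<in> box n j' k'" using q(3) jk jk' by blast
  have sub: "box n i' l' \<subseteq> box n i l" if "j1 \<le> i" "i \<le> i'" "\<And>a. a < n \<Longrightarrow> 0 \<le> l a \<and> l a < int (h i)"
    "\<And>a. a < n \<Longrightarrow> 0 \<le> l' a \<and> l' a < int (h i')" "x \<in> box n i l" "x \<in> box n i' l'" for i i' l l'
    unfolding box_def
  proof (rule PiE_mono)
    fix a assume "a \<in> {..<n}"
    then show "lv i' (l' a) \<subseteq> lv i (l a)"
      using that j1 by (intro lv_nested[of i i' _ _ "x a"]) (auto simp: box_def PiE_iff)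
  qed
  have "q \<inter> q' = q \<or> q \<inter> q' = q'"
  proof (cases "j \<le> j'")
    case True
    then show ?thesis using sub[of j j' k k'] jk jk' x by blast
  next
    case False
    then show ?thesis using sub[of j' j k' k] jk jk' x by fastforce
  qed
  then show ?thesis using q by metis
qed

text \<open>Here it matters that levels are intervals and not merely sets of small measure: boxes
  become small in diameter.\<close>

lemma lv_close:
  assumes j: "1 \<le> j" and k: "0 \<le> k" "k < int (h j)" and xy: "x \<in> lv j k" "y \<in> lv j k"
  shows "\<bar>x - y\<bar> < eps j"
proof -
  obtain l where l: "\<forall>k<h j. half_interval X l ((T ^^ k) ` E j)" using levels[OF j] by auto
  have hi: "half_interval X l (lv j k)"
    using l lv_nat[of j "nat k"] k by (auto simp: nat_less_iff)
  then have "l = eps j" using half_interval_measure(3)[OF hi] lv_measure(2)[OF j, of k] by simp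
  moreover obtain a where "lv j k = X \<inter> {a..<a + l}" using hi unfolding half_interval_def by auto
  ultimately show ?thesis using xy by auto
qed

lemma eps_tendsto:
  assumes r: "filterlim r at_top sequentially" and e: "0 < e"
  shows "eventually (\<lambda>j. eps j < e) sequentially"
proof -
  have le: "eps j \<le> eps 1" if "1 \<le> j" for j
    using that
  proof (induction j rule: dec_induct)
    case (step j)
    have "eps (Suc j) * 1 \<le> eps (Suc j) * real (r j)"
      using cuts_pos[of j] step by (intro mult_left_mono) auto
    then show ?case using eps_Suc[of j] step by (simp add: mult.commute)
  qed simp
  have "eventually (\<lambda>j. nat \<lceil>eps 1 / e\<rceil> + 1 \<le> r j \<and> 1 \<le> j) sequentially"
    using r by (intro eventually_conj eventually_ge_at_top) (auto simp: filterlim_at_top)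
  then have "eventually (\<lambda>j. eps (Suc j) < e) sequentially"
  proof eventually_elim
    case (elim j)
    have "eps 1 / e < real (r j)" using elim by linarith
    then have "eps 1 < e * real (r j)" using e by (simp add: field_simps)
    moreover have "real (r j) * eps (Suc j) \<le> eps 1" using le[of j] eps_Suc[of j] elim by simp
    ultimately have "real (r j) * eps (Suc j) < real (r j) * e" by (simp only: mult.commute)
    then show "eps (Suc j) < e" by (rule mult_left_less_imp_less) simp
  qed
  then show ?thesis using eventually_sequentially_Suc[of "\<lambda>j. eps j < e"] by simp
qed

lemma eventually_tow: assumes "x \<in> X" shows "eventually (\<lambda>j. x \<in> tow j) sequentially"
proof -
  obtain i where i: "1 \<le> i" "x \<in> tow i" using assms exhausts by auto
  show ?thesis
    unfolding eventually_sequentially using tow_mono[OF i(1)] i(2) by (intro exI[of _ i]) auto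
qed

lemma boxes_shrink:
  assumes r: "filterlim r at_top sequentially" and x: "x \<in> space (tensor n)" and e: "0 < e"
  shows "\<exists>q\<in>boxes n j1. x \<in> q \<and> (\<forall>y\<in>q. \<forall>a<n. \<bar>x a - y a\<bar> < e)"
proof -
  have "eventually (\<lambda>j. \<forall>a\<in>{..<n}. x a \<in> tow j) sequentially"
    using x by (intro eventually_ball_finite ballI eventually_tow) (auto simp: space_tensorX)
  then have "eventually (\<lambda>j. (\<forall>a\<in>{..<n}. x a \<in> tow j) \<and> eps j < e \<and> j1 \<le> j \<and> 1 \<le> j) sequentially"
    by (intro eventually_conj eventually_ge_at_top eps_tendsto r e)
  then obtain j where j: "\<And>a. a < n \<Longrightarrow> x a \<in> tow j" "eps j < e" "j1 \<le> j" "1 \<le> j"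
    unfolding eventually_sequentially by auto
  have "\<forall>a\<in>{..<n}. \<exists>k. 0 \<le> k \<and> k < int (h j) \<and> x a \<in> lv j k"
    using j(1) unfolding tow_eq by fastforce
  then obtain k where k: "\<And>a. a < n \<Longrightarrow> 0 \<le> k a \<and> k a < int (h j) \<and> x a \<in> lv j (k a)"
    unfolding bchoice_iff by auto
  have "x \<in> box n j k" unfolding box_def using k x by (auto simp: space_tensorX PiE_iff)
  moreover have "\<bar>x a - y a\<bar> < e" if "y \<in> box n j k" "a < n" for y a
  proof -
    have "\<bar>x a - y a\<bar> < eps j" using that k unfolding box_def by (intro lv_close[OF j(4), of "k a"]) (auto simp: PiE_iff)
    then show ?thesis using j(2) by simp
  qed
  ultimately show ?thesis using box_boxes[of j1 j n k] j(3) k by blast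
qed

text \<open>Small boxes around each point write the preimage of an open set under a coordinate as a
  union of boxes, and there are only countably many boxes.\<close>

lemma boxes_generate:
  assumes j1: "1 \<le> j1" and r: "filterlim r at_top sequentially"
  shows "sets (tensor n) = sigma_sets (space (tensor n)) (boxes n j1)"
proof
  let ?\<Omega> = "space (tensor n)"
  have bs: "boxes n j1 \<subseteq> sets (tensor n)"
    using boxesE[of _ n j1] box_sets[of _ n] j1 by (metis order_trans subsetI)
  then show "sigma_sets ?\<Omega> (boxes n j1) \<subseteq> sets (tensor n)" by (rule sets.sigma_sets_subset)
  have Pow: "boxes n j1 \<subseteq> Pow ?\<Omega>" using bs sets.space_closed by blast
  let ?N = "sigma ?\<Omega> (boxes n j1)"
  have sN: "space ?N = ?\<Omega>" "sets ?N = sigma_sets ?\<Omega> (boxes n j1)" using Pow by (simp_all add: space_measure_of sets_measure_of)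
  have restr: "f \<in> measurable N' M" if "f \<in> measurable N' (restrict_space lborel X)" for f :: "(nat \<Rightarrow> real) \<Rightarrow> real" and N'
    using that unfolding lebesgue_space_def .
  have "(\<lambda>x. x a) \<in> measurable ?N M" if a: "a \<in> {..<n}" for a
  proof (rule restr, rule measurable_restrict_space2)
    show "(\<lambda>x. x a) \<in> space ?N \<rightarrow> X" using a unfolding sN by (auto simp: space_tensorX)
    have "(\<lambda>x. x a) \<in> borel_measurable ?N"
    proof (rule borel_measurableI)
      fix U :: "real set" assume U: "open U"
      have "(\<lambda>x. x a) -` U \<inter> space ?N = \<Union>{q \<in> boxes n j1. q \<subseteq> {x. x a \<in> U}}"
      proof
        show "\<Union>{q \<in> boxes n j1. q \<subseteq> {x. x a \<in> U}} \<subseteq> (\<lambda>x. x a) -` U \<inter> space ?N" unfolding sN using Pow by blast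
        show "(\<lambda>x. x a) -` U \<inter> space ?N \<subseteq> \<Union>{q \<in> boxes n j1. q \<subseteq> {x. x a \<in> U}}"
        proof
          fix x assume "x \<in> (\<lambda>x. x a) -` U \<inter> space ?N"
          then have x: "x a \<in> U" "x \<in> ?\<Omega>" unfolding sN by auto
          obtain e where e: "0 < e" "\<And>y. dist y (x a) < e \<Longrightarrow> y \<in> U" using U x(1) unfolding open_dist by blast
          obtain q where q: "q \<in> boxes n j1" "x \<in> q" "\<And>y. y \<in> q \<Longrightarrow> \<bar>x a - y a\<bar> < e"
            using boxes_shrink[OF r x(2) e(1), of j1] a by auto
          then have "q \<subseteq> {x. x a \<in> U}" using e(2) by (auto simp: dist_real_def abs_minus_commute)
          then show "x \<in> \<Union>{q \<in> boxes n j1. q \<subseteq> {x. x a \<in> U}}" using q by blast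
        qed
      qed
      also have "\<dots> \<in> sets ?N"
      proof (rule sets.countable_Union)
        show "countable {q \<in> boxes n j1. q \<subseteq> {x. x a \<in> U}}" using countable_boxes by (rule countable_subset[rotated]) auto
        show "{q \<in> boxes n j1. q \<subseteq> {x. x a \<in> U}} \<subseteq> sets ?N" unfolding sN by auto
      qed
      finally show "(\<lambda>x. x a) -` U \<inter> space ?N \<in> sets ?N" .
    qed
    then show "(\<lambda>x. x a) \<in> measurable ?N lborel" by simp
  qed
  \<comment> \<open>The identity of the space, now measurable from the sigma-algebra of boxes to the
    product sigma-algebra; preimages under it are the sets themselves.\<close>
  then have id: "(\<lambda>x. \<lambda>a\<in>{..<n}. x a) \<in> measurable ?N (tensor n)"
    unfolding tensor_space_def by (rule measurable_restrict)
  show "sets (tensor n) \<subseteq> sigma_sets ?\<Omega> (boxes n j1)"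
  proof
    fix A assume A: "A \<in> sets (tensor n)"
    have "(\<lambda>x. \<lambda>a\<in>{..<n}. x a) -` A \<inter> space ?N = A"
      unfolding sN using sets.sets_into_space[OF A] by (auto simp: space_tensorX PiE_restrict subset_iff)
    then show "A \<in> sigma_sets ?\<Omega> (boxes n j1)" using measurable_sets[OF id A] unfolding sN by simp
  qed
qed

lemma boxes_test_sets:
  assumes j1: "1 \<le> j1" and r: "filterlim r at_top sequentially"
  shows "test_sets (tensor n) (boxes n j1) (from_nat_into (boxes n j1))"
  unfolding test_sets_def
proof (intro conjI allI impI)
  have ne: "boxes n j1 \<noteq> {}"
    using box_boxes[of j1 j1 n "\<lambda>_. 0"] h_pos[OF j1] by auto
  have rg: "range (from_nat_into (boxes n j1)) = boxes n j1" by (rule range_from_nat_into[OF ne countable_boxes])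
  then show "range (from_nat_into (boxes n j1)) \<subseteq> boxes n j1" by simp
  have bs: "q \<in> sets (tensor n)" if "q \<in> boxes n j1" for q
    using that by (rule boxesE) (use box_sets j1 in auto)
  show Pow: "boxes n j1 \<subseteq> Pow (space (tensor n))" using bs sets.sets_into_space by blast
  show "(\<Union>i. from_nat_into (boxes n j1) i) = space (tensor n)"
  proof
    show "(\<Union>i. from_nat_into (boxes n j1) i) \<subseteq> space (tensor n)" using rg Pow by blast
    show "space (tensor n) \<subseteq> (\<Union>i. from_nat_into (boxes n j1) i)"
      unfolding rg using boxes_shrink[OF r _ zero_less_one, of _ n j1] by blast
  qed
  show "q \<inter> q' \<in> boxes n j1" if "q \<in> boxes n j1" "q' \<in> boxes n j1" "q \<inter> q' \<noteq> {}" for q q'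
    by (rule boxes_Int[OF j1 that])
  show "sets (tensor n) = sigma_sets (space (tensor n)) (boxes n j1)" by (rule boxes_generate[OF j1 r])
  show "emeasure (tensor n) q < \<infinity>" if "q \<in> boxes n j1" for q
    using that by (rule boxesE) (use box_measure j1 in auto)
qed

lemma box_spectral_measure:
  assumes j: "1 \<le> j"
  shows "\<exists>\<nu>. finite_circle_measure \<nu> \<and> prob_space \<nu> \<and> (\<forall>m. (LINT z|\<nu>. z powi m) = complex_of_real (corr j m ^ n)) \<and>
    (\<exists>f\<in>L2 (tensor n). is_spectral_measure (tensor n) (tensor_power n T) f \<nu>)"
proof -
  interpret N: measure_automorphism "tensor n" "tensor_power n T" by (rule tensor_locale)
  let ?q = "box n j (\<lambda>_. 0)"
  let ?c = "complex_of_real (1 / sqrt (eps j ^ n))"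
  let ?f = "\<lambda>x. ?c * indicator ?q x"
  have ep: "0 < eps j ^ n" using eps_pos[OF j] by simp
  have q: "indicator ?q \<in> L2 (tensor n)" by (intro L2_indicator box_sets j) (simp add: box_measure[OF j])
  then have f: "?f \<in> L2 (tensor n)" by (rule L2_cmult)
  have cc: "?c * cnj ?c = complex_of_real (1 / eps j ^ n)"
    unfolding complex_cnj_complex_of_real of_real_mult[symmetric] using ep by simp
  have co: "L2_inner (tensor n) (\<lambda>x. ?f (N.act m x)) ?f = complex_of_real (corr j m ^ n)" for m
  proof -
    have "L2_inner (tensor n) (\<lambda>x. ?f (N.act m x)) ?f = (?c * cnj ?c) * L2_inner (tensor n) (\<lambda>x. indicator ?q (N.act m x)) (indicator ?q)"
      unfolding L2_inner_cmult_left L2_inner_cmult_right by (simp only: mult.assoc)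
    then show ?thesis unfolding cc box_correlation[OF j] of_real_mult[symmetric] using eps_pos[OF j] by simp
  qed
  have "complex_of_real (sqnorm (tensor n) ?f) = complex_of_real 1"
    using co[of 0] corr_0[OF j] unfolding N.act_0 L2_inner_self by simp
  then have "sqnorm (tensor n) ?f = 1" by (simp only: of_real_eq_iff)
  from N.spectral_measure_exists[OF f this] obtain \<nu> where \<nu>: "prob_space \<nu>" "is_spectral_measure (tensor n) (tensor_power n T) ?f \<nu>" by auto
  have "finite_circle_measure \<nu>" using \<nu>(2) unfolding is_spectral_measure_def by simp
  moreover have "(LINT z|\<nu>. z powi m) = complex_of_real (corr j m ^ n)" for m
    using \<nu>(2) unfolding is_spectral_measure_def koopman_power_def o_def co by blast
  ultimately show ?thesis using \<nu> f by blast
qed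

lemma box_spectral_family:
  obtains \<nu> where "\<And>j. 1 \<le> j \<Longrightarrow> finite_circle_measure (\<nu> j)" "\<And>j. 1 \<le> j \<Longrightarrow> prob_space (\<nu> j)"
    "\<And>j m. 1 \<le> j \<Longrightarrow> (LINT z|\<nu> j. z powi m) = complex_of_real (corr j m ^ n)"
    "\<And>j. 1 \<le> j \<Longrightarrow> \<exists>f\<in>L2 (tensor n). is_spectral_measure (tensor n) (tensor_power n T) f (\<nu> j)"
proof -
  have "\<forall>j. \<exists>\<nu>. 1 \<le> j \<longrightarrow> finite_circle_measure \<nu> \<and> prob_space \<nu> \<and> (\<forall>m. (LINT z|\<nu>. z powi m) = complex_of_real (corr j m ^ n)) \<and>
      (\<exists>f\<in>L2 (tensor n). is_spectral_measure (tensor n) (tensor_power n T) f \<nu>)"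
    using box_spectral_measure by blast
  from choice[OF this] obtain \<nu> where "\<forall>j. 1 \<le> j \<longrightarrow> finite_circle_measure (\<nu> j) \<and> prob_space (\<nu> j) \<and>
      (\<forall>m. (LINT z|\<nu> j. z powi m) = complex_of_real (corr j m ^ n)) \<and>
      (\<exists>f\<in>L2 (tensor n). is_spectral_measure (tensor n) (tensor_power n T) f (\<nu> j))" ..
  then show ?thesis by (intro that) auto
qed

text \<open>The shift i + j1 re-indexes the stages from j1 on by all natural numbers, as
  \<open>maximal_spectral_type\<close> expects.\<close>

lemma boxes_correlation:
  assumes "1 \<le> j1" "q \<in> boxes n j1"
    and \<nu>: "\<And>j m. 1 \<le> j \<Longrightarrow> (LINT z|\<nu> j. z powi m) = complex_of_real (corr j m ^ n)"
  shows "\<exists>\<kappa> i. \<forall>m. L2_inner (tensor n) (\<lambda>x. indicator q (int_iterate (space (tensor n)) (tensor_power n T) m x)) (indicator q) =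
    of_real \<kappa> * (LINT z|\<nu> (i + j1). z powi m)"
proof -
  obtain j k where jk: "j1 \<le> j" "q = box n j k" using assms(2) by (rule boxesE)
  then have "j = (j - j1) + j1" "1 \<le> j" using assms(1) by auto
  then show ?thesis
    using box_correlation[of j n k] \<nu>[of j] unfolding jk(2)
    by (intro exI[of _ "eps j ^ n"] exI[of _ "j - j1"]) simp
qed

text \<open>The hypothesis \<open>sing\<close> receives the whole family of measures, because the
  Riesz product argument for n = 1 relates different stages.\<close>

lemma tensor_singular_spectrum:
  assumes j1: "1 \<le> j1" and r: "filterlim r at_top sequentially"
    and sing: "\<And>\<nu> j. (\<And>i. j1 \<le> i \<Longrightarrow> finite_circle_measure (\<nu> i)) \<Longrightarrow> (\<And>i. j1 \<le> i \<Longrightarrow> prob_space (\<nu> i)) \<Longrightarrow>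
      (\<And>i m. j1 \<le> i \<Longrightarrow> (LINT z|\<nu> i. z powi m) = complex_of_real (corr i m ^ n)) \<Longrightarrow> j1 \<le> j \<Longrightarrow>
      mutually_singular circle_lebesgue (\<nu> j)"
  shows "singular_spectrum (tensor n) (tensor_power n T)"
proof -
  interpret N: measure_automorphism "tensor n" "tensor_power n T" by (rule tensor_locale)
  obtain \<nu> where \<nu>: "\<And>j. 1 \<le> j \<Longrightarrow> finite_circle_measure (\<nu> j)" "\<And>j. 1 \<le> j \<Longrightarrow> prob_space (\<nu> j)"
    "\<And>j m. 1 \<le> j \<Longrightarrow> (LINT z|\<nu> j. z powi m) = complex_of_real (corr j m ^ n)"
    "\<And>j. 1 \<le> j \<Longrightarrow> \<exists>f\<in>L2 (tensor n). is_spectral_measure (tensor n) (tensor_power n T) f (\<nu> j)"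
    using box_spectral_family[of n] by blast
  show ?thesis
    by (rule N.singular_spectrumI[OF boxes_test_sets[OF j1 r, of n], of "\<lambda>i. \<nu> (i + j1)"];
        (rule boxes_correlation[OF j1])?; (rule sing)?; (rule \<nu>)?) (use j1 in auto)
qed

lemma tensor_absolutely_continuous_spectrum:
  assumes j1: "1 \<le> j1" and r: "filterlim r at_top sequentially"
    and ac: "\<And>\<nu> j. finite_circle_measure \<nu> \<Longrightarrow> j1 \<le> j \<Longrightarrow>
      (\<And>m. (LINT z|\<nu>. z powi m) = complex_of_real (corr j m ^ n)) \<Longrightarrow> absolutely_continuous circle_lebesgue \<nu>"
  shows "absolutely_continuous_spectrum (tensor n) (tensor_power n T)"
proof -
  interpret N: measure_automorphism "tensor n" "tensor_power n T" by (rule tensor_locale)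
  obtain \<nu> where \<nu>: "\<And>j. 1 \<le> j \<Longrightarrow> finite_circle_measure (\<nu> j)" "\<And>j. 1 \<le> j \<Longrightarrow> prob_space (\<nu> j)"
    "\<And>j m. 1 \<le> j \<Longrightarrow> (LINT z|\<nu> j. z powi m) = complex_of_real (corr j m ^ n)"
    "\<And>j. 1 \<le> j \<Longrightarrow> \<exists>f\<in>L2 (tensor n). is_spectral_measure (tensor n) (tensor_power n T) f (\<nu> j)"
    using box_spectral_family[of n] by blast
  show ?thesis
    by (rule N.absolutely_continuous_spectrumI[OF boxes_test_sets[OF j1 r, of n], of "\<lambda>i. \<nu> (i + j1)"];
        (rule boxes_correlation[OF j1])?; (rule ac)?; (rule \<nu>)?) (use j1 in auto)
qed

end

section \<open>Dissipativity and conservativity\<close>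

text \<open>Almost every orbit meets each \<open>A j\<close> in a set of times bounded below. The wandering set consists
  of the first visits to the first of the sets \<open>A j\<close> that the orbit meets.\<close>

lemma (in measure_automorphism) dissipativeI:
  assumes A: "\<And>j::nat. A j \<in> sets M" "(\<Union>j. A j) = space M"
    and Z: "\<And>j. Z j \<in> null_sets M" "\<And>j x. x \<in> A j \<Longrightarrow> x \<notin> Z j \<Longrightarrow> finite {m::nat. act (- int m) x \<in> A j}"
  shows "dissipative M S"
proof -
  define W where "W = {x \<in> space M. \<exists>j. x \<in> A j \<and> (\<forall>k<0. act k x \<notin> A j) \<and> (\<forall>i<j. \<forall>k. act k x \<notin> A i)}"
  define D where "D = (\<Union>k::int. act k ` (\<Union>j. Z j))"
  have Wsets: "W \<in> sets M"
    unfolding W_def using A(1)[measurable] by measurable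
  have UZ: "(\<Union>j. Z j) \<in> null_sets M" using Z(1) by (intro null_sets_UN) auto
  have D: "D \<in> null_sets M"
    unfolding D_def
  proof (intro null_sets_UN')
    fix k :: int
    show "act k ` (\<Union>j. Z j) \<in> null_sets M"
      using UZ emeasure_act_image[of "\<Union>j. Z j" k] act_image_sets[of "\<Union>j. Z j" k] by (auto simp: null_sets_def)
  qed simp
  have "disjoint_family (\<lambda>m. act m ` W)"
    unfolding disjoint_family_on_def
  proof (intro ballI impI equals0I)
    fix m k y assume mk: "m \<noteq> k" and "y \<in> act m ` W \<inter> act k ` W"
    then obtain x x' where x: "x \<in> W" "x' \<in> W" "act m x = act k x'" by auto
    have sp: "x \<in> space M" "x' \<in> space M" using x unfolding W_def by auto
    have x'1: "x' = act (m - k) x"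
      using act_add[OF sp(1), of "- k" m] sp unfolding x(3) by simp
    have x'2: "x = act (k - m) x'"
      using act_add[OF sp(2), of "- m" k] sp unfolding x(3)[symmetric] by simp
    obtain j where j: "x \<in> A j" "\<And>k. k < 0 \<Longrightarrow> act k x \<notin> A j" "\<And>i k. i < j \<Longrightarrow> act k x \<notin> A i"
      using x(1) unfolding W_def by auto
    obtain j' where j': "x' \<in> A j'" "\<And>k. k < 0 \<Longrightarrow> act k x' \<notin> A j'" "\<And>i k. i < j' \<Longrightarrow> act k x' \<notin> A i"
      using x(2) unfolding W_def by auto
    have "\<not> j' < j" using j(3)[of j' "m - k"] j'(1) unfolding x'1[symmetric] by blast
    moreover have "\<not> j < j'" using j'(3)[of j "k - m"] j(1) unfolding x'2[symmetric] by blast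
    ultimately have e: "j' = j" by simp
    have "\<not> m - k < 0" using j(2)[of "m - k"] j'(1) unfolding x'1[symmetric] e by blast
    moreover have "\<not> k - m < 0" using j'(2)[of "k - m"] j(1) unfolding x'2[symmetric] e by blast
    ultimately show False using mk by simp
  qed
  then have wand: "wandering M S W" unfolding wandering_def using Wsets by simp
  have "x \<in> (\<Union>m. act m ` W)" if x: "x \<in> space M" "x \<notin> D" for x
  proof -
    have good: "act k x \<notin> Z j" for k j
    proof
      assume "act k x \<in> Z j"
      then have "act (- k) (act k x) \<in> D" unfolding D_def by blast
      then show False using x by simp
    qed
    have "\<exists>j. x \<in> A j" using x(1) A(2) by blast
    then have ex: "\<exists>j k. act k x \<in> A j" using act_0 by metis
    define j where "j = (LEAST j. \<exists>k. act k x \<in> A j)"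
    obtain k where k: "act k x \<in> A j" using LeastI_ex[OF ex] unfolding j_def by auto
    have least: "act l x \<notin> A i" if "i < j" for i l using not_less_Least[of i] that unfolding j_def by blast
    have fin: "finite {m::nat. act (- int m) (act k x) \<in> A j}" by (rule Z(2)[OF k good])
    define m where "m = Max {m::nat. act (- int m) (act k x) \<in> A j}"
    have "0 \<in> {m::nat. act (- int m) (act k x) \<in> A j}" using k by simp
    then have m: "act (- int m) (act k x) \<in> A j" using Max_in[OF fin] unfolding m_def by blast
    define y where "y = act (k - int m) x"
    have y1: "y \<in> space M" unfolding y_def by (rule act_space[OF x(1)])
    have y2: "y = act (- int m) (act k x)" unfolding y_def using act_add[OF x(1), of "- int m" k] by simp
    have y3: "act l y = act (l + k - int m) x" for l
      unfolding y_def using act_add[OF x(1), of l "k - int m"] by (simp add: algebra_simps)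
    have "act l y \<notin> A j" if l: "l < 0" for l
    proof
      assume a: "act l y \<in> A j"
      have "act l y = act (- int (m + nat (- l))) (act k x)"
        unfolding y3 using act_add[OF x(1), of "- int (m + nat (- l))" k] l by (simp add: algebra_simps)
      then have "m + nat (- l) \<le> m" using a Max_ge[OF fin, of "m + nat (- l)"] unfolding m_def by simp
      then show False using l by simp
    qed
    then have "y \<in> W" unfolding W_def using y1 y2 y3 m least by auto
    moreover have "x = act (int m - k) y" unfolding y_def using act_add[OF x(1), of "int m - k" "k - int m"] by simp
    ultimately show ?thesis by blast
  qed
  then have sub: "space M - (\<Union>m. act m ` W) \<subseteq> D" by blast
  have "space M - (\<Union>m. act m ` W) \<in> sets M"
    using act_image_sets[OF Wsets] by (intro sets.Diff sets.top sets.countable_UN') auto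
  then have "space M - (\<Union>m. act m ` W) \<in> null_sets M" using D sub by (metis null_sets_subset)
  then show ?thesis unfolding dissipative_def using wand by blast
qed

text \<open>On Q the number of sets V j containing a point has mean S = sum of p j and variance at
  most S by pairwise independence, so it is close to S for most points. On W its integral is at most
  the measure of Q. Hence W cannot occupy a substantial part of Q when S is large.\<close>

lemma second_moment_dense:
  fixes p :: "nat \<Rightarrow> real"
  assumes V: "\<And>j. j \<in> I \<Longrightarrow> V j \<in> sets M" "\<And>j. j \<in> I \<Longrightarrow> V j \<subseteq> Q" and I: "finite I"
    and Q: "Q \<in> sets M" "emeasure M Q < \<infinity>" and W: "W \<in> sets M"
    and one: "\<And>j. j \<in> I \<Longrightarrow> measure M (V j) = p j * measure M Q"
    and two: "\<And>i j. i \<in> I \<Longrightarrow> j \<in> I \<Longrightarrow> i \<noteq> j \<Longrightarrow> measure M (V i \<inter> V j) = p i * p j * measure M Q"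
    and WV: "(\<Sum>j\<in>I. measure M (W \<inter> V j)) \<le> measure M Q" and t: "0 < t" and S: "0 < (\<Sum>j\<in>I. p j)"
  shows "measure M (W \<inter> Q) \<le> ((1 + 1 / (2 * t)) / (\<Sum>j\<in>I. p j) + t / 2) * measure M Q"
proof -
  define S where "S = (\<Sum>j\<in>I. p j)"
  have S0: "0 < S" using S unfolding S_def .
  have fin: "integrable M (indicat_real A)" if "A \<in> sets M" "A \<subseteq> Q" for A
    using that Q by (intro integrable_real_indicator) (auto intro: le_less_trans[OF emeasure_mono])
  have int: "(LINT x|M. indicat_real A x) = measure M A" if "A \<in> sets M" for A
    using that by (simp add: sets.Int_space_eq2)
  define f where "f x = (\<Sum>j\<in>I. indicat_real (V j) x) - S * indicat_real Q x" for x
  define g where "g x = (\<Sum>j\<in>I. \<Sum>i\<in>I. indicat_real (V j \<inter> V i) x) - 2 * S * (\<Sum>j\<in>I. indicat_real (V j) x) + S\<^sup>2 * indicat_real Q x" for x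
  have fg: "(f x)\<^sup>2 = g x" for x
  proof -
    have VQ: "indicat_real (V j) x * indicat_real Q x = indicat_real (V j) x" if "j \<in> I" for j
      using V(2)[OF that] by (auto split: split_indicator)
    have "(\<Sum>j\<in>I. indicat_real (V j) x) * indicat_real Q x = (\<Sum>j\<in>I. indicat_real (V j) x)"
      unfolding sum_distrib_right by (intro sum.cong refl VQ)
    moreover have "(\<Sum>j\<in>I. indicat_real (V j) x) * (\<Sum>j\<in>I. indicat_real (V j) x) = (\<Sum>j\<in>I. \<Sum>i\<in>I. indicat_real (V j \<inter> V i) x)"
      unfolding sum_product indicator_inter_arith ..
    moreover have "indicat_real Q x * indicat_real Q x = indicat_real Q x" by (simp split: split_indicator)
    moreover have "(f x)\<^sup>2 = (\<Sum>j\<in>I. indicat_real (V j) x) * (\<Sum>j\<in>I. indicat_real (V j) x) -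
        2 * S * ((\<Sum>j\<in>I. indicat_real (V j) x) * indicat_real Q x) + S\<^sup>2 * (indicat_real Q x * indicat_real Q x)"
      unfolding f_def by (simp add: power2_eq_square algebra_simps)
    ultimately show ?thesis unfolding g_def by (simp only:)
  qed
  have VI: "V j \<inter> V i \<in> sets M" "V j \<inter> V i \<subseteq> Q" if "j \<in> I" "i \<in> I" for i j using V that by blast+
  have ig: "integrable M g"
    unfolding g_def
    by (intro Bochner_Integration.integrable_add Bochner_Integration.integrable_diff Bochner_Integration.integrable_sum
      integrable_mult_right fin V VI Q order_refl)
  have "(LINT x|M. g x) = (\<Sum>j\<in>I. \<Sum>i\<in>I. measure M (V j \<inter> V i)) - 2 * S * (\<Sum>j\<in>I. measure M (V j)) + S\<^sup>2 * measure M Q"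
  proof -
    have i1: "integrable M (\<lambda>x. \<Sum>j\<in>I. \<Sum>i\<in>I. indicat_real (V j \<inter> V i) x)"
      by (intro Bochner_Integration.integrable_sum fin VI)
    have i2: "integrable M (\<lambda>x. \<Sum>j\<in>I. indicat_real (V j) x)"
      by (intro Bochner_Integration.integrable_sum fin V)
    have i3: "integrable M (indicat_real Q)" by (intro fin Q order_refl)
    have e1: "(LINT x|M. (\<Sum>j\<in>I. \<Sum>i\<in>I. indicat_real (V j \<inter> V i) x)) = (\<Sum>j\<in>I. \<Sum>i\<in>I. measure M (V j \<inter> V i))"
    proof -
      have "(LINT x|M. (\<Sum>j\<in>I. \<Sum>i\<in>I. indicat_real (V j \<inter> V i) x)) = (\<Sum>j\<in>I. LINT x|M. (\<Sum>i\<in>I. indicat_real (V j \<inter> V i) x))"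
        by (intro Bochner_Integration.integral_sum Bochner_Integration.integrable_sum fin VI)
      also have "\<dots> = (\<Sum>j\<in>I. \<Sum>i\<in>I. LINT x|M. indicat_real (V j \<inter> V i) x)"
        by (intro sum.cong refl Bochner_Integration.integral_sum fin VI)
      finally show ?thesis using int VI by simp
    qed
    have e2: "(LINT x|M. (\<Sum>j\<in>I. indicat_real (V j) x)) = (\<Sum>j\<in>I. measure M (V j))"
    proof -
      have "(LINT x|M. (\<Sum>j\<in>I. indicat_real (V j) x)) = (\<Sum>j\<in>I. LINT x|M. indicat_real (V j) x)"
        by (intro Bochner_Integration.integral_sum fin V)
      then show ?thesis using int V by simp
    qed
    have "(LINT x|M. g x) = (LINT x|M. (\<Sum>j\<in>I. \<Sum>i\<in>I. indicat_real (V j \<inter> V i) x)) -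
        2 * S * (LINT x|M. (\<Sum>j\<in>I. indicat_real (V j) x)) + S\<^sup>2 * (LINT x|M. indicat_real Q x)"
      unfolding g_def using i1 i2 i3 by simp
    then show ?thesis unfolding e1 e2 int[OF Q(1)] .
  qed
  also have "(\<Sum>j\<in>I. \<Sum>i\<in>I. measure M (V j \<inter> V i)) \<le> (\<Sum>j\<in>I. \<Sum>i\<in>I. (p j * p i + (if i = j then p j else 0)) * measure M Q)"
  proof (intro sum_mono)
    fix j i assume ji: "j \<in> I" "i \<in> I"
    have "0 \<le> p j * p j * measure M Q" by simp
    then show "measure M (V j \<inter> V i) \<le> (p j * p i + (if i = j then p j else 0)) * measure M Q"
      using one[OF ji(1)] two[OF ji] by (cases "i = j") (auto simp: distrib_right)
  qed
  also have "(\<Sum>j\<in>I. \<Sum>i\<in>I. (p j * p i + (if i = j then p j else 0)) * measure M Q) = (S * S + S) * measure M Q"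
    unfolding sum_distrib_right[symmetric] sum.distrib S_def sum_product using I by simp
  also have "(\<Sum>j\<in>I. measure M (V j)) = S * measure M Q"
    unfolding S_def sum_distrib_right by (intro sum.cong refl one)
  finally have var: "(LINT x|M. g x) \<le> S * measure M Q" by (simp add: power2_eq_square algebra_simps)
  have WQ: "W \<inter> Q \<in> sets M" "W \<inter> Q \<subseteq> Q" "\<And>j. j \<in> I \<Longrightarrow> W \<inter> V j \<in> sets M" "\<And>j. j \<in> I \<Longrightarrow> W \<inter> V j \<subseteq> Q"
    using W Q V by auto
  have "S * measure M (W \<inter> Q) = (LINT x|M. S * indicat_real (W \<inter> Q) x)"
    unfolding integral_mult_right_zero int[OF WQ(1)] ..
  also have "\<dots> \<le> (LINT x|M. (\<Sum>j\<in>I. indicat_real (W \<inter> V j) x) + (1 / (2 * t * S) * g x + t * S / 2 * indicat_real Q x))"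
  proof (rule integral_mono)
    show "integrable M (\<lambda>x. S * indicat_real (W \<inter> Q) x)" by (intro integrable_mult_right fin WQ)
    show "integrable M (\<lambda>x. (\<Sum>j\<in>I. indicat_real (W \<inter> V j) x) + (1 / (2 * t * S) * g x + t * S / 2 * indicat_real Q x))"
      by (intro Bochner_Integration.integrable_add Bochner_Integration.integrable_sum integrable_mult_right ig fin WQ Q order_refl)
    fix x
    \<comment> \<open>The arithmetic-geometric mean inequality replaces the deviation by its square;
      taken with c = t * S it leads to the term t / 2 of the bound.\<close>
    have am': "- y \<le> 1 / (2 * c) * y\<^sup>2 + c / 2" if "0 < c" for y c :: real
    proof -
      have "0 \<le> (y + c)\<^sup>2" by simp
      then have "- y * (2 * c) \<le> y\<^sup>2 + c * c" by (simp add: power2_eq_square algebra_simps)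
      then have "- y \<le> (y\<^sup>2 + c * c) / (2 * c)" using that by (simp only: pos_le_divide_eq mult_pos_pos zero_less_numeral)
      then show ?thesis using that by (simp add: add_divide_distrib)
    qed
    have "0 < t * S" using t S0 by simp
    from am'[OF this] have am: "- y \<le> 1 / (2 * t * S) * y\<^sup>2 + t * S / 2" for y by (simp only: mult.assoc)
    show "S * indicat_real (W \<inter> Q) x \<le> (\<Sum>j\<in>I. indicat_real (W \<inter> V j) x) + (1 / (2 * t * S) * g x + t * S / 2 * indicat_real Q x)"
    proof (cases "x \<in> W \<inter> Q")
      case True
      then have "indicat_real (W \<inter> V j) x = indicat_real (V j) x" for j by (auto split: split_indicator)
      then show ?thesis using am[of "f x"] True unfolding fg[symmetric] by (simp add: f_def)
    next
      case False
      have "0 \<le> (\<Sum>j\<in>I. indicat_real (W \<inter> V j) x)" by (intro sum_nonneg) auto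
      moreover have "0 \<le> 1 / (2 * t * S) * g x + t * S / 2 * indicat_real Q x"
        unfolding fg[symmetric] using t S0 by (intro add_nonneg_nonneg mult_nonneg_nonneg) auto
      ultimately show ?thesis using False by simp
    qed
  qed
  also have "\<dots> = (\<Sum>j\<in>I. measure M (W \<inter> V j)) + (1 / (2 * t * S) * (LINT x|M. g x) + t * S / 2 * measure M Q)"
  proof -
    have i1: "integrable M (\<lambda>x. \<Sum>j\<in>I. indicat_real (W \<inter> V j) x)" by (intro Bochner_Integration.integrable_sum fin WQ)
    have i3: "integrable M (indicat_real Q)" by (intro fin Q order_refl)
    have "(LINT x|M. (\<Sum>j\<in>I. indicat_real (W \<inter> V j) x)) = (\<Sum>j\<in>I. LINT x|M. indicat_real (W \<inter> V j) x)"
      by (intro Bochner_Integration.integral_sum fin WQ)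
    also have "\<dots> = (\<Sum>j\<in>I. measure M (W \<inter> V j))" using int WQ by simp
    finally have e: "(LINT x|M. (\<Sum>j\<in>I. indicat_real (W \<inter> V j) x)) = (\<Sum>j\<in>I. measure M (W \<inter> V j))" .
    have "(LINT x|M. (\<Sum>j\<in>I. indicat_real (W \<inter> V j) x) + (1 / (2 * t * S) * g x + t * S / 2 * indicat_real Q x)) =
        (LINT x|M. (\<Sum>j\<in>I. indicat_real (W \<inter> V j) x)) + (LINT x|M. 1 / (2 * t * S) * g x + t * S / 2 * indicat_real Q x)"
      by (intro Bochner_Integration.integral_add i1 Bochner_Integration.integrable_add integrable_mult_right ig i3)
    also have "(LINT x|M. 1 / (2 * t * S) * g x + t * S / 2 * indicat_real Q x) =
        (LINT x|M. 1 / (2 * t * S) * g x) + (LINT x|M. t * S / 2 * indicat_real Q x)"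
      by (intro Bochner_Integration.integral_add integrable_mult_right ig i3)
    also have "\<dots> = 1 / (2 * t * S) * (LINT x|M. g x) + t * S / 2 * measure M Q"
      unfolding integral_mult_right_zero int[OF Q(1)] ..
    finally show ?thesis unfolding e .
  qed
  also have "\<dots> \<le> measure M Q + (1 / (2 * t * S) * (S * measure M Q) + t * S / 2 * measure M Q)"
    using t S0 by (intro add_mono WV mult_left_mono var order_refl) auto
  also have "\<dots> = S * (((1 + 1 / (2 * t)) / S + t / 2) * measure M Q)"
    using t S0 by (simp add: field_simps)
  finally show ?thesis unfolding S_def[symmetric] using S0 by (simp only: mult_le_cancel_left_pos)
qed

section \<open>Coincidence of columns and wandering sets in the product\<close>

context rank_one_construction
begin

lemma levelset_box:
  assumes "1 \<le> j" "\<And>a. a < n \<Longrightarrow> levelset j (Y a)"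
  shows "PiE {..<n} Y \<in> sets (tensor n)" "emeasure (tensor n) (PiE {..<n} Y) < \<infinity>"
    "measure (tensor n) (PiE {..<n} Y) = (\<Prod>a<n. measure M (Y a))"
proof -
  have Y: "Y a \<in> sets M" "emeasure M (Y a) < \<infinity>" if "a < n" for a
    using levelset_sets[OF assms(1) assms(2)[OF that]] levelset_finite[OF assms(1) assms(2)[OF that]] by auto
  show "PiE {..<n} Y \<in> sets (tensor n)" by (intro sets_tensor_PiE Y)
  show "measure (tensor n) (PiE {..<n} Y) = (\<Prod>a<n. measure M (Y a))" by (intro measure_tensor_PiE Y)
  have "emeasure (tensor n) (PiE {..<n} Y) = ennreal (\<Prod>a<n. measure M (Y a))" by (intro measure_tensor_PiE Y)
  then show "emeasure (tensor n) (PiE {..<n} Y) < \<infinity>" by simp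
qed

text \<open>I is the set of all columns for dissipativity and of all columns but the first for
  conservativity.\<close>

definition diagonal :: "nat \<Rightarrow> nat \<Rightarrow> nat \<Rightarrow> nat set \<Rightarrow> (nat \<Rightarrow> real) set" where
  "diagonal n q j I = (\<Union>i\<in>I. PiE {..<n} (\<lambda>_. tow q \<inter> col j i))"

text \<open>Each coordinate lies in a given column with probability 1 / r j, independently of the
  others and of the level sets Y a.\<close>

lemma diagonal_measure:
  assumes j: "1 \<le> j" and n: "1 \<le> n" and I: "I \<subseteq> {1..r j}" and Y: "\<And>a. a < n \<Longrightarrow> levelset j (Y a)"
  shows "measure (tensor n) (\<Union>i\<in>I. PiE {..<n} (\<lambda>a. Y a \<inter> col j i)) = real (card I) / real (r j) ^ n * measure (tensor n) (PiE {..<n} Y)"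
    and "disjoint_family_on (\<lambda>i. PiE {..<n} (\<lambda>a. Y a \<inter> col j i)) I"
    and "(\<Union>i\<in>I. PiE {..<n} (\<lambda>a. Y a \<inter> col j i)) \<in> sets (tensor n)"
proof -
  have fin: "finite I" using I by (rule finite_subset) simp
  have Yc: "levelset (Suc j) (Y a \<inter> col j i)" "measure M (Y a \<inter> col j i) = measure M (Y a) / real (r j)" if "a < n" "i \<in> I" for a i
    using levelset_col[OF j, of i "Y a"] Y[OF that(1)] I that(2) by auto
  have box: "PiE {..<n} (\<lambda>a. Y a \<inter> col j i) \<in> sets (tensor n)" "emeasure (tensor n) (PiE {..<n} (\<lambda>a. Y a \<inter> col j i)) < \<infinity>"
    "measure (tensor n) (PiE {..<n} (\<lambda>a. Y a \<inter> col j i)) = measure (tensor n) (PiE {..<n} Y) / real (r j) ^ n" if i: "i \<in> I" for i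
  proof -
    note b = levelset_box[of "Suc j" n "\<lambda>a. Y a \<inter> col j i", OF _ Yc(1)[OF _ i]]
    show "PiE {..<n} (\<lambda>a. Y a \<inter> col j i) \<in> sets (tensor n)" "emeasure (tensor n) (PiE {..<n} (\<lambda>a. Y a \<inter> col j i)) < \<infinity>"
      using b(1,2) by auto
    have "measure (tensor n) (PiE {..<n} (\<lambda>a. Y a \<inter> col j i)) = (\<Prod>a<n. measure M (Y a) / real (r j))"
      using b(3) Yc(2)[OF _ i] by simp
    then show "measure (tensor n) (PiE {..<n} (\<lambda>a. Y a \<inter> col j i)) = measure (tensor n) (PiE {..<n} Y) / real (r j) ^ n"
      using levelset_box(3)[OF j Y] by (simp add: prod_dividef)
  qed
  show dis: "disjoint_family_on (\<lambda>i. PiE {..<n} (\<lambda>a. Y a \<inter> col j i)) I"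
    unfolding disjoint_family_on_def
  proof (intro ballI impI equals0I)
    fix i i' x assume *: "i \<in> I" "i' \<in> I" "i \<noteq> i'" "x \<in> PiE {..<n} (\<lambda>a. Y a \<inter> col j i) \<inter> PiE {..<n} (\<lambda>a. Y a \<inter> col j i')"
    then have "x 0 \<in> col j i" "x 0 \<in> col j i'" using n by (auto simp: PiE_iff)
    moreover have "i \<in> {1..r j}" "i' \<in> {1..r j}" using * I by blast+
    ultimately show False using col_disjoint[OF j, of i i' "x 0"] *(3) by auto
  qed
  show "(\<Union>i\<in>I. PiE {..<n} (\<lambda>a. Y a \<inter> col j i)) \<in> sets (tensor n)" using fin box(1) by (intro sets.finite_UN) auto
  have "measure (tensor n) (\<Union>i\<in>I. PiE {..<n} (\<lambda>a. Y a \<inter> col j i)) = (\<Sum>i\<in>I. measure (tensor n) (PiE {..<n} (\<lambda>a. Y a \<inter> col j i)))"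
    by (rule measure_finite_Union[OF fin _ dis]) (use box in \<open>auto simp: less_top\<close>)
  also have "\<dots> = (\<Sum>i\<in>I. measure (tensor n) (PiE {..<n} Y) / real (r j) ^ n)" by (intro sum.cong refl box(3))
  finally show "measure (tensor n) (\<Union>i\<in>I. PiE {..<n} (\<lambda>a. Y a \<inter> col j i)) = real (card I) / real (r j) ^ n * measure (tensor n) (PiE {..<n} Y)"
    by simp
qed

lemma tow_levelset: "1 \<le> q \<Longrightarrow> q \<le> j \<Longrightarrow> levelset j (tow q)"
  by (rule levelset_mono[OF _ levelset_tow])

text \<open>The part of the tower in a column of stage j is a union of levels of stage j', so that
  \<open>diagonal_measure\<close> applies to it again.\<close>

lemma diagonal_pair:
  assumes q: "1 \<le> q" "q \<le> j" "j < j'" and n: "1 \<le> n" and I: "I \<subseteq> {1..r j}" and I': "I' \<subseteq> {1..r j'}"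
  shows "measure (tensor n) (diagonal n q j I \<inter> diagonal n q j' I') =
    (real (card I) / real (r j) ^ n) * (real (card I') / real (r j') ^ n) * measure (tensor n) (PiE {..<n} (\<lambda>_. tow q))"
proof -
  have j: "1 \<le> j" "1 \<le> j'" using q by auto
  have fin: "finite I" using I by (rule finite_subset) simp
  let ?D = "\<lambda>i. \<Union>i'\<in>I'. PiE {..<n} (\<lambda>a. (tow q \<inter> col j i) \<inter> col j' i')"
  have lev: "levelset j (tow q)" by (rule tow_levelset[OF q(1,2)])
  have lev': "levelset j' (tow q \<inter> col j i)" if "i \<in> I" for i
    using that I q by (intro levelset_mono[OF _ levelset_col(2)[OF j(1) _ _ lev]]) auto
  have eq: "diagonal n q j I \<inter> diagonal n q j' I' = (\<Union>i\<in>I. ?D i)"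
    unfolding diagonal_def by (auto simp: PiE_iff)
  have "measure (tensor n) (\<Union>i\<in>I. ?D i) = (\<Sum>i\<in>I. measure (tensor n) (?D i))"
  proof (rule measure_finite_Union[OF fin])
    show "?D ` I \<subseteq> sets (tensor n)" using diagonal_measure(3)[OF j(2) n I' lev'] by auto
    show "disjoint_family_on ?D I"
    proof (rule disjoint_family_on_bisimulation[OF diagonal_measure(2)[OF j(1) n I, of "\<lambda>_. tow q"]])
      fix i i' assume "PiE {..<n} (\<lambda>a. tow q \<inter> col j i) \<inter> PiE {..<n} (\<lambda>a. tow q \<inter> col j i') = {}"
      moreover have "?D i \<subseteq> PiE {..<n} (\<lambda>a. tow q \<inter> col j i)" for i by (auto simp: PiE_iff)
      ultimately show "?D i \<inter> ?D i' = {}" by blast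
    qed (rule lev)
    fix i assume i: "i \<in> I"
    have "emeasure (tensor n) (?D i) \<le> emeasure (tensor n) (PiE {..<n} (\<lambda>_. tow q \<inter> col j i))"
      using levelset_box(1)[OF j(2) lev'[OF i]] by (intro emeasure_mono) (auto simp: PiE_iff)
    also have "\<dots> < \<infinity>" by (rule levelset_box(2)[OF j(2) lev'[OF i]])
    finally show "emeasure (tensor n) (?D i) \<noteq> \<infinity>" by simp
  qed
  also have "\<dots> = (\<Sum>i\<in>I. real (card I') / real (r j') ^ n * (measure (tensor n) (PiE {..<n} (\<lambda>_. tow q)) / real (r j) ^ n))"
  proof (intro sum.cong refl)
    fix i assume i: "i \<in> I"
    have "measure (tensor n) (?D i) = real (card I') / real (r j') ^ n * measure (tensor n) (PiE {..<n} (\<lambda>_. tow q \<inter> col j i))"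
      by (rule diagonal_measure(1)[OF j(2) n I' lev'[OF i]])
    also have "measure (tensor n) (PiE {..<n} (\<lambda>_. tow q \<inter> col j i)) = measure (tensor n) (PiE {..<n} (\<lambda>_. tow q)) / real (r j) ^ n"
      using diagonal_measure(1)[OF j(1) n, of "{i}" "\<lambda>_. tow q"] lev i I by auto
    finally show "measure (tensor n) (?D i) = real (card I') / real (r j') ^ n * (measure (tensor n) (PiE {..<n} (\<lambda>_. tow q)) / real (r j) ^ n)" .
  qed
  finally show ?thesis unfolding eq by (simp add: mult_ac)
qed

text \<open>Neighbouring columns carry the same levels of stage j, h j + s j i steps apart, and the
  tower of stage q is a union of such levels.\<close>

lemma tr_col:
  assumes q: "1 \<le> q" "q \<le> j" and i: "1 \<le> i" "i < r j" and x: "x \<in> tow q \<inter> col j (Suc i)"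
  shows "tr (- int (h j + s j i)) x \<in> tow q \<inter> col j i"
proof -
  have j: "1 \<le> j" using q by simp
  obtain L where L: "L \<subseteq> {0..<int (h j)}" "tow q = (\<Union>k\<in>L. lv j k)"
    using tow_levelset[OF q] unfolding levelset_def by auto
  obtain k where k: "k \<in> L" "x \<in> lv j k" using x L(2) by auto
  then have k': "0 \<le> k" "k < int (h j)" using L(1) by auto
  have "x \<in> lv j k \<inter> col j (Suc i)" using x k by blast
  then have "x \<in> lv (Suc j) (k + int (pos j (Suc i)))" using lv_col[OF j _ _ k', of "Suc i"] i by auto
  moreover have "x \<in> X" using k(2) lv_sub[OF j] by blast
  ultimately have "tr (- int (h j + s j i)) x \<in> lv (Suc j) (k + int (pos j i))"
    using pos_Suc[of i j] i by (subst mem_lv_shift) (auto simp: algebra_simps)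
  then have "tr (- int (h j + s j i)) x \<in> lv j k \<inter> col j i" using lv_col[OF j _ _ k', of i] i by simp
  then show ?thesis using L(2) k(1) by blast
qed

text \<open>Pieces of W are moved back by one column and stay inside the product tower. Images from
  one stage are disjoint because they lie in different columns, although their powers of T may
  coincide. Images from different stages are disjoint because the powers differ and W is
  wandering.\<close>

lemma wandering_diagonal:
  assumes q: "1 \<le> q" and n: "1 \<le> n" and r2: "\<And>j. q \<le> j \<Longrightarrow> 2 \<le> r j"
    and W: "wandering (tensor n) (tensor_power n T) W"
  shows "(\<Sum>j\<in>{q..<J}. measure (tensor n) (W \<inter> diagonal n q j {2..r j})) \<le> measure (tensor n) (PiE {..<n} (\<lambda>_. tow q))"
proof -
  interpret N: measure_automorphism "tensor n" "tensor_power n T" by (rule tensor_locale)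
  let ?N = "tensor n"
  let ?Q = "PiE {..<n} (\<lambda>_. tow q)"
  have Ws: "W \<in> sets ?N" and dis: "disjoint_family (\<lambda>m. N.act m ` W)" using W unfolding wandering_def by auto
  have Q: "?Q \<in> sets ?N" "emeasure ?N ?Q < \<infinity>" using levelset_box(1,2)[OF q levelset_tow] by auto
  define P where "P j i = PiE {..<n} (\<lambda>_. tow q \<inter> col j i)" for j i
  have PQ: "P j i \<subseteq> ?Q" for j i unfolding P_def by (intro PiE_mono) auto
  define K where "K = (SIGMA j:{q..<J}. {1..<r j})"
  have finK: "finite K" unfolding K_def by auto
  define d where "d p = int (h (fst p) + s (fst p) (snd p))" for p
  define G where "G p = N.act (- d p) ` (W \<inter> P (fst p) (Suc (snd p)))" for p
  have Ps: "P j i \<in> sets ?N" if "q \<le> j" "i \<in> {1..r j}" for j i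
    using diagonal_measure(3)[OF _ n, of j "{i}" "\<lambda>_. tow q"] tow_levelset[OF q that(1)] that q unfolding P_def by auto
  have KP: "q \<le> fst p" "1 \<le> snd p" "snd p < r (fst p)" if "p \<in> K" for p using that unfolding K_def by auto
  have WP: "W \<inter> P (fst p) (Suc (snd p)) \<in> sets ?N" if "p \<in> K" for p
    using KP[OF that] Ws by (intro sets.Int Ps) auto
  have GP: "G p \<subseteq> P (fst p) (snd p)" if p: "p \<in> K" for p
  proof
    fix x assume "x \<in> G p"
    then obtain y where y: "x = N.act (- d p) y" "y \<in> P (fst p) (Suc (snd p))" unfolding G_def by auto
    have yN: "y \<in> space ?N" using sets.sets_into_space[OF Ps[of "fst p" "Suc (snd p)"]] KP[OF p] y(2) by auto
    show "x \<in> P (fst p) (snd p)"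
      using tr_col[OF q KP[OF p]] y(2) unfolding y(1) tensor_tr[OF yN] P_def d_def
      by (simp add: tensor_power_def PiE_iff)
  qed
  have GW: "G p \<subseteq> N.act (- d p) ` W" for p unfolding G_def by blast
  have disG: "disjoint_family_on G K"
    unfolding disjoint_family_on_def
  proof (intro ballI impI)
    fix p p' assume p: "p \<in> K" "p' \<in> K" "p \<noteq> p'"
    show "G p \<inter> G p' = {}"
    proof (cases "fst p = fst p'")
      case True
      then have "snd p \<noteq> snd p'" using p(3) by (simp add: prod_eq_iff)
      then have "P (fst p) (snd p) \<inter> P (fst p') (snd p') = {}"
        using diagonal_measure(2)[OF _ n, of "fst p" "{snd p, snd p'}" "\<lambda>_. tow q"] tow_levelset[OF q KP(1)[OF p(1)]] True KP[OF p(1)] KP[OF p(2)] q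
        unfolding P_def disjoint_family_on_def by auto
      then show ?thesis using GP[OF p(1)] GP[OF p(2)] by blast
    next
      case False
      \<comment> \<open>A step to the next column of stage j takes less than h (j + 1) units of
        time, and a step at any later stage takes at least that long.\<close>
      have less: "d p < d p'" if p: "p \<in> K" "p' \<in> K" "fst p < fst p'" for p p'
      proof -
        let ?j = "fst p"
        have j: "1 \<le> ?j" "1 \<le> h ?j" using KP[OF p(1)] q h_pos[of ?j] by auto
        have "h ?j + s ?j (snd p) < pos ?j (Suc (Suc (snd p)))"
          using pos_mono[of 1 "Suc (snd p)" ?j] pos_Suc[of "Suc (snd p)" ?j] pos_Suc[of "snd p" ?j] KP[OF p(1)] j by simp
        also have "\<dots> \<le> h (Suc ?j)"
          using KP[OF p(1)] pos_top[OF j(1), of "Suc (snd p)"] pos_Suc[of "Suc (snd p)" ?j] by simp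
        also have "\<dots> \<le> h (fst p')" using p(3) by (intro h_mono) auto
        finally show ?thesis unfolding d_def by simp
      qed
      have "d p \<noteq> d p'"
      proof (cases "fst p < fst p'")
        case True
        from less[OF p(1,2) this] show ?thesis by simp
      next
        case f: False
        then have "fst p' < fst p" using False by simp
        from less[OF p(2,1) this] show ?thesis by simp
      qed
      then have "- d p \<noteq> - d p'" by simp
      then have "N.act (- d p) ` W \<inter> N.act (- d p') ` W = {}"
        by (rule disjoint_family_onD[OF dis UNIV_I UNIV_I])
      moreover have "G p \<inter> G p' \<subseteq> N.act (- d p) ` W \<inter> N.act (- d p') ` W" by (intro Int_mono GW)
      ultimately show ?thesis by (simp only: subset_empty)
    qed
  qed
  have "(\<Sum>j\<in>{q..<J}. measure ?N (W \<inter> diagonal n q j {2..r j})) \<le> (\<Sum>j\<in>{q..<J}. \<Sum>i\<in>{1..<r j}. measure ?N (W \<inter> P j (Suc i)))"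
  proof (rule sum_mono)
    fix j assume j: "j \<in> {q..<J}"
    have e: "{2..r j} = Suc ` {1..<r j}" using image_Suc_atLeastLessThan[of 1 "r j"] by (simp add: numeral_2_eq_2 atLeastLessThanSuc_atLeastAtMost)
    have "W \<inter> diagonal n q j {2..r j} = (\<Union>i\<in>{1..<r j}. W \<inter> P j (Suc i))" unfolding diagonal_def P_def e by blast
    also have "measure ?N \<dots> \<le> (\<Sum>i\<in>{1..<r j}. measure ?N (W \<inter> P j (Suc i)))"
    proof (rule measure_UNION_le)
      fix i assume "i \<in> {1..<r j}"
      then show "W \<inter> P j (Suc i) \<in> sets ?N" using j Ws by (intro sets.Int Ps) auto
    qed simp
    finally show "measure ?N (W \<inter> diagonal n q j {2..r j}) \<le> (\<Sum>i\<in>{1..<r j}. measure ?N (W \<inter> P j (Suc i)))" .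
  qed
  also have "\<dots> = (\<Sum>p\<in>K. measure ?N (W \<inter> P (fst p) (Suc (snd p))))"
    unfolding K_def by (subst sum.Sigma) (auto simp: split_def)
  also have "\<dots> = (\<Sum>p\<in>K. measure ?N (G p))"
    unfolding G_def measure_def by (intro sum.cong refl) (simp add: N.emeasure_act_image[OF WP])
  also have "\<dots> = measure ?N (\<Union>p\<in>K. G p)"
  proof (rule measure_finite_Union[OF finK _ disG, symmetric])
    show "G ` K \<subseteq> sets ?N" unfolding G_def using N.act_image_sets[OF WP] by auto
    fix p assume "p \<in> K"
    then have "emeasure ?N (G p) \<le> emeasure ?N ?Q" using GP PQ Q(1) by (intro emeasure_mono) blast+
    then show "emeasure ?N (G p) \<noteq> \<infinity>" using Q(2) by (auto simp: top_unique)
  qed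
  also have "\<dots> \<le> measure ?N ?Q"
  proof (rule measure_mono_fmeasurable)
    show "(\<Union>p\<in>K. G p) \<subseteq> ?Q" using GP PQ by blast
    show "(\<Union>p\<in>K. G p) \<in> sets ?N" unfolding G_def using N.act_image_sets[OF WP] finK by (intro sets.finite_UN) auto
    show "?Q \<in> fmeasurable ?N" using Q by (simp add: fmeasurable_def)
  qed
  finally show ?thesis .
qed

lemma tensor_conservative:
  assumes j1: "1 \<le> j1" and n: "1 \<le> n" and r2: "\<And>j. j1 \<le> j \<Longrightarrow> 2 \<le> r j"
    and div: "\<And>b q. j1 \<le> q \<Longrightarrow> \<exists>J. b \<le> (\<Sum>j\<in>{q..<J}. 1 / real (r j) ^ (n - 1))"
  shows "conservative (tensor n) (tensor_power n T)"
  unfolding conservative_def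
proof (rule notI, erule exE, erule conjE)
  fix W assume W: "wandering (tensor n) (tensor_power n T) W" and pos: "0 < emeasure (tensor n) W"
  have Ws: "W \<in> sets (tensor n)" using W unfolding wandering_def by simp
  let ?Q = "\<lambda>q. PiE {..<n} (\<lambda>_. tow q)"
  define p where "p j = real (card {2..r j}) / real (r j) ^ n" for j
  have zero: "emeasure (tensor n) (W \<inter> ?Q q) = 0" if q: "j1 \<le> q" for q
  proof -
    have q1: "1 \<le> q" using q j1 by simp
    have Q: "?Q q \<in> sets (tensor n)" "emeasure (tensor n) (?Q q) < \<infinity>" using levelset_box(1,2)[OF q1 levelset_tow] by auto
    have plow: "1 / real (r j) ^ (n - 1) \<le> 2 * p j" if "q \<le> j" for j
    proof -
      have rj: "2 \<le> r j" using r2[of j] that q by simp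
      have "1 / real (r j) ^ (n - 1) = real (r j) / real (r j) ^ n"
        using rj n by (cases n) auto
      also have "\<dots> \<le> 2 * real (card {2..r j}) / real (r j) ^ n"
        using rj by (intro divide_right_mono) auto
      finally show ?thesis unfolding p_def by simp
    qed
    have bound: "measure (tensor n) (W \<inter> ?Q q) \<le> t * measure (tensor n) (?Q q)" if t: "0 < t" for t
    proof -
      \<comment> \<open>Solves (1 + 1 / (2 t)) / c = t / 2. The factor 2 in front of c in the next
        line is the loss in \<open>plow\<close>, where r j - 1 \<ge> r j / 2.\<close>
      define c where "c = 2 * (1 + 1 / (2 * t)) / t"
      obtain J where J: "2 * c \<le> (\<Sum>j\<in>{q..<J}. 1 / real (r j) ^ (n - 1))"
        using div[OF q] by blast
      also have "\<dots> \<le> (\<Sum>j\<in>{q..<J}. 2 * p j)" by (intro sum_mono plow) auto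
      finally have S: "c \<le> (\<Sum>j\<in>{q..<J}. p j)" by (simp add: sum_distrib_left[symmetric])
      have "0 < c" unfolding c_def using t by (simp add: add_pos_pos)
      then have S0: "0 < (\<Sum>j\<in>{q..<J}. p j)" using S by linarith
      have sub: "{2..r j} \<subseteq> {1..r j}" for j by auto
      have lev: "levelset j (tow q)" if "j \<in> {q..<J}" for j using tow_levelset[OF q1] that by auto
      have "measure (tensor n) (W \<inter> ?Q q) \<le> ((1 + 1 / (2 * t)) / (\<Sum>j\<in>{q..<J}. p j) + t / 2) * measure (tensor n) (?Q q)"
      proof (rule second_moment_dense[where V = "\<lambda>j. diagonal n q j {2..r j}"])
        fix j assume j: "j \<in> {q..<J}"
        show "diagonal n q j {2..r j} \<in> sets (tensor n)"
          unfolding diagonal_def by (rule diagonal_measure(3)[OF _ n sub lev[OF j]]) (use j q1 in auto)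
        show "diagonal n q j {2..r j} \<subseteq> ?Q q" unfolding diagonal_def by (auto simp: PiE_iff)
        show "measure (tensor n) (diagonal n q j {2..r j}) = p j * measure (tensor n) (?Q q)"
          unfolding diagonal_def p_def by (rule diagonal_measure(1)[OF _ n sub lev[OF j]]) (use j q1 in auto)
      next
        fix i j assume ij: "i \<in> {q..<J}" "j \<in> {q..<J}" "i \<noteq> j"
        show "measure (tensor n) (diagonal n q i {2..r i} \<inter> diagonal n q j {2..r j}) = p i * p j * measure (tensor n) (?Q q)"
        proof (cases "i < j")
          case True
          then show ?thesis unfolding p_def using ij by (intro diagonal_pair q1 n sub) auto
        next
          case False
          then have "measure (tensor n) (diagonal n q j {2..r j} \<inter> diagonal n q i {2..r i}) = p j * p i * measure (tensor n) (?Q q)"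
            unfolding p_def using ij by (intro diagonal_pair q1 n sub) auto
          then show ?thesis by (simp add: Int_commute mult.commute)
        qed
      next
        show "(\<Sum>j\<in>{q..<J}. measure (tensor n) (W \<inter> diagonal n q j {2..r j})) \<le> measure (tensor n) (?Q q)"
          using r2 q by (intro wandering_diagonal q1 n W) auto
      qed (use Q Ws t S0 in auto)
      also have "\<dots> \<le> t * measure (tensor n) (?Q q)"
      proof (rule mult_right_mono)
        have "(1 + 1 / (2 * t)) / (\<Sum>j\<in>{q..<J}. p j) \<le> t / 2"
          using S S0 t unfolding c_def by (simp add: field_simps)
        then show "(1 + 1 / (2 * t)) / (\<Sum>j\<in>{q..<J}. p j) + t / 2 \<le> t" by linarith
      qed simp
      finally show ?thesis .
    qed
    have "measure (tensor n) (W \<inter> ?Q q) \<le> 0"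
    proof (rule field_le_epsilon)
      fix e :: real assume e: "0 < e"
      have "measure (tensor n) (W \<inter> ?Q q) \<le> e / (measure (tensor n) (?Q q) + 1) * measure (tensor n) (?Q q)"
        by (rule bound) (use e in \<open>simp add: add_nonneg_pos\<close>)
      also have "\<dots> \<le> e / (measure (tensor n) (?Q q) + 1) * (measure (tensor n) (?Q q) + 1)"
        using e by (intro mult_left_mono) (auto simp: add_nonneg_pos)
      also have "\<dots> = e" using measure_nonneg[of "tensor n" "?Q q"] by (simp add: add_nonneg_eq_0_iff)
      finally show "measure (tensor n) (W \<inter> ?Q q) \<le> 0 + e" by simp
    qed
    moreover have "emeasure (tensor n) (W \<inter> ?Q q) \<noteq> top"
      using emeasure_mono[of "W \<inter> ?Q q" "?Q q" "tensor n"] Q by (auto simp: top_unique)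
    ultimately show ?thesis by (simp add: emeasure_eq_ennreal_measure measure_le_0_iff)
  qed
  have "W \<subseteq> (\<Union>q\<in>{j1..}. W \<inter> ?Q q)"
  proof
    fix x assume x: "x \<in> W"
    then have xs: "x \<in> space (tensor n)" using sets.sets_into_space[OF Ws] by blast
    have "eventually (\<lambda>q. \<forall>a\<in>{..<n}. x a \<in> tow q) sequentially"
      using xs by (intro eventually_ball_finite ballI eventually_tow) (auto simp: space_tensorX)
    then have "eventually (\<lambda>q. (\<forall>a\<in>{..<n}. x a \<in> tow q) \<and> j1 \<le> q) sequentially"
      by (intro eventually_conj eventually_ge_at_top)
    then obtain q where "\<forall>a\<in>{..<n}. x a \<in> tow q" "j1 \<le> q" unfolding eventually_sequentially by blast
    then show "x \<in> (\<Union>q\<in>{j1..}. W \<inter> ?Q q)" using x xs by (auto simp: space_tensorX PiE_iff)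
  qed
  moreover have "(\<Union>q\<in>{j1..}. W \<inter> ?Q q) \<in> null_sets (tensor n)"
  proof (rule null_sets_UN')
    fix q assume "q \<in> {j1..}"
    then show "W \<inter> ?Q q \<in> null_sets (tensor n)"
      using zero[of q] Ws levelset_box(1)[of q n "\<lambda>_. tow q", OF _ levelset_tow] j1 by (auto simp: null_sets_def)
  qed simp
  ultimately have "W \<in> null_sets (tensor n)" using null_sets_subset[OF _ Ws] by blast
  then show False using pos by (auto simp: null_sets_def)
qed

end

context sidon_construction
begin

lemma tensor_dissipative:
  assumes n: "1 \<le> n" and h: "filterlim h at_top sequentially"
    and sum: "summable (\<lambda>j. 1 / real (r j) ^ (n - 1))"
  shows "dissipative (tensor n) (tensor_power n T)"
proof -
  interpret N: measure_automorphism "tensor n" "tensor_power n T" by (rule tensor_locale)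
  let ?Q = "\<lambda>q. PiE {..<n} (\<lambda>_. tow q)"
  \<comment> \<open>Stages are numbered from 1, hence \<open>Suc q\<close> throughout.\<close>
  have Qs: "?Q (Suc q) \<in> sets (tensor n)" for q by (intro levelset_box(1)[of "Suc q"] levelset_tow) simp
  have "\<exists>Z. Z \<in> null_sets (tensor n) \<and> (\<forall>x\<in>?Q (Suc q). x \<notin> Z \<longrightarrow> finite {m::nat. N.act (- int m) x \<in> ?Q (Suc q)})" for q
  proof -
    let ?q = "Suc q"
    define V where "V j = diagonal n ?q (j + ?q) {1..r (j + ?q)}" for j
    have lev: "levelset (j + ?q) (tow ?q)" for j by (rule tow_levelset) auto
    have Vs: "V j \<in> sets (tensor n)" for j
      unfolding V_def diagonal_def by (intro diagonal_measure(3) n lev) auto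
    have Vm: "measure (tensor n) (V j) = 1 / real (r (j + ?q)) ^ (n - 1) * measure (tensor n) (?Q ?q)" for j
    proof -
      have "measure (tensor n) (V j) = real (card {1..r (j + ?q)}) / real (r (j + ?q)) ^ n * measure (tensor n) (?Q ?q)"
        unfolding V_def diagonal_def by (intro diagonal_measure(1) n lev) auto
      then show ?thesis using n cuts_pos[of "j + ?q"] by (cases n) auto
    qed
    have "emeasure (tensor n) (V j) < \<infinity>" for j
    proof -
      have "emeasure (tensor n) (V j) \<le> emeasure (tensor n) (?Q ?q)"
        using Qs[of q] unfolding V_def diagonal_def by (intro emeasure_mono) (auto simp: PiE_iff)
      then show ?thesis using levelset_box(2)[of ?q n "\<lambda>_. tow ?q", OF _ levelset_tow] by (simp add: le_less_trans)
    qed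
    moreover have "summable (\<lambda>j. measure (tensor n) (V j))"
      unfolding Vm using sum by (intro summable_mult2) (rule summable_ignore_initial_segment)
    ultimately have ae: "AE x in tensor n. eventually (\<lambda>j. x \<in> space (tensor n) - V j) sequentially"
      using Vs by (intro borel_cantelli_AE1)
    obtain Z where "{x \<in> space (tensor n). \<not> eventually (\<lambda>j. x \<in> space (tensor n) - V j) sequentially} \<subseteq> Z"
      "emeasure (tensor n) Z = 0" "Z \<in> sets (tensor n)"
      using AE_E[OF ae] .
    then have Z: "Z \<in> null_sets (tensor n)"
      "{x \<in> space (tensor n). \<not> eventually (\<lambda>j. x \<in> space (tensor n) - V j) sequentially} \<subseteq> Z"
      by (auto simp only: null_sets_def)
    have "finite {m::nat. N.act (- int m) x \<in> ?Q ?q}" if x: "x \<in> ?Q ?q" "x \<notin> Z" for x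
    proof -
      have xs: "x \<in> space (tensor n)" using sets.sets_into_space[OF Qs[of q]] x(1) by blast
      then have "eventually (\<lambda>j. x \<in> space (tensor n) - V j) sequentially" using Z(2) x(2) by blast
      then obtain J where J: "\<And>j. J \<le> j \<Longrightarrow> x \<notin> V j" unfolding eventually_sequentially by blast
      have "m \<le> h (J + ?q)" if m: "N.act (- int m) x \<in> ?Q ?q" for m :: nat
      proof (rule ccontr)
        assume "\<not> m \<le> h (J + ?q)"
        then have mJ: "h (J + ?q) < m" by simp
        have "eventually (\<lambda>j. m \<le> h j \<and> J + ?q \<le> j) sequentially"
          using h by (intro eventually_conj eventually_ge_at_top) (auto simp: filterlim_at_top)
        then have ex: "\<exists>j. J + ?q \<le> j \<and> m \<le> h j" unfolding eventually_sequentially by blast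
        \<comment> \<open>The first admissible stage whose height is at least m. Its predecessor j
          satisfies h j < m \<le> h (j + 1), the range of the Sidon property.\<close>
        define l where "l = (LEAST j. J + ?q \<le> j \<and> m \<le> h j)"
        have l: "J + ?q \<le> l" "m \<le> h l" using LeastI_ex[OF ex] unfolding l_def by auto
        have "l \<noteq> J + ?q" using l(2) mJ by auto
        then obtain j where j: "l = Suc j" "J + ?q \<le> j" using l(1) by (cases l) auto
        have "h j < m" using not_less_Least[of j "\<lambda>j. J + ?q \<le> j \<and> m \<le> h j"] j unfolding l_def[symmetric] by auto
        then have hm: "int (h j) < int m" "int m \<le> int (h (Suc j))" using l(2) j by auto
        have j1: "1 \<le> j" "?q \<le> j" using j by auto
        obtain i where i: "i \<in> {1..r j}" "\<And>y. y \<in> tow j \<Longrightarrow> tr (int m) y \<in> tow j \<Longrightarrow> tr (int m) y \<in> col j i"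
          using sidon_tr[OF j1(1) hm] by blast
        have "x a \<in> tow ?q \<inter> col j i" if a: "a < n" for a
        proof -
          have xa: "x a \<in> tow ?q" "tr (- int m) (x a) \<in> tow ?q" "x a \<in> X"
            using x(1) m a xs unfolding tensor_tr[OF xs] by (auto simp: tensor_power_def PiE_iff space_tensorX)
          then have "tr (- int m) (x a) \<in> tow j" "tr (int m) (tr (- int m) (x a)) = x a" "x a \<in> tow j"
            using tow_mono[of ?q j] j1 tr_cancel by auto
          then show ?thesis using i(2)[of "tr (- int m) (x a)"] xa(1) by simp
        qed
        then have "x \<in> PiE {..<n} (\<lambda>_. tow ?q \<inter> col j i)" using xs by (auto simp: PiE_iff space_tensorX)
        then have "x \<in> V (j - ?q)"
          unfolding V_def diagonal_def using i(1) j1(2) by (intro UN_I[of i]) auto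
        then show False using J[of "j - ?q"] j(2) by auto
      qed
      then show ?thesis by (intro finite_subset[OF _ finite_atMost[of "h (J + ?q)"]]) auto
    qed
    then show ?thesis using Z(1) by blast
  qed
  then obtain Z where Z: "\<And>q. Z q \<in> null_sets (tensor n)"
    "\<And>q x. x \<in> ?Q (Suc q) \<Longrightarrow> x \<notin> Z q \<Longrightarrow> finite {m::nat. N.act (- int m) x \<in> ?Q (Suc q)}" by metis
  show ?thesis
  proof (rule N.dissipativeI[of "\<lambda>q. ?Q (Suc q)", OF Qs _ Z])
    show "(\<Union>q. ?Q (Suc q)) = space (tensor n)"
    proof
      show "(\<Union>q. ?Q (Suc q)) \<subseteq> space (tensor n)" using sets.sets_into_space[OF Qs] by blast
      show "space (tensor n) \<subseteq> (\<Union>q. ?Q (Suc q))"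
      proof
        fix x assume x: "x \<in> space (tensor n)"
        have "eventually (\<lambda>q. \<forall>a\<in>{..<n}. x a \<in> tow q) sequentially"
          using x by (intro eventually_ball_finite ballI eventually_tow) (auto simp: space_tensorX)
        then obtain q where "\<And>a. a < n \<Longrightarrow> x a \<in> tow (Suc q)" unfolding eventually_sequentially by (meson le_Suc_eq lessThan_iff order_refl)
        then show "x \<in> (\<Union>q. ?Q (Suc q))" using x by (auto simp: PiE_iff space_tensorX)
      qed
    qed
  qed
qed

end

section \<open>The class \<open>C(\<alpha>)\<close>\<close>

lemma sum_blocks:
  fixes f :: "nat \<Rightarrow> real"
  assumes J: "strict_mono J"
  shows "(\<Sum>j\<in>{J a..<J (a + m)}. f j) = (\<Sum>k<m. \<Sum>j\<in>{J (a + k)..<J (Suc (a + k))}. f j)"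
proof (induction m)
  case (Suc m)
  have "J a \<le> J (a + m)" "J (a + m) \<le> J (Suc (a + m))" using J by (simp_all add: strict_mono_less_eq)
  from sum.atLeastLessThan_concat[OF this, of f] show ?case using Suc by simp
qed simp

context class_C
begin

text \<open>The stages \<open>j(k) \<le> j < j(k+1)\<close> contribute \<open>[r\<^sup>\<alpha>] r\<^sup>-\<^sup>p\<close>, with \<open>r = r (j(k))\<close>, to \<open>\<Sum>\<^sub>j r\<^sub>j\<^sup>-\<^sup>p\<close>.\<close>

definition block_starts :: "(nat \<Rightarrow> nat) \<Rightarrow> bool" where
  "block_starts J \<longleftrightarrow> (\<forall>k. 1 \<le> J k) \<and>
    strict_mono J \<and>
    (\<forall>\<delta>>0. summable (\<lambda>k. real (r (J k)) powr (- \<delta>))) \<and>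
    (\<forall>k j. J k \<le> j \<and> j < J (Suc k) \<longrightarrow> r j = r (J k)) \<and>
    (\<forall>k p. (\<Sum>j\<in>{J k..<J (Suc k)}. 1 / real (r j) ^ p) \<le> real (r (J k)) powr (\<alpha> - real p)) \<and>
    (\<forall>k p. real (r (J k)) powr (\<alpha> - real p) / 2 \<le> (\<Sum>j\<in>{J k..<J (Suc k)}. 1 / real (r j) ^ p))"

lemma block_startsD:
  assumes "block_starts J"
  shows "1 \<le> J k" "strict_mono J" "0 < \<delta> \<Longrightarrow> summable (\<lambda>k. real (r (J k)) powr (- \<delta>))"
    "J k \<le> j \<Longrightarrow> j < J (Suc k) \<Longrightarrow> r j = r (J k)"
    "(\<Sum>j\<in>{J k..<J (Suc k)}. 1 / real (r j) ^ p) \<le> real (r (J k)) powr (\<alpha> - real p)"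
    "real (r (J k)) powr (\<alpha> - real p) / 2 \<le> (\<Sum>j\<in>{J k..<J (Suc k)}. 1 / real (r j) ^ p)"
  using assms unfolding block_starts_def by blast+

lemma block_starts_exist:
  assumes \<alpha>: "0 \<le> \<alpha>"
  shows "\<exists>J. block_starts J"
proof -
  obtain J :: "nat \<Rightarrow> nat" where J': "(\<forall>k. 1 \<le> J k) \<and> filterlim J at_top sequentially \<and>
      (\<forall>\<delta>>0. summable (\<lambda>k. real (r (J k)) powr (- \<delta>))) \<and>
      (\<forall>k j. J k \<le> j \<and> j < J (Suc k) \<longrightarrow> r j = r (J k)) \<and>
      (\<forall>k. int (J (Suc k)) - int (J k) = \<lfloor>real (r (J k)) powr \<alpha>\<rfloor>)"
    using class_C ..
  have J: "1 \<le> J k" "0 < \<delta> \<Longrightarrow> summable (\<lambda>k. real (r (J k)) powr (- \<delta>))"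
    "J k \<le> j \<Longrightarrow> j < J (Suc k) \<Longrightarrow> r j = r (J k)"
    "int (J (Suc k)) - int (J k) = \<lfloor>real (r (J k)) powr \<alpha>\<rfloor>" for k j and \<delta> :: real
    using J' by blast+
  have r1: "1 \<le> real (r (J k))" for k using cuts_pos[OF J(1)[of k]] by simp
  \<comment> \<open>Since \<alpha> \<ge> 0 every block contains at least one stage, so J is strictly
    increasing, and rounding down loses at most a factor 2.\<close>
  have ra: "1 \<le> real (r (J k)) powr \<alpha>" for k using ge_one_powr_ge_zero[OF r1 \<alpha>] .
  have half_floor: "x / 2 \<le> of_int \<lfloor>x\<rfloor>" if "1 \<le> x" for x :: real
  proof -
    have "1 \<le> \<lfloor>x\<rfloor>" using that by simp
    then show ?thesis by linarith
  qed
  have len: "real (J (Suc k) - J k) \<le> real (r (J k)) powr \<alpha>" "real (r (J k)) powr \<alpha> / 2 \<le> real (J (Suc k) - J k)" "J k < J (Suc k)" for k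
  proof -
    have "1 \<le> \<lfloor>real (r (J k)) powr \<alpha>\<rfloor>" using ra[of k] by simp
    then show less: "J k < J (Suc k)" using J(4)[of k] by linarith
    have "int (J (Suc k) - J k) = \<lfloor>real (r (J k)) powr \<alpha>\<rfloor>" using J(4)[of k] less by linarith
    from arg_cong[OF this, of real_of_int]
    have e: "real (J (Suc k) - J k) = of_int \<lfloor>real (r (J k)) powr \<alpha>\<rfloor>" unfolding of_int_of_nat_eq .
    show "real (J (Suc k) - J k) \<le> real (r (J k)) powr \<alpha>" unfolding e by simp
    show "real (r (J k)) powr \<alpha> / 2 \<le> real (J (Suc k) - J k)" using half_floor[OF ra[of k]] unfolding e .
  qed
  have blk: "(\<Sum>j\<in>{J k..<J (Suc k)}. 1 / real (r j) ^ p) = real (J (Suc k) - J k) / real (r (J k)) ^ p" for k p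
  proof -
    have "(\<Sum>j\<in>{J k..<J (Suc k)}. 1 / real (r j) ^ p) = (\<Sum>j\<in>{J k..<J (Suc k)}. 1 / real (r (J k)) ^ p)"
    proof (rule sum.cong)
      fix j assume "j \<in> {J k..<J (Suc k)}"
      then have "r j = r (J k)" by (intro J(3)) auto
      then show "1 / real (r j) ^ p = 1 / real (r (J k)) ^ p" by (simp only:)
    qed simp
    then show ?thesis by simp
  qed
  have pw: "real (r (J k)) powr (\<alpha> - real p) = real (r (J k)) powr \<alpha> / real (r (J k)) ^ p" for k p
  proof -
    have "0 < real (r (J k))" using r1[of k] by simp
    then show ?thesis by (simp add: powr_diff powr_realpow)
  qed
  show ?thesis
    unfolding block_starts_def
  proof (intro exI[of _ J] conjI allI impI)
    show "strict_mono J" using len(3) by (simp add: strict_mono_Suc_iff)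
    fix k p
    show "(\<Sum>j\<in>{J k..<J (Suc k)}. 1 / real (r j) ^ p) \<le> real (r (J k)) powr (\<alpha> - real p)"
      unfolding blk pw by (intro divide_right_mono len) simp
    show "real (r (J k)) powr (\<alpha> - real p) / 2 \<le> (\<Sum>j\<in>{J k..<J (Suc k)}. 1 / real (r j) ^ p)"
      unfolding blk pw using divide_right_mono[OF len(2)[of k], of "real (r (J k)) ^ p"] by simp
  next
    fix k j assume "J k \<le> j \<and> j < J (Suc k)"
    then show "r j = r (J k)" by (intro J(3)) auto
  qed (rule J, assumption?)+
qed

text \<open>The summability condition with \<delta> = 1 forces r (J k) to infinity, and r is
  constant on each block.\<close>

lemma class_C_cuts:
  assumes \<alpha>: "0 \<le> \<alpha>" shows "filterlim r at_top sequentially"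
proof -
  obtain J where J: "block_starts J" using block_starts_exist[OF \<alpha>] ..
  note J = block_startsD[OF J]
  show ?thesis
    unfolding filterlim_at_top
  proof
    fix Z :: nat
    have "(\<lambda>k. real (r (J k)) powr (- 1)) \<longlonglongrightarrow> 0" by (rule summable_LIMSEQ_zero[OF J(3)]) simp
    then have "eventually (\<lambda>k. real (r (J k)) powr (- 1) < 1 / (real Z + 1)) sequentially"
      by (rule order_tendstoD) simp
    then obtain K where K: "\<And>k. K \<le> k \<Longrightarrow> real (r (J k)) powr (- 1) < 1 / (real Z + 1)"
      unfolding eventually_sequentially by blast
    have Zr: "Z \<le> r (J k)" if "K \<le> k" for k
    proof -
      have pos: "0 < real (r (J k))" using cuts_pos[OF J(1)[of k]] by simp
      then have "1 / real (r (J k)) < 1 / (real Z + 1)" using K[OF that] by (simp add: powr_minus divide_simps)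
      then have "real Z + 1 < real (r (J k))" using pos by (simp add: divide_simps split: if_splits)
      then show ?thesis by linarith
    qed
    have "Z \<le> r j" if j: "J K \<le> j" for j
    proof -
      \<comment> \<open>The least k with j < J k is the successor of the index of the block that
        contains j.\<close>
      define P where "P k \<longleftrightarrow> j < J k" for k
      have "P (Suc j)" unfolding P_def using strict_mono_imp_increasing[OF J(2), of "Suc j"] by simp
      then have L: "P (LEAST k. P k)" by (rule LeastI)
      have "\<not> P 0" using j strict_mono_less_eq[OF J(2), of 0 K] unfolding P_def by simp
      then have "(LEAST k. P k) \<noteq> 0" using L by metis
      then obtain k where k: "(LEAST k. P k) = Suc k" using not0_implies_Suc by blast
      have "\<not> P k" using not_less_Least[of k P] k by simp
      then have jk: "J k \<le> j" "j < J (Suc k)" using L k unfolding P_def by auto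
      have "J K < J (Suc k)" using j jk by simp
      then have "K \<le> k" using strict_mono_less[OF J(2)] by simp
      then show ?thesis using Zr J(4)[OF jk] by simp
    qed
    then show "eventually (\<lambda>j. Z \<le> r j) sequentially" unfolding eventually_sequentially by blast
  qed
qed

lemma class_C_heights:
  assumes \<alpha>: "0 \<le> \<alpha>" shows "filterlim h at_top sequentially"
  unfolding filterlim_at_top
proof
  fix Z
  have "eventually (\<lambda>j. Z \<le> r j \<and> 1 \<le> j) sequentially"
    using class_C_cuts[OF \<alpha>] by (intro eventually_conj eventually_ge_at_top) (auto simp: filterlim_at_top)
  then have "eventually (\<lambda>j. Z \<le> h (Suc j)) sequentially"
  proof eventually_elim
    case (elim j)
    then have "1 * r j \<le> h j * r j" using h_pos[of j] by (intro mult_le_mono1) auto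
    then show ?case using elim h_Suc_ge[of j] by linarith
  qed
  then show "eventually (\<lambda>j. Z \<le> h j) sequentially" using eventually_sequentially_Suc[of "\<lambda>j. Z \<le> h j"] by simp
qed

text \<open>A block contributes at most r ^ (\<alpha> - p), and the defining condition with \<delta>
  = p - \<alpha> sums these contributions.\<close>

lemma class_C_summable:
  assumes \<alpha>: "0 \<le> \<alpha>" and p: "\<alpha> < real p"
  shows "summable (\<lambda>j. 1 / real (r j) ^ p)"
proof -
  obtain J where J: "block_starts J" using block_starts_exist[OF \<alpha>] ..
  note J = block_startsD[OF J]
  let ?f = "\<lambda>j. 1 / real (r j) ^ p"
  have s: "summable (\<lambda>k. real (r (J k)) powr (\<alpha> - real p))" using J(3)[of "real p - \<alpha>"] p by simp
  show ?thesis
  proof (rule summableI_nonneg_bounded)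
    fix N
    have NJ: "N \<le> J N" using strict_mono_imp_increasing[OF J(2)] .
    have "sum ?f {..<N} \<le> sum ?f ({..<J 0} \<union> {J 0..<J (0 + N)})"
      using NJ by (intro sum_mono2) auto
    also have "\<dots> = sum ?f {..<J 0} + sum ?f {J 0..<J (0 + N)}" by (intro sum.union_disjoint) auto
    also have "sum ?f {J 0..<J (0 + N)} = (\<Sum>k<N. \<Sum>j\<in>{J (0 + k)..<J (Suc (0 + k))}. ?f j)" by (rule sum_blocks[OF J(2)])
    also have "\<dots> \<le> (\<Sum>k<N. real (r (J k)) powr (\<alpha> - real p))" using J(5) by (intro sum_mono) simp
    also have "\<dots> \<le> (\<Sum>k. real (r (J k)) powr (\<alpha> - real p))" by (intro sum_le_suminf s) auto
    finally show "sum ?f {..<N} \<le> sum ?f {..<J 0} + (\<Sum>k. real (r (J k)) powr (\<alpha> - real p))" by simp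
  qed simp
qed

lemma class_C_divergent:
  assumes \<alpha>: "0 \<le> \<alpha>" and p: "real p \<le> \<alpha>"
  shows "\<exists>N. b \<le> (\<Sum>j\<in>{q..<N}. 1 / real (r j) ^ p)"
proof -
  obtain J where J: "block_starts J" using block_starts_exist[OF \<alpha>] ..
  note J = block_startsD[OF J]
  let ?f = "\<lambda>j. 1 / real (r j) ^ p"
  \<comment> \<open>For p \<le> \<alpha> each block contributes at least 1/2, so that 2 b blocks
    suffice.\<close>
  define m where "m = nat \<lceil>2 * b\<rceil>"
  have half: "1 / 2 \<le> (\<Sum>j\<in>{J k..<J (Suc k)}. ?f j)" for k
  proof -
    have "1 \<le> real (r (J k)) powr (\<alpha> - real p)" using cuts_pos[OF J(1)[of k]] p by (intro ge_one_powr_ge_zero) auto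
    then show ?thesis using J(6)[of k p] by simp
  qed
  have "b \<le> (\<Sum>k<m. 1 / 2)" unfolding m_def by simp linarith
  also have "\<dots> \<le> (\<Sum>k<m. \<Sum>j\<in>{J (q + k)..<J (Suc (q + k))}. ?f j)" by (intro sum_mono half)
  also have "\<dots> = sum ?f {J q..<J (q + m)}" by (rule sum_blocks[OF J(2), symmetric])
  also have "\<dots> \<le> sum ?f {q..<J (q + m)}"
    using strict_mono_imp_increasing[OF J(2), of q] by (intro sum_mono2) auto
  finally show ?thesis by blast
qed

end

theorem theorem2:
  fixes \<alpha> :: real and n :: nat
    and h r :: "nat \<Rightarrow> nat" and s :: "nat \<Rightarrow> nat \<Rightarrow> nat"
    and X :: "real set" and T :: "real \<Rightarrow> real"
    and E :: "nat \<Rightarrow> real set" and B :: "nat \<Rightarrow> nat \<Rightarrow> real set"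
  assumes "0 \<le> \<alpha>"
    and "class_C h r s X T E B \<alpha>"
    and "1 \<le> n"
  shows "(real n \<le> 1 + \<alpha> / 2 \<longrightarrow>
            singular_spectrum (tensor_space n (lebesgue_space X)) (tensor_power n T)) \<and>
         (real n > 1 + \<alpha> / 2 \<longrightarrow>
            absolutely_continuous_spectrum (tensor_space n (lebesgue_space X)) (tensor_power n T)) \<and>
         (real n \<le> 1 + \<alpha> \<longrightarrow>
            conservative (tensor_space n (lebesgue_space X)) (tensor_power n T)) \<and>
         (real n > 1 + \<alpha> \<longrightarrow>
            dissipative (tensor_space n (lebesgue_space X)) (tensor_power n T))"
proof -
  interpret class_C h r s X T E B \<alpha> by fact
  note \<alpha> = assms(1) and n = assms(3)
  note r = class_C_cuts[OF \<alpha>] and h = class_C_heights[OF \<alpha>]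
  \<comment> \<open>From some stage on all numerical requirements on r and h hold. Nothing is lost,
    because the boxes of these stages alone generate the sigma-algebra.\<close>
  have "eventually (\<lambda>j. 4 \<le> r j \<and> 2 \<le> h j \<and> 1 \<le> j) sequentially"
    using r h by (intro eventually_conj eventually_ge_at_top) (auto simp: filterlim_at_top)
  then obtain j1 where j1: "\<And>j. j1 \<le> j \<Longrightarrow> 4 \<le> r j \<and> 2 \<le> h j \<and> 1 \<le> j"
    unfolding eventually_sequentially by blast
  then have j1_ge: "1 \<le> j1" by simp
  have sing: "singular_spectrum (tensor n) (tensor_power n T)" if le: "real n \<le> 1 + \<alpha> / 2"
  proof (rule tensor_singular_spectrum[OF j1_ge r])
    fix \<nu> :: "nat \<Rightarrow> complex measure" and j
    assume \<nu>: "\<And>i. j1 \<le> i \<Longrightarrow> finite_circle_measure (\<nu> i)" "\<And>i. j1 \<le> i \<Longrightarrow> prob_space (\<nu> i)"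
      and coef: "\<And>i m. j1 \<le> i \<Longrightarrow> (LINT z|\<nu> i. z powi m) = complex_of_real (corr i m ^ n)" and j: "j1 \<le> j"
    show "mutually_singular circle_lebesgue (\<nu> j)"
    \<comment> \<open>For n = 1 the bound 1 \<le> 1 + \<alpha> / 2 always holds, and the Riesz
      product argument needs only that r and h tend to infinity.\<close>
    proof (cases "n = 1")
      case True
      then show ?thesis using j j1_ge \<nu> coef by (intro singular_power_1[OF _ r h]) auto
    next
      case False
      \<comment> \<open>The spectral threshold n \<le> 1 + \<alpha> / 2 says precisely that the
        exponent 2 n - 2 is on the divergent side.\<close>
      have "real (2 * n - 2) \<le> \<alpha>" using le n by (simp add: of_nat_diff)
      from class_C_divergent[OF \<alpha> this] show ?thesis
        using False n j j1_ge j1 \<nu> coef by (intro singular_power_ge2[of j n]) auto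
    qed
  qed
  have ac: "absolutely_continuous_spectrum (tensor n) (tensor_power n T)" if less: "1 + \<alpha> / 2 < real n"
  proof (rule tensor_absolutely_continuous_spectrum[OF j1_ge r])
    fix \<nu> :: "complex measure" and j
    assume \<nu>: "finite_circle_measure \<nu>" and j: "j1 \<le> j"
      and coef: "\<And>m. (LINT z|\<nu>. z powi m) = complex_of_real (corr j m ^ n)"
    have "\<alpha> < real (2 * n - 2)" using less n by (simp add: of_nat_diff)
    then have s: "summable (\<lambda>j. 1 / real (r j) ^ (2 * n - 2))" by (rule class_C_summable[OF \<alpha>])
    \<comment> \<open>The power 2 n arises because the squares of the coefficients c(m)^n have to be
      summed.\<close>
    have "\<exists>C. \<forall>I. finite I \<longrightarrow> (\<Sum>m\<in>I. corr j m ^ (2 * n)) \<le> C"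
    proof (rule corr_power_bounded)
      show "(\<Sum>i\<in>{j..<J}. 1 / real (r i) ^ (2 * n - 2)) \<le> (\<Sum>i. 1 / real (r i) ^ (2 * n - 2))" for J
        by (rule sum_le_suminf[OF s]) auto
      fix m :: int
      have "eventually (\<lambda>i. nat m \<le> h i \<and> j \<le> i) sequentially"
        using h by (intro eventually_conj eventually_ge_at_top) (auto simp: filterlim_at_top)
      then obtain i where "nat m \<le> h i" "j \<le> i" unfolding eventually_sequentially by blast
      then show "\<exists>i\<ge>j. m \<le> int (h i)" by (intro exI[of _ i]) auto
    qed (use j j1_ge n in auto)
    then obtain C where C: "\<And>I. finite I \<Longrightarrow> (\<Sum>m\<in>I. corr j m ^ (2 * n)) \<le> C" by blast
    show "absolutely_continuous circle_lebesgue \<nu>"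
    proof (rule l2_coefficients_absolutely_continuous[OF \<nu>])
      fix I :: "int set" assume I: "finite I"
      have "(norm (complex_of_real (corr j m ^ n)))\<^sup>2 = corr j m ^ (2 * n)" for m
        unfolding norm_of_real power2_abs by (simp add: power_mult[symmetric] mult.commute)
      then show "(\<Sum>m\<in>I. (norm (LINT z|\<nu>. z powi m))\<^sup>2) \<le> C" unfolding coef using C[OF I] by simp
    qed
  qed
  have con: "conservative (tensor n) (tensor_power n T)" if le: "real n \<le> 1 + \<alpha>"
  proof (rule tensor_conservative[OF j1_ge n])
    have "real (n - 1) \<le> \<alpha>" using le n by (simp add: of_nat_diff)
    then show "\<exists>J. b \<le> (\<Sum>j\<in>{q..<J}. 1 / real (r j) ^ (n - 1))" for b q by (rule class_C_divergent[OF \<alpha>])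
    show "2 \<le> r j" if "j1 \<le> j" for j using j1[OF that] by simp
  qed
  have dis: "dissipative (tensor n) (tensor_power n T)" if less: "1 + \<alpha> < real n"
  proof (rule tensor_dissipative[OF n h])
    have "\<alpha> < real (n - 1)" using less n by (simp add: of_nat_diff)
    then show "summable (\<lambda>j. 1 / real (r j) ^ (n - 1))" by (rule class_C_summable[OF \<alpha>])
  qed
  show ?thesis using sing ac con dis by blast
qed

end
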